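(* Let $n\geq 1$ be an integer and let $(\mathcal{C},\mathbb{E},\mathfrak{s})$ be an $n$-exangulated category. Let $\widetilde{\mathcal{C}}$ be the idempotent completion of $\mathcal{C}$, and let $\mathbb{F}\colon\widetilde{\mathcal{C}}^{\mathrm{op}}\times\widetilde{\mathcal{C}}\to\mathsf{Ab}$ and $\mathfrak{t}$ be the biadditive functor and the realisation defined in the context. Then $(\widetilde{\mathcal{C}},\mathbb{F},\mathfrak{t})$ is an idempotent complete $n$-exangulated category. Furthermore, the inclusion functor $\mathscr{I}_{\mathcal{C}}\colon\mathcal{C}\to\widetilde{\mathcal{C}}$ extends to an $n$-exangulated functor $(\mathscr{I}_{\mathcal{C}},\Gamma)\colon(\mathcal{C},\mathbb{E},\mathfrak{s})\to(\widetilde{\mathcal{C}},\mathbb{F},\mathfrak{t})$, where $\Gamma_{(X_{n+1},X_0)}(\delta)=(\mathrm{id}_{X_0},\delta,\mathrm{id}_{X_{n+1}})$ for $\delta\in\mathbb{E}(X_{n+1},X_0)$, and this functor is $2$-universal among $n$-exangulated functors from $(\mathcal{C},\mathbb{E},\mathfrak{s})$ to idempotent complete $n$-exangulated categories. That is, for every $n$-exangulated functor $(\mathscr{F},\Lambda)\colon(\mathcal{C},\mathbb{E},\mathfrak{s})\to(\mathcal{C}',\mathbb{E}',\mathfrak{s}')$ to an idempotent complete $n$-exangulated category: (i) there are an $n$-exangulated functor $(\mathscr{E},\Psi)\colon(\widetilde{\mathcal{C}},\mathbb{F},\mathfrak{t})\to(\mathcal{C}',\mathbb{E}',\mathfrak{s}')$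 and an $n$-exangulated natural isomorphism $\alpha\colon(\mathscr{F},\Lambda)\Rightarrow(\mathscr{E},\Psi)\circ(\mathscr{I}_{\mathcal{C}},\Gamma)$; and, in addition, (ii) for any $n$-exangulated functor $(\mathscr{G},\Theta)\colon(\widetilde{\mathcal{C}},\mathbb{F},\mathfrak{t})\to(\mathcal{C}',\mathbb{E}',\mathfrak{s}')$ and any $n$-exangulated natural transformation $\beta\colon(\mathscr{F},\Lambda)\Rightarrow(\mathscr{G},\Theta)\circ(\mathscr{I}_{\mathcal{C}},\Gamma)$, there is a unique $n$-exangulated natural transformation $\gamma\colon(\mathscr{E},\Psi)\Rightarrow(\mathscr{G},\Theta)$ with $\beta=\gamma_{\mathscr{I}_{\mathcal{C}}}\alpha$.
   Context: **$n$-exangulated categories.** Let $\mathcal{C}$ be an additive category and $\mathbb{E}\colon\mathcal{C}^{\mathrm{op}}\times\mathcal{C}\to\mathsf{Ab}$ a biadditive functor. An $\mathbb{E}$-extension is an element $\delta\in\mathbb{E}(C,A)$. For $a\colon A\to B$ and $d\colon D\to C$ put $a_{\mathbb{E}}\delta=\mathbb{E}(C,a)(\delta)$ and $d^{\mathbb{E}}\delta=\mathbb{E}(d,A)(\delta)$. The zero of $\mathbb{E}(C,A)$ is ${}_A0_C$. A morphism of $\mathbb{E}$-extensions from $\delta\in\mathbb{E}(C,A)$ to $\rho\in\mathbb{E}(D,B)$ is a pair $(a\colon A\to B,\,c\colon C\to D)$ with $a_{\mathbb{E}}\delta=c^{\mathbb{E}}\rho$. $\mathsf{Ch}(\mathcal{C})^n$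 is the category of complexes $X_\bullet\colon X_0\xrightarrow{d^X_0}X_1\to\cdots\xrightarrow{d^X_n}X_{n+1}$ concentrated in degrees $0,\dots,n+1$. An $\mathbb{E}$-attached complex $\langle X_\bullet,\delta\rangle$ consists of $X_\bullet\in\mathsf{Ch}(\mathcal{C})^n$ and $\delta\in\mathbb{E}(X_{n+1},X_0)$ with $(d^X_0)_{\mathbb{E}}\delta=0$ and $(d^X_n)^{\mathbb{E}}\delta=0$. It is an $n$-exangle if for every $Y\in\mathcal{C}$ the sequences $\mathcal{C}(Y,X_0)\to\cdots\to\mathcal{C}(Y,X_{n+1})\to\mathbb{E}(Y,X_0)$ (last map $u\mapsto u^{\mathbb{E}}\delta$) and $\mathcal{C}(X_{n+1},Y)\to\cdots\to\mathcal{C}(X_0,Y)\to\mathbb{E}(X_{n+1},Y)$ (last map $u\mapsto u_{\mathbb{E}}\delta$) are exact. For $A,C\in\mathcal{C}$, $\mathsf{Ch}(\mathcal{C})^n_{(A,C)}$ has as objects the $X_\bullet\in\mathsf{Ch}(\mathcal{C})^n$ with $X_0=A$, $X_{n+1}=C$, and as morphisms the chain maps $f_\bullet$ with $f_0=\mathrm{id}_A$, $f_{n+1}=\mathrm{id}_C$; $\mathsf{K}(\mathcal{C})^n_{(A,C)}$ is its quotient by the usual chain homotopy relation, and $[X_\bullet]$ is the isomorphism class of $X_\bullet$ in $\mathsf{K}(\mathcal{C})^n_{(A,C)}$. An exact realisation $\mathfrak{s}$ of $\mathbb{E}$ assigns to each $\delta\in\mathbb{E}(C,A)$ a class $\mathfrak{s}(\delta)=[X_\bullet]$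 in $\mathsf{K}(\mathcal{C})^n_{(A,C)}$ such that: (R0) for each morphism $(a,c)\colon\delta\to\rho$ with $\mathfrak{s}(\delta)=[X_\bullet]$, $\mathfrak{s}(\rho)=[Y_\bullet]$ there is a chain map $f_\bullet\colon X_\bullet\to Y_\bullet$ with $f_0=a$, $f_{n+1}=c$ (a lift of $(a,c)$); (R1) if $\mathfrak{s}(\delta)=[X_\bullet]$ then $\langle X_\bullet,\delta\rangle$ is an $n$-exangle; (R2) $\mathfrak{s}({}_A0_0)=[A\xrightarrow{\mathrm{id}}A\to0\to\cdots\to0]$ and $\mathfrak{s}({}_00_A)=[0\to\cdots\to0\to A\xrightarrow{\mathrm{id}}A]$. If $\mathfrak{s}(\delta)=[X_\bullet]$, then $\langle X_\bullet,\delta\rangle$ is called $\mathfrak{s}$-distinguished, $d^X_0$ an $\mathfrak{s}$-inflation and $d^X_n$ an $\mathfrak{s}$-deflation. For a chain map $f_\bullet\colon X_\bullet\to Y_\bullet$ in $\mathsf{Ch}(\mathcal{C})^n$ with $X_0=Y_0$, $f_0=\mathrm{id}$, the mapping cone $M_f$ is the complex $X_1\to X_2\oplus Y_1\to X_3\oplus Y_2\to\cdots\to X_{n+1}\oplus Y_n\to Y_{n+1}$ with differentials $\begin{pmatrix}-d^X_1\\ f_1\end{pmatrix}$, $\begin{pmatrix}-d^X_{i+1}&0\\ f_{i+1}&d^Y_i\end{pmatrix}$ ($1\le i\le n-1$), $\begin{pmatrix}f_{n+1}&d^Y_n\end{pmatrix}$. $(\mathcal{C},\mathbb{E},\mathfrak{s})$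 is an $n$-exangulated category if $\mathfrak{s}$ is an exact realisation of $\mathbb{E}$ and: (EA1) $\mathfrak{s}$-inflations are closed under composition and $\mathfrak{s}$-deflations are closed under composition; (EA2) for $\delta\in\mathbb{E}(D,A)$, $c\colon C\to D$, $\mathfrak{s}(c^{\mathbb{E}}\delta)=[Y_\bullet]$, $\mathfrak{s}(\delta)=[X_\bullet]$, there is a lift $f_\bullet\colon Y_\bullet\to X_\bullet$ of $(\mathrm{id}_A,c)$ with $\mathfrak{s}((d^Y_0)_{\mathbb{E}}\delta)=[M_f]$ (a good lift); (EA2)$^{\mathrm{op}}$ the dual of (EA2). It is idempotent complete if every idempotent $e\colon X\to X$ in $\mathcal{C}$ splits (i.e. $e=sr$ and $rs=\mathrm{id}_Y$ for some $r\colon X\to Y$, $s\colon Y\to X$). **Functors and transformations.** An $n$-exangulated functor $(\mathscr{F},\Lambda)\colon(\mathcal{C},\mathbb{E},\mathfrak{s})\to(\mathcal{C}',\mathbb{E}',\mathfrak{s}')$ is an additive functor $\mathscr{F}$ with a natural transformation $\Lambda\colon\mathbb{E}(-,-)\Rightarrow\mathbb{E}'(\mathscr{F}-,\mathscr{F}-)$ (of $\mathsf{Ab}$-valued functors) such that $\mathfrak{s}(\delta)=[X_\bullet]$ implies $\mathfrak{s}'(\Lambda_{(C,A)}(\delta))=[\mathscr{F}(X_\bullet)]$ for all $\delta\in\mathbb{E}(C,A)$. Composition: $(\mathscr{L},\Phi)\circ(\mathscr{F},\Gamma)=(\mathscr{L}\mathscr{F},\Phi_{\mathscr{F}\times\mathscr{F}}\circ\Gamma)$.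 An $n$-exangulated natural transformation $(\mathscr{F},\Gamma)\Rightarrow(\mathscr{G},\Lambda)$ is a natural transformation $\beta\colon\mathscr{F}\Rightarrow\mathscr{G}$ with $(\beta_A)_{\mathbb{E}'}\Gamma_{(C,A)}(\delta)=(\beta_C)^{\mathbb{E}'}\Lambda_{(C,A)}(\delta)$ for all $\delta\in\mathbb{E}(C,A)$; it is an $n$-exangulated natural isomorphism if it has an $n$-exangulated inverse (equivalently, each component is an isomorphism). Whiskering: $(\gamma_{\mathscr{I}})_X=\gamma_{\mathscr{I}(X)}$. **Idempotent completion.** Objects of $\widetilde{\mathcal{C}}$ are pairs $(X,e)$ with $e\in\mathrm{End}_{\mathcal{C}}(X)$, $e^2=e$. Morphisms $(X,e)\to(Y,e')$ are triplets $(e',r,e)$ with $r\in\mathcal{C}(X,Y)$, $re=r=e'r$. Composition: $(e'',s,e')\circ(e',r,e)=(e'',sr,e)$; the identity of $(X,e)$ is $(e,e,e)$. $\mathscr{I}_{\mathcal{C}}(X)=(X,\mathrm{id}_X)$, $\mathscr{I}_{\mathcal{C}}(r)=(\mathrm{id}_Y,r,\mathrm{id}_X)$. $\mathbb{F}((Z,e'),(X,e))=\{(e,\delta,e')\mid\delta\in\mathbb{E}(Z,X),\ e_{\mathbb{E}}\delta=\delta=(e')^{\mathbb{E}}\delta\}$ with addition inherited from $\mathbb{E}(Z,X)$; for morphisms $\tilde a=(e_1,a,e)\colon(X,e)\to(X_1,e_1)$ and $\tilde c=(e',c,e_2)\colon(Z_2,e_2)\to(Z,e')$, $\mathbb{F}(\tilde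 c,\tilde a)(e,\delta,e')=(e_1,\mathbb{E}(c,a)(\delta),e_2)$. For $\tilde\delta=(e_0,\delta,e_{n+1})\in\mathbb{F}((X_{n+1},e_{n+1}),(X_0,e_0))$ choose $X_\bullet$ with $\mathfrak{s}(\delta)=[X_\bullet]$ and an idempotent chain map $e_\bullet\colon X_\bullet\to X_\bullet$ with the given end terms $e_0$ and $e_{n+1}$ (such exists), and set $\mathfrak{t}(\tilde\delta)=[(X_\bullet,e_\bullet)]$, where $(X_\bullet,e_\bullet)$ is the complex in $\widetilde{\mathcal{C}}$ with objects $(X_i,e_i)$ and differentials $(e_{i+1},e_{i+1}d^X_ie_i,e_i)$; this class is independent of the choices. *)

theory Defs
  imports "HOL-Algebra.Coset"
begin

section \<open>Additive categories\<close>

text \<open>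
  Abelian groups are \<open>comm_group\<close>s, so the group operation of a hom-set or of an extension
  group is written \<open>\<otimes>\<close>, its zero \<open>\<one>\<close>, and its negation \<open>inv\<close>.
\<close>

record ('o, 'm) cat =
  Obj :: "'o set"
  Hom :: "'o \<Rightarrow> 'o \<Rightarrow> 'm monoid"
  Cmp :: "'m \<Rightarrow> 'm \<Rightarrow> 'm" (infixl "\<cdot>\<index>" 75)
  Idt :: "'o \<Rightarrow> 'm"

abbreviation Arr :: "('o, 'm) cat \<Rightarrow> 'o \<Rightarrow> 'o \<Rightarrow> 'm set" where
  "Arr C A B \<equiv> carrier (Hom C A B)"

text \<open>Hom-sets are pairwise disjoint, i.e. an arrow determines its domain and codomain.\<close>

locale preadditive_category =
  fixes C :: "('o, 'm) cat" (structure)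
  assumes hom_group: "\<lbrakk>A \<in> Obj C; B \<in> Obj C\<rbrakk> \<Longrightarrow> comm_group (Hom C A B)"
    and hom_disjoint: "\<lbrakk>A \<in> Obj C; B \<in> Obj C; A' \<in> Obj C; B' \<in> Obj C;
      f \<in> Arr C A B; f \<in> Arr C A' B'\<rbrakk> \<Longrightarrow> A = A' \<and> B = B'"
    and id_arr: "A \<in> Obj C \<Longrightarrow> Idt C A \<in> Arr C A A"
    and cmp_arr: "\<lbrakk>A \<in> Obj C; B \<in> Obj C; D \<in> Obj C; f \<in> Arr C A B; g \<in> Arr C B D\<rbrakk>
      \<Longrightarrow> g \<cdot> f \<in> Arr C A D"
    and cmp_assoc: "\<lbrakk>A \<in> Obj C; B \<in> Obj C; D \<in> Obj C; D' \<in> Obj C;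
      f \<in> Arr C A B; g \<in> Arr C B D; h \<in> Arr C D D'\<rbrakk> \<Longrightarrow> (h \<cdot> g) \<cdot> f = h \<cdot> (g \<cdot> f)"
    and cmp_id_right: "\<lbrakk>A \<in> Obj C; B \<in> Obj C; f \<in> Arr C A B\<rbrakk> \<Longrightarrow> f \<cdot> Idt C A = f"
    and cmp_id_left: "\<lbrakk>A \<in> Obj C; B \<in> Obj C; f \<in> Arr C A B\<rbrakk> \<Longrightarrow> Idt C B \<cdot> f = f"
    and cmp_add_right: "\<lbrakk>A \<in> Obj C; B \<in> Obj C; D \<in> Obj C;
      f \<in> Arr C A B; f' \<in> Arr C A B; g \<in> Arr C B D\<rbrakk>
      \<Longrightarrow> g \<cdot> (f \<otimes>\<^bsub>Hom C A B\<^esub> f') = (g \<cdot> f) \<otimes>\<^bsub>Hom C A D\<^esub> (g \<cdot> f')"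
    and cmp_add_left: "\<lbrakk>A \<in> Obj C; B \<in> Obj C; D \<in> Obj C;
      f \<in> Arr C A B; g \<in> Arr C B D; g' \<in> Arr C B D\<rbrakk>
      \<Longrightarrow> (g \<otimes>\<^bsub>Hom C B D\<^esub> g') \<cdot> f = (g \<cdot> f) \<otimes>\<^bsub>Hom C A D\<^esub> (g' \<cdot> f)"

definition zero_object :: "('o, 'm) cat \<Rightarrow> 'o \<Rightarrow> bool" where
  "zero_object C Z \<longleftrightarrow> Z \<in> Obj C \<and>
     (\<forall>A\<in>Obj C. (\<exists>!f. f \<in> Arr C Z A) \<and> (\<exists>!f. f \<in> Arr C A Z))"

record ('o, 'm) bip =
  bob :: 'o
  inl :: 'm
  inr :: 'm
  prl :: 'm
  prr :: 'm

definition is_biproduct :: "('o, 'm) cat \<Rightarrow> 'o \<Rightarrow> 'o \<Rightarrow> ('o, 'm) bip \<Rightarrow> bool" where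
  "is_biproduct C A B P \<longleftrightarrow> bob P \<in> Obj C \<and>
     inl P \<in> Arr C A (bob P) \<and> inr P \<in> Arr C B (bob P) \<and>
     prl P \<in> Arr C (bob P) A \<and> prr P \<in> Arr C (bob P) B \<and>
     prl P \<cdot>\<^bsub>C\<^esub> inl P = Idt C A \<and> prr P \<cdot>\<^bsub>C\<^esub> inr P = Idt C B \<and>
     prl P \<cdot>\<^bsub>C\<^esub> inr P = \<one>\<^bsub>Hom C B A\<^esub> \<and> prr P \<cdot>\<^bsub>C\<^esub> inl P = \<one>\<^bsub>Hom C A B\<^esub> \<and>
     (inl P \<cdot>\<^bsub>C\<^esub> prl P) \<otimes>\<^bsub>Hom C (bob P) (bob P)\<^esub> (inr P \<cdot>\<^bsub>C\<^esub> prr P) = Idt C (bob P)"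

locale additive_category = preadditive_category C for C :: "('o, 'm) cat" (structure) +
  assumes ex_zero: "\<exists>Z. zero_object C Z"
    and ex_biproduct: "\<lbrakk>A \<in> Obj C; B \<in> Obj C\<rbrakk> \<Longrightarrow> \<exists>P. is_biproduct C A B P"

definition idempotent_complete :: "('o, 'm) cat \<Rightarrow> bool" where
  "idempotent_complete C \<longleftrightarrow> (\<forall>X\<in>Obj C. \<forall>e\<in>Arr C X X. e \<cdot>\<^bsub>C\<^esub> e = e \<longrightarrow>
     (\<exists>Y\<in>Obj C. \<exists>r\<in>Arr C X Y. \<exists>s\<in>Arr C Y X. e = s \<cdot>\<^bsub>C\<^esub> r \<and> r \<cdot>\<^bsub>C\<^esub> s = Idt C Y))"

text \<open>A fixed choice of \<open>A \<oplus> B\<close>, and the \<open>2 \<times> 1\<close> and \<open>1 \<times> 2\<close> matrices with respect to it.\<close>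

definition bip_of :: "('o, 'm) cat \<Rightarrow> 'o \<Rightarrow> 'o \<Rightarrow> ('o, 'm) bip" where
  "bip_of C A B = (SOME P. is_biproduct C A B P)"

abbreviation bsum :: "('o, 'm) cat \<Rightarrow> 'o \<Rightarrow> 'o \<Rightarrow> 'o" where
  "bsum C A B \<equiv> bob (bip_of C A B)"

text \<open>\<open>col C T A B f g\<close> is \<open>T \<rightarrow> A \<oplus> B\<close>, and \<open>row C A B T f g\<close> is \<open>A \<oplus> B \<rightarrow> T\<close>.\<close>

definition col :: "('o, 'm) cat \<Rightarrow> 'o \<Rightarrow> 'o \<Rightarrow> 'o \<Rightarrow> 'm \<Rightarrow> 'm \<Rightarrow> 'm" where
  "col C T A B f g =
     (inl (bip_of C A B) \<cdot>\<^bsub>C\<^esub> f) \<otimes>\<^bsub>Hom C T (bsum C A B)\<^esub> (inr (bip_of C A B) \<cdot>\<^bsub>C\<^esub> g)"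

definition row :: "('o, 'm) cat \<Rightarrow> 'o \<Rightarrow> 'o \<Rightarrow> 'o \<Rightarrow> 'm \<Rightarrow> 'm \<Rightarrow> 'm" where
  "row C A B T f g =
     (f \<cdot>\<^bsub>C\<^esub> prl (bip_of C A B)) \<otimes>\<^bsub>Hom C (bsum C A B) T\<^esub> (g \<cdot>\<^bsub>C\<^esub> prr (bip_of C A B))"


section \<open>Biadditive functors to abelian groups\<close>

text \<open>
  \<open>Ext E K A\<close> is the group \<open>E(K, A)\<close>, contravariant in \<open>K\<close>, and \<open>Act E c a\<close> is \<open>E(c, a)\<close>.
\<close>

record ('o, 'm, 'x) ext =
  Ext :: "'o \<Rightarrow> 'o \<Rightarrow> 'x monoid"
  Act :: "'m \<Rightarrow> 'm \<Rightarrow> 'x \<Rightarrow> 'x"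

definition push :: "('o, 'm) cat \<Rightarrow> ('o, 'm, 'x) ext \<Rightarrow> 'o \<Rightarrow> 'm \<Rightarrow> 'x \<Rightarrow> 'x" where
  "push C E K a \<delta> = Act E (Idt C K) a \<delta>"

definition pull :: "('o, 'm) cat \<Rightarrow> ('o, 'm, 'x) ext \<Rightarrow> 'o \<Rightarrow> 'm \<Rightarrow> 'x \<Rightarrow> 'x" where
  "pull C E A d \<delta> = Act E d (Idt C A) \<delta>"

locale biadditive_functor = additive_category C
  for C :: "('o, 'm) cat" (structure) and E :: "('o, 'm, 'x) ext" +
  assumes ext_group: "\<lbrakk>K \<in> Obj C; A \<in> Obj C\<rbrakk> \<Longrightarrow> comm_group (Ext E K A)"
    and act_hom: "\<lbrakk>K \<in> Obj C; L \<in> Obj C; A \<in> Obj C; B \<in> Obj C; c \<in> Arr C L K; a \<in> Arr C A B\<rbrakk>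
      \<Longrightarrow> Act E c a \<in> hom (Ext E K A) (Ext E L B)"
    and act_id: "\<lbrakk>K \<in> Obj C; A \<in> Obj C; \<delta> \<in> carrier (Ext E K A)\<rbrakk>
      \<Longrightarrow> Act E (Idt C K) (Idt C A) \<delta> = \<delta>"
    and act_cmp: "\<lbrakk>K \<in> Obj C; L \<in> Obj C; M \<in> Obj C; A \<in> Obj C; B \<in> Obj C; D \<in> Obj C;
      c \<in> Arr C L K; c' \<in> Arr C M L; a \<in> Arr C A B; a' \<in> Arr C B D; \<delta> \<in> carrier (Ext E K A)\<rbrakk>
      \<Longrightarrow> Act E (c \<cdot> c') (a' \<cdot> a) \<delta> = Act E c' a' (Act E c a \<delta>)"
    and push_add: "\<lbrakk>K \<in> Obj C; A \<in> Obj C; B \<in> Obj C; a \<in> Arr C A B; a' \<in> Arr C A B;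
      \<delta> \<in> carrier (Ext E K A)\<rbrakk>
      \<Longrightarrow> push C E K (a \<otimes>\<^bsub>Hom C A B\<^esub> a') \<delta> = push C E K a \<delta> \<otimes>\<^bsub>Ext E K B\<^esub> push C E K a' \<delta>"
    and pull_add: "\<lbrakk>K \<in> Obj C; L \<in> Obj C; A \<in> Obj C; c \<in> Arr C L K; c' \<in> Arr C L K;
      \<delta> \<in> carrier (Ext E K A)\<rbrakk>
      \<Longrightarrow> pull C E A (c \<otimes>\<^bsub>Hom C L K\<^esub> c') \<delta> = pull C E A c \<delta> \<otimes>\<^bsub>Ext E L A\<^esub> pull C E A c' \<delta>"


section \<open>Complexes in degrees 0 to n + 1\<close>

text \<open>
  Only \<open>ob X i\<close> for \<open>i \<le> n + 1\<close> and \<open>df X i\<close> for \<open>i \<le> n\<close> matter. All notions below ignore the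
  remaining values; in particular the isomorphism classes are closed under changing them.
\<close>

record ('o, 'm) cpx =
  ob :: "nat \<Rightarrow> 'o"
  df :: "nat \<Rightarrow> 'm"

definition complexes :: "nat \<Rightarrow> ('o, 'm) cat \<Rightarrow> ('o, 'm) cpx set" where
  "complexes n C = {X. (\<forall>i\<le>n+1. ob X i \<in> Obj C) \<and>
     (\<forall>i\<le>n. df X i \<in> Arr C (ob X i) (ob X (i+1))) \<and>
     (\<forall>i<n. df X (i+1) \<cdot>\<^bsub>C\<^esub> df X i = \<one>\<^bsub>Hom C (ob X i) (ob X (i+2))\<^esub>)}"

definition chain_maps ::
  "nat \<Rightarrow> ('o, 'm) cat \<Rightarrow> ('o, 'm) cpx \<Rightarrow> ('o, 'm) cpx \<Rightarrow> (nat \<Rightarrow> 'm) set" where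
  "chain_maps n C X Y = {f. (\<forall>i\<le>n+1. f i \<in> Arr C (ob X i) (ob Y i)) \<and>
     (\<forall>i\<le>n. f (i+1) \<cdot>\<^bsub>C\<^esub> df X i = df Y i \<cdot>\<^bsub>C\<^esub> f i)}"

definition lifts ::
  "nat \<Rightarrow> ('o, 'm) cat \<Rightarrow> ('o, 'm) cpx \<Rightarrow> ('o, 'm) cpx \<Rightarrow> 'm \<Rightarrow> 'm \<Rightarrow> (nat \<Rightarrow> 'm) set" where
  "lifts n C X Y a c = {f \<in> chain_maps n C X Y. f 0 = a \<and> f (n+1) = c}"

definition complexes_between :: "nat \<Rightarrow> ('o, 'm) cat \<Rightarrow> 'o \<Rightarrow> 'o \<Rightarrow> ('o, 'm) cpx set" where
  "complexes_between n C A K = {X \<in> complexes n C. ob X 0 = A \<and> ob X (n+1) = K}"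

text \<open>The homotopy consists of \<open>h i : X i \<rightarrow> Y (i-1)\<close> for \<open>1 \<le> i \<le> n + 1\<close>.\<close>

definition homotopic :: "nat \<Rightarrow> ('o, 'm) cat \<Rightarrow> ('o, 'm) cpx \<Rightarrow> ('o, 'm) cpx
    \<Rightarrow> (nat \<Rightarrow> 'm) \<Rightarrow> (nat \<Rightarrow> 'm) \<Rightarrow> bool" where
  "homotopic n C X Y f g \<longleftrightarrow> (\<exists>h.
     (\<forall>i\<in>{1..n+1}. h i \<in> Arr C (ob X i) (ob Y (i-1))) \<and>
     f 0 \<otimes>\<^bsub>Hom C (ob X 0) (ob Y 0)\<^esub> inv\<^bsub>Hom C (ob X 0) (ob Y 0)\<^esub> g 0 = h 1 \<cdot>\<^bsub>C\<^esub> df X 0 \<and>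
     (\<forall>i\<in>{1..n}. f i \<otimes>\<^bsub>Hom C (ob X i) (ob Y i)\<^esub> inv\<^bsub>Hom C (ob X i) (ob Y i)\<^esub> g i
        = (h (i+1) \<cdot>\<^bsub>C\<^esub> df X i) \<otimes>\<^bsub>Hom C (ob X i) (ob Y i)\<^esub> (df Y (i-1) \<cdot>\<^bsub>C\<^esub> h i)) \<and>
     f (n+1) \<otimes>\<^bsub>Hom C (ob X (n+1)) (ob Y (n+1))\<^esub> inv\<^bsub>Hom C (ob X (n+1)) (ob Y (n+1))\<^esub> g (n+1)
        = df Y n \<cdot>\<^bsub>C\<^esub> h (n+1))"

text \<open>Isomorphism in the homotopy category of complexes with fixed end terms.\<close>

definition homotopy_iso ::
  "nat \<Rightarrow> ('o, 'm) cat \<Rightarrow> 'o \<Rightarrow> 'o \<Rightarrow> ('o, 'm) cpx \<Rightarrow> ('o, 'm) cpx \<Rightarrow> bool" where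
  "homotopy_iso n C A K X Y \<longleftrightarrow>
     (\<exists>f\<in>lifts n C X Y (Idt C A) (Idt C K). \<exists>g\<in>lifts n C Y X (Idt C A) (Idt C K).
        homotopic n C X X (\<lambda>i. g i \<cdot>\<^bsub>C\<^esub> f i) (\<lambda>i. Idt C (ob X i)) \<and>
        homotopic n C Y Y (\<lambda>i. f i \<cdot>\<^bsub>C\<^esub> g i) (\<lambda>i. Idt C (ob Y i)))"

definition iso_class ::
  "nat \<Rightarrow> ('o, 'm) cat \<Rightarrow> 'o \<Rightarrow> 'o \<Rightarrow> ('o, 'm) cpx \<Rightarrow> ('o, 'm) cpx set" where
  "iso_class n C A K X = {Y \<in> complexes_between n C A K. homotopy_iso n C A K X Y}"

text \<open>For \<open>f : X \<rightarrow> Y\<close> with \<open>X 0 = Y 0\<close> and \<open>f 0\<close> the identity.\<close>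

definition mapping_cone :: "nat \<Rightarrow> ('o, 'm) cat \<Rightarrow> ('o, 'm) cpx \<Rightarrow> ('o, 'm) cpx
    \<Rightarrow> (nat \<Rightarrow> 'm) \<Rightarrow> ('o, 'm) cpx" where
  "mapping_cone n C X Y f = \<lparr>
     ob = (\<lambda>i. if i = 0 then ob X 1
               else if i \<le> n then bsum C (ob X (i+1)) (ob Y i)
               else ob Y (n+1)),
     df = (\<lambda>i. let neg_d = inv\<^bsub>Hom C (ob X (i+1)) (ob X (i+2))\<^esub> (df X (i+1)) in
            if i = 0 then
              col C (ob X 1) (ob X 2) (ob Y 1) neg_d (f 1)
            else if i < n then
              col C (bsum C (ob X (i+1)) (ob Y i)) (ob X (i+2)) (ob Y (i+1))
                (row C (ob X (i+1)) (ob Y i) (ob X (i+2)) neg_d \<one>\<^bsub>Hom C (ob Y i) (ob X (i+2))\<^esub>)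
                (row C (ob X (i+1)) (ob Y i) (ob Y (i+1)) (f (i+1)) (df Y i))
            else
              row C (ob X (n+1)) (ob Y n) (ob Y (n+1)) (f (n+1)) (df Y n))\<rparr>"


section \<open>n-exangles and exact realisations\<close>

definition attached_complex ::
  "nat \<Rightarrow> ('o, 'm) cat \<Rightarrow> ('o, 'm, 'x) ext \<Rightarrow> ('o, 'm) cpx \<Rightarrow> 'x \<Rightarrow> bool" where
  "attached_complex n C E X \<delta> \<longleftrightarrow>
     X \<in> complexes n C \<and> \<delta> \<in> carrier (Ext E (ob X (n+1)) (ob X 0)) \<and>
     push C E (ob X (n+1)) (df X 0) \<delta> = \<one>\<^bsub>Ext E (ob X (n+1)) (ob X 1)\<^esub> \<and>
     pull C E (ob X 0) (df X n) \<delta> = \<one>\<^bsub>Ext E (ob X n) (ob X 0)\<^esub>"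

text \<open>Exactness is required at every term except the two outermost ones.\<close>

definition exangle ::
  "nat \<Rightarrow> ('o, 'm) cat \<Rightarrow> ('o, 'm, 'x) ext \<Rightarrow> ('o, 'm) cpx \<Rightarrow> 'x \<Rightarrow> bool" where
  "exangle n C E X \<delta> \<longleftrightarrow> attached_complex n C E X \<delta> \<and> (\<forall>Y\<in>Obj C.
     (\<forall>i\<in>{1..n}. kernel (Hom C Y (ob X i)) (Hom C Y (ob X (i+1))) (\<lambda>u. df X i \<cdot>\<^bsub>C\<^esub> u)
        = (\<lambda>v. df X (i-1) \<cdot>\<^bsub>C\<^esub> v) ` Arr C Y (ob X (i-1))) \<and>
     kernel (Hom C Y (ob X (n+1))) (Ext E Y (ob X 0)) (\<lambda>u. pull C E (ob X 0) u \<delta>)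
        = (\<lambda>v. df X n \<cdot>\<^bsub>C\<^esub> v) ` Arr C Y (ob X n) \<and>
     (\<forall>i\<in>{1..n}. kernel (Hom C (ob X i) Y) (Hom C (ob X (i-1)) Y) (\<lambda>u. u \<cdot>\<^bsub>C\<^esub> df X (i-1))
        = (\<lambda>v. v \<cdot>\<^bsub>C\<^esub> df X i) ` Arr C (ob X (i+1)) Y) \<and>
     kernel (Hom C (ob X 0) Y) (Ext E (ob X (n+1)) Y) (\<lambda>u. push C E (ob X (n+1)) u \<delta>)
        = (\<lambda>v. v \<cdot>\<^bsub>C\<^esub> df X 0) ` Arr C (ob X 1) Y)"

text \<open>\<open>s K A \<delta>\<close> is the class assigned to \<open>\<delta> \<in> E(K, A)\<close>, as a set of complexes.\<close>

type_synonym ('o, 'm, 'x) realisation = "'o \<Rightarrow> 'o \<Rightarrow> 'x \<Rightarrow> ('o, 'm) cpx set"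

definition realises :: "nat \<Rightarrow> ('o, 'm) cat \<Rightarrow> ('o, 'm, 'x) realisation
    \<Rightarrow> 'o \<Rightarrow> 'o \<Rightarrow> 'x \<Rightarrow> ('o, 'm) cpx \<Rightarrow> bool" where
  "realises n C s K A \<delta> X \<longleftrightarrow> X \<in> complexes_between n C A K \<and> s K A \<delta> = iso_class n C A K X"

definition split_left :: "('o, 'm) cat \<Rightarrow> 'o \<Rightarrow> 'o \<Rightarrow> ('o, 'm) cpx" where
  "split_left C A Z = (let X = (\<lambda>i. if i \<le> 1 then A else Z) in
     \<lparr>ob = X, df = (\<lambda>i. if i = 0 then Idt C A else \<one>\<^bsub>Hom C (X i) (X (i+1))\<^esub>)\<rparr>)"

definition split_right :: "nat \<Rightarrow> ('o, 'm) cat \<Rightarrow> 'o \<Rightarrow> 'o \<Rightarrow> ('o, 'm) cpx" where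
  "split_right n C Z A = (let X = (\<lambda>i. if i < n then Z else A) in
     \<lparr>ob = X, df = (\<lambda>i. if i = n then Idt C A else \<one>\<^bsub>Hom C (X i) (X (i+1))\<^esub>)\<rparr>)"

locale exact_realisation = biadditive_functor C E
  for n :: nat and C :: "('o, 'm) cat" (structure) and E :: "('o, 'm, 'x) ext"
    and s :: "('o, 'm, 'x) realisation" +
  assumes realised: "\<lbrakk>K \<in> Obj C; A \<in> Obj C; \<delta> \<in> carrier (Ext E K A)\<rbrakk>
      \<Longrightarrow> \<exists>X. realises n C s K A \<delta> X"
    and R0: "\<lbrakk>K \<in> Obj C; A \<in> Obj C; L \<in> Obj C; B \<in> Obj C;
      \<delta> \<in> carrier (Ext E K A); \<rho> \<in> carrier (Ext E L B); a \<in> Arr C A B; c \<in> Arr C K L;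
      push C E K a \<delta> = pull C E B c \<rho>; realises n C s K A \<delta> X; realises n C s L B \<rho> Y\<rbrakk>
      \<Longrightarrow> \<exists>f. f \<in> lifts n C X Y a c"
    and R1: "\<lbrakk>K \<in> Obj C; A \<in> Obj C; \<delta> \<in> carrier (Ext E K A); realises n C s K A \<delta> X\<rbrakk>
      \<Longrightarrow> exangle n C E X \<delta>"
    and R2: "\<lbrakk>A \<in> Obj C; zero_object C Z\<rbrakk>
      \<Longrightarrow> realises n C s Z A \<one>\<^bsub>Ext E Z A\<^esub> (split_left C A Z) \<and>
          realises n C s A Z \<one>\<^bsub>Ext E A Z\<^esub> (split_right n C Z A)"


section \<open>n-exangulated categories\<close>

definition inflation :: "nat \<Rightarrow> ('o, 'm) cat \<Rightarrow> ('o, 'm, 'x) ext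
    \<Rightarrow> ('o, 'm, 'x) realisation \<Rightarrow> 'm \<Rightarrow> bool" where
  "inflation n C E s f \<longleftrightarrow> (\<exists>K\<in>Obj C. \<exists>A\<in>Obj C. \<exists>\<delta>\<in>carrier (Ext E K A). \<exists>X.
     realises n C s K A \<delta> X \<and> f = df X 0)"

definition deflation :: "nat \<Rightarrow> ('o, 'm) cat \<Rightarrow> ('o, 'm, 'x) ext
    \<Rightarrow> ('o, 'm, 'x) realisation \<Rightarrow> 'm \<Rightarrow> bool" where
  "deflation n C E s f \<longleftrightarrow> (\<exists>K\<in>Obj C. \<exists>A\<in>Obj C. \<exists>\<delta>\<in>carrier (Ext E K A). \<exists>X.
     realises n C s K A \<delta> X \<and> f = df X n)"

definition EA1 :: "nat \<Rightarrow> ('o, 'm) cat \<Rightarrow> ('o, 'm, 'x) ext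
    \<Rightarrow> ('o, 'm, 'x) realisation \<Rightarrow> bool" where
  "EA1 n C E s \<longleftrightarrow> (\<forall>A\<in>Obj C. \<forall>B\<in>Obj C. \<forall>D\<in>Obj C. \<forall>f\<in>Arr C A B. \<forall>g\<in>Arr C B D.
     (inflation n C E s f \<and> inflation n C E s g \<longrightarrow> inflation n C E s (g \<cdot>\<^bsub>C\<^esub> f)) \<and>
     (deflation n C E s f \<and> deflation n C E s g \<longrightarrow> deflation n C E s (g \<cdot>\<^bsub>C\<^esub> f)))"

definition EA2 :: "nat \<Rightarrow> ('o, 'm) cat \<Rightarrow> ('o, 'm, 'x) ext
    \<Rightarrow> ('o, 'm, 'x) realisation \<Rightarrow> bool" where
  "EA2 n C E s \<longleftrightarrow> (\<forall>A\<in>Obj C. \<forall>K\<in>Obj C. \<forall>D\<in>Obj C. \<forall>\<delta>\<in>carrier (Ext E D A). \<forall>c\<in>Arr C K D.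
     \<forall>X Y. realises n C s K A (pull C E A c \<delta>) Y \<and> realises n C s D A \<delta> X \<longrightarrow>
       (\<exists>f\<in>lifts n C Y X (Idt C A) c.
          realises n C s D (ob Y 1) (push C E D (df Y 0) \<delta>) (mapping_cone n C Y X f)))"

text \<open>
  The opposite of \<open>(C, E, s)\<close>, in terms of which the dual of \<open>EA2\<close> is stated. The opposite
  realisation is a preimage under reversal because \<open>rev_cpx n\<close> normalises the irrelevant
  values of a complex.
\<close>

definition op_cat :: "('o, 'm) cat \<Rightarrow> ('o, 'm) cat" where
  "op_cat C = \<lparr>Obj = Obj C, Hom = (\<lambda>A B. Hom C B A), Cmp = (\<lambda>g f. f \<cdot>\<^bsub>C\<^esub> g), Idt = Idt C\<rparr>"

definition op_ext :: "('o, 'm, 'x) ext \<Rightarrow> ('o, 'm, 'x) ext" where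
  "op_ext E = \<lparr>Ext = (\<lambda>K A. Ext E A K), Act = (\<lambda>c a. Act E a c)\<rparr>"

definition rev_cpx :: "nat \<Rightarrow> ('o, 'm) cpx \<Rightarrow> ('o, 'm) cpx" where
  "rev_cpx n X = \<lparr>ob = (\<lambda>i. ob X (n + 1 - i)), df = (\<lambda>i. df X (n - i))\<rparr>"

definition op_real :: "nat \<Rightarrow> ('o, 'm, 'x) realisation \<Rightarrow> ('o, 'm, 'x) realisation" where
  "op_real n s = (\<lambda>K A \<delta>. rev_cpx n -` s A K \<delta>)"

locale exangulated_category = exact_realisation n C E s
  for n :: nat and C :: "('o, 'm) cat" (structure) and E :: "('o, 'm, 'x) ext"
    and s :: "('o, 'm, 'x) realisation" +
  assumes EA1: "EA1 n C E s"
    and EA2: "EA2 n C E s"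
    and EA2_op: "EA2 n (op_cat C) (op_ext E) (op_real n s)"


section \<open>n-exangulated functors and natural transformations\<close>

record ('o, 'm, 'p, 'q) cfunctor =
  fob :: "'o \<Rightarrow> 'p"
  farr :: "'m \<Rightarrow> 'q"

definition additive_functor ::
  "('o, 'm) cat \<Rightarrow> ('p, 'q) cat \<Rightarrow> ('o, 'm, 'p, 'q) cfunctor \<Rightarrow> bool" where
  "additive_functor C D F \<longleftrightarrow>
     (\<forall>A\<in>Obj C. fob F A \<in> Obj D \<and> farr F (Idt C A) = Idt D (fob F A)) \<and>
     (\<forall>A\<in>Obj C. \<forall>B\<in>Obj C. farr F \<in> hom (Hom C A B) (Hom D (fob F A) (fob F B))) \<and>
     (\<forall>A\<in>Obj C. \<forall>B\<in>Obj C. \<forall>B'\<in>Obj C. \<forall>f\<in>Arr C A B. \<forall>g\<in>Arr C B B'.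
        farr F (g \<cdot>\<^bsub>C\<^esub> f) = farr F g \<cdot>\<^bsub>D\<^esub> farr F f)"

definition map_cpx :: "('o, 'm, 'p, 'q) cfunctor \<Rightarrow> ('o, 'm) cpx \<Rightarrow> ('p, 'q) cpx" where
  "map_cpx F X = \<lparr>ob = (\<lambda>i. fob F (ob X i)), df = (\<lambda>i. farr F (df X i))\<rparr>"

definition ext_transformation :: "('o, 'm) cat \<Rightarrow> ('o, 'm, 'x) ext \<Rightarrow> ('p, 'q, 'y) ext
    \<Rightarrow> ('o, 'm, 'p, 'q) cfunctor \<Rightarrow> ('o \<Rightarrow> 'o \<Rightarrow> 'x \<Rightarrow> 'y) \<Rightarrow> bool" where
  "ext_transformation C E E' F \<Lambda> \<longleftrightarrow>
     (\<forall>K\<in>Obj C. \<forall>A\<in>Obj C. \<Lambda> K A \<in> hom (Ext E K A) (Ext E' (fob F K) (fob F A))) \<and>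
     (\<forall>K\<in>Obj C. \<forall>L\<in>Obj C. \<forall>A\<in>Obj C. \<forall>B\<in>Obj C. \<forall>c\<in>Arr C L K. \<forall>a\<in>Arr C A B.
        \<forall>\<delta>\<in>carrier (Ext E K A).
          \<Lambda> L B (Act E c a \<delta>) = Act E' (farr F c) (farr F a) (\<Lambda> K A \<delta>))"

definition exangulated_functor :: "nat
    \<Rightarrow> ('o, 'm) cat \<Rightarrow> ('o, 'm, 'x) ext \<Rightarrow> ('o, 'm, 'x) realisation
    \<Rightarrow> ('p, 'q) cat \<Rightarrow> ('p, 'q, 'y) ext \<Rightarrow> ('p, 'q, 'y) realisation
    \<Rightarrow> ('o, 'm, 'p, 'q) cfunctor \<Rightarrow> ('o \<Rightarrow> 'o \<Rightarrow> 'x \<Rightarrow> 'y) \<Rightarrow> bool" where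
  "exangulated_functor n C E s C' E' s' F \<Lambda> \<longleftrightarrow>
     additive_functor C C' F \<and> ext_transformation C E E' F \<Lambda> \<and>
     (\<forall>K\<in>Obj C. \<forall>A\<in>Obj C. \<forall>\<delta>\<in>carrier (Ext E K A). \<forall>X. realises n C s K A \<delta> X \<longrightarrow>
        realises n C' s' (fob F K) (fob F A) (\<Lambda> K A \<delta>) (map_cpx F X))"

definition functor_comp :: "('p, 'q, 'u, 'v) cfunctor \<Rightarrow> ('o, 'm, 'p, 'q) cfunctor
    \<Rightarrow> ('o, 'm, 'u, 'v) cfunctor" where
  "functor_comp L F = \<lparr>fob = fob L \<circ> fob F, farr = farr L \<circ> farr F\<rparr>"

text \<open>The second component of \<open>(L, \<Phi>) \<circ> (F, \<Gamma>)\<close>.\<close>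

definition ext_comp :: "('p \<Rightarrow> 'p \<Rightarrow> 'y \<Rightarrow> 'z) \<Rightarrow> ('o, 'm, 'p, 'q) cfunctor
    \<Rightarrow> ('o \<Rightarrow> 'o \<Rightarrow> 'x \<Rightarrow> 'y) \<Rightarrow> ('o \<Rightarrow> 'o \<Rightarrow> 'x \<Rightarrow> 'z)" where
  "ext_comp \<Phi> F \<Gamma> = (\<lambda>K A. \<Phi> (fob F K) (fob F A) \<circ> \<Gamma> K A)"

definition nat_transformation :: "('o, 'm) cat \<Rightarrow> ('p, 'q) cat
    \<Rightarrow> ('o, 'm, 'p, 'q) cfunctor \<Rightarrow> ('o, 'm, 'p, 'q) cfunctor \<Rightarrow> ('o \<Rightarrow> 'q) \<Rightarrow> bool" where
  "nat_transformation C D F G \<beta> \<longleftrightarrow>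
     (\<forall>A\<in>Obj C. \<beta> A \<in> Arr D (fob F A) (fob G A)) \<and>
     (\<forall>A\<in>Obj C. \<forall>B\<in>Obj C. \<forall>f\<in>Arr C A B. \<beta> B \<cdot>\<^bsub>D\<^esub> farr F f = farr G f \<cdot>\<^bsub>D\<^esub> \<beta> A)"

definition exangulated_trans :: "('o, 'm) cat \<Rightarrow> ('o, 'm, 'x) ext
    \<Rightarrow> ('p, 'q) cat \<Rightarrow> ('p, 'q, 'y) ext
    \<Rightarrow> ('o, 'm, 'p, 'q) cfunctor \<Rightarrow> ('o \<Rightarrow> 'o \<Rightarrow> 'x \<Rightarrow> 'y)
    \<Rightarrow> ('o, 'm, 'p, 'q) cfunctor \<Rightarrow> ('o \<Rightarrow> 'o \<Rightarrow> 'x \<Rightarrow> 'y) \<Rightarrow> ('o \<Rightarrow> 'q) \<Rightarrow> bool" where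
  "exangulated_trans C E C' E' F \<Gamma> G \<Lambda> \<beta> \<longleftrightarrow> nat_transformation C C' F G \<beta> \<and>
     (\<forall>K\<in>Obj C. \<forall>A\<in>Obj C. \<forall>\<delta>\<in>carrier (Ext E K A).
        push C' E' (fob F K) (\<beta> A) (\<Gamma> K A \<delta>) = pull C' E' (fob G A) (\<beta> K) (\<Lambda> K A \<delta>))"

definition exangulated_iso :: "('o, 'm) cat \<Rightarrow> ('o, 'm, 'x) ext
    \<Rightarrow> ('p, 'q) cat \<Rightarrow> ('p, 'q, 'y) ext
    \<Rightarrow> ('o, 'm, 'p, 'q) cfunctor \<Rightarrow> ('o \<Rightarrow> 'o \<Rightarrow> 'x \<Rightarrow> 'y)
    \<Rightarrow> ('o, 'm, 'p, 'q) cfunctor \<Rightarrow> ('o \<Rightarrow> 'o \<Rightarrow> 'x \<Rightarrow> 'y) \<Rightarrow> ('o \<Rightarrow> 'q) \<Rightarrow> bool" where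
  "exangulated_iso C E C' E' F \<Gamma> G \<Lambda> \<beta> \<longleftrightarrow> exangulated_trans C E C' E' F \<Gamma> G \<Lambda> \<beta> \<and>
     (\<exists>\<beta>'. exangulated_trans C E C' E' G \<Lambda> F \<Gamma> \<beta>' \<and>
        (\<forall>A\<in>Obj C. \<beta>' A \<cdot>\<^bsub>C'\<^esub> \<beta> A = Idt C' (fob F A) \<and> \<beta> A \<cdot>\<^bsub>C'\<^esub> \<beta>' A = Idt C' (fob G A)))"


section \<open>The idempotent completion\<close>

definition idem_cat :: "('o, 'm) cat \<Rightarrow> ('o \<times> 'm, 'm \<times> 'm \<times> 'm) cat" where
  "idem_cat C = \<lparr>
     Obj = {(X, e). X \<in> Obj C \<and> e \<in> Arr C X X \<and> e \<cdot>\<^bsub>C\<^esub> e = e},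
     Hom = (\<lambda>(X, e) (Y, e').
        \<lparr>carrier = {(e', r, e) | r. r \<in> Arr C X Y \<and> r \<cdot>\<^bsub>C\<^esub> e = r \<and> e' \<cdot>\<^bsub>C\<^esub> r = r},
         mult = (\<lambda>(_, r, _) (_, r', _). (e', r \<otimes>\<^bsub>Hom C X Y\<^esub> r', e)),
         one = (e', \<one>\<^bsub>Hom C X Y\<^esub>, e)\<rparr>),
     Cmp = (\<lambda>(e'', s, _) (_, r, e). (e'', s \<cdot>\<^bsub>C\<^esub> r, e)),
     Idt = (\<lambda>(X, e). (e, e, e))\<rparr>"

definition idem_ext ::
  "('o, 'm) cat \<Rightarrow> ('o, 'm, 'x) ext \<Rightarrow> ('o \<times> 'm, 'm \<times> 'm \<times> 'm, 'm \<times> 'x \<times> 'm) ext" where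
  "idem_ext C E = \<lparr>
     Ext = (\<lambda>(Z, e') (X, e).
        \<lparr>carrier = {(e, \<delta>, e') | \<delta>. \<delta> \<in> carrier (Ext E Z X) \<and>
            push C E Z e \<delta> = \<delta> \<and> pull C E X e' \<delta> = \<delta>},
         mult = (\<lambda>(_, \<delta>, _) (_, \<delta>', _). (e, \<delta> \<otimes>\<^bsub>Ext E Z X\<^esub> \<delta>', e')),
         one = (e, \<one>\<^bsub>Ext E Z X\<^esub>, e')\<rparr>),
     Act = (\<lambda>(_, c, e2) (e1, a, _) (_, \<delta>, _). (e1, Act E c a \<delta>, e2))\<rparr>"

definition idem_cpx ::
  "('o, 'm) cat \<Rightarrow> ('o, 'm) cpx \<Rightarrow> (nat \<Rightarrow> 'm) \<Rightarrow> ('o \<times> 'm, 'm \<times> 'm \<times> 'm) cpx" where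
  "idem_cpx C X e = \<lparr>
     ob = (\<lambda>i. (ob X i, e i)),
     df = (\<lambda>i. (e (i+1), e (i+1) \<cdot>\<^bsub>C\<^esub> df X i \<cdot>\<^bsub>C\<^esub> e i, e i))\<rparr>"

text \<open>The representative and the idempotent chain map on it are chosen by \<open>SOME\<close>.\<close>

definition idem_real :: "nat \<Rightarrow> ('o, 'm) cat \<Rightarrow> ('o, 'm, 'x) realisation
    \<Rightarrow> ('o \<times> 'm, 'm \<times> 'm \<times> 'm, 'm \<times> 'x \<times> 'm) realisation" where
  "idem_real n C s = (\<lambda>(K, k) (A, a) (_, \<delta>, _).
     let (X, e) = (SOME (X, e). realises n C s K A \<delta> X \<and> e \<in> lifts n C X X a k \<and>
                     (\<forall>i\<le>n+1. e i \<cdot>\<^bsub>C\<^esub> e i = e i))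
     in iso_class n (idem_cat C) (A, a) (K, k) (idem_cpx C X e))"

definition dom_of :: "('o, 'm) cat \<Rightarrow> 'm \<Rightarrow> 'o" where
  "dom_of C f = (THE A. A \<in> Obj C \<and> (\<exists>B\<in>Obj C. f \<in> Arr C A B))"

definition cod_of :: "('o, 'm) cat \<Rightarrow> 'm \<Rightarrow> 'o" where
  "cod_of C f = (THE B. B \<in> Obj C \<and> (\<exists>A\<in>Obj C. f \<in> Arr C A B))"

definition idem_incl :: "('o, 'm) cat \<Rightarrow> ('o, 'm, 'o \<times> 'm, 'm \<times> 'm \<times> 'm) cfunctor" where
  "idem_incl C = \<lparr>
     fob = (\<lambda>X. (X, Idt C X)),
     farr = (\<lambda>r. (Idt C (cod_of C r), r, Idt C (dom_of C r)))\<rparr>"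

definition idem_incl_ext :: "('o, 'm) cat \<Rightarrow> 'o \<Rightarrow> 'o \<Rightarrow> 'x \<Rightarrow> 'm \<times> 'x \<times> 'm" where
  "idem_incl_ext C = (\<lambda>K A \<delta>. (Idt C A, \<delta>, Idt C K))"

end

theory Submission
  imports Defs
begin

text \<open>
  An exangle of \<open>\<delta>\<close> is determined up to homotopy by the existence of lifts of the identities in both
  directions, so a complex that is a strict retract of a realisation, with end terms compatible with
  the extensions, is again a realisation. Conversely every realisation in the completion is a strict
  retract, degree by degree, of one that comes from \<open>\<C>\<close>, once contractible summands \<open>W = W\<close> have been added
  to the latter. The axioms (EA1) and (EA2) are transported along such retracts. A composite of
  inflations is a summand of one in \<open>\<C>\<close>, and splitting one idempotent removes the superfluous summands.
  For a good lift, the complement of a strict retract is null-homotopic, and its contraction provides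
  the homotopies that make the mapping cone in the completion a strict retract of one in \<open>\<C>\<close>. The dual
  axioms follow by applying this to the opposite categories, and the extension of a functor to the
  completion sends strict retracts to strict retracts.
\<close>

section \<open>Arithmetic of arrows\<close>

text \<open>Strictness matters because composites of differentials and mapping cones are recognised
  as realisations through identities \<open>p i = 1\<close> holding in every degree, not merely up
  to homotopy. The end terms are prescribed by the extension, so a contractible summand fits only
  into degrees \<open>m\<close> and \<open>m + 1\<close> with \<open>1 \<le> m < n\<close>; in
  degree \<open>n\<close> a unipotent factor \<open>1 + h\<close> with \<open>h h = 0\<close> does
  the correction instead. The same phenomenon recurs: a homotopy built from exactness by recursion
  is under control except near the upper end, and the error left there squares to zero. This is why
  lifts of identities become invertible up to homotopy and why idempotents that kill the extension
  are contractible. A homotopy that enters a map of cones has its difficulty at the other end: the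
  cone has a single summand in degree 0, so the homotopy must vanish there. Duality is used for
  whole axioms: closure of inflations under composition and (EA2) are transferred along any dense
  embedding, and the notion of dense embedding is self-dual.\<close>

context preadditive_category
begin

text \<open>As an arrow determines its two objects, typing is expressed by \<open>ar\<close>,
  \<open>dm\<close> and \<open>cd\<close>, conditions on the arrow alone. Composability becomes an
  equation that rewriting can decide, and no objects have to be carried along.\<close>

definition ar :: "'m \<Rightarrow> bool" where
  "ar f \<longleftrightarrow> (\<exists>A\<in>Obj C. \<exists>B\<in>Obj C. f \<in> Arr C A B)"

abbreviation "dm \<equiv> dom_of C"
abbreviation "cd \<equiv> cod_of C"
abbreviation "zr A B \<equiv> \<one>\<^bsub>Hom C A B\<^esub>"

text \<open>The additions of all hom-sets in one operation; junk unless the arrows are parallel.\<close>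

definition padd :: "'m \<Rightarrow> 'm \<Rightarrow> 'm" (infixl "\<oplus>" 65) where
  "f \<oplus> g = f \<otimes>\<^bsub>Hom C (dm f) (cd f)\<^esub> g"

definition neg :: "'m \<Rightarrow> 'm" where
  "neg f = inv\<^bsub>Hom C (dm f) (cd f)\<^esub> f"

lemma dm_cd_eq:
  assumes "A \<in> Obj C" "B \<in> Obj C" "f \<in> Arr C A B"
  shows "ar f" "dm f = A" "cd f = B"
proof -
  show "ar f" using assms by (auto simp: ar_def)
  show "dm f = A" unfolding dom_of_def
    by (rule the_equality) (use assms hom_disjoint in blast)+
  show "cd f = B" unfolding cod_of_def
    by (rule the_equality) (use assms hom_disjoint in blast)+
qed

lemma ar_Arr:
  assumes "ar f"
  shows "f \<in> Arr C (dm f) (cd f)" "dm f \<in> Obj C" "cd f \<in> Obj C"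
  using assms dm_cd_eq unfolding ar_def by auto

lemmas ar_obj [simp] = ar_Arr(2,3)

text \<open>Being a rewrite rule, it dissolves each membership in a hom-set into typing equations.
  Proofs that must keep a hom-set visible, above all next to an opposite category or the completion,
  switch it off.\<close>

lemma Arr_iff [simp]:
  "A \<in> Obj C \<Longrightarrow> B \<in> Obj C \<Longrightarrow> f \<in> Arr C A B \<longleftrightarrow> ar f \<and> dm f = A \<and> cd f = B"
  by (metis dm_cd_eq ar_Arr(1))

lemma id_typed [simp]:
  assumes "A \<in> Obj C"
  shows "ar (Idt C A)" "dm (Idt C A) = A" "cd (Idt C A) = A"
  by (fact dm_cd_eq[OF assms assms id_arr[OF assms]])+

lemma cmp_typed [simp]:
  assumes "ar f" "ar g" "cd f = dm g"
  shows "ar (g \<cdot> f)" "dm (g \<cdot> f) = dm f" "cd (g \<cdot> f) = cd g"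
  proof -
  have "g \<cdot> f \<in> Arr C (dm f) (cd g)"
    using cmp_arr[OF ar_Arr(2,3)[OF assms(1)] ar_Arr(3)[OF assms(2)] ar_Arr(1)[OF assms(1)]]
      ar_Arr(1)[OF assms(2)] assms(3) by simp
  from dm_cd_eq[OF ar_Arr(2)[OF assms(1)] ar_Arr(3)[OF assms(2)] this]
  show "ar (g \<cdot> f)" "dm (g \<cdot> f) = dm f" "cd (g \<cdot> f) = cd g" .
qed

lemma cmp_assoc' [simp]:
  "\<lbrakk>ar f; ar g; ar h; cd f = dm g; cd g = dm h\<rbrakk> \<Longrightarrow> (h \<cdot> g) \<cdot> f = h \<cdot> (g \<cdot> f)"
  using cmp_assoc[of "dm f" "cd f" "cd g" "cd h" f g h] by simp

lemma id_cmp [simp]: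
  "\<lbrakk>ar f; cd f = A\<rbrakk> \<Longrightarrow> Idt C A \<cdot> f = f"
  "\<lbrakk>ar f; dm f = A\<rbrakk> \<Longrightarrow> f \<cdot> Idt C A = f"
  using cmp_id_left[of "dm f" "cd f" f] cmp_id_right[of "dm f" "cd f" f] by auto

lemma group_Hom: "\<lbrakk>A \<in> Obj C; B \<in> Obj C\<rbrakk> \<Longrightarrow> group (Hom C A B)"
  using hom_group comm_group.axioms(2) by blast

lemma zr_typed [simp]:
  assumes "A \<in> Obj C" "B \<in> Obj C"
  shows "ar (zr A B)" "dm (zr A B) = A" "cd (zr A B) = B"
  by (fact dm_cd_eq[OF assms group.is_monoid[OF group_Hom[OF assms], THEN monoid.one_closed]])+

lemma padd_eq [simp]:
  "\<lbrakk>ar f; dm f = A; cd f = B\<rbrakk> \<Longrightarrow> f \<otimes>\<^bsub>Hom C A B\<^esub> g = f \<oplus> g"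
  by (simp add: padd_def)

lemma neg_eq [simp]:
  "\<lbrakk>ar f; dm f = A; cd f = B\<rbrakk> \<Longrightarrow> inv\<^bsub>Hom C A B\<^esub> f = neg f"
  by (simp add: neg_def)

lemma padd_typed [simp]:
  assumes "ar f" "ar g" "dm g = dm f" "cd g = cd f"
  shows "ar (f \<oplus> g)" "dm (f \<oplus> g) = dm f" "cd (f \<oplus> g) = cd f"
proof -
  have "f \<oplus> g \<in> Arr C (dm f) (cd f)" unfolding padd_def
    using monoid.m_closed[OF group.is_monoid[OF group_Hom[OF ar_Arr(2,3)[OF assms(1)]]] ar_Arr(1)[OF assms(1)], of g]
      ar_Arr(1)[OF assms(2)] assms(3,4) by metis
  then show "ar (f \<oplus> g)" "dm (f \<oplus> g) = dm f" "cd (f \<oplus> g) = cd f"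
    using dm_cd_eq[OF ar_Arr(2,3)[OF assms(1)]] by blast+
qed

lemma neg_typed [simp]:
  assumes "ar f"
  shows "ar (neg f)" "dm (neg f) = dm f" "cd (neg f) = cd f"
proof -
  have "neg f \<in> Arr C (dm f) (cd f)" unfolding neg_def
    by (rule group.inv_closed[OF group_Hom[OF ar_Arr(2,3)[OF assms]] ar_Arr(1)[OF assms]])
  then show "ar (neg f)" "dm (neg f) = dm f" "cd (neg f) = cd f"
    using dm_cd_eq[OF ar_Arr(2,3)[OF assms]] by blast+
qed

lemma padd_assoc:
  assumes "ar f" "ar g" "ar h" "dm g = dm f" "dm h = dm f" "cd g = cd f" "cd h = cd f"
  shows "(f \<oplus> g) \<oplus> h = f \<oplus> (g \<oplus> h)"
  using monoid.m_assoc[OF group.is_monoid[OF group_Hom], of "dm f" "cd f" f g h] assms by simp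

lemma padd_comm:
  assumes "ar f" "ar g" "dm g = dm f" "cd g = cd f"
  shows "f \<oplus> g = g \<oplus> f"
  using comm_monoid.m_comm[OF comm_group.axioms(1)[OF hom_group], of "dm f" "cd f" f g] assms by simp

lemma padd_lcomm:
  assumes "ar f" "ar g" "ar h" "dm g = dm f" "dm h = dm f" "cd g = cd f" "cd h = cd f"
  shows "f \<oplus> (g \<oplus> h) = g \<oplus> (f \<oplus> h)"
  using padd_assoc[of f g h] padd_assoc[of g f h] padd_comm[of f g] assms by simp

lemmas padd_ac = padd_assoc padd_comm padd_lcomm

lemma padd_zr [simp]:
  "\<lbrakk>ar f; dm f = A; cd f = B\<rbrakk> \<Longrightarrow> f \<oplus> zr A B = f"
  "\<lbrakk>ar f; dm f = A; cd f = B\<rbrakk> \<Longrightarrow> zr A B \<oplus> f = f"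
  using monoid.r_one[OF group.is_monoid[OF group_Hom], of A B f]
    monoid.l_one[OF group.is_monoid[OF group_Hom], of A B f] by auto

lemma padd_neg [simp]:
  assumes "ar f"
  shows "f \<oplus> neg f = zr (dm f) (cd f)" "neg f \<oplus> f = zr (dm f) (cd f)"
  using group.r_inv[OF group_Hom, of "dm f" "cd f" f] group.l_inv[OF group_Hom, of "dm f" "cd f" f] assms
  by auto

lemma padd_neg_cancel [simp]:
  assumes "ar f" "ar g" "dm g = dm f" "cd g = cd f"
  shows "f \<oplus> (neg f \<oplus> g) = g" "neg f \<oplus> (f \<oplus> g) = g"
    "f \<oplus> (g \<oplus> neg f) = g" "neg f \<oplus> (g \<oplus> f) = g"
proof -
  show *: "f \<oplus> (neg f \<oplus> g) = g" "neg f \<oplus> (f \<oplus> g) = g"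
    using assms by (simp_all flip: padd_assoc)
  show "f \<oplus> (g \<oplus> neg f) = g" "neg f \<oplus> (g \<oplus> f) = g"
    using * assms by (simp_all add: padd_comm[of g])
qed

lemma padd_cancel:
  assumes "ar f" "ar g" "ar h" "dm g = dm f" "dm h = dm f" "cd g = cd f" "cd h = cd f"
  shows "f \<oplus> g = f \<oplus> h \<longleftrightarrow> g = h"
proof
  assume "f \<oplus> g = f \<oplus> h"
  then have "neg f \<oplus> (f \<oplus> g) = neg f \<oplus> (f \<oplus> h)" by simp
  then show "g = h" using assms by simp
qed simp

lemma neg_unique:
  assumes "ar f" "ar g" "dm g = dm f" "cd g = cd f" "f \<oplus> g = zr (dm f) (cd f)"
  shows "g = neg f"
  using padd_cancel[of f g "neg f"] assms by simp

lemma neg_neg [simp]: "ar f \<Longrightarrow> neg (neg f) = f"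
  using neg_unique[of "neg f" f] by simp

lemma neg_zr [simp]: "\<lbrakk>A \<in> Obj C; B \<in> Obj C\<rbrakk> \<Longrightarrow> neg (zr A B) = zr A B"
  using neg_unique[of "zr A B" "zr A B"] by simp

lemma neg_padd [simp]:
  assumes "ar f" "ar g" "dm g = dm f" "cd g = cd f"
  shows "neg (f \<oplus> g) = neg f \<oplus> neg g"
proof -
  have "(f \<oplus> g) \<oplus> (neg f \<oplus> neg g) = zr (dm f) (cd f)"
    using assms by (simp add: padd_assoc padd_lcomm[of g "neg f" "neg g"])
  then show ?thesis using neg_unique[of "f \<oplus> g" "neg f \<oplus> neg g"] assms by simp
qed

lemma cmp_padd [simp]:
  "\<lbrakk>ar f; ar g; ar h; dm g = dm f; cd g = cd f; dm h = cd f\<rbrakk> \<Longrightarrow> h \<cdot> (f \<oplus> g) = h \<cdot> f \<oplus> h \<cdot> g"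
  using cmp_add_right[of "dm f" "cd f" "cd h" f g h] by simp

lemma padd_cmp [simp]:
  "\<lbrakk>ar f; ar g; ar h; dm g = dm f; cd g = cd f; cd h = dm f\<rbrakk> \<Longrightarrow> (f \<oplus> g) \<cdot> h = f \<cdot> h \<oplus> g \<cdot> h"
  using cmp_add_left[of "dm h" "cd h" "cd f" h f g] by simp

lemma padd_idem_zr: "\<lbrakk>ar f; f \<oplus> f = f\<rbrakk> \<Longrightarrow> f = zr (dm f) (cd f)"
  using padd_cancel[of f f "zr (dm f) (cd f)"] by simp

lemma cmp_zr [simp]:
  assumes "ar f" "cd f = A" "B \<in> Obj C"
  shows "zr A B \<cdot> f = zr (dm f) B"
proof -
  have "A \<in> Obj C" using assms by auto
  then have "zr A B \<cdot> f \<oplus> zr A B \<cdot> f = zr A B \<cdot> f"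
    using assms by (simp flip: padd_cmp)
  then show ?thesis using padd_idem_zr[of "zr A B \<cdot> f"] assms \<open>A \<in> Obj C\<close> by simp
qed

lemma zr_cmp [simp]:
  assumes "ar f" "dm f = B" "A \<in> Obj C"
  shows "f \<cdot> zr A B = zr A (cd f)"
proof -
  have "B \<in> Obj C" using assms by auto
  then have "f \<cdot> zr A B \<oplus> f \<cdot> zr A B = f \<cdot> zr A B"
    using assms by (simp flip: cmp_padd)
  then show ?thesis using padd_idem_zr[of "f \<cdot> zr A B"] assms \<open>B \<in> Obj C\<close> by simp
qed

lemma cmp_neg [simp]:
  assumes "ar f" "ar g" "cd f = dm g"
  shows "g \<cdot> neg f = neg (g \<cdot> f)"
proof (rule neg_unique)
  show "g \<cdot> f \<oplus> g \<cdot> neg f = zr (dm (g \<cdot> f)) (cd (g \<cdot> f))"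
    using assms by (simp flip: cmp_padd)
qed (use assms in auto)

lemma neg_cmp [simp]:
  assumes "ar f" "ar g" "cd f = dm g"
  shows "neg g \<cdot> f = neg (g \<cdot> f)"
proof (rule neg_unique)
  show "g \<cdot> f \<oplus> neg g \<cdot> f = zr (dm (g \<cdot> f)) (cd (g \<cdot> f))"
    using assms by (simp flip: padd_cmp)
qed (use assms in auto)

text \<open>Composites are normalised by bracketing to the right, so a known value of
  \<open>g \<cdot> f\<close> does not match inside \<open>g \<cdot> (f \<cdot> u)\<close>. This
  supplies the variant with a trailing arrow.\<close>

lemma cmp_extend:
  "\<lbrakk>g \<cdot> f = x; ar f; ar g; cd f = dm g; ar u; cd u = dm f\<rbrakk> \<Longrightarrow> g \<cdot> (f \<cdot> u) = x \<cdot> u"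
  by auto

end

section \<open>Complexes and duality\<close>

text \<open>Reversing a complex twice gives it back only in the meaningful degrees, since truncated
  subtraction collapses the others; images under functors likewise match a given complex only
  there.\<close>

definition agree :: "nat \<Rightarrow> ('o, 'm) cpx \<Rightarrow> ('o, 'm) cpx \<Rightarrow> bool" where
  "agree n X Y \<longleftrightarrow> (\<forall>i\<le>Suc n. ob X i = ob Y i) \<and> (\<forall>i\<le>n. df X i = df Y i)"

text \<open>In a complex the image lies in the kernel anyway, so exactness reduces to a single
  implication.\<close>

lemma ker_im_eq:
  assumes "\<And>u. u \<in> I \<Longrightarrow> u \<in> K" "\<And>u. u \<in> K \<longleftrightarrow> P u" "\<And>u. u \<in> I \<longleftrightarrow> Q u"
  shows "K = I \<longleftrightarrow> (\<forall>u. P u \<longrightarrow> Q u)"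
  using assms by blast

lemma agree_refl [simp]: "agree n X X"
  and agree_sym: "agree n X Y \<Longrightarrow> agree n Y X"
  and agree_trans: "agree n X Y \<Longrightarrow> agree n Y Z \<Longrightarrow> agree n X Z"
  by (simp_all add: agree_def)

lemma rev_cpx_sel [simp]: "ob (rev_cpx n X) i = ob X (Suc n - i)" "df (rev_cpx n X) i = df X (n - i)"
  by (simp_all add: rev_cpx_def)

lemma agree_rev_rev: "agree n (rev_cpx n (rev_cpx n X)) X"
  by (simp add: agree_def)

lemma op_cat_sel [simp]: "Obj (op_cat C) = Obj C" "Hom (op_cat C) A B = Hom C B A"
  "Cmp (op_cat C) f g = Cmp C g f" "Idt (op_cat C) = Idt C"
  by (simp_all add: op_cat_def)

lemma op_ext_sel [simp]: "Ext (op_ext E) K A = Ext E A K" "Act (op_ext E) c a = Act E a c"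
  by (simp_all add: op_ext_def)

lemma op_op [simp]: "op_cat (op_cat C) = C" "op_ext (op_ext E) = E"
  by (simp_all add: op_cat_def op_ext_def)

lemma dom_cod_op [simp]: "dom_of (op_cat C) = cod_of C" "cod_of (op_cat C) = dom_of C"
  by (auto simp: fun_eq_iff dom_of_def cod_of_def)

lemma push_pull_op [simp]:
  "push (op_cat C) (op_ext E) K a \<delta> = pull C E K a \<delta>"
  "pull (op_cat C) (op_ext E) K a \<delta> = push C E K a \<delta>"
  by (simp_all add: push_def pull_def)

context preadditive_category
begin

lemma preadditive_op: "preadditive_category (op_cat C)"
proof (rule preadditive_category.intro, goal_cases)
  case 2
  show ?case using hom_disjoint 2[unfolded op_cat_sel] by metis
next
  case 8
  show ?case unfolding op_cat_sel by (rule cmp_add_left) (use 8 in \<open>simp_all del: Arr_iff\<close>)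
next
  case 9
  show ?case unfolding op_cat_sel by (rule cmp_add_right) (use 9 in \<open>simp_all del: Arr_iff\<close>)
qed (auto intro: hom_group)

text \<open>\<open>padd\<close>, \<open>ar\<close> and \<open>neg\<close> treat domain and codomain
  symmetrically, so they are the same functions for the opposite category. Dual statements then
  differ only in the order of composition and in the exchange of \<open>dm\<close> and
  \<open>cd\<close>.\<close>

lemma padd_op: "preadditive_category.padd (op_cat C) = padd"
  by (intro ext) (simp add: preadditive_category.padd_def[OF preadditive_op] padd_def)

lemma ar_op: "preadditive_category.ar (op_cat C) = ar"
  by (intro ext) (auto simp add: preadditive_category.ar_def[OF preadditive_op] ar_def simp del: Arr_iff)

lemma neg_op: "preadditive_category.neg (op_cat C) = neg"
  by (intro ext) (simp add: preadditive_category.neg_def[OF preadditive_op] neg_def)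

lemmas op_simps = padd_op ar_op neg_op

lemma complexes_iff: "X \<in> complexes n C \<longleftrightarrow> (\<forall>i\<le>Suc n. ob X i \<in> Obj C) \<and>
  (\<forall>i\<le>n. ar (df X i) \<and> dm (df X i) = ob X i \<and> cd (df X i) = ob X (Suc i)) \<and>
  (\<forall>i<n. df X (Suc i) \<cdot> df X i = zr (ob X i) (ob X (Suc (Suc i))))"
  by (auto simp: complexes_def simp del: Arr_iff intro: dm_cd_eq) (auto simp: ar_Arr(1) dest: ar_Arr(1))

lemma complexesD:
  assumes "X \<in> complexes n C"
  shows "i \<le> Suc n \<Longrightarrow> ob X i \<in> Obj C"
    "i \<le> n \<Longrightarrow> ar (df X i)" "i \<le> n \<Longrightarrow> dm (df X i) = ob X i" "i \<le> n \<Longrightarrow> cd (df X i) = ob X (Suc i)"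
    "i < n \<Longrightarrow> df X (Suc i) \<cdot> df X i = zr (ob X i) (ob X (Suc (Suc i)))"
    "i < n \<Longrightarrow> ar u \<Longrightarrow> cd u = ob X i \<Longrightarrow> df X (Suc i) \<cdot> (df X i \<cdot> u) = zr (dm u) (ob X (Suc (Suc i)))"
proof -
  note * = assms[unfolded complexes_iff]
  show "i < n \<Longrightarrow> ar u \<Longrightarrow> cd u = ob X i \<Longrightarrow> df X (Suc i) \<cdot> (df X i \<cdot> u) = zr (dm u) (ob X (Suc (Suc i)))"
    by (subst cmp_extend) (use * in auto)
qed (use assms[unfolded complexes_iff] in auto)

text \<open>The test object in a covariant exactness condition is the domain of the test arrow, so
  the quantifier over objects can be absorbed.\<close>

lemma all_dm:
  "(\<forall>Y\<in>Obj C. \<forall>u. ar u \<and> dm u = Y \<and> P Y u \<longrightarrow> Q Y u) \<longleftrightarrow> (\<forall>u. ar u \<and> P (dm u) u \<longrightarrow> Q (dm u) u)"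
  "(\<forall>Y\<in>Obj C. \<forall>j<n. \<forall>u. ar u \<and> dm u = Y \<and> P' Y j u \<longrightarrow> Q' Y j u) \<longleftrightarrow>
    (\<forall>j u. j < n \<and> ar u \<and> P' (dm u) j u \<longrightarrow> Q' (dm u) j u)"
  by auto

lemma all_cd:
  "(\<forall>Y\<in>Obj C. \<forall>u. ar u \<and> dm u = A \<and> cd u = Y \<and> P Y u \<longrightarrow> Q Y u) \<longleftrightarrow>
    (\<forall>u. ar u \<and> dm u = A \<and> P (cd u) u \<longrightarrow> Q (cd u) u)"
  "(\<forall>Y\<in>Obj C. \<forall>j<n. \<forall>u. ar u \<and> dm u = A' j \<and> cd u = Y \<and> P' Y j u \<longrightarrow> Q' Y j u) \<longleftrightarrow>
    (\<forall>j u. j < n \<and> ar u \<and> dm u = A' j \<and> P' (cd u) j u \<longrightarrow> Q' (cd u) j u)"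
  by auto

lemma mem_hom_image: "A \<in> Obj C \<Longrightarrow> B \<in> Obj C \<Longrightarrow>
    u \<in> F ` Arr C A B \<longleftrightarrow> (\<exists>v. ar v \<and> dm v = A \<and> cd v = B \<and> u = F v)"
  by (auto simp: image_iff Bex_def)

lemma mem_hom_kernel: "A \<in> Obj C \<Longrightarrow> B \<in> Obj C \<Longrightarrow>
    u \<in> kernel (Hom C A B) G F \<longleftrightarrow> ar u \<and> dm u = A \<and> cd u = B \<and> F u = \<one>\<^bsub>G\<^esub>"
  by (auto simp: kernel_def)

lemma chain_maps_iff:
  assumes "\<And>i. i \<le> Suc n \<Longrightarrow> ob X i \<in> Obj C" "\<And>i. i \<le> Suc n \<Longrightarrow> ob Y i \<in> Obj C"
  shows "f \<in> chain_maps n C X Y \<longleftrightarrow>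
    (\<forall>i\<le>Suc n. ar (f i) \<and> dm (f i) = ob X i \<and> cd (f i) = ob Y i) \<and>
    (\<forall>i\<le>n. f (Suc i) \<cdot> df X i = df Y i \<cdot> f i)"
  using assms by (simp add: chain_maps_def)

lemma chain_mapsD:
  assumes "f \<in> chain_maps n C X Y" "X \<in> complexes n C" "Y \<in> complexes n C"
  shows "i \<le> Suc n \<Longrightarrow> ar (f i)" "i \<le> Suc n \<Longrightarrow> dm (f i) = ob X i" "i \<le> Suc n \<Longrightarrow> cd (f i) = ob Y i"
    "i \<le> n \<Longrightarrow> f (Suc i) \<cdot> df X i = df Y i \<cdot> f i"
    "i \<le> n \<Longrightarrow> ar u \<Longrightarrow> cd u = ob X i \<Longrightarrow> f (Suc i) \<cdot> (df X i \<cdot> u) = df Y i \<cdot> (f i \<cdot> u)"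
proof -
  note [simp] = complexesD[OF assms(2)] complexesD[OF assms(3)]
  have *: "(\<forall>i\<le>Suc n. ar (f i) \<and> dm (f i) = ob X i \<and> cd (f i) = ob Y i) \<and>
    (\<forall>i\<le>n. f (Suc i) \<cdot> df X i = df Y i \<cdot> f i)"
    using assms(1) by (subst (asm) chain_maps_iff) auto
  then show "i \<le> Suc n \<Longrightarrow> ar (f i)" "i \<le> Suc n \<Longrightarrow> dm (f i) = ob X i" "i \<le> Suc n \<Longrightarrow> cd (f i) = ob Y i"
    "i \<le> n \<Longrightarrow> f (Suc i) \<cdot> df X i = df Y i \<cdot> f i"
    by auto
  show "i \<le> n \<Longrightarrow> ar u \<Longrightarrow> cd u = ob X i \<Longrightarrow> f (Suc i) \<cdot> (df X i \<cdot> u) = df Y i \<cdot> (f i \<cdot> u)"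
    using cmp_extend[of "f (Suc i)" "df X i" "df Y i \<cdot> f i" u] * by auto
qed

lemma chain_maps_cmp:
  assumes "f \<in> chain_maps n C X Y" "g \<in> chain_maps n C Y Z"
    "X \<in> complexes n C" "Y \<in> complexes n C" "Z \<in> complexes n C"
  shows "(\<lambda>i. g i \<cdot> f i) \<in> chain_maps n C X Z"
proof -
  note [simp] = complexesD[OF assms(3)] complexesD[OF assms(4)] complexesD[OF assms(5)]
    chain_mapsD[OF assms(1,3,4)] chain_mapsD[OF assms(2,4,5)]
  show ?thesis by (subst chain_maps_iff) auto
qed

lemma lifts_cmp:
  assumes "f \<in> lifts n C X Y a c" "g \<in> lifts n C Y Z a' c'"
    "X \<in> complexes n C" "Y \<in> complexes n C" "Z \<in> complexes n C"
  shows "(\<lambda>i. g i \<cdot> f i) \<in> lifts n C X Z (a' \<cdot> a) (c' \<cdot> c)"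
  using assms chain_maps_cmp[of f n X Y g Z] by (simp add: lifts_def)

lemma chain_maps_id:
  assumes "X \<in> complexes n C"
  shows "(\<lambda>i. Idt C (ob X i)) \<in> chain_maps n C X X"
proof -
  note [simp] = complexesD[OF assms]
  show ?thesis by (subst chain_maps_iff) auto
qed

lemma complexes_agree: "agree n X Y \<Longrightarrow> X \<in> complexes n C \<longleftrightarrow> Y \<in> complexes n C"
  by (auto simp: complexes_iff agree_def)

lemma chain_maps_agree:
  "agree n X X' \<Longrightarrow> agree n Y Y' \<Longrightarrow> chain_maps n C X Y = chain_maps n C X' Y'"
  by (auto simp: chain_maps_def agree_def simp del: Arr_iff)

lemma lifts_agree:
  "agree n X X' \<Longrightarrow> agree n Y Y' \<Longrightarrow> lifts n C X Y a c = lifts n C X' Y' a c"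
  using chain_maps_agree by (auto simp: lifts_def)

lemma complexes_between_iff: "X \<in> complexes_between n C A K \<longleftrightarrow> X \<in> complexes n C \<and> ob X 0 = A \<and> ob X (Suc n) = K"
  by (auto simp: complexes_between_def)

lemma complexes_between_obj: "X \<in> complexes_between n C A K \<Longrightarrow> A \<in> Obj C \<and> K \<in> Obj C"
  by (auto simp: complexes_between_def complexes_iff)

lemma complexes_rev:
  assumes "X \<in> complexes n C"
  shows "rev_cpx n X \<in> complexes n (op_cat C)"
proof -
  interpret op: preadditive_category "op_cat C" by (rule preadditive_op)
  note [simp] = complexesD[OF assms]
  have "df X (n - Suc i) = df X (n - Suc i) \<and> n - i = Suc (n - Suc i) \<and> Suc n - i = Suc (Suc (n - Suc i))"
    if "i < n" for i using that by auto
  then show ?thesis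
    unfolding op.complexes_iff op_simps by (auto simp: Suc_diff_le)
qed

lemma chain_maps_rev:
  assumes "f \<in> chain_maps n C X Y" "X \<in> complexes n C" "Y \<in> complexes n C"
  shows "(\<lambda>i. f (Suc n - i)) \<in> chain_maps n (op_cat C) (rev_cpx n Y) (rev_cpx n X)"
proof -
  interpret op: preadditive_category "op_cat C" by (rule preadditive_op)
  note [simp] = complexesD[OF assms(2)] complexesD[OF assms(3)] chain_mapsD[OF assms]
  show ?thesis
    by (subst op.chain_maps_iff) (auto simp: op_simps Suc_diff_le)
qed

lemma lifts_rev:
  assumes "f \<in> lifts n C X Y a c" "X \<in> complexes n C" "Y \<in> complexes n C"
  shows "(\<lambda>i. f (Suc n - i)) \<in> lifts n (op_cat C) (rev_cpx n Y) (rev_cpx n X) c a"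
  using assms chain_maps_rev[of f n X Y] by (simp add: lifts_def)

end

context additive_category
begin

lemma additive_op: "additive_category (op_cat C)"
proof (intro additive_category.intro additive_category_axioms.intro preadditive_op)
  show "\<exists>Z. zero_object (op_cat C) Z"
    using ex_zero unfolding zero_object_def op_cat_sel by (simp only: conj_commute)
  fix A B assume "A \<in> Obj (op_cat C)" "B \<in> Obj (op_cat C)"
  then obtain P where "is_biproduct C A B P" using ex_biproduct unfolding op_cat_sel by blast
  then have "is_biproduct (op_cat C) A B
    \<lparr>bob = bob P, inl = prl P, inr = prr P, prl = inl P, prr = inr P\<rparr>"
    unfolding is_biproduct_def op_cat_sel bip.simps by (simp only: conj_ac)
  then show "\<exists>P. is_biproduct (op_cat C) A B P" by blast
qed

end

section \<open>Arithmetic of the action on extensions, and exactness by elements\<close>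

context biadditive_functor
begin

lemma group_Ext: "\<lbrakk>K \<in> Obj C; A \<in> Obj C\<rbrakk> \<Longrightarrow> group (Ext E K A)"
  using ext_group comm_group.axioms(2) by blast

lemma ext_one [simp]: "\<lbrakk>K \<in> Obj C; A \<in> Obj C\<rbrakk> \<Longrightarrow> \<one>\<^bsub>Ext E K A\<^esub> \<in> carrier (Ext E K A)"
  by (simp add: group.is_monoid[OF group_Ext] monoid.one_closed)

lemma act_typed [simp]:
  assumes "ar c" "ar a" "dm c = L" "cd a = B" "\<delta> \<in> carrier (Ext E (cd c) (dm a))"
  shows "Act E c a \<delta> \<in> carrier (Ext E L B)"
  using act_hom[of "cd c" L "dm a" B c a] assms by (auto simp: hom_def)

lemma act_act [simp]:
  "\<lbrakk>ar c; ar a; ar c'; ar a'; cd c' = dm c; dm a' = cd a; \<delta> \<in> carrier (Ext E (cd c) (dm a))\<rbrakk>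
    \<Longrightarrow> Act E c' a' (Act E c a \<delta>) = Act E (c \<cdot> c') (a' \<cdot> a) \<delta>"
  using act_cmp[of "cd c" "dm c" "dm c'" "dm a" "cd a" "cd a'" c c' a a' \<delta>] by simp

lemma act_idt [simp]:
  "\<lbrakk>\<delta> \<in> carrier (Ext E K A); K \<in> Obj C; A \<in> Obj C\<rbrakk> \<Longrightarrow> Act E (Idt C K) (Idt C A) \<delta> = \<delta>"
  by (rule act_id)

lemma act_one [simp]:
  assumes "ar c" "ar a" "cd c = K" "dm a = A"
  shows "Act E c a \<one>\<^bsub>Ext E K A\<^esub> = \<one>\<^bsub>Ext E (dm c) (cd a)\<^esub>"
proof -
  have *: "K \<in> Obj C" "A \<in> Obj C" using assms by auto
  have "Act E c a \<in> hom (Ext E K A) (Ext E (dm c) (cd a))"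
    using act_hom[of K "dm c" A "cd a" c a] assms * by simp
  then have "group_hom (Ext E K A) (Ext E (dm c) (cd a)) (Act E c a)"
    using * assms by (intro group_hom.intro group_hom_axioms.intro group_Ext) auto
  then show ?thesis by (rule group_hom.hom_one)
qed

text \<open>The axiom speaks of pushforwards only. Writing \<open>E(c, a)\<close> as a pullback
  along \<open>c\<close> followed by a pushforward along \<open>a\<close> extends additivity to the
  general action.\<close>

lemma act_padd_push:
  assumes "ar c" "ar a" "ar a'" "dm a' = dm a" "cd a' = cd a" "\<delta> \<in> carrier (Ext E (cd c) (dm a))"
  shows "Act E c (a \<oplus> a') \<delta> = Act E c a \<delta> \<otimes>\<^bsub>Ext E (dm c) (cd a)\<^esub> Act E c a' \<delta>"
proof -
  let ?\<epsilon> = "Act E c (Idt C (dm a)) \<delta>"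
  have "?\<epsilon> \<in> carrier (Ext E (dm c) (dm a))" using assms by simp
  then show ?thesis
    using push_add[of "dm c" "dm a" "cd a" a a' ?\<epsilon>] assms by (simp add: push_def)
qed

lemma act_padd_pull:
  assumes "ar c" "ar c'" "ar a" "dm c' = dm c" "cd c' = cd c" "\<delta> \<in> carrier (Ext E (cd c) (dm a))"
  shows "Act E (c \<oplus> c') a \<delta> = Act E c a \<delta> \<otimes>\<^bsub>Ext E (dm c) (cd a)\<^esub> Act E c' a \<delta>"
proof -
  let ?\<epsilon> = "Act E (Idt C (cd c)) a \<delta>"
  have "?\<epsilon> \<in> carrier (Ext E (cd c) (cd a))" using assms by simp
  then show ?thesis
    using pull_add[of "cd c" "dm c" "cd a" c c' ?\<epsilon>] assms by (simp add: pull_def)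
qed

text \<open>Meant for the action of a zero arrow: additivity makes its value \<open>x\<close>
  satisfy \<open>x + x = x\<close>.\<close>

lemma ext_idem:
  assumes "K \<in> Obj C" "A \<in> Obj C" "x \<in> carrier (Ext E K A)" "x \<otimes>\<^bsub>Ext E K A\<^esub> x = x"
  shows "x = \<one>\<^bsub>Ext E K A\<^esub>"
  using group.l_cancel_one'[OF group_Ext, of K A x x] assms by simp

lemma act_zr_push [simp]:
  assumes "ar c" "A \<in> Obj C" "B \<in> Obj C" "\<delta> \<in> carrier (Ext E (cd c) A)"
  shows "Act E c (zr A B) \<delta> = \<one>\<^bsub>Ext E (dm c) B\<^esub>"
  using act_padd_push[of c "zr A B" "zr A B" \<delta>] assms
  by (intro ext_idem) auto

lemma act_zr_pull [simp]:
  assumes "ar a" "K \<in> Obj C" "L \<in> Obj C" "\<delta> \<in> carrier (Ext E K (dm a))"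
  shows "Act E (zr L K) a \<delta> = \<one>\<^bsub>Ext E L (cd a)\<^esub>"
  using act_padd_pull[of "zr L K" "zr L K" a \<delta>] assms
  by (intro ext_idem) auto

lemma biadditive_op: "biadditive_functor (op_cat C) (op_ext E)"
proof -
  interpret op: additive_category "op_cat C" by (rule additive_op)
  show ?thesis
  proof (intro biadditive_functor.intro biadditive_functor_axioms.intro additive_op, goal_cases)
    case 5
    show ?case unfolding op_cat_sel op_ext_sel push_pull_op
      by (rule pull_add) (use 5 in \<open>simp_all del: Arr_iff op.Arr_iff\<close>)
  next
    case 6
    show ?case unfolding op_cat_sel op_ext_sel push_pull_op
      by (rule push_add) (use 6 in \<open>simp_all del: Arr_iff op.Arr_iff\<close>)
  next
    case 2
    show ?case unfolding op_cat_sel op_ext_sel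
      by (rule act_hom) (use 2 in \<open>simp_all del: Arr_iff op.Arr_iff\<close>)
  next
    case (4 K L M A B D)
    show ?case unfolding op_cat_sel op_ext_sel
      by (rule act_cmp) (use 4 in \<open>simp_all del: Arr_iff op.Arr_iff\<close>)
  qed (auto intro: ext_group)
qed

text \<open>Exactness becomes solvability: a test arrow annihilated by one map factors through the
  neighbouring one. The inclusions of images in kernels disappear because they follow from
  \<open>d d = 0\<close> and from the two vanishing conditions on \<open>\<delta>\<close>. The range
  \<open>1..n\<close> is rewritten as \<open>Suc j\<close> with \<open>j < n\<close> to avoid
  predecessors.\<close>

lemma exangle_iff: "exangle n C E X \<delta> \<longleftrightarrow> X \<in> complexes n C \<and>
  \<delta> \<in> carrier (Ext E (ob X (Suc n)) (ob X 0)) \<and>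
  Act E (Idt C (ob X (Suc n))) (df X 0) \<delta> = \<one>\<^bsub>Ext E (ob X (Suc n)) (ob X (Suc 0))\<^esub> \<and>
  Act E (df X n) (Idt C (ob X 0)) \<delta> = \<one>\<^bsub>Ext E (ob X n) (ob X 0)\<^esub> \<and>
  (\<forall>j u. j < n \<and> ar u \<and> cd u = ob X (Suc j) \<and> df X (Suc j) \<cdot> u = zr (dm u) (ob X (Suc (Suc j))) \<longrightarrow>
     (\<exists>v. ar v \<and> dm v = dm u \<and> cd v = ob X j \<and> u = df X j \<cdot> v)) \<and>
  (\<forall>u. ar u \<and> cd u = ob X (Suc n) \<and> Act E u (Idt C (ob X 0)) \<delta> = \<one>\<^bsub>Ext E (dm u) (ob X 0)\<^esub> \<longrightarrow>
     (\<exists>v. ar v \<and> dm v = dm u \<and> cd v = ob X n \<and> u = df X n \<cdot> v)) \<and>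
  (\<forall>j u. j < n \<and> ar u \<and> dm u = ob X (Suc j) \<and> u \<cdot> df X j = zr (ob X j) (cd u) \<longrightarrow>
     (\<exists>v. ar v \<and> dm v = ob X (Suc (Suc j)) \<and> cd v = cd u \<and> u = v \<cdot> df X (Suc j))) \<and>
  (\<forall>u. ar u \<and> dm u = ob X 0 \<and> Act E (Idt C (ob X (Suc n))) u \<delta> = \<one>\<^bsub>Ext E (ob X (Suc n)) (cd u)\<^esub> \<longrightarrow>
     (\<exists>v. ar v \<and> dm v = ob X (Suc 0) \<and> cd v = cd u \<and> u = v \<cdot> df X 0))"
  (is "?L \<longleftrightarrow> ?X \<and> ?\<delta> \<and> ?push \<and> ?pull \<and> ?cov \<and> ?covE \<and> ?con \<and> ?conE")
proof (cases "X \<in> complexes n C \<and> \<delta> \<in> carrier (Ext E (ob X (Suc n)) (ob X 0)) \<and> ?push \<and> ?pull")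
  case False
  then show ?thesis by (auto simp: exangle_def attached_complex_def push_def pull_def)
next
  case True
  then have X: "X \<in> complexes n C" and d [simp]: "\<delta> \<in> carrier (Ext E (ob X (Suc n)) (ob X 0))"
    and ps: ?push and pl: ?pull by auto
  note [simp] = complexesD[OF X]
  have ivl: "(\<forall>i\<in>{1..n}. P i) \<longleftrightarrow> (\<forall>j<n. P (Suc j))" for P
    by (metis Suc_le_eq atLeastAtMost_iff gr0_conv_Suc One_nat_def Suc_pred less_Suc_eq_le plus_1_eq_Suc zero_less_Suc)
  \<comment> \<open>This and its dual are the inclusions of image in kernel at the two places where
    the sequences pass from arrows to extensions.\<close>
  have Act_df: "Act E (df X n \<cdot> v) (Idt C (ob X 0)) \<delta> = \<one>\<^bsub>Ext E (dm v) (ob X 0)\<^esub>"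
    if "ar v" "cd v = ob X n" for v
  proof -
    have "Act E (df X n \<cdot> v) (Idt C (ob X 0)) \<delta> = Act E v (Idt C (ob X 0)) (Act E (df X n) (Idt C (ob X 0)) \<delta>)"
      using that by (subst act_act) auto
    then show ?thesis unfolding pl using that by simp
  qed
  have Act_df': "Act E (Idt C (ob X (Suc n))) (v \<cdot> df X 0) \<delta> = \<one>\<^bsub>Ext E (ob X (Suc n)) (cd v)\<^esub>"
    if "ar v" "dm v = ob X (Suc 0)" for v
  proof -
    have "Act E (Idt C (ob X (Suc n))) (v \<cdot> df X 0) \<delta> =
      Act E (Idt C (ob X (Suc n))) v (Act E (Idt C (ob X (Suc n))) (df X 0) \<delta>)"
      using that by (subst act_act) auto
    then show ?thesis unfolding ps using that by simp
  qed
  have cov: "(\<forall>Y\<in>Obj C. \<forall>i\<in>{1..n}. kernel (Hom C Y (ob X i)) (Hom C Y (ob X (i+1))) (\<lambda>u. df X i \<cdot> u)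
        = (\<lambda>v. df X (i-1) \<cdot> v) ` Arr C Y (ob X (i-1))) \<longleftrightarrow> ?cov"
  proof -
    have 1: "(\<lambda>v. df X j \<cdot> v) ` Arr C Y (ob X j) \<subseteq>
      kernel (Hom C Y (ob X (Suc j))) (Hom C Y (ob X (Suc j + 1))) (\<lambda>u. df X (Suc j) \<cdot> u)"
      if "Y \<in> Obj C" "j < n" for Y j
      using that by (auto simp: kernel_def)
    have 2: "kernel (Hom C Y (ob X (Suc j))) (Hom C Y (ob X (Suc j + 1))) (\<lambda>u. df X (Suc j) \<cdot> u)
      = (\<lambda>v. df X j \<cdot> v) ` Arr C Y (ob X j) \<longleftrightarrow>
      (\<forall>u. ar u \<and> dm u = Y \<and> cd u = ob X (Suc j) \<and> df X (Suc j) \<cdot> u = zr Y (ob X (Suc (Suc j))) \<longrightarrow>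
     (\<exists>v. ar v \<and> dm v = Y \<and> cd v = ob X j \<and> u = df X j \<cdot> v))"
      if "Y \<in> Obj C" "j < n" for Y j
      by (rule ker_im_eq[OF subsetD[OF 1[OF that]]], assumption)
        (use that in \<open>simp_all add: mem_hom_image mem_hom_kernel push_def pull_def\<close>)
    show ?thesis unfolding ivl
      by (rule trans[OF ball_cong[OF refl all_cong] all_dm(2)]) (simp only: 2 diff_Suc_1)
  qed
  have covE: "(\<forall>Y\<in>Obj C. kernel (Hom C Y (ob X (n+1))) (Ext E Y (ob X 0)) (\<lambda>u. pull C E (ob X 0) u \<delta>)
        = (\<lambda>v. df X n \<cdot> v) ` Arr C Y (ob X n)) \<longleftrightarrow> ?covE"
  proof -
    have 1: "(\<lambda>v. df X n \<cdot> v) ` Arr C Y (ob X n) \<subseteq>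
      kernel (Hom C Y (ob X (n+1))) (Ext E Y (ob X 0)) (\<lambda>u. pull C E (ob X 0) u \<delta>)"
      if "Y \<in> Obj C" for Y
      using that by (auto simp: kernel_def pull_def Act_df)
    have 2: "kernel (Hom C Y (ob X (n+1))) (Ext E Y (ob X 0)) (\<lambda>u. pull C E (ob X 0) u \<delta>)
      = (\<lambda>v. df X n \<cdot> v) ` Arr C Y (ob X n) \<longleftrightarrow>
      (\<forall>u. ar u \<and> dm u = Y \<and> cd u = ob X (Suc n) \<and> Act E u (Idt C (ob X 0)) \<delta> = \<one>\<^bsub>Ext E Y (ob X 0)\<^esub> \<longrightarrow>
     (\<exists>v. ar v \<and> dm v = Y \<and> cd v = ob X n \<and> u = df X n \<cdot> v))"
      if "Y \<in> Obj C" for Y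
      by (rule ker_im_eq[OF subsetD[OF 1[OF that]]], assumption)
        (use that in \<open>simp_all add: mem_hom_image mem_hom_kernel push_def pull_def\<close>)
    show ?thesis by (rule trans[OF ball_cong[OF refl] all_dm(1)]) (simp only: 2)
  qed
  have con: "(\<forall>Y\<in>Obj C. \<forall>i\<in>{1..n}. kernel (Hom C (ob X i) Y) (Hom C (ob X (i-1)) Y) (\<lambda>u. u \<cdot> df X (i-1))
        = (\<lambda>v. v \<cdot> df X i) ` Arr C (ob X (i+1)) Y) \<longleftrightarrow> ?con"
  proof -
    have 1: "(\<lambda>v. v \<cdot> df X (Suc j)) ` Arr C (ob X (Suc j + 1)) Y \<subseteq>
      kernel (Hom C (ob X (Suc j)) Y) (Hom C (ob X j) Y) (\<lambda>u. u \<cdot> df X j)"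
      if "Y \<in> Obj C" "j < n" for Y j
      using that by (auto simp: kernel_def)
    have 2: "kernel (Hom C (ob X (Suc j)) Y) (Hom C (ob X j) Y) (\<lambda>u. u \<cdot> df X j)
      = (\<lambda>v. v \<cdot> df X (Suc j)) ` Arr C (ob X (Suc j + 1)) Y \<longleftrightarrow>
      (\<forall>u. ar u \<and> dm u = ob X (Suc j) \<and> cd u = Y \<and> u \<cdot> df X j = zr (ob X j) Y \<longrightarrow>
     (\<exists>v. ar v \<and> dm v = ob X (Suc (Suc j)) \<and> cd v = Y \<and> u = v \<cdot> df X (Suc j)))"
      if "Y \<in> Obj C" "j < n" for Y j
      by (rule ker_im_eq[OF subsetD[OF 1[OF that]]], assumption)
        (use that in \<open>simp_all add: mem_hom_image mem_hom_kernel push_def pull_def\<close>)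
    show ?thesis unfolding ivl
      by (rule trans[OF ball_cong[OF refl all_cong] all_cd(2)]) (simp only: 2 diff_Suc_1)
  qed
  have conE: "(\<forall>Y\<in>Obj C. kernel (Hom C (ob X 0) Y) (Ext E (ob X (n+1)) Y) (\<lambda>u. push C E (ob X (n+1)) u \<delta>)
        = (\<lambda>v. v \<cdot> df X 0) ` Arr C (ob X 1) Y) \<longleftrightarrow> ?conE"
  proof -
    have 1: "(\<lambda>v. v \<cdot> df X 0) ` Arr C (ob X 1) Y \<subseteq>
      kernel (Hom C (ob X 0) Y) (Ext E (ob X (n+1)) Y) (\<lambda>u. push C E (ob X (n+1)) u \<delta>)"
      if "Y \<in> Obj C" for Y
      using that by (auto simp: kernel_def push_def Act_df')
    have 2: "kernel (Hom C (ob X 0) Y) (Ext E (ob X (n+1)) Y) (\<lambda>u. push C E (ob X (n+1)) u \<delta>)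
      = (\<lambda>v. v \<cdot> df X 0) ` Arr C (ob X 1) Y \<longleftrightarrow>
      (\<forall>u. ar u \<and> dm u = ob X 0 \<and> cd u = Y \<and> Act E (Idt C (ob X (Suc n))) u \<delta> = \<one>\<^bsub>Ext E (ob X (Suc n)) Y\<^esub> \<longrightarrow>
     (\<exists>v. ar v \<and> dm v = ob X (Suc 0) \<and> cd v = Y \<and> u = v \<cdot> df X 0))"
      if "Y \<in> Obj C" for Y
      by (rule ker_im_eq[OF subsetD[OF 1[OF that]]], assumption)
        (use that in \<open>simp_all add: mem_hom_image mem_hom_kernel push_def pull_def\<close>)
    show ?thesis by (rule trans[OF ball_cong[OF refl] all_cd(1)]) (simp only: 2)
  qed
  have "?L \<longleftrightarrow> ?cov \<and> ?covE \<and> ?con \<and> ?conE"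
    unfolding cov[symmetric] covE[symmetric] con[symmetric] conE[symmetric] exangle_def
    using True by (auto simp: attached_complex_def push_def pull_def)
  then show ?thesis using True by blast
qed

end

section \<open>Null-homotopies and exangles\<close>

context preadditive_category
begin

text \<open>Sorting by \<open>padd_ac\<close> need not bring an arrow next to its negative; these
  rules cancel such a pair across up to three summands in between.\<close>

lemma padd_cancels:
  assumes [simp]: "ar f" "ar g" "ar h" "ar k" "dm g = dm f" "cd g = cd f" "dm h = dm f" "cd h = cd f" "dm k = dm f" "cd k = cd f"
  shows "f \<oplus> (g \<oplus> (neg f \<oplus> h)) = g \<oplus> h" "neg f \<oplus> (g \<oplus> (f \<oplus> h)) = g \<oplus> h"
    "f \<oplus> (g \<oplus> (h \<oplus> neg f)) = g \<oplus> h" "neg f \<oplus> (g \<oplus> (h \<oplus> f)) = g \<oplus> h"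
    "f \<oplus> (g \<oplus> (h \<oplus> (neg f \<oplus> k))) = g \<oplus> (h \<oplus> k)" "neg f \<oplus> (g \<oplus> (h \<oplus> (f \<oplus> k))) = g \<oplus> (h \<oplus> k)"
    "f \<oplus> (g \<oplus> (h \<oplus> (k \<oplus> neg f))) = g \<oplus> (h \<oplus> k)" "neg f \<oplus> (g \<oplus> (h \<oplus> (k \<oplus> f))) = g \<oplus> (h \<oplus> k)"
proof -
  have *: "g \<oplus> (neg f \<oplus> h) = neg f \<oplus> (g \<oplus> h)" "g \<oplus> (f \<oplus> h) = f \<oplus> (g \<oplus> h)"
    "g \<oplus> (h \<oplus> neg f) = neg f \<oplus> (g \<oplus> h)" "g \<oplus> (h \<oplus> f) = f \<oplus> (g \<oplus> h)"
    "g \<oplus> (h \<oplus> (neg f \<oplus> k)) = neg f \<oplus> (g \<oplus> (h \<oplus> k))" "g \<oplus> (h \<oplus> (f \<oplus> k)) = f \<oplus> (g \<oplus> (h \<oplus> k))"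
    "g \<oplus> (h \<oplus> (k \<oplus> neg f)) = neg f \<oplus> (g \<oplus> (h \<oplus> k))" "g \<oplus> (h \<oplus> (k \<oplus> f)) = f \<oplus> (g \<oplus> (h \<oplus> k))"
    by (simp_all add: padd_ac)
  show "f \<oplus> (g \<oplus> (neg f \<oplus> h)) = g \<oplus> h" "neg f \<oplus> (g \<oplus> (f \<oplus> h)) = g \<oplus> h"
    "f \<oplus> (g \<oplus> (h \<oplus> neg f)) = g \<oplus> h" "neg f \<oplus> (g \<oplus> (h \<oplus> f)) = g \<oplus> h"
    "f \<oplus> (g \<oplus> (h \<oplus> (neg f \<oplus> k))) = g \<oplus> (h \<oplus> k)" "neg f \<oplus> (g \<oplus> (h \<oplus> (f \<oplus> k))) = g \<oplus> (h \<oplus> k)"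
    "f \<oplus> (g \<oplus> (h \<oplus> (k \<oplus> neg f))) = g \<oplus> (h \<oplus> k)" "neg f \<oplus> (g \<oplus> (h \<oplus> (k \<oplus> f))) = g \<oplus> (h \<oplus> k)"
    unfolding * by (rule padd_neg_cancel; simp)+
qed

lemmas padd_norm = padd_ac padd_cancels

lemma biproductD:
  assumes P: "is_biproduct C A B P" and AB: "A \<in> Obj C" "B \<in> Obj C"
  shows "bob P \<in> Obj C"
    "ar (inl P)" "dm (inl P) = A" "cd (inl P) = bob P" "ar (inr P)" "dm (inr P) = B" "cd (inr P) = bob P"
    "ar (prl P)" "dm (prl P) = bob P" "cd (prl P) = A" "ar (prr P)" "dm (prr P) = bob P" "cd (prr P) = B"
    "prl P \<cdot> inl P = Idt C A" "prr P \<cdot> inr P = Idt C B"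
    "prl P \<cdot> inr P = zr B A" "prr P \<cdot> inl P = zr A B"
    "ar u \<Longrightarrow> cd u = A \<Longrightarrow> prl P \<cdot> (inl P \<cdot> u) = u" "ar u \<Longrightarrow> cd u = B \<Longrightarrow> prr P \<cdot> (inr P \<cdot> u) = u"
    "ar u \<Longrightarrow> cd u = B \<Longrightarrow> prl P \<cdot> (inr P \<cdot> u) = zr (dm u) A"
    "ar u \<Longrightarrow> cd u = A \<Longrightarrow> prr P \<cdot> (inl P \<cdot> u) = zr (dm u) B"
    "inl P \<cdot> prl P \<oplus> inr P \<cdot> prr P = Idt C (bob P)"
proof -
  have bp [simp]: "bob P \<in> Obj C" using P by (simp add: is_biproduct_def)
  show bp': "bob P \<in> Obj C" by simp
  show t [simp]: "ar (inl P)" "dm (inl P) = A" "cd (inl P) = bob P" "ar (inr P)" "dm (inr P) = B" "cd (inr P) = bob P"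
    "ar (prl P)" "dm (prl P) = bob P" "cd (prl P) = A" "ar (prr P)" "dm (prr P) = bob P" "cd (prr P) = B"
    using P AB by (auto simp add: is_biproduct_def)
  show e: "prl P \<cdot> inl P = Idt C A" "prr P \<cdot> inr P = Idt C B"
    "prl P \<cdot> inr P = zr B A" "prr P \<cdot> inl P = zr A B"
    using P unfolding is_biproduct_def by blast+
  show "ar u \<Longrightarrow> cd u = A \<Longrightarrow> prl P \<cdot> (inl P \<cdot> u) = u"
    using cmp_extend[OF e(1), of u] by simp
  show "ar u \<Longrightarrow> cd u = B \<Longrightarrow> prr P \<cdot> (inr P \<cdot> u) = u"
    using cmp_extend[OF e(2), of u] by simp
  show "ar u \<Longrightarrow> cd u = B \<Longrightarrow> prl P \<cdot> (inr P \<cdot> u) = zr (dm u) A"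
    using cmp_extend[OF e(3), of u] AB by simp
  show "ar u \<Longrightarrow> cd u = A \<Longrightarrow> prr P \<cdot> (inl P \<cdot> u) = zr (dm u) B"
    using cmp_extend[OF e(4), of u] AB by simp
  have "inl P \<cdot> prl P \<otimes>\<^bsub>Hom C (bob P) (bob P)\<^esub> inr P \<cdot> prr P = Idt C (bob P)"
    using P unfolding is_biproduct_def by blast
  then show "inl P \<cdot> prl P \<oplus> inr P \<cdot> prr P = Idt C (bob P)" by simp
qed

text \<open>A homotopy condition on one family of arrows instead of two. In this form it is visibly
  closed under sums, negatives and composition with chain maps on either side. The index is shifted,
  with \<open>k j\<close> in the role of \<open>h (j + 1)\<close>, so that all degrees
  \<open>0..n\<close> occur.\<close>

definition null :: "nat \<Rightarrow> ('o, 'm) cpx \<Rightarrow> ('o, 'm) cpx \<Rightarrow> (nat \<Rightarrow> 'm) \<Rightarrow> bool" where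
  "null n X Y f \<longleftrightarrow> (\<exists>k. (\<forall>j\<le>n. ar (k j) \<and> dm (k j) = ob X (Suc j) \<and> cd (k j) = ob Y j) \<and>
     f 0 = k 0 \<cdot> df X 0 \<and>
     (\<forall>j<n. f (Suc j) = k (Suc j) \<cdot> df X (Suc j) \<oplus> df Y j \<cdot> k j) \<and>
     f (Suc n) = df Y n \<cdot> k n)"

lemma nullI:
  assumes "\<And>j. j \<le> n \<Longrightarrow> ar (k j)" "\<And>j. j \<le> n \<Longrightarrow> dm (k j) = ob X (Suc j)" "\<And>j. j \<le> n \<Longrightarrow> cd (k j) = ob Y j"
    "f 0 = k 0 \<cdot> df X 0" "\<And>j. j < n \<Longrightarrow> f (Suc j) = k (Suc j) \<cdot> df X (Suc j) \<oplus> df Y j \<cdot> k j"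
    "f (Suc n) = df Y n \<cdot> k n"
  shows "null n X Y f"
  unfolding null_def using assms by blast

lemma nullE:
  assumes "null n X Y f"
  obtains k where "\<And>j. j \<le> n \<Longrightarrow> ar (k j)" "\<And>j. j \<le> n \<Longrightarrow> dm (k j) = ob X (Suc j)" "\<And>j. j \<le> n \<Longrightarrow> cd (k j) = ob Y j"
    "f 0 = k 0 \<cdot> df X 0" "\<And>j. j < n \<Longrightarrow> f (Suc j) = k (Suc j) \<cdot> df X (Suc j) \<oplus> df Y j \<cdot> k j"
    "f (Suc n) = df Y n \<cdot> k n"
  using assms unfolding null_def by blast

lemma null_cong: "null n X Y f \<Longrightarrow> (\<And>j. j \<le> Suc n \<Longrightarrow> g j = f j) \<Longrightarrow> null n X Y g"
  unfolding null_def by (elim exE conjE, rule exI) (auto simp: less_imp_le_nat)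

lemma null_add:
  assumes X: "X \<in> complexes n C" and Y: "Y \<in> complexes n C" and "null n X Y f" "null n X Y g"
  shows "null n X Y (\<lambda>j. f j \<oplus> g j)"
proof -
  note [simp] = complexesD[OF X] complexesD[OF Y]
  obtain k where k [simp]: "\<And>j. j \<le> n \<Longrightarrow> ar (k j)" "\<And>j. j \<le> n \<Longrightarrow> dm (k j) = ob X (Suc j)" "\<And>j. j \<le> n \<Longrightarrow> cd (k j) = ob Y j"
    "f 0 = k 0 \<cdot> df X 0" "\<And>j. j < n \<Longrightarrow> f (Suc j) = k (Suc j) \<cdot> df X (Suc j) \<oplus> df Y j \<cdot> k j"
    "f (Suc n) = df Y n \<cdot> k n" using assms(3) by (rule nullE) blast
  obtain l where l [simp]: "\<And>j. j \<le> n \<Longrightarrow> ar (l j)" "\<And>j. j \<le> n \<Longrightarrow> dm (l j) = ob X (Suc j)" "\<And>j. j \<le> n \<Longrightarrow> cd (l j) = ob Y j"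
    "g 0 = l 0 \<cdot> df X 0" "\<And>j. j < n \<Longrightarrow> g (Suc j) = l (Suc j) \<cdot> df X (Suc j) \<oplus> df Y j \<cdot> l j"
    "g (Suc n) = df Y n \<cdot> l n" using assms(4) by (rule nullE) blast
  show ?thesis by (rule nullI[of _ "\<lambda>j. k j \<oplus> l j"]) (simp_all add: padd_ac)
qed

lemma null_neg:
  assumes X: "X \<in> complexes n C" and Y: "Y \<in> complexes n C" and "null n X Y f"
  shows "null n X Y (\<lambda>j. neg (f j))"
proof -
  note [simp] = complexesD[OF X] complexesD[OF Y]
  obtain k where k [simp]: "\<And>j. j \<le> n \<Longrightarrow> ar (k j)" "\<And>j. j \<le> n \<Longrightarrow> dm (k j) = ob X (Suc j)" "\<And>j. j \<le> n \<Longrightarrow> cd (k j) = ob Y j"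
    "f 0 = k 0 \<cdot> df X 0" "\<And>j. j < n \<Longrightarrow> f (Suc j) = k (Suc j) \<cdot> df X (Suc j) \<oplus> df Y j \<cdot> k j"
    "f (Suc n) = df Y n \<cdot> k n" using assms(3) by (rule nullE) blast
  show ?thesis by (rule nullI[of _ "\<lambda>j. neg (k j)"]) simp_all
qed

lemma null_cmp:
  assumes X: "X \<in> complexes n C" and Y: "Y \<in> complexes n C" and Z: "Z \<in> complexes n C" and W: "W \<in> complexes n C"
    and f: "null n X Y f" and b: "b \<in> chain_maps n C W X" and a: "a \<in> chain_maps n C Y Z"
  shows "null n W Z (\<lambda>j. a j \<cdot> (f j \<cdot> b j))"
proof -
  note [simp] = complexesD[OF X] complexesD[OF Y] complexesD[OF Z] complexesD[OF W]
  note [simp] = chain_mapsD(1-3)[OF b W X] chain_mapsD(1-3)[OF a Y Z]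
  note b' = chain_mapsD(4,5)[OF b W X] and a' [simp] = chain_mapsD(4,5)[OF a Y Z]
  obtain k where k [simp]: "\<And>j. j \<le> n \<Longrightarrow> ar (k j)" "\<And>j. j \<le> n \<Longrightarrow> dm (k j) = ob X (Suc j)" "\<And>j. j \<le> n \<Longrightarrow> cd (k j) = ob Y j"
    "f 0 = k 0 \<cdot> df X 0" "\<And>j. j < n \<Longrightarrow> f (Suc j) = k (Suc j) \<cdot> df X (Suc j) \<oplus> df Y j \<cdot> k j"
    "f (Suc n) = df Y n \<cdot> k n" using f by (rule nullE) blast
  show ?thesis by (rule nullI[of _ "\<lambda>j. a j \<cdot> (k j \<cdot> b (Suc j))"]) (simp_all add: b')
qed

lemma homotopic_iff_null:
  assumes X: "X \<in> complexes n C" and Y: "Y \<in> complexes n C"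
    and f: "f \<in> chain_maps n C X Y" and g: "g \<in> chain_maps n C X Y"
  shows "homotopic n C X Y f g \<longleftrightarrow> null n X Y (\<lambda>j. f j \<oplus> neg (g j))"
proof
  note [simp] = complexesD[OF X] complexesD[OF Y]
  note [simp] = chain_mapsD(1-3)[OF f X Y] chain_mapsD(1-3)[OF g X Y]
  show "null n X Y (\<lambda>j. f j \<oplus> neg (g j))" if "homotopic n C X Y f g"
  proof -
    from that obtain h where h: "\<And>i. i\<in>{1..n+1} \<Longrightarrow> h i \<in> Arr C (ob X i) (ob Y (i-1))"
     "f 0 \<otimes>\<^bsub>Hom C (ob X 0) (ob Y 0)\<^esub> inv\<^bsub>Hom C (ob X 0) (ob Y 0)\<^esub> g 0 = h 1 \<cdot> df X 0"
     "\<And>i. i\<in>{1..n} \<Longrightarrow> f i \<otimes>\<^bsub>Hom C (ob X i) (ob Y i)\<^esub> inv\<^bsub>Hom C (ob X i) (ob Y i)\<^esub> g i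
        = (h (i+1) \<cdot> df X i) \<otimes>\<^bsub>Hom C (ob X i) (ob Y i)\<^esub> (df Y (i-1) \<cdot> h i)"
     "f (n+1) \<otimes>\<^bsub>Hom C (ob X (n+1)) (ob Y (n+1))\<^esub> inv\<^bsub>Hom C (ob X (n+1)) (ob Y (n+1))\<^esub> g (n+1)
        = df Y n \<cdot> h (n+1)" unfolding homotopic_def by blast
    have [simp]: "ar (h (Suc j))" "dm (h (Suc j)) = ob X (Suc j)" "cd (h (Suc j)) = ob Y j" if "j \<le> n" for j
      using h(1)[of "Suc j"] that by auto
    show ?thesis
    proof (rule nullI[of _ "\<lambda>j. h (Suc j)"])
      fix j assume "j < n"
      then show "f (Suc j) \<oplus> neg (g (Suc j)) = h (Suc (Suc j)) \<cdot> df X (Suc j) \<oplus> df Y j \<cdot> h (Suc j)"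
        using h(3)[of "Suc j"] by simp
    qed (use h(2,4) in simp_all)
  qed
  show "homotopic n C X Y f g" if "null n X Y (\<lambda>j. f j \<oplus> neg (g j))"
  proof -
    from that obtain k where k [simp]: "\<And>j. j \<le> n \<Longrightarrow> ar (k j)" "\<And>j. j \<le> n \<Longrightarrow> dm (k j) = ob X (Suc j)" "\<And>j. j \<le> n \<Longrightarrow> cd (k j) = ob Y j"
      "f 0 \<oplus> neg (g 0) = k 0 \<cdot> df X 0"
      "\<And>j. j < n \<Longrightarrow> f (Suc j) \<oplus> neg (g (Suc j)) = k (Suc j) \<cdot> df X (Suc j) \<oplus> df Y j \<cdot> k j"
      "f (Suc n) \<oplus> neg (g (Suc n)) = df Y n \<cdot> k n" by (rule nullE) blast
    show ?thesis unfolding homotopic_def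
    proof (intro exI conjI ballI)
      fix i assume "i \<in> {1..n}"
      then obtain j where "i = Suc j" "j < n" by (cases i) auto
      then show "f i \<otimes>\<^bsub>Hom C (ob X i) (ob Y i)\<^esub> inv\<^bsub>Hom C (ob X i) (ob Y i)\<^esub> g i
        = (k (i + 1 - 1) \<cdot> df X i) \<otimes>\<^bsub>Hom C (ob X i) (ob Y i)\<^esub> (df Y (i-1) \<cdot> k (i - 1))" by simp
    next
      fix i assume "i \<in> {1..n+1}"
      then obtain j where "i = Suc j" "j \<le> n" by (cases i) auto
      then show "k (i - 1) \<in> Arr C (ob X i) (ob Y (i - 1))" by simp
    qed simp_all
  qed
qed

end

section \<open>Homotopy retracts and null-homotopies of exangles\<close>

context biadditive_functor
begin

lemma exangleD:
  assumes "exangle n C E X \<delta>"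
  shows "X \<in> complexes n C" "\<delta> \<in> carrier (Ext E (ob X (Suc n)) (ob X 0))"
    "Act E (Idt C (ob X (Suc n))) (df X 0) \<delta> = \<one>\<^bsub>Ext E (ob X (Suc n)) (ob X (Suc 0))\<^esub>"
    "Act E (df X n) (Idt C (ob X 0)) \<delta> = \<one>\<^bsub>Ext E (ob X n) (ob X 0)\<^esub>"
  using assms unfolding exangle_iff by blast+

lemma exangle_cov:
  assumes "exangle n C E X \<delta>" "j < n" "ar u" "dm u = D" "cd u = ob X (Suc j)"
    "df X (Suc j) \<cdot> u = zr D (ob X (Suc (Suc j)))"
  obtains v where "ar v" "dm v = D" "cd v = ob X j" "u = df X j \<cdot> v"
  using assms unfolding exangle_iff by blast

lemma exangle_covE:
  assumes "exangle n C E X \<delta>" "ar u" "dm u = D" "cd u = ob X (Suc n)"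
    "Act E u (Idt C (ob X 0)) \<delta> = \<one>\<^bsub>Ext E D (ob X 0)\<^esub>"
  obtains v where "ar v" "dm v = D" "cd v = ob X n" "u = df X n \<cdot> v"
  using assms unfolding exangle_iff by blast

lemma exangle_con:
  assumes "exangle n C E X \<delta>" "j < n" "ar u" "dm u = ob X (Suc j)" "cd u = D"
    "u \<cdot> df X j = zr (ob X j) D"
  obtains v where "ar v" "dm v = ob X (Suc (Suc j))" "cd v = D" "u = v \<cdot> df X (Suc j)"
  using assms unfolding exangle_iff by blast

lemma exangle_conE:
  assumes "exangle n C E X \<delta>" "ar u" "dm u = ob X 0" "cd u = D"
    "Act E (Idt C (ob X (Suc n))) u \<delta> = \<one>\<^bsub>Ext E (ob X (Suc n)) D\<^esub>"
  obtains v where "ar v" "dm v = ob X (Suc 0)" "cd v = D" "u = v \<cdot> df X 0"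
  using assms unfolding exangle_iff by blast

lemma exangle_agree: "agree n X Y \<Longrightarrow> exangle n C E X \<delta> \<Longrightarrow> exangle n C E Y \<delta>"
proof -
  assume *: "agree n X Y" and X: "exangle n C E X \<delta>"
  then have [simp]: "\<And>i. i \<le> Suc n \<Longrightarrow> ob Y i = ob X i" "\<And>i. i \<le> n \<Longrightarrow> df Y i = df X i"
    by (auto simp: agree_def)
  have "Y \<in> complexes n C" using complexes_agree[OF *] exangleD(1)[OF X] by simp
  with X show ?thesis unfolding exangle_iff by (simp cong: conj_cong)
qed

text \<open>A test arrow for \<open>Y\<close> is carried to \<open>X\<close> by \<open>i\<close> or
  \<open>p\<close>, factored there, and carried back; what \<open>p i\<close> misses is a boundary
  of the homotopy \<open>h\<close>, which contributes a factorisation of its own. At the ends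
  \<open>p i = 1\<close> holds exactly, so that extensions can be compared. The formulation covers
  strict retracts, with \<open>h = 0\<close>, as well as homotopy equivalences with fixed
  ends.\<close>

lemma exangle_retract:
  assumes X: "exangle n C E X \<epsilon>" and Y: "Y \<in> complexes n C"
    and d: "\<delta> \<in> carrier (Ext E (ob Y (Suc n)) (ob Y 0))"
    and i: "i \<in> chain_maps n C Y X" and p: "p \<in> chain_maps n C X Y"
    and h: "\<And>j. j \<le> n \<Longrightarrow> ar (h j)" "\<And>j. j \<le> n \<Longrightarrow> dm (h j) = ob Y (Suc j)" "\<And>j. j \<le> n \<Longrightarrow> cd (h j) = ob Y j"
    and hom: "\<And>j. j < n \<Longrightarrow> Idt C (ob Y (Suc j)) = p (Suc j) \<cdot> i (Suc j) \<oplus> (h (Suc j) \<cdot> df Y (Suc j) \<oplus> df Y j \<cdot> h j)"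
    and e0: "p 0 \<cdot> i 0 = Idt C (ob Y 0)" and e1: "p (Suc n) \<cdot> i (Suc n) = Idt C (ob Y (Suc n))"
    and ci: "Act E (Idt C (ob Y (Suc n))) (i 0) \<delta> = Act E (i (Suc n)) (Idt C (ob X 0)) \<epsilon>"
    and cp: "Act E (Idt C (ob X (Suc n))) (p 0) \<epsilon> = Act E (p (Suc n)) (Idt C (ob Y 0)) \<delta>"
  shows "exangle n C E Y \<delta>"
proof -
  have X': "X \<in> complexes n C" using exangleD(1)[OF X] .
  note [simp] = complexesD[OF X'] complexesD[OF Y] chain_mapsD[OF i Y X'] chain_mapsD[OF p X' Y] h d exangleD(2)[OF X]
  have p0i0: "p 0 \<cdot> (i 0 \<cdot> u) = u" if "ar u" "cd u = ob Y 0" for u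
    using cmp_extend[OF e0, of u] that by simp
  have p1i1: "p (Suc n) \<cdot> (i (Suc n) \<cdot> u) = u" if "ar u" "cd u = ob Y (Suc n)" for u
    using cmp_extend[OF e1, of u] that by simp
  \<comment> \<open>Since \<open>p 0 \<cdot> i 0 = 1\<close>, the extension of \<open>Y\<close> is
    recovered from \<open>\<epsilon>\<close>, and its two vanishing conditions follow from those of
    \<open>\<epsilon>\<close>.\<close>
  have d1: "\<delta> = Act E (i (Suc n)) (p 0) \<epsilon>"
  proof -
    have "\<delta> = Act E (Idt C (ob Y (Suc n))) (p 0 \<cdot> i 0) \<delta>" by (simp add: e0)
    also have "\<dots> = Act E (Idt C (ob Y (Suc n))) (p 0) (Act E (Idt C (ob Y (Suc n))) (i 0) \<delta>)"
      by (subst act_act) simp_all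
    also have "\<dots> = Act E (i (Suc n)) (p 0) \<epsilon>" unfolding ci by simp
    finally show ?thesis .
  qed
  have push: "Act E c (u \<cdot> df X 0) \<epsilon> = \<one>\<^bsub>Ext E (dm c) (cd u)\<^esub>"
    if "ar c" "cd c = ob X (Suc n)" "ar u" "dm u = ob X (Suc 0)" for c u
  proof -
    have "Act E c (u \<cdot> df X 0) \<epsilon> = Act E c u (Act E (Idt C (ob X (Suc n))) (df X 0) \<epsilon>)"
      using that by (subst act_act) auto
    then show ?thesis using that exangleD(3)[OF X] by simp
  qed
  have pull: "Act E (df X n \<cdot> c) u \<epsilon> = \<one>\<^bsub>Ext E (dm c) (cd u)\<^esub>"
    if "ar c" "cd c = ob X n" "ar u" "dm u = ob X 0" for c u
  proof -
    have "Act E (df X n \<cdot> c) u \<epsilon> = Act E c u (Act E (df X n) (Idt C (ob X 0)) \<epsilon>)"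
      using that by (subst act_act) auto
    then show ?thesis using that exangleD(4)[OF X] by simp
  qed
  have 1: "Act E (Idt C (ob Y (Suc n))) (df Y 0) \<delta> = \<one>\<^bsub>Ext E (ob Y (Suc n)) (ob Y (Suc 0))\<^esub>"
  proof -
    have "Act E (Idt C (ob Y (Suc n))) (df Y 0) \<delta> = Act E (i (Suc n)) (df Y 0 \<cdot> p 0) \<epsilon>"
      by (subst d1) simp
    also have "df Y 0 \<cdot> p 0 = p (Suc 0) \<cdot> df X 0" by simp
    also have "Act E (i (Suc n)) (p (Suc 0) \<cdot> df X 0) \<epsilon> = \<one>\<^bsub>Ext E (ob Y (Suc n)) (ob Y (Suc 0))\<^esub>"
      by (subst push) simp_all
    finally show ?thesis .
  qed
  have 2: "Act E (df Y n) (Idt C (ob Y 0)) \<delta> = \<one>\<^bsub>Ext E (ob Y n) (ob Y 0)\<^esub>"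
  proof -
    have "Act E (df Y n) (Idt C (ob Y 0)) \<delta> = Act E (i (Suc n) \<cdot> df Y n) (p 0) \<epsilon>"
      by (subst d1) simp
    also have "i (Suc n) \<cdot> df Y n = df X n \<cdot> i n" by simp
    also have "Act E (df X n \<cdot> i n) (p 0) \<epsilon> = \<one>\<^bsub>Ext E (ob Y n) (ob Y 0)\<^esub>"
      by (subst pull) simp_all
    finally show ?thesis .
  qed
  have id_l: "u = p (Suc j) \<cdot> (i (Suc j) \<cdot> u) \<oplus> (h (Suc j) \<cdot> (df Y (Suc j) \<cdot> u) \<oplus> df Y j \<cdot> (h j \<cdot> u))"
    if "j < n" "ar u" "cd u = ob Y (Suc j)" for j u
  proof -
    have "u = Idt C (ob Y (Suc j)) \<cdot> u" using that by simp
    also have "\<dots> = p (Suc j) \<cdot> (i (Suc j) \<cdot> u) \<oplus> (h (Suc j) \<cdot> (df Y (Suc j) \<cdot> u) \<oplus> df Y j \<cdot> (h j \<cdot> u))"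
      unfolding hom[OF that(1)] using that by simp
    finally show ?thesis .
  qed
  have id_r: "u = u \<cdot> (p (Suc j) \<cdot> i (Suc j)) \<oplus> (u \<cdot> (h (Suc j) \<cdot> df Y (Suc j)) \<oplus> u \<cdot> (df Y j \<cdot> h j))"
    if "j < n" "ar u" "dm u = ob Y (Suc j)" for j u
  proof -
    have "u = u \<cdot> Idt C (ob Y (Suc j))" using that by simp
    also have "\<dots> = u \<cdot> (p (Suc j) \<cdot> i (Suc j)) \<oplus> (u \<cdot> (h (Suc j) \<cdot> df Y (Suc j)) \<oplus> u \<cdot> (df Y j \<cdot> h j))"
      unfolding hom[OF that(1)] using that by simp
    finally show ?thesis .
  qed
  have 3: "\<exists>v. ar v \<and> dm v = dm u \<and> cd v = ob Y j \<and> u = df Y j \<cdot> v"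
    if j: "j < n" and u [simp]: "ar u" "cd u = ob Y (Suc j)" and du: "df Y (Suc j) \<cdot> u = zr (dm u) (ob Y (Suc (Suc j)))" for j u
  proof -
    have "df X (Suc j) \<cdot> (i (Suc j) \<cdot> u) = i (Suc (Suc j)) \<cdot> (df Y (Suc j) \<cdot> u)"
      using j by simp
    also have "\<dots> = zr (dm u) (ob X (Suc (Suc j)))" unfolding du using j by simp
    finally have *: "df X (Suc j) \<cdot> (i (Suc j) \<cdot> u) = zr (dm u) (ob X (Suc (Suc j)))" .
    obtain v where v [simp]: "ar v" "dm v = dm u" "cd v = ob X j" "i (Suc j) \<cdot> u = df X j \<cdot> v"
      by (rule exangle_cov[OF X j, of "i (Suc j) \<cdot> u" "dm u"]) (use j * in auto)
    have "u = df Y j \<cdot> (p j \<cdot> v \<oplus> h j \<cdot> u)"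
      using j by (subst id_l[OF j u]) (simp add: du)
    then show ?thesis using j by (intro exI[of _ "p j \<cdot> v \<oplus> h j \<cdot> u"]) simp
  qed
  have 4: "\<exists>v. ar v \<and> dm v = ob Y (Suc (Suc j)) \<and> cd v = cd u \<and> u = v \<cdot> df Y (Suc j)"
    if j: "j < n" and u [simp]: "ar u" "dm u = ob Y (Suc j)" and du: "u \<cdot> df Y j = zr (ob Y j) (cd u)" for j u
  proof -
    have du': "u \<cdot> (df Y j \<cdot> x) = zr (dm x) (cd u)" if "ar x" "cd x = ob Y j" for x
      using cmp_extend[OF du, of x] that j by simp
    have *: "(u \<cdot> p (Suc j)) \<cdot> df X j = zr (ob X j) (cd u)"
      using j by (simp add: du')
    obtain v where v: "ar v" "dm v = ob X (Suc (Suc j))" "cd v = cd u" "u \<cdot> p (Suc j) = v \<cdot> df X (Suc j)"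
      by (rule exangle_con[OF X j, of "u \<cdot> p (Suc j)" "cd u"]) (use j * in auto)
    note [simp] = v(1-3)
    have "u \<cdot> (p (Suc j) \<cdot> i (Suc j)) = (v \<cdot> df X (Suc j)) \<cdot> i (Suc j)"
      using j by (simp flip: v(4))
    also have "\<dots> = v \<cdot> (i (Suc (Suc j)) \<cdot> df Y (Suc j))" using j by simp
    finally have **: "u \<cdot> (p (Suc j) \<cdot> i (Suc j)) = v \<cdot> (i (Suc (Suc j)) \<cdot> df Y (Suc j))" .
    have "u = (v \<cdot> i (Suc (Suc j)) \<oplus> u \<cdot> h (Suc j)) \<cdot> df Y (Suc j)"
      by (subst id_r[OF j u], subst **) (use j in \<open>simp add: du'\<close>)
    then show ?thesis using j by (intro exI[of _ "v \<cdot> i (Suc (Suc j)) \<oplus> u \<cdot> h (Suc j)"]) simp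
  qed
  have 5: "\<exists>v. ar v \<and> dm v = dm u \<and> cd v = ob Y n \<and> u = df Y n \<cdot> v"
    if u [simp]: "ar u" "cd u = ob Y (Suc n)" and du: "Act E u (Idt C (ob Y 0)) \<delta> = \<one>\<^bsub>Ext E (dm u) (ob Y 0)\<^esub>" for u
  proof -
    have "Act E (i (Suc n) \<cdot> u) (Idt C (ob X 0)) \<epsilon> = Act E u (Idt C (ob X 0)) (Act E (i (Suc n)) (Idt C (ob X 0)) \<epsilon>)"
      by (subst act_act) simp_all
    also have "\<dots> = Act E u (i 0) \<delta>" by (subst ci[symmetric], subst act_act) simp_all
    also have "\<dots> = Act E (Idt C (dm u)) (i 0) (Act E u (Idt C (ob Y 0)) \<delta>)" by simp
    also have "\<dots> = \<one>\<^bsub>Ext E (dm u) (ob X 0)\<^esub>" unfolding du by simp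
    finally have *: "Act E (i (Suc n) \<cdot> u) (Idt C (ob X 0)) \<epsilon> = \<one>\<^bsub>Ext E (dm u) (ob X 0)\<^esub>" .
    obtain v where v [simp]: "ar v" "dm v = dm u" "cd v = ob X n" "i (Suc n) \<cdot> u = df X n \<cdot> v"
      by (rule exangle_covE[OF X, of "i (Suc n) \<cdot> u" "dm u"]) (use * in auto)
    have "u = p (Suc n) \<cdot> (i (Suc n) \<cdot> u)" by (simp add: p1i1 del: v(4))
    also have "\<dots> = df Y n \<cdot> (p n \<cdot> v)" by simp
    finally have eq: "u = df Y n \<cdot> (p n \<cdot> v)" .
    show ?thesis by (intro exI[of _ "p n \<cdot> v"] conjI eq) simp_all
  qed
  have 6: "\<exists>v. ar v \<and> dm v = ob Y (Suc 0) \<and> cd v = cd u \<and> u = v \<cdot> df Y 0"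
    if u [simp]: "ar u" "dm u = ob Y 0" and du: "Act E (Idt C (ob Y (Suc n))) u \<delta> = \<one>\<^bsub>Ext E (ob Y (Suc n)) (cd u)\<^esub>" for u
  proof -
    have "Act E (Idt C (ob X (Suc n))) (u \<cdot> p 0) \<epsilon> = Act E (Idt C (ob X (Suc n))) u (Act E (Idt C (ob X (Suc n))) (p 0) \<epsilon>)"
      by (subst act_act) simp_all
    also have "\<dots> = Act E (p (Suc n)) u \<delta>" by (subst cp, subst act_act) simp_all
    also have "\<dots> = Act E (p (Suc n)) (Idt C (cd u)) (Act E (Idt C (ob Y (Suc n))) u \<delta>)" by simp
    also have "\<dots> = \<one>\<^bsub>Ext E (ob X (Suc n)) (cd u)\<^esub>" unfolding du by simp
    finally have *: "Act E (Idt C (ob X (Suc n))) (u \<cdot> p 0) \<epsilon> = \<one>\<^bsub>Ext E (ob X (Suc n)) (cd u)\<^esub>" .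
    obtain v where v: "ar v" "dm v = ob X (Suc 0)" "cd v = cd u" "u \<cdot> p 0 = v \<cdot> df X 0"
      by (rule exangle_conE[OF X, of "u \<cdot> p 0" "cd u"]) (use * in auto)
    note [simp] = v(1-3)
    have "u = (u \<cdot> p 0) \<cdot> i 0" by (simp add: e0)
    also have "\<dots> = (v \<cdot> i (Suc 0)) \<cdot> df Y 0" unfolding v(4) by simp
    finally have eq: "u = (v \<cdot> i (Suc 0)) \<cdot> df Y 0" .
    show ?thesis by (intro exI[of _ "v \<cdot> i (Suc 0)"] conjI eq) simp_all
  qed
  show ?thesis unfolding exangle_iff using Y d 1 2 3 4 5 6 by blast
qed

text \<open>The usual comparison argument: the defect of \<open>f\<close> after subtracting the
  previous term of the homotopy vanishes on the incoming differential of \<open>X\<close>, hence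
  factors through the outgoing one. Exactness is exhausted after degree \<open>n\<close>, so nothing
  is obtained about \<open>f (n + 1)\<close>.\<close>

lemma null_homotopy_rec:
  assumes X: "exangle n C E X \<delta>" and Y: "Y \<in> complexes n C" and f: "f \<in> chain_maps n C X Y"
    and k0: "ar k0" "dm k0 = ob X (Suc 0)" "cd k0 = ob Y 0" "f 0 = k0 \<cdot> df X 0"
  obtains k where "k 0 = k0" "\<And>j. j \<le> n \<Longrightarrow> ar (k j)" "\<And>j. j \<le> n \<Longrightarrow> dm (k j) = ob X (Suc j)"
    "\<And>j. j \<le> n \<Longrightarrow> cd (k j) = ob Y j" "\<And>j. j < n \<Longrightarrow> f (Suc j) = k (Suc j) \<cdot> df X (Suc j) \<oplus> df Y j \<cdot> k j"
proof -
  have X': "X \<in> complexes n C" using exangleD(1)[OF X] .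
  note [simp] = complexesD[OF X'] complexesD[OF Y] chain_mapsD[OF f X' Y] k0(1-3)
  have "\<exists>k. k 0 = k0 \<and> (\<forall>j\<le>m. ar (k j) \<and> dm (k j) = ob X (Suc j) \<and> cd (k j) = ob Y j) \<and>
    (\<forall>j<m. f (Suc j) = k (Suc j) \<cdot> df X (Suc j) \<oplus> df Y j \<cdot> k j)" if "m \<le> n" for m
    using that
  proof (induction m)
    case 0
    show ?case by (rule exI[of _ "\<lambda>_. k0"]) simp
  next
    case (Suc m)
    then obtain k where k: "k 0 = k0" "\<And>j. j \<le> m \<Longrightarrow> ar (k j) \<and> dm (k j) = ob X (Suc j) \<and> cd (k j) = ob Y j"
      "\<And>j. j < m \<Longrightarrow> f (Suc j) = k (Suc j) \<cdot> df X (Suc j) \<oplus> df Y j \<cdot> k j" by auto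
    have m: "m < n" "m \<le> n" using Suc by auto
    have [simp]: "ar (k m)" "dm (k m) = ob X (Suc m)" "cd (k m) = ob Y m" using k(2)[of m] by auto
    \<comment> \<open>The earlier homotopy term drops out because two consecutive differentials of
      \<open>Y\<close> compose to zero; for \<open>m = 0\<close> the equation is the initial
      factorisation.\<close>
    have *: "df Y m \<cdot> f m = df Y m \<cdot> (k m \<cdot> df X m)"
    proof (cases m)
      case 0
      then show ?thesis using k0(4) k(1) by simp
    next
      case (Suc m')
      have "ar (k m')" "dm (k m') = ob X m" "cd (k m') = ob Y m'" using k(2)[of m'] Suc by auto
      moreover have "ar (k (Suc m'))" "dm (k (Suc m')) = ob X (Suc (Suc m'))" "cd (k (Suc m')) = ob Y (Suc m')"
        using k(2)[of m] Suc by auto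
      moreover have "f m = k m \<cdot> df X m \<oplus> df Y m' \<cdot> k m'" using k(3)[of m'] Suc by simp
      ultimately show ?thesis using m Suc by simp
    qed
    obtain v where v: "ar v" "dm v = ob X (Suc (Suc m))" "cd v = ob Y (Suc m)"
      "f (Suc m) \<oplus> neg (df Y m \<cdot> k m) = v \<cdot> df X (Suc m)"
      by (rule exangle_con[OF X m(1), of "f (Suc m) \<oplus> neg (df Y m \<cdot> k m)" "ob Y (Suc m)"])
        (use m * in auto)
    have "f (Suc m) = v \<cdot> df X (Suc m) \<oplus> df Y m \<cdot> k m"
      using m unfolding v(4)[symmetric] by (simp add: padd_ac)
    then show ?case using k v m
      by (intro exI[of _ "k(Suc m := v)"]) (auto simp: less_Suc_eq le_Suc_eq)
  qed
  from this[of n] that show ?thesis by auto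
qed

text \<open>Started at \<open>k0 = 0\<close>, the recursion contracts \<open>h\<close> except for
  the summand \<open>k n \<cdot> d\<close> in degree \<open>n\<close>. As \<open>h\<close> vanishes
  in degree \<open>n + 1\<close>, the arrow \<open>d \<cdot> k n \<cdot> d\<close> is zero, so this
  summand is a chain map by itself and squares to zero.\<close>

lemma square_zero_representative:
  assumes X: "exangle n C E X \<delta>" and h: "h \<in> chain_maps n C X X" and n: "1 \<le> n"
    and h0: "h 0 = zr (ob X 0) (ob X 0)" and h1: "h (Suc n) = zr (ob X (Suc n)) (ob X (Suc n))"
  obtains h' where "h' \<in> chain_maps n C X X" "\<And>j. j \<le> Suc n \<Longrightarrow> h' j \<cdot> h' j = zr (ob X j) (ob X j)"
    "h' 0 = zr (ob X 0) (ob X 0)" "h' (Suc n) = zr (ob X (Suc n)) (ob X (Suc n))"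
    "null n X X (\<lambda>j. h j \<oplus> neg (h' j))"
proof -
  have X': "X \<in> complexes n C" using exangleD(1)[OF X] .
  note [simp] = complexesD[OF X'] chain_mapsD[OF h X' X']
  obtain k where k: "k 0 = zr (ob X (Suc 0)) (ob X 0)"
    and k' [simp]: "\<And>j. j \<le> n \<Longrightarrow> ar (k j)" "\<And>j. j \<le> n \<Longrightarrow> dm (k j) = ob X (Suc j)" "\<And>j. j \<le> n \<Longrightarrow> cd (k j) = ob X j"
    and hk: "\<And>j. j < n \<Longrightarrow> h (Suc j) = k (Suc j) \<cdot> df X (Suc j) \<oplus> df X j \<cdot> k j"
    by (rule null_homotopy_rec[OF X X' h, of "zr (ob X (Suc 0)) (ob X 0)"]) (use h0 in auto)
  obtain m where m: "n = Suc m" using n by (cases n) auto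
  have hn: "h n = k n \<cdot> df X n \<oplus> df X m \<cdot> k m" using hk[of m] m by simp
  have "df X n \<cdot> h n = zr (ob X n) (ob X (Suc n))"
    using chain_mapsD(4)[OF h X' X', of n] h1 by simp
  then have dkd: "df X n \<cdot> (k n \<cdot> df X n) = zr (ob X n) (ob X (Suc n))"
    unfolding hn using m by simp
  have dkd': "df X n \<cdot> (k n \<cdot> (df X n \<cdot> u)) = zr (dm u) (ob X (Suc n))" if "ar u" "cd u = ob X n" for u
    using cmp_extend[OF dkd, of u] that by simp
  define h' where "h' = (\<lambda>j. if j = n then k n \<cdot> df X n else zr (ob X j) (ob X j))"
  show ?thesis
  proof
    show "h' \<in> chain_maps n C X X"
      by (subst chain_maps_iff) (auto simp: h'_def m dkd[unfolded m])
    show "h' j \<cdot> h' j = zr (ob X j) (ob X j)" if "j \<le> Suc n" for j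
      using that by (auto simp: h'_def dkd)
    show "h' 0 = zr (ob X 0) (ob X 0)" "h' (Suc n) = zr (ob X (Suc n)) (ob X (Suc n))"
      using n by (auto simp: h'_def)
    show "null n X X (\<lambda>j. h j \<oplus> neg (h' j))"
    proof (rule nullI[of _ "\<lambda>j. if j = n then zr (ob X (Suc n)) (ob X n) else k j"])
      fix j assume j: "j < n"
      show "h (Suc j) \<oplus> neg (h' (Suc j)) =
        (if Suc j = n then zr (ob X (Suc n)) (ob X n) else k (Suc j)) \<cdot> df X (Suc j) \<oplus>
        df X j \<cdot> (if j = n then zr (ob X (Suc n)) (ob X n) else k j)"
      proof (cases "Suc j = n")
        case True
        then have "j = m" using m by simp
        have "h n \<oplus> neg (k n \<cdot> df X n) = df X m \<cdot> k m"
          unfolding hn using m by (simp add: padd_norm)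
        then show ?thesis using j True m \<open>j = m\<close> by (simp add: h'_def)
      qed (use j hk[of j] in \<open>simp add: h'_def\<close>)
    qed (use n h0 h1 k in \<open>auto simp: h'_def\<close>)
  qed
qed

section \<open>Realisations up to homotopy\<close>

text \<open>Up to homotopy, \<open>g f = 1 + x\<close> with \<open>x\<^sup>2 = 0\<close>, and \<open>(1 - x) g\<close> is a homotopy inverse of \<open>f\<close>.\<close>

lemma homotopy_iso_of_lifts:
  assumes X: "exangle n C E X \<delta>" and Y: "exangle n C E Y \<delta>" and n: "1 \<le> n"
    and f: "f \<in> lifts n C X Y (Idt C (ob X 0)) (Idt C (ob X (Suc n)))"
    and g: "g \<in> lifts n C Y X (Idt C (ob X 0)) (Idt C (ob X (Suc n)))"
    and e [simp]: "ob Y 0 = ob X 0" "ob Y (Suc n) = ob X (Suc n)"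
  shows "homotopy_iso n C (ob X 0) (ob X (Suc n)) X Y"
proof -
  have X': "X \<in> complexes n C" and Y': "Y \<in> complexes n C" using exangleD(1)[OF X] exangleD(1)[OF Y] .
  have f': "f \<in> chain_maps n C X Y" and fe [simp]: "f 0 = Idt C (ob X 0)" "f (Suc n) = Idt C (ob X (Suc n))"
    and g': "g \<in> chain_maps n C Y X" and ge [simp]: "g 0 = Idt C (ob X 0)" "g (Suc n) = Idt C (ob X (Suc n))"
    using f g by (auto simp: lifts_def)
  note [simp] = complexesD[OF X'] complexesD[OF Y'] chain_mapsD[OF f' X' Y'] chain_mapsD[OF g' Y' X']
  define hX where "hX j = g j \<cdot> f j \<oplus> neg (Idt C (ob X j))" for j
  define hY where "hY j = f j \<cdot> g j \<oplus> neg (Idt C (ob Y j))" for j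
  have hX: "hX \<in> chain_maps n C X X" and hY: "hY \<in> chain_maps n C Y Y"
    by (subst chain_maps_iff; auto simp: hX_def hY_def)+
  obtain x where x: "x \<in> chain_maps n C X X"
    and xx: "\<And>j. j \<le> Suc n \<Longrightarrow> x j \<cdot> x j = zr (ob X j) (ob X j)"
    and x0: "x 0 = zr (ob X 0) (ob X 0)" "x (Suc n) = zr (ob X (Suc n)) (ob X (Suc n))"
    and nx: "null n X X (\<lambda>j. hX j \<oplus> neg (x j))"
    by (rule square_zero_representative[OF X hX n]) (auto simp: hX_def)
  obtain y where y: "y \<in> chain_maps n C Y Y"
    and yy: "\<And>j. j \<le> Suc n \<Longrightarrow> y j \<cdot> y j = zr (ob Y j) (ob Y j)"
    and ny: "null n Y Y (\<lambda>j. hY j \<oplus> neg (y j))"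
    by (rule square_zero_representative[OF Y hY n]) (auto simp: hY_def)
  note [simp] = chain_mapsD[OF x X' X'] chain_mapsD[OF y Y' Y']
  define N where "N j = hX j \<oplus> neg (x j)" for j
  define M where "M j = hY j \<oplus> neg (y j)" for j
  have NT [simp]: "ar (N j)" "dm (N j) = ob X j" "cd (N j) = ob X j" if "j \<le> Suc n" for j
    using that by (auto simp: N_def hX_def)
  have MT [simp]: "ar (M j)" "dm (M j) = ob Y j" "cd (M j) = ob Y j" if "j \<le> Suc n" for j
    using that by (auto simp: M_def hY_def)
  have gf: "g j \<cdot> f j = Idt C (ob X j) \<oplus> (N j \<oplus> x j)" if "j \<le> Suc n" for j
    using that by (simp add: N_def hX_def padd_norm)
  have fg: "f j \<cdot> g j = Idt C (ob Y j) \<oplus> (M j \<oplus> y j)" if "j \<le> Suc n" for j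
    using that by (simp add: M_def hY_def padd_norm)
  have Nc: "N \<in> chain_maps n C X X" and Mc: "M \<in> chain_maps n C Y Y"
    by (subst chain_maps_iff; auto simp: N_def M_def hX_def hY_def)+
  have nN: "null n X X N" and nM: "null n Y Y M"
    by (rule null_cong[OF nx] null_cong[OF ny]; simp add: N_def M_def)+
  define G where "G j = g j \<oplus> neg (x j \<cdot> g j)" for j
  have Gc: "G \<in> chain_maps n C Y X" by (subst chain_maps_iff; auto simp: G_def)
  have G: "G \<in> lifts n C Y X (Idt C (ob X 0)) (Idt C (ob X (Suc n)))"
    using Gc x0 by (simp add: lifts_def G_def)
  have Gf: "G j \<cdot> f j \<oplus> neg (Idt C (ob X j)) = N j \<oplus> neg (x j \<cdot> N j)" if j: "j \<le> Suc n" for j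
  proof -
    have "G j \<cdot> f j = g j \<cdot> f j \<oplus> neg (x j \<cdot> (g j \<cdot> f j))" using j by (simp add: G_def)
    then show ?thesis using j by (simp add: gf xx padd_norm)
  qed
  have "null n X X (\<lambda>j. N j \<oplus> neg (x j \<cdot> (N j \<cdot> Idt C (ob X j))))"
    by (intro null_add null_neg null_cmp[OF X' X' X' X' nN] chain_maps_id x X' nN)
  then have nullGf: "null n X X (\<lambda>j. G j \<cdot> f j \<oplus> neg (Idt C (ob X j)))"
    by (rule null_cong) (simp add: Gf)
  \<comment> \<open>Comparing the two bracketings of \<open>f g f\<close> turns the error
    \<open>x\<close> on \<open>X\<close> into the error \<open>y\<close> on \<open>Y\<close>, up to
    null-homotopic terms. Thus the correction of \<open>g\<close> that was made for the left inverse
    serves for the right inverse too.\<close>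
  have fx: "f j \<cdot> x j = M j \<cdot> f j \<oplus> (y j \<cdot> f j \<oplus> neg (f j \<cdot> N j))" if j: "j \<le> Suc n" for j
  proof -
    have "f j \<cdot> (g j \<cdot> f j) = (f j \<cdot> g j) \<cdot> f j" using j by simp
    then have "f j \<oplus> (f j \<cdot> N j \<oplus> f j \<cdot> x j) = f j \<oplus> (M j \<cdot> f j \<oplus> y j \<cdot> f j)"
      using j by (simp add: gf fg)
    then have "f j \<cdot> N j \<oplus> f j \<cdot> x j = M j \<cdot> f j \<oplus> y j \<cdot> f j" using j by (simp add: padd_cancel)
    then have "neg (f j \<cdot> N j) \<oplus> (f j \<cdot> N j \<oplus> f j \<cdot> x j) = neg (f j \<cdot> N j) \<oplus> (M j \<cdot> f j \<oplus> y j \<cdot> f j)" by simp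
    then show ?thesis using j by (simp add: padd_ac)
  qed
  have fG: "f j \<cdot> G j \<oplus> neg (Idt C (ob Y j)) =
    f j \<cdot> (N j \<cdot> g j) \<oplus> (neg (M j \<cdot> M j) \<oplus> (neg (M j \<cdot> y j) \<oplus> neg (y j \<cdot> M j)))" if j: "j \<le> Suc n" for j
  proof -
    have "f j \<cdot> G j = f j \<cdot> g j \<oplus> neg ((f j \<cdot> x j) \<cdot> g j)" using j by (simp add: G_def)
    also have "(f j \<cdot> x j) \<cdot> g j = M j \<cdot> (f j \<cdot> g j) \<oplus> (y j \<cdot> (f j \<cdot> g j) \<oplus> neg (f j \<cdot> (N j \<cdot> g j)))"
      using j by (simp add: fx)
    finally show ?thesis using j by (simp add: fg yy padd_norm)
  qed
  have "null n Y Y (\<lambda>j. f j \<cdot> (N j \<cdot> g j) \<oplus> (neg (M j \<cdot> (M j \<cdot> Idt C (ob Y j))) \<oplus>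
      (neg (Idt C (ob Y j) \<cdot> (M j \<cdot> y j)) \<oplus> neg (y j \<cdot> (M j \<cdot> Idt C (ob Y j))))))"
    by (intro null_add null_neg null_cmp[OF X' X' Y' Y' nN] null_cmp[OF Y' Y' Y' Y' nM] chain_maps_id y X' Y' Mc f' g')
  then have nullfG: "null n Y Y (\<lambda>j. f j \<cdot> G j \<oplus> neg (Idt C (ob Y j)))"
    by (rule null_cong) (simp add: fG)
  show ?thesis unfolding homotopy_iso_def
  proof (intro bexI conjI)
    show "homotopic n C X X (\<lambda>i. G i \<cdot> f i) (\<lambda>i. Idt C (ob X i))"
      using nullGf homotopic_iff_null[OF X' X' chain_maps_cmp[OF f' Gc X' Y' X'] chain_maps_id[OF X']] by simp
    show "homotopic n C Y Y (\<lambda>i. f i \<cdot> G i) (\<lambda>i. Idt C (ob Y i))"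
      using nullfG homotopic_iff_null[OF Y' Y' chain_maps_cmp[OF Gc f' Y' X' Y'] chain_maps_id[OF Y']] by simp
  qed (use f G in auto)
qed

text \<open>Homotopies disappear from the description of a class. A homotopy equivalence with fixed
  ends exhibits \<open>Y\<close> as a homotopy retract and so as an exangle; in the other direction,
  lifts of identities between exangles are already homotopy equivalences.\<close>

lemma iso_class_iff:
  assumes X: "exangle n C E X \<delta>" and n: "1 \<le> n" and Xb: "X \<in> complexes_between n C A K"
  shows "Y \<in> iso_class n C A K X \<longleftrightarrow> Y \<in> complexes_between n C A K \<and> exangle n C E Y \<delta> \<and>
    (\<exists>f. f \<in> lifts n C X Y (Idt C A) (Idt C K)) \<and> (\<exists>g. g \<in> lifts n C Y X (Idt C A) (Idt C K))"
  (is "?L \<longleftrightarrow> ?R")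
proof
  assume ?R
  then show ?L using homotopy_iso_of_lifts[OF X _ n] Xb by (auto simp: iso_class_def complexes_between_iff)
next
  assume L: ?L
  then have Yb: "Y \<in> complexes_between n C A K" by (simp add: iso_class_def)
  from L obtain f g where f: "f\<in>lifts n C X Y (Idt C A) (Idt C K)" and g: "g\<in>lifts n C Y X (Idt C A) (Idt C K)"
    and hom: "homotopic n C Y Y (\<lambda>i. f i \<cdot> g i) (\<lambda>i. Idt C (ob Y i))"
    by (auto simp: iso_class_def homotopy_iso_def)
  have X': "X \<in> complexes n C" and Y': "Y \<in> complexes n C"
    and [simp]: "ob X 0 = A" "ob Y 0 = A" "ob X (Suc n) = K" "ob Y (Suc n) = K"
    using Xb Yb by (auto simp: complexes_between_iff)
  have f': "f \<in> chain_maps n C X Y" and fe [simp]: "f 0 = Idt C A" "f (Suc n) = Idt C K"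
    and g': "g \<in> chain_maps n C Y X" and ge [simp]: "g 0 = Idt C A" "g (Suc n) = Idt C K"
    using f g by (auto simp: lifts_def)
  note [simp] = complexesD[OF X'] complexesD[OF Y'] chain_mapsD[OF f' X' Y'] chain_mapsD[OF g' Y' X']
  have AK [simp]: "A \<in> Obj C" "K \<in> Obj C" using complexes_between_obj[OF Xb] by auto
  have "null n Y Y (\<lambda>j. f j \<cdot> g j \<oplus> neg (Idt C (ob Y j)))"
    using hom homotopic_iff_null[OF Y' Y' chain_maps_cmp[OF g' f' Y' X' Y'] chain_maps_id[OF Y']] by simp
  then obtain k where k: "\<And>j. j \<le> n \<Longrightarrow> ar (k j)" "\<And>j. j \<le> n \<Longrightarrow> dm (k j) = ob Y (Suc j)" "\<And>j. j \<le> n \<Longrightarrow> cd (k j) = ob Y j"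
    "\<And>j. j < n \<Longrightarrow> f (Suc j) \<cdot> g (Suc j) \<oplus> neg (Idt C (ob Y (Suc j))) = k (Suc j) \<cdot> df Y (Suc j) \<oplus> df Y j \<cdot> k j"
    by (rule nullE) blast
  note [simp] = k(1-3)
  have d: "\<delta> \<in> carrier (Ext E K A)" using exangleD(2)[OF X] by simp
  have "exangle n C E Y \<delta>"
  \<comment> \<open>The available homotopy contracts \<open>f g - 1\<close>, whereas the retract
    needs \<open>1 - f g\<close>; hence the negatives.\<close>
  proof (rule exangle_retract[OF X Y' _ g' f', of \<delta> "\<lambda>j. neg (k j)"])
    fix j assume j: "j < n"
    let ?s = "k (Suc j) \<cdot> df Y (Suc j) \<oplus> df Y j \<cdot> k j"
    have "f (Suc j) \<cdot> g (Suc j) = ?s \<oplus> Idt C (ob Y (Suc j))"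
      unfolding k(4)[OF j, symmetric] using j by (simp add: padd_assoc)
    then show "Idt C (ob Y (Suc j)) = f (Suc j) \<cdot> g (Suc j) \<oplus> (neg (k (Suc j)) \<cdot> df Y (Suc j) \<oplus> df Y j \<cdot> neg (k j))"
      using j by (simp add: padd_norm)
  qed (use d in auto)
  then show ?R using Yb f g by blast
qed

text \<open>Turns an equality of classes into a membership, from which lifts can be
  extracted.\<close>

lemma iso_class_refl:
  assumes Xb: "X \<in> complexes_between n C A K"
  shows "X \<in> iso_class n C A K X"
proof -
  have X: "X \<in> complexes n C" and [simp]: "ob X 0 = A" "ob X (Suc n) = K" "A \<in> Obj C" "K \<in> Obj C"
    using Xb complexes_between_obj[OF Xb] by (auto simp: complexes_between_iff)
  note c = chain_maps_id[OF X]
  note [simp] = complexesD[OF X]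
  have "null n X X (\<lambda>j. Idt C (ob X j) \<cdot> Idt C (ob X j) \<oplus> neg (Idt C (ob X j)))"
    by (rule nullI[of _ "\<lambda>j. zr (ob X (Suc j)) (ob X j)"]) simp_all
  then have "homotopic n C X X (\<lambda>j. Idt C (ob X j) \<cdot> Idt C (ob X j)) (\<lambda>j. Idt C (ob X j))"
    using homotopic_iff_null[OF X X chain_maps_cmp[OF c c X X X] c] by simp
  then show ?thesis
    unfolding iso_class_def homotopy_iso_def lifts_def mem_Collect_eq
    by (intro conjI Xb bexI[of _ "\<lambda>i. Idt C (ob X i)"]) (use c in simp_all)
qed

lemma iso_class_eq:
  assumes n: "1 \<le> n" and eX: "exangle n C E X \<delta>" and eY: "exangle n C E Y \<delta>"
    and Xb: "X \<in> complexes_between n C A K" and Yb: "Y \<in> complexes_between n C A K"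
    and f: "f \<in> lifts n C X Y (Idt C A) (Idt C K)" and g: "g \<in> lifts n C Y X (Idt C A) (Idt C K)"
  shows "iso_class n C A K X = iso_class n C A K Y"
proof -
  have AK: "A \<in> Obj C" "K \<in> Obj C" using complexes_between_obj[OF Xb] by auto
  have id: "Idt C A \<cdot> Idt C A = Idt C A" "Idt C K \<cdot> Idt C K = Idt C K" using AK by auto
  have tr: "\<exists>h. h \<in> lifts n C U W (Idt C A) (Idt C K)"
    if "f \<in> lifts n C U V (Idt C A) (Idt C K)" "\<exists>g. g \<in> lifts n C V W (Idt C A) (Idt C K)"
      "U \<in> complexes_between n C A K" "V \<in> complexes_between n C A K" "W \<in> complexes_between n C A K" for f U V W
    using that lifts_cmp[OF that(1), of _ W "Idt C A" "Idt C K"] unfolding id complexes_between_iff by blast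
  have tr': "\<exists>h. h \<in> lifts n C U W (Idt C A) (Idt C K)"
    if "\<exists>g. g \<in> lifts n C U V (Idt C A) (Idt C K)" "f \<in> lifts n C V W (Idt C A) (Idt C K)"
      "U \<in> complexes_between n C A K" "V \<in> complexes_between n C A K" "W \<in> complexes_between n C A K" for f U V W
    using that tr by blast
  have "Z \<in> iso_class n C A K X \<longleftrightarrow> Z \<in> iso_class n C A K Y" for Z
    unfolding iso_class_iff[OF eX n Xb] iso_class_iff[OF eY n Yb]
    using tr[OF f _ Xb Yb] tr[OF g _ Yb Xb] tr'[OF _ f _ Xb Yb] tr'[OF _ g _ Yb Xb] by blast
  then show ?thesis by blast
qed

lemma exangle_strict_retract:
  assumes X: "exangle n C E X \<epsilon>" and Y: "Y \<in> complexes n C"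
    and d: "\<delta> \<in> carrier (Ext E (ob Y (Suc n)) (ob Y 0))"
    and i: "i \<in> chain_maps n C Y X" and p: "p \<in> chain_maps n C X Y"
    and pi: "\<And>j. j \<le> Suc n \<Longrightarrow> p j \<cdot> i j = Idt C (ob Y j)"
    and ci: "Act E (Idt C (ob Y (Suc n))) (i 0) \<delta> = Act E (i (Suc n)) (Idt C (ob X 0)) \<epsilon>"
    and cp: "Act E (Idt C (ob X (Suc n))) (p 0) \<epsilon> = Act E (p (Suc n)) (Idt C (ob Y 0)) \<delta>"
  shows "exangle n C E Y \<delta>"
proof (rule exangle_retract[OF X Y d i p, of "\<lambda>j. zr (ob Y (Suc j)) (ob Y j)"])
  note [simp] = complexesD[OF Y]
  fix j assume "j < n"
  then show "Idt C (ob Y (Suc j)) = p (Suc j) \<cdot> i (Suc j) \<oplus>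
    (zr (ob Y (Suc (Suc j))) (ob Y (Suc j)) \<cdot> df Y (Suc j) \<oplus> df Y j \<cdot> zr (ob Y (Suc j)) (ob Y j))"
    using pi[of "Suc j"] by simp
qed (use complexesD[OF Y] pi ci cp in auto)

text \<open>The recursion leaves the error \<open>m = e - d k\<close> in degree
  \<open>n + 1\<close>. There \<open>m d = 0\<close>, and \<open>e\<close> factors through
  \<open>d\<close> because it kills \<open>\<delta>\<close>, so \<open>m m = 0\<close>. Expanding
  \<open>e = e e\<close> then gives \<open>e = d (e k + k m)\<close> in the top degree. Hence the
  homotopy \<open>e k\<close>, with the extra term \<open>k m\<close> in degree \<open>n\<close>,
  satisfies all conditions; the lower ones are unaffected because \<open>m d = 0\<close>.\<close>

lemma null_idempotent:
  assumes X: "exangle n C E X \<delta>" and e: "e \<in> chain_maps n C X X" and n: "1 \<le> n"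
    and ee: "\<And>j. j \<le> Suc n \<Longrightarrow> e j \<cdot> e j = e j"
    and e0: "Act E (Idt C (ob X (Suc n))) (e 0) \<delta> = \<one>\<^bsub>Ext E (ob X (Suc n)) (ob X 0)\<^esub>"
    and e1: "Act E (e (Suc n)) (Idt C (ob X 0)) \<delta> = \<one>\<^bsub>Ext E (ob X (Suc n)) (ob X 0)\<^esub>"
  shows "null n X X e"
proof -
  have X': "X \<in> complexes n C" using exangleD(1)[OF X] .
  note [simp] = complexesD[OF X'] chain_mapsD[OF e X' X']
  obtain k0 where k0: "ar k0" "dm k0 = ob X (Suc 0)" "cd k0 = ob X 0" "e 0 = k0 \<cdot> df X 0"
    by (rule exangle_conE[OF X, of "e 0" "ob X 0"]) (use e0 in auto)
  obtain k where kk: "k 0 = k0" and k [simp]: "\<And>j. j \<le> n \<Longrightarrow> ar (k j)" "\<And>j. j \<le> n \<Longrightarrow> dm (k j) = ob X (Suc j)"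
    "\<And>j. j \<le> n \<Longrightarrow> cd (k j) = ob X j"
    and ek: "\<And>j. j < n \<Longrightarrow> e (Suc j) = k (Suc j) \<cdot> df X (Suc j) \<oplus> df X j \<cdot> k j"
    by (rule null_homotopy_rec[OF X X' e k0]) blast
  define m where "m = e (Suc n) \<oplus> neg (df X n \<cdot> k n)"
  have m [simp]: "ar m" "dm m = ob X (Suc n)" "cd m = ob X (Suc n)" by (auto simp: m_def)
  have eS: "e (Suc n) = df X n \<cdot> k n \<oplus> m" by (simp add: m_def padd_norm)
  obtain n' where n': "n = Suc n'" using n by (cases n) auto
  have "df X n \<cdot> e n = df X n \<cdot> (k n \<cdot> df X n)"
    using ek[of n'] n' by simp
  then have md: "m \<cdot> df X n = zr (ob X n) (ob X (Suc n))" by (simp add: m_def)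
  have md': "m \<cdot> (df X n \<cdot> u) = zr (dm u) (ob X (Suc n))" if "ar u" "cd u = ob X n" for u
    using cmp_extend[OF md, of u] that by simp
  obtain l where l: "ar l" "dm l = ob X (Suc n)" "cd l = ob X n" "e (Suc n) = df X n \<cdot> l"
    by (rule exangle_covE[OF X, of "e (Suc n)" "ob X (Suc n)"]) (use e1 in auto)
  have mm: "m \<cdot> m = zr (ob X (Suc n)) (ob X (Suc n))"
  proof -
    have "m \<cdot> m = m \<cdot> (df X n \<cdot> l) \<oplus> neg (m \<cdot> (df X n \<cdot> k n))"
      unfolding l(4)[symmetric] by (subst (2) m_def) simp
    then show ?thesis using l(1-3) by (simp add: md')
  qed
  have e_n: "e (Suc n) = df X n \<cdot> (e n \<cdot> k n \<oplus> k n \<cdot> m)"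
  proof -
    have "e (Suc n) = e (Suc n) \<cdot> e (Suc n)" by (simp add: ee)
    also have "\<dots> = e (Suc n) \<cdot> (df X n \<cdot> k n) \<oplus> e (Suc n) \<cdot> m" by (subst (2) eS) simp
    also have "e (Suc n) \<cdot> m = df X n \<cdot> (k n \<cdot> m)" by (subst eS) (simp add: mm)
    finally show ?thesis by simp
  qed
  show ?thesis
  proof (rule nullI[of _ "\<lambda>j. if j = n then e n \<cdot> k n \<oplus> k n \<cdot> m else e j \<cdot> k j"])
    show "e 0 = (if 0 = n then e n \<cdot> k n \<oplus> k n \<cdot> m else e 0 \<cdot> k 0) \<cdot> df X 0"
      using n ee[of 0] kk k0 by simp
    fix j assume j: "j < n"
    have "e (Suc j) = e (Suc j) \<cdot> e (Suc j)" using j by (simp add: ee)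
    also have "\<dots> = e (Suc j) \<cdot> (k (Suc j) \<cdot> df X (Suc j) \<oplus> df X j \<cdot> k j)" using ek[OF j] by simp
    also have "\<dots> = e (Suc j) \<cdot> (k (Suc j) \<cdot> df X (Suc j)) \<oplus> df X j \<cdot> (e j \<cdot> k j)" using j by simp
    finally have *: "e (Suc j) = e (Suc j) \<cdot> (k (Suc j) \<cdot> df X (Suc j)) \<oplus> df X j \<cdot> (e j \<cdot> k j)" .
    show "e (Suc j) = (if Suc j = n then e n \<cdot> k n \<oplus> k n \<cdot> m else e (Suc j) \<cdot> k (Suc j)) \<cdot> df X (Suc j) \<oplus>
      df X j \<cdot> (if j = n then e n \<cdot> k n \<oplus> k n \<cdot> m else e j \<cdot> k j)"
    proof (cases "Suc j = n")
      case True
      then have md2: "m \<cdot> df X (Suc j) = zr (ob X (Suc j)) (ob X (Suc n))" using md by simp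
      show ?thesis using True j md2 by (subst *) simp
    next
      case False
      show ?thesis using j False by (subst *) simp
    qed
  qed (use e_n in auto)
qed

section \<open>Exangles and lifts in the opposite category\<close>

lemma exangle_rev:
  assumes X: "exangle n C E X \<delta>"
  shows "exangle n (op_cat C) (op_ext E) (rev_cpx n X) \<delta>"
proof -
  interpret op: biadditive_functor "op_cat C" "op_ext E" by (rule biadditive_op)
  have X': "X \<in> complexes n C" using exangleD(1)[OF X] .
  have *: "\<exists>j'. j' < n \<and> n - j = Suc j' \<and> n - Suc j = j' \<and> Suc n - j = Suc (Suc j') \<and> Suc n - Suc j = Suc j' \<and>
    Suc n - Suc (Suc j) = j'" if "j < n" for j
    using that by (intro exI[of _ "n - Suc j"]) auto
  show ?thesis
    unfolding op.exangle_iff op_simps op_cat_sel op_ext_sel rev_cpx_sel dom_cod_op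
  proof (intro conjI allI impI)
    fix j u assume a: "j < n \<and> ar u \<and> dm u = ob X (Suc n - Suc j) \<and>
           u \<cdot> df X (n - Suc j) = zr (ob X (Suc n - Suc (Suc j))) (cd u)"
    then obtain j' where j': "j' < n \<and> n - j = Suc j' \<and> n - Suc j = j' \<and> Suc n - j = Suc (Suc j') \<and> Suc n - Suc j = Suc j' \<and>
    Suc n - Suc (Suc j) = j'" using * by blast
    show "\<exists>v. ar v \<and> cd v = cd u \<and> dm v = ob X (Suc n - j) \<and> u = v \<cdot> df X (n - j)"
      by (rule exangle_con[OF X, of j' u "cd u"]) (use a j' in auto)
  next
    fix j u assume a: "j < n \<and> ar u \<and> cd u = ob X (Suc n - Suc j) \<and>
           df X (n - j) \<cdot> u = zr (dm u) (ob X (Suc n - j))"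
    then obtain j' where j': "j' < n \<and> n - j = Suc j' \<and> n - Suc j = j' \<and> Suc n - j = Suc (Suc j') \<and> Suc n - Suc j = Suc j' \<and>
    Suc n - Suc (Suc j) = j'" using * by blast
    show "\<exists>v. ar v \<and> cd v = ob X (Suc n - Suc (Suc j)) \<and> dm v = dm u \<and> u = df X (n - Suc j) \<cdot> v"
      by (rule exangle_cov[OF X, of j' u "dm u"]) (use a j' in auto)
  next
    fix u assume a: "ar u \<and> dm u = ob X (Suc n - Suc n) \<and> Act E (Idt C (ob X (Suc n - 0))) u \<delta> = \<one>\<^bsub>Ext E (ob X (Suc n - 0)) (cd u)\<^esub>"
    show "\<exists>v. ar v \<and> cd v = cd u \<and> dm v = ob X (Suc n - n) \<and> u = v \<cdot> df X (n - n)"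
      by (rule exangle_conE[OF X, of u "cd u"]) (use a in auto)
  next
    fix u assume a: "ar u \<and> cd u = ob X (Suc n - 0) \<and> Act E u (Idt C (ob X (Suc n - Suc n))) \<delta> = \<one>\<^bsub>Ext E (dm u) (ob X (Suc n - Suc n))\<^esub>"
    show "\<exists>v. ar v \<and> cd v = ob X (Suc n - Suc 0) \<and> dm v = dm u \<and> u = df X (n - 0) \<cdot> v"
      by (rule exangle_covE[OF X, of u "dm u"]) (use a in auto)
  qed (use exangleD[OF X] complexes_rev[OF X'] in auto)
qed

lemma exangle_rev_iff: "exangle n C E (rev_cpx n X) \<delta> \<longleftrightarrow> exangle n (op_cat C) (op_ext E) X \<delta>"
proof -
  interpret op: biadditive_functor "op_cat C" "op_ext E" by (rule biadditive_op)
  show ?thesis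
    using op.exangle_rev[of n X \<delta>] exangle_rev[of n "rev_cpx n X" \<delta>]
      op.exangle_agree[OF agree_rev_rev, of n X \<delta>] by auto
qed

lemma complexes_rev_iff: "rev_cpx n X \<in> complexes n C \<longleftrightarrow> X \<in> complexes n (op_cat C)"
proof -
  interpret op: biadditive_functor "op_cat C" "op_ext E" by (rule biadditive_op)
  show ?thesis
    using op.complexes_rev[of X n] complexes_rev[of "rev_cpx n X" n]
      op.complexes_agree[OF agree_rev_rev, of n X] by auto
qed

lemma complexes_between_rev_iff: "rev_cpx n X \<in> complexes_between n C K A \<longleftrightarrow> X \<in> complexes_between n (op_cat C) A K"
proof -
  interpret op: biadditive_functor "op_cat C" "op_ext E" by (rule biadditive_op)
  show ?thesis unfolding complexes_between_iff op.complexes_between_iff complexes_rev_iff by auto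
qed

lemma lifts_rev_iff:
  assumes "X \<in> complexes n (op_cat C)" "Y \<in> complexes n (op_cat C)"
  shows "(\<exists>f. f \<in> lifts n C (rev_cpx n Y) (rev_cpx n X) c a) \<longleftrightarrow> (\<exists>f. f \<in> lifts n (op_cat C) X Y a c)"
proof -
  interpret op: biadditive_functor "op_cat C" "op_ext E" by (rule biadditive_op)
  show ?thesis
    using op.lifts_rev[of _ n X Y a c] lifts_rev[of _ n "rev_cpx n Y" "rev_cpx n X" c a]
      op.lifts_agree[OF agree_rev_rev agree_rev_rev, of n X Y a c] complexes_rev_iff assms by auto
qed

end

text \<open>Existence, (R0) and (R1) form a self-dual package on which all retract arguments rest.
  It can be established for opposite categories and for the completion before the remaining axioms
  are available there.\<close>

locale realisation = biadditive_functor C E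
  for n :: nat and C :: "('o, 'm) cat" (structure) and E :: "('o, 'm, 'x) ext"
    and s :: "('o, 'm, 'x) realisation" +
  assumes n_pos: "1 \<le> n"
    and realised: "\<lbrakk>K \<in> Obj C; A \<in> Obj C; \<delta> \<in> carrier (Ext E K A)\<rbrakk>
      \<Longrightarrow> \<exists>X. realises n C s K A \<delta> X"
    and R0: "\<lbrakk>K \<in> Obj C; A \<in> Obj C; L \<in> Obj C; B \<in> Obj C;
      \<delta> \<in> carrier (Ext E K A); \<rho> \<in> carrier (Ext E L B); a \<in> Arr C A B; c \<in> Arr C K L;
      push C E K a \<delta> = pull C E B c \<rho>; realises n C s K A \<delta> X; realises n C s L B \<rho> Y\<rbrakk>
      \<Longrightarrow> \<exists>f. f \<in> lifts n C X Y a c"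
    and R1: "\<lbrakk>K \<in> Obj C; A \<in> Obj C; \<delta> \<in> carrier (Ext E K A); realises n C s K A \<delta> X\<rbrakk>
      \<Longrightarrow> exangle n C E X \<delta>"

lemma (in exact_realisation) realisation: "1 \<le> n \<Longrightarrow> realisation n C E s"
  by (intro realisation.intro realisation_axioms.intro biadditive_functor_axioms realised R0 R1)

context realisation
begin

lemma realisesD:
  assumes "realises n C s K A \<delta> X"
  shows "X \<in> complexes n C" "ob X 0 = A" "ob X (Suc n) = K" "A \<in> Obj C" "K \<in> Obj C"
  using assms by (auto simp: realises_def complexes_between_iff complexes_iff)

lemma realises_exangle: "\<delta> \<in> carrier (Ext E K A) \<Longrightarrow> realises n C s K A \<delta> X \<Longrightarrow> exangle n C E X \<delta>"
  by (rule R1[OF realisesD(5,4)])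

lemma realises_lift:
  assumes "realises n C s K A \<delta> X" "realises n C s L B \<rho> Y" "\<delta> \<in> carrier (Ext E K A)" "\<rho> \<in> carrier (Ext E L B)"
    "ar a" "dm a = A" "cd a = B" "ar c" "dm c = K" "cd c = L"
    "Act E (Idt C K) a \<delta> = Act E c (Idt C B) \<rho>"
  obtains f where "f \<in> lifts n C X Y a c"
  using R0[of K A L B \<delta> \<rho> a c X Y] assms realisesD[OF assms(1)] realisesD[OF assms(2)]
  by (auto simp: push_def pull_def)

text \<open>By (R0) any two realisations of an extension admit lifts of the identities in both
  directions, and \<open>iso_class_eq\<close> converts such lifts back into an equality of
  classes.\<close>

lemma realises_iff:
  assumes X: "realises n C s K A \<delta> X" and d: "\<delta> \<in> carrier (Ext E K A)"
  shows "realises n C s K A \<delta> Y \<longleftrightarrow> Y \<in> complexes_between n C A K \<and> exangle n C E Y \<delta> \<and>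
    (\<exists>f. f \<in> lifts n C X Y (Idt C A) (Idt C K)) \<and> (\<exists>g. g \<in> lifts n C Y X (Idt C A) (Idt C K))"
  (is "?L \<longleftrightarrow> ?R")
proof
  have Xb: "X \<in> complexes_between n C A K" using X by (simp add: realises_def)
  have AK: "A \<in> Obj C" "K \<in> Obj C" using complexes_between_obj[OF Xb] by auto
  have eX: "exangle n C E X \<delta>" using realises_exangle[OF d X] .
  show ?R if ?L
  proof -
    have Yb: "Y \<in> complexes_between n C A K" using that by (simp add: realises_def)
    have eY: "exangle n C E Y \<delta>" using realises_exangle[OF d that] .
    have ids: "\<exists>f. f \<in> lifts n C X Y (Idt C A) (Idt C K)" "\<exists>f. f \<in> lifts n C Y X (Idt C A) (Idt C K)"
      by (rule realises_lift[OF X that d d, of "Idt C A" "Idt C K"]; use AK in \<open>auto simp del: Arr_iff\<close>)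
        (rule realises_lift[OF that X d d, of "Idt C A" "Idt C K"]; use AK in \<open>auto simp del: Arr_iff\<close>)
    show ?thesis using Yb eY ids by blast
  qed
  show ?L if R: ?R
  proof -
    have Yb: "Y \<in> complexes_between n C A K" and eY: "exangle n C E Y \<delta>" using R by auto
    obtain f g where f: "f \<in> lifts n C X Y (Idt C A) (Idt C K)" and g: "g \<in> lifts n C Y X (Idt C A) (Idt C K)"
      using R by blast
    have "iso_class n C A K X = iso_class n C A K Y" by (rule iso_class_eq[OF n_pos eX eY Xb Yb f g])
    then show ?thesis using X Yb by (simp add: realises_def)
  qed
qed

text \<open>Let \<open>Z\<close> be any realisation of \<open>\<delta>\<close>. By (R0) the end
  components of \<open>i\<close> and \<open>p\<close> lift to chain maps between \<open>Z\<close>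
  and \<open>X\<close>. The composites \<open>Z \<rightarrow> X \<rightarrow> Y\<close> and
  \<open>Y \<rightarrow> X \<rightarrow> Z\<close> are lifts of identities, so once \<open>Y\<close>
  is an exangle only the end terms of \<open>p i\<close> matter.\<close>

lemma realises_retractI:
  assumes X: "realises n C s L B \<epsilon> X" and e: "\<epsilon> \<in> carrier (Ext E L B)"
    and Y: "exangle n C E Y \<delta>" and Yb: "ob Y 0 = A" "ob Y (Suc n) = K"
    and i: "i \<in> chain_maps n C Y X" and p: "p \<in> chain_maps n C X Y"
    and pi: "p 0 \<cdot> i 0 = Idt C A" "p (Suc n) \<cdot> i (Suc n) = Idt C K"
    and ci: "Act E (Idt C K) (i 0) \<delta> = Act E (i (Suc n)) (Idt C B) \<epsilon>"
    and cp: "Act E (Idt C L) (p 0) \<epsilon> = Act E (p (Suc n)) (Idt C A) \<delta>"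
  shows "realises n C s K A \<delta> Y"
proof -
  have Y': "Y \<in> complexes n C" and d: "\<delta> \<in> carrier (Ext E K A)" using exangleD[OF Y] Yb by auto
  have Yb': "Y \<in> complexes_between n C A K" using Y' Yb by (simp add: complexes_between_iff)
  then have AK: "A \<in> Obj C" "K \<in> Obj C" using complexes_between_obj by auto
  note X' = realisesD[OF X]
  obtain Z where Z: "realises n C s K A \<delta> Z" using realised[OF AK(2,1) d] by blast
  note Z' = realisesD[OF Z]
  note [simp] = chain_mapsD(1-3)[OF i Y' X'(1)] chain_mapsD(1-3)[OF p X'(1) Y'] X'(2-) Yb
  obtain f where f: "f \<in> lifts n C Z X (i 0) (i (Suc n))"
    by (rule realises_lift[OF Z X d e, of "i 0" "i (Suc n)"]) (use ci in auto)
  obtain g where g: "g \<in> lifts n C X Z (p 0) (p (Suc n))"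
    by (rule realises_lift[OF X Z e d, of "p 0" "p (Suc n)"]) (use cp in auto)
  have i': "i \<in> lifts n C Y X (i 0) (i (Suc n))" and p': "p \<in> lifts n C X Y (p 0) (p (Suc n))"
    using i p by (auto simp: lifts_def)
  show ?thesis
    unfolding realises_iff[OF Z d]
    using Yb' Y lifts_cmp[OF f p' Z'(1) X'(1) Y'] lifts_cmp[OF i' g Y' X'(1) Z'(1)] unfolding pi by blast
qed

text \<open>Composites of inflations, mapping cones, the split complexes of (R2) and images under
  the extended functor are all recognised as realisations by this criterion.\<close>

lemma realises_strict_retract:
  assumes X: "realises n C s L B \<epsilon> X" and e: "\<epsilon> \<in> carrier (Ext E L B)"
    and Y: "Y \<in> complexes n C" and Yb: "ob Y 0 = A" "ob Y (Suc n) = K"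
    and d: "\<delta> \<in> carrier (Ext E K A)"
    and i: "i \<in> chain_maps n C Y X" and p: "p \<in> chain_maps n C X Y"
    and pi: "\<And>j. j \<le> Suc n \<Longrightarrow> p j \<cdot> i j = Idt C (ob Y j)"
    and ci: "Act E (Idt C K) (i 0) \<delta> = Act E (i (Suc n)) (Idt C B) \<epsilon>"
    and cp: "Act E (Idt C L) (p 0) \<epsilon> = Act E (p (Suc n)) (Idt C A) \<delta>"
  shows "realises n C s K A \<delta> Y"
proof -
  have "exangle n C E Y \<delta>"
    by (rule exangle_strict_retract[OF realises_exangle[OF e X] Y _ i p pi]) (use Yb d ci cp realisesD[OF X] in auto)
  then show ?thesis
    by (rule realises_retractI[OF X e _ Yb i p]) (use pi[of 0] pi[of "Suc n"] Yb ci cp in auto)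
qed

lemma realises_agree:
  assumes X: "realises n C s K A \<delta> X" and d: "\<delta> \<in> carrier (Ext E K A)" and ag: "agree n X Y"
  shows "realises n C s K A \<delta> Y"
proof -
  note X' = realisesD[OF X]
  have Y: "Y \<in> complexes n C" using complexes_agree[OF ag] X' by simp
  have ids: "(\<lambda>i. Idt C (ob X i)) \<in> lifts n C X X (Idt C A) (Idt C K)"
    using chain_maps_id[OF X'(1)] X' by (simp add: lifts_def)
  show ?thesis unfolding realises_iff[OF X d]
    using exangle_agree[OF ag realises_exangle[OF d X]] Y ag X' ids lifts_agree[OF agree_refl ag] lifts_agree[OF ag agree_refl]
    by (auto simp: complexes_between_iff agree_def)
qed

text \<open>\<open>op_real\<close> is only a preimage under reversal. That such a preimage is an
  isomorphism class in the opposite category follows from \<open>iso_class_iff\<close>, whose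
  conditions, exangle and lifts both ways, are exchanged by duality.\<close>

lemma realises_op_iff:
  assumes d: "\<delta> \<in> carrier (Ext E A K)" and AK: "A \<in> Obj C" "K \<in> Obj C"
  shows "realises n (op_cat C) (op_real n s) K A \<delta> X \<longleftrightarrow> realises n C s A K \<delta> (rev_cpx n X)"
proof -
  interpret op: biadditive_functor "op_cat C" "op_ext E" by (rule biadditive_op)
  show ?thesis
  proof
    assume a: "realises n (op_cat C) (op_real n s) K A \<delta> X"
    then have Xb: "X \<in> complexes_between n (op_cat C) A K"
      and eq: "rev_cpx n -` s A K \<delta> = iso_class n (op_cat C) A K X"
      by (auto simp: realises_def op_real_def)
    have "X \<in> iso_class n (op_cat C) A K X" by (rule op.iso_class_refl[OF Xb])
    then have "rev_cpx n X \<in> s A K \<delta>" using eq by blast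
    moreover obtain Z where Z: "realises n C s A K \<delta> Z" using realised[OF AK d] by blast
    ultimately have "rev_cpx n X \<in> iso_class n C K A Z" by (simp add: realises_def)
    then show "realises n C s A K \<delta> (rev_cpx n X)"
      using iso_class_iff[OF realises_exangle[OF d Z] n_pos] Z realises_iff[OF Z d] unfolding realises_def by blast
  next
    assume a: "realises n C s A K \<delta> (rev_cpx n X)"
    then have Xb: "rev_cpx n X \<in> complexes_between n C K A"
      and eq: "s A K \<delta> = iso_class n C K A (rev_cpx n X)"
      by (auto simp: realises_def)
    have ex: "exangle n C E (rev_cpx n X) \<delta>" by (rule realises_exangle[OF d a])
    have Xb': "X \<in> complexes_between n (op_cat C) A K" using Xb complexes_between_rev_iff by blast
    have ex': "exangle n (op_cat C) (op_ext E) X \<delta>" using ex exangle_rev_iff by blast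
    have "rev_cpx n Y \<in> s A K \<delta> \<longleftrightarrow> Y \<in> iso_class n (op_cat C) A K X" for Y
      unfolding eq iso_class_iff[OF ex n_pos Xb] op.iso_class_iff[OF ex' n_pos Xb'] complexes_between_rev_iff exangle_rev_iff
      using lifts_rev_iff[of X n Y "Idt C K" "Idt C A"] lifts_rev_iff[of Y n X "Idt C K" "Idt C A"] Xb'
      by (auto simp: op.complexes_between_iff)
    then show "realises n (op_cat C) (op_real n s) K A \<delta> X"
      using Xb' by (auto simp: realises_def op_real_def)
  qed
qed

lemma realisation_op: "realisation n (op_cat C) (op_ext E) (op_real n s)"
proof (intro realisation.intro realisation_axioms.intro biadditive_op n_pos)
  fix K A \<delta> assume a: "K \<in> Obj (op_cat C)" "A \<in> Obj (op_cat C)" "\<delta> \<in> carrier (Ext (op_ext E) K A)"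
  then have a': "K \<in> Obj C" "A \<in> Obj C" "\<delta> \<in> carrier (Ext E A K)" by simp_all
  obtain X where X: "realises n C s A K \<delta> X" using realised a' by blast
  have "realises n C s A K \<delta> (rev_cpx n (rev_cpx n X))"
    by (rule realises_agree[OF X a'(3) agree_sym[OF agree_rev_rev]])
  then show "\<exists>X. realises n (op_cat C) (op_real n s) K A \<delta> X"
    using realises_op_iff[OF a'(3,2,1)] by blast
next
  fix K A \<delta> X assume a: "K \<in> Obj (op_cat C)" "A \<in> Obj (op_cat C)" "\<delta> \<in> carrier (Ext (op_ext E) K A)"
    "realises n (op_cat C) (op_real n s) K A \<delta> X"
  then have a': "K \<in> Obj C" "A \<in> Obj C" "\<delta> \<in> carrier (Ext E A K)" by simp_all
  show "exangle n (op_cat C) (op_ext E) X \<delta>"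
    using realises_exangle[OF a'(3)] a(4) unfolding realises_op_iff[OF a'(3,2,1)] exangle_rev_iff[symmetric] by blast
next
  fix K A L B \<delta> \<rho> a c X Y
  assume o: "K \<in> Obj (op_cat C)" "A \<in> Obj (op_cat C)" "L \<in> Obj (op_cat C)" "B \<in> Obj (op_cat C)"
    and d: "\<delta> \<in> carrier (Ext (op_ext E) K A)" and r: "\<rho> \<in> carrier (Ext (op_ext E) L B)"
    and a: "a \<in> Arr (op_cat C) A B" and c: "c \<in> Arr (op_cat C) K L"
    and eq: "push (op_cat C) (op_ext E) K a \<delta> = pull (op_cat C) (op_ext E) B c \<rho>"
    and X: "realises n (op_cat C) (op_real n s) K A \<delta> X" and Y: "realises n (op_cat C) (op_real n s) L B \<rho> Y"
  have o': "K \<in> Obj C" "A \<in> Obj C" "L \<in> Obj C" "B \<in> Obj C" using o by simp_all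
  have d': "\<delta> \<in> carrier (Ext E A K)" and r': "\<rho> \<in> carrier (Ext E B L)" using d r by simp_all
  have X': "realises n C s A K \<delta> (rev_cpx n X)" using X realises_op_iff[OF d' o'(2,1)] by blast
  have Y': "realises n C s B L \<rho> (rev_cpx n Y)" using Y realises_op_iff[OF r' o'(4,3)] by blast
  have "\<exists>f. f \<in> lifts n C (rev_cpx n Y) (rev_cpx n X) c a"
    by (rule R0[OF o'(4,3,2,1) r' d' _ _ _ Y' X']) (use a c eq in \<open>simp_all del: Arr_iff\<close>)
  then show "\<exists>f. f \<in> lifts n (op_cat C) X Y a c"
    using lifts_rev_iff realisesD(1)[OF X'] realisesD(1)[OF Y'] complexes_rev_iff by blast
qed

end

section \<open>Contractible summands and mapping cones\<close>

context preadditive_category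
begin

definition pad_in :: "('o, 'm) cpx \<Rightarrow> nat \<Rightarrow> ('o, 'm) bip \<Rightarrow> ('o, 'm) bip \<Rightarrow> nat \<Rightarrow> 'm" where
  "pad_in X m P Q i = (if i = m then inl P else if i = Suc m then inl Q else Idt C (ob X i))"

definition pad_pr :: "('o, 'm) cpx \<Rightarrow> nat \<Rightarrow> ('o, 'm) bip \<Rightarrow> ('o, 'm) bip \<Rightarrow> nat \<Rightarrow> 'm" where
  "pad_pr X m P Q i = (if i = m then prl P else if i = Suc m then prl Q else Idt C (ob X i))"

text \<open>\<open>X \<oplus> (W = W)\<close> with the summand \<open>W = W\<close> in degrees \<open>m\<close> and \<open>m + 1\<close>, where \<open>P = X\<^sub>m \<oplus> W\<close> and
  \<open>Q = X\<^sub>m\<^sub>+\<^sub>1 \<oplus> W\<close>.\<close>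

definition pad :: "('o, 'm) cpx \<Rightarrow> nat \<Rightarrow> ('o, 'm) bip \<Rightarrow> ('o, 'm) bip \<Rightarrow> ('o, 'm) cpx" where
  "pad X m P Q = \<lparr>
     ob = (\<lambda>i. if i = m then bob P else if i = Suc m then bob Q else ob X i),
     df = (\<lambda>i. if i = m then inl Q \<cdot> (df X m \<cdot> prl P) \<oplus> inr Q \<cdot> prr P
               else pad_in X m P Q (Suc i) \<cdot> (df X i \<cdot> pad_pr X m P Q i))\<rparr>"

lemma pad_sel:
  "ob (pad X m P Q) i = (if i = m then bob P else if i = Suc m then bob Q else ob X i)"
  "df (pad X m P Q) i = (if i = m then inl Q \<cdot> (df X m \<cdot> prl P) \<oplus> inr Q \<cdot> prr P
               else pad_in X m P Q (Suc i) \<cdot> (df X i \<cdot> pad_pr X m P Q i))"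
  by (simp_all add: pad_def)

lemma pad_props:
  assumes X: "X \<in> complexes n C" and m: "m < n" "1 \<le> m" and W: "W \<in> Obj C"
    and P: "is_biproduct C (ob X m) W P" and Q: "is_biproduct C (ob X (Suc m)) W Q"
  shows "pad X m P Q \<in> complexes n C" "pad_in X m P Q \<in> chain_maps n C X (pad X m P Q)"
    "pad_pr X m P Q \<in> chain_maps n C (pad X m P Q) X"
    "\<And>j. j \<le> Suc n \<Longrightarrow> pad_pr X m P Q j \<cdot> pad_in X m P Q j = Idt C (ob X j)"
proof -
  note [simp] = complexesD[OF X] W
  have [simp]: "ob X m \<in> Obj C" "ob X (Suc m) \<in> Obj C" using m by auto
  note p [simp] = biproductD[OF P] biproductD[OF Q]
  show cp: "pad X m P Q \<in> complexes n C"
    unfolding complexes_iff using m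
    by (auto simp: pad_sel pad_in_def pad_pr_def)
  show "pad_in X m P Q \<in> chain_maps n C X (pad X m P Q)"
    by (subst chain_maps_iff) (use complexesD(1)[OF cp] m in \<open>auto simp: pad_sel pad_in_def pad_pr_def\<close>)
  show "pad_pr X m P Q \<in> chain_maps n C (pad X m P Q) X"
    by (subst chain_maps_iff) (use complexesD(1)[OF cp] m in \<open>auto simp: pad_sel pad_in_def pad_pr_def\<close>)
  show "pad_pr X m P Q j \<cdot> pad_in X m P Q j = Idt C (ob X j)" if "j \<le> Suc n" for j
    using that m by (auto simp: pad_in_def pad_pr_def)
qed

text \<open>The mapping cone \<open>M\<close> of \<open>f : Y \<rightarrow> X\<close> with respect to arbitrary biproducts: \<open>a i\<close>, \<open>b i\<close> are the
  projections of \<open>M i\<close> to \<open>Y (i + 1)\<close> and \<open>X i\<close>, and \<open>a' i\<close>, \<open>b' i\<close> are the inclusions. The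
  convention \<open>b 0 = 0\<close> gives the lowest differential the same shape as the others.\<close>

definition cone_data :: "nat \<Rightarrow> ('o, 'm) cpx \<Rightarrow> ('o, 'm) cpx \<Rightarrow> (nat \<Rightarrow> 'm) \<Rightarrow> ('o, 'm) cpx
    \<Rightarrow> (nat \<Rightarrow> 'm) \<Rightarrow> (nat \<Rightarrow> 'm) \<Rightarrow> (nat \<Rightarrow> 'm) \<Rightarrow> (nat \<Rightarrow> 'm) \<Rightarrow> bool" where
  "cone_data n Y X f M a a' b b' \<longleftrightarrow>
     ob M 0 = ob Y (Suc 0) \<and> ob M (Suc n) = ob X (Suc n) \<and>
     a 0 = Idt C (ob Y (Suc 0)) \<and> a' 0 = Idt C (ob Y (Suc 0)) \<and>
     b 0 = zr (ob Y (Suc 0)) (ob X 0) \<and> b' 0 = zr (ob X 0) (ob Y (Suc 0)) \<and>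
     b (Suc n) = Idt C (ob X (Suc n)) \<and> b' (Suc n) = Idt C (ob X (Suc n)) \<and>
     (\<forall>i\<le>n. ar (a i) \<and> dm (a i) = ob M i \<and> cd (a i) = ob Y (Suc i) \<and>
        ar (a' i) \<and> dm (a' i) = ob Y (Suc i) \<and> cd (a' i) = ob M i \<and>
        ar (b i) \<and> dm (b i) = ob M i \<and> cd (b i) = ob X i \<and>
        ar (b' i) \<and> dm (b' i) = ob X i \<and> cd (b' i) = ob M i \<and>
        a i \<cdot> a' i = Idt C (ob Y (Suc i)) \<and> a i \<cdot> b' i = zr (ob X i) (ob Y (Suc i)) \<and>
        b i \<cdot> a' i = zr (ob Y (Suc i)) (ob X i) \<and> a' i \<cdot> a i \<oplus> b' i \<cdot> b i = Idt C (ob M i)) \<and>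
     (\<forall>i<n. b (Suc i) \<cdot> b' (Suc i) = Idt C (ob X (Suc i)) \<and>
        df M i = a' (Suc i) \<cdot> (neg (df Y (Suc i)) \<cdot> a i) \<oplus>
          (b' (Suc i) \<cdot> (f (Suc i) \<cdot> a i) \<oplus> b' (Suc i) \<cdot> (df X i \<cdot> b i))) \<and>
     df M n = f (Suc n) \<cdot> a n \<oplus> df X n \<cdot> b n"

text \<open>Preserved by additive functors, unlike \<open>mapping_cone\<close>, whose biproducts are
  chosen separately in each category.\<close>

definition is_cone :: "nat \<Rightarrow> ('o, 'm) cpx \<Rightarrow> ('o, 'm) cpx \<Rightarrow> (nat \<Rightarrow> 'm) \<Rightarrow> ('o, 'm) cpx \<Rightarrow> bool" where
  "is_cone n Y X f M \<longleftrightarrow> (\<exists>a a' b b'. cone_data n Y X f M a a' b b')"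

lemma cone_dataD:
  assumes M: "cone_data n Y X f M a a' b b'" and Y: "Y \<in> complexes n C" and X: "X \<in> complexes n C"
  shows "ob M 0 = ob Y (Suc 0)" "ob M (Suc n) = ob X (Suc n)"
    "a 0 = Idt C (ob Y (Suc 0))" "a' 0 = Idt C (ob Y (Suc 0))"
    "b 0 = zr (ob Y (Suc 0)) (ob X 0)" "b' 0 = zr (ob X 0) (ob Y (Suc 0))"
    "b (Suc n) = Idt C (ob X (Suc n))" "b' (Suc n) = Idt C (ob X (Suc n))"
    "i \<le> n \<Longrightarrow> ar (a i)" "i \<le> n \<Longrightarrow> dm (a i) = ob M i" "i \<le> n \<Longrightarrow> cd (a i) = ob Y (Suc i)"
    "i \<le> n \<Longrightarrow> ar (a' i)" "i \<le> n \<Longrightarrow> dm (a' i) = ob Y (Suc i)" "i \<le> n \<Longrightarrow> cd (a' i) = ob M i"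
    "i \<le> n \<Longrightarrow> ar (b i)" "i \<le> n \<Longrightarrow> dm (b i) = ob M i" "i \<le> n \<Longrightarrow> cd (b i) = ob X i"
    "i \<le> n \<Longrightarrow> ar (b' i)" "i \<le> n \<Longrightarrow> dm (b' i) = ob X i" "i \<le> n \<Longrightarrow> cd (b' i) = ob M i"
    "i \<le> n \<Longrightarrow> ar u \<Longrightarrow> cd u = ob Y (Suc i) \<Longrightarrow> a i \<cdot> (a' i \<cdot> u) = u"
    "i \<le> n \<Longrightarrow> ar u \<Longrightarrow> cd u = ob X i \<Longrightarrow> a i \<cdot> (b' i \<cdot> u) = zr (dm u) (ob Y (Suc i))"
    "i \<le> n \<Longrightarrow> ar u \<Longrightarrow> cd u = ob Y (Suc i) \<Longrightarrow> b i \<cdot> (a' i \<cdot> u) = zr (dm u) (ob X i)"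
    "i < n \<Longrightarrow> ar u \<Longrightarrow> cd u = ob X (Suc i) \<Longrightarrow> b (Suc i) \<cdot> (b' (Suc i) \<cdot> u) = u"
    "i \<le> n \<Longrightarrow> ob M i \<in> Obj C"
proof -
  note [simp] = complexesD[OF X] complexesD[OF Y]
  note * = M[unfolded cone_data_def]
  show "ob M 0 = ob Y (Suc 0)" "ob M (Suc n) = ob X (Suc n)"
    "a 0 = Idt C (ob Y (Suc 0))" "a' 0 = Idt C (ob Y (Suc 0))"
    "b 0 = zr (ob Y (Suc 0)) (ob X 0)" "b' 0 = zr (ob X 0) (ob Y (Suc 0))"
    "b (Suc n) = Idt C (ob X (Suc n))" "b' (Suc n) = Idt C (ob X (Suc n))"
    using * by blast+
  show t: "i \<le> n \<Longrightarrow> ar (a i)" "i \<le> n \<Longrightarrow> dm (a i) = ob M i" "i \<le> n \<Longrightarrow> cd (a i) = ob Y (Suc i)"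
    "i \<le> n \<Longrightarrow> ar (a' i)" "i \<le> n \<Longrightarrow> dm (a' i) = ob Y (Suc i)" "i \<le> n \<Longrightarrow> cd (a' i) = ob M i"
    "i \<le> n \<Longrightarrow> ar (b i)" "i \<le> n \<Longrightarrow> dm (b i) = ob M i" "i \<le> n \<Longrightarrow> cd (b i) = ob X i"
    "i \<le> n \<Longrightarrow> ar (b' i)" "i \<le> n \<Longrightarrow> dm (b' i) = ob X i" "i \<le> n \<Longrightarrow> cd (b' i) = ob M i" for i
    using * by blast+
  show "i \<le> n \<Longrightarrow> ob M i \<in> Obj C" using ar_obj(1)[OF t(1)] t(2) by metis
  have e: "i \<le> n \<Longrightarrow> a i \<cdot> a' i = Idt C (ob Y (Suc i))" "i \<le> n \<Longrightarrow> a i \<cdot> b' i = zr (ob X i) (ob Y (Suc i))"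
    "i \<le> n \<Longrightarrow> b i \<cdot> a' i = zr (ob Y (Suc i)) (ob X i)" "i < n \<Longrightarrow> b (Suc i) \<cdot> b' (Suc i) = Idt C (ob X (Suc i))"
    using * by blast+
  show "i \<le> n \<Longrightarrow> ar u \<Longrightarrow> cd u = ob Y (Suc i) \<Longrightarrow> a i \<cdot> (a' i \<cdot> u) = u"
    by (subst cmp_extend[OF e(1)]) (auto simp: t)
  show "i \<le> n \<Longrightarrow> ar u \<Longrightarrow> cd u = ob X i \<Longrightarrow> a i \<cdot> (b' i \<cdot> u) = zr (dm u) (ob Y (Suc i))"
    by (subst cmp_extend[OF e(2)]) (auto simp: t)
  show "i \<le> n \<Longrightarrow> ar u \<Longrightarrow> cd u = ob Y (Suc i) \<Longrightarrow> b i \<cdot> (a' i \<cdot> u) = zr (dm u) (ob X i)"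
    by (subst cmp_extend[OF e(3)]) (auto simp: t)
  show "i < n \<Longrightarrow> ar u \<Longrightarrow> cd u = ob X (Suc i) \<Longrightarrow> b (Suc i) \<cdot> (b' (Suc i) \<cdot> u) = u"
    by (subst cmp_extend[OF e(4)]) (auto simp: t)
qed

lemma cone_data_df:
  assumes M: "cone_data n Y X f M a a' b b'"
  shows "i < n \<Longrightarrow> df M i = a' (Suc i) \<cdot> (neg (df Y (Suc i)) \<cdot> a i) \<oplus>
          (b' (Suc i) \<cdot> (f (Suc i) \<cdot> a i) \<oplus> b' (Suc i) \<cdot> (df X i \<cdot> b i))"
    "df M n = f (Suc n) \<cdot> a n \<oplus> df X n \<cdot> b n"
    "i \<le> n \<Longrightarrow> a' i \<cdot> a i \<oplus> b' i \<cdot> b i = Idt C (ob M i)"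
  using M[unfolded cone_data_def] by blast+

lemma cone_data_typed:
  assumes M: "cone_data n Y X f M a a' b b'" and Y: "Y \<in> complexes n C" and X: "X \<in> complexes n C"
    and f: "f \<in> chain_maps n C Y X"
  shows "i \<le> Suc n \<Longrightarrow> ob M i \<in> Obj C"
    "i \<le> n \<Longrightarrow> ar (df M i)" "i \<le> n \<Longrightarrow> dm (df M i) = ob M i" "i \<le> n \<Longrightarrow> cd (df M i) = ob M (Suc i)"
proof -
  note [simp] = complexesD[OF X] complexesD[OF Y] chain_mapsD[OF f Y X] cone_dataD[OF M Y X]
  note d = cone_data_df[OF M]
  show "i \<le> Suc n \<Longrightarrow> ob M i \<in> Obj C" by (cases "i = Suc n") auto
  show "i \<le> n \<Longrightarrow> ar (df M i)" "i \<le> n \<Longrightarrow> dm (df M i) = ob M i" "i \<le> n \<Longrightarrow> cd (df M i) = ob M (Suc i)"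
    using d by (cases "i = n"; auto)+
qed

text \<open>The rows of the differential as a matrix. Products of cone maps are computed from these
  rows and never from the full sum of inclusions and projections.\<close>

lemma cone_data_proj:
  assumes M: "cone_data n Y X f M a a' b b'" and Y: "Y \<in> complexes n C" and X: "X \<in> complexes n C"
    and f: "f \<in> chain_maps n C Y X"
  shows "i < n \<Longrightarrow> a (Suc i) \<cdot> df M i = neg (df Y (Suc i) \<cdot> a i)"
    "i \<le> n \<Longrightarrow> b (Suc i) \<cdot> df M i = f (Suc i) \<cdot> a i \<oplus> df X i \<cdot> b i"
    "i < n \<Longrightarrow> ar u \<Longrightarrow> cd u = ob M i \<Longrightarrow> a (Suc i) \<cdot> (df M i \<cdot> u) = neg (df Y (Suc i) \<cdot> (a i \<cdot> u))"
    "i \<le> n \<Longrightarrow> ar u \<Longrightarrow> cd u = ob M i \<Longrightarrow> b (Suc i) \<cdot> (df M i \<cdot> u) = f (Suc i) \<cdot> (a i \<cdot> u) \<oplus> df X i \<cdot> (b i \<cdot> u)"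
proof -
  note [simp] = complexesD[OF X] complexesD[OF Y] chain_mapsD[OF f Y X] cone_dataD[OF M Y X] cone_data_typed[OF M Y X f]
  note d = cone_data_df[OF M]
  show 1: "i < n \<Longrightarrow> a (Suc i) \<cdot> df M i = neg (df Y (Suc i) \<cdot> a i)"
    by (simp add: d(1))
  have bn: "ar (b (Suc n))" "dm (b (Suc n)) = ob M (Suc n)" by simp_all
  show 2: "i \<le> n \<Longrightarrow> b (Suc i) \<cdot> df M i = f (Suc i) \<cdot> a i \<oplus> df X i \<cdot> b i"
    by (cases "i = n") (simp_all add: d)
  show "i < n \<Longrightarrow> ar u \<Longrightarrow> cd u = ob M i \<Longrightarrow> a (Suc i) \<cdot> (df M i \<cdot> u) = neg (df Y (Suc i) \<cdot> (a i \<cdot> u))"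
    by (subst cmp_extend[OF 1]) simp_all
  have bi: "i \<le> n \<Longrightarrow> ar (b (Suc i)) \<and> dm (b (Suc i)) = ob M (Suc i)"
    by (cases "i = n") auto
  show "i \<le> n \<Longrightarrow> ar u \<Longrightarrow> cd u = ob M i \<Longrightarrow> b (Suc i) \<cdot> (df M i \<cdot> u) = f (Suc i) \<cdot> (a i \<cdot> u) \<oplus> df X i \<cdot> (b i \<cdot> u)"
    using bi by (subst cmp_extend[OF 2]) simp_all
qed

lemma cone_complex:
  assumes M: "cone_data n Y X f M a a' b b'" and Y: "Y \<in> complexes n C" and X: "X \<in> complexes n C"
    and f: "f \<in> chain_maps n C Y X" and n: "1 \<le> n"
  shows "M \<in> complexes n C"
proof -
  note [simp] = complexesD[OF X] complexesD[OF Y] chain_mapsD[OF f Y X] cone_dataD[OF M Y X] cone_data_typed[OF M Y X f]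
    cone_data_proj(1,2)[OF M Y X f]
  note d = cone_data_df[OF M]
  have "df M (Suc i) \<cdot> df M i = zr (ob M i) (ob M (Suc (Suc i)))" if i: "i < n" for i
  proof (cases "Suc i = n")
    case True
    have e: "df M (Suc i) = f (Suc (Suc i)) \<cdot> a (Suc i) \<oplus> df X (Suc i) \<cdot> b (Suc i)"
      "ob M (Suc (Suc i)) = ob X (Suc (Suc i))"
      unfolding True by (simp_all add: d(2))
    show ?thesis unfolding e using i by simp
  next
    case False
    then have d': "df M (Suc i) = a' (Suc (Suc i)) \<cdot> (neg (df Y (Suc (Suc i))) \<cdot> a (Suc i)) \<oplus>
          (b' (Suc (Suc i)) \<cdot> (f (Suc (Suc i)) \<cdot> a (Suc i)) \<oplus> b' (Suc (Suc i)) \<cdot> (df X (Suc i) \<cdot> b (Suc i)))"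
      using i d(1)[of "Suc i"] by simp
    show ?thesis unfolding d' using i False by simp
  qed
  then show ?thesis unfolding complexes_iff by auto
qed

text \<open>A square of chain maps that commutes up to a homotopy \<open>H\<close> induces the map
  of cones with diagonal entries \<open>u\<close>, \<open>v\<close> and off-diagonal entry
  \<open>H\<close>. The sign in the cone differential makes the two boundary terms of
  \<open>H\<close> match. In degree 0 the summand \<open>X1 0\<close> is missing from the target
  cone and \<open>b1' 0 = 0\<close> would discard \<open>H 0\<close>, whence the normalisation
  \<open>H 0 = 0\<close>.\<close>

lemma cone_map:
  assumes M: "cone_data n Y X f M a a' b b'" and Y: "Y \<in> complexes n C" and X: "X \<in> complexes n C"
    and f: "f \<in> chain_maps n C Y X" and n: "1 \<le> n"
    and M1: "cone_data n Y1 X1 f1 M1 a1 a1' b1 b1'" and Y1: "Y1 \<in> complexes n C" and X1: "X1 \<in> complexes n C"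
    and f1: "f1 \<in> chain_maps n C Y1 X1"
    and u: "u \<in> chain_maps n C Y Y1" and v: "v \<in> chain_maps n C X X1"
    and H: "\<forall>j\<le>n. ar (H j) \<and> dm (H j) = ob Y (Suc j) \<and> cd (H j) = ob X1 j"
    and H0: "H 0 = zr (ob Y (Suc 0)) (ob X1 0)"
    and Hj: "\<forall>j<n. v (Suc j) \<cdot> f (Suc j) =
      f1 (Suc j) \<cdot> u (Suc j) \<oplus> (df X1 j \<cdot> H j \<oplus> H (Suc j) \<cdot> df Y (Suc j))"
    and Hn: "v (Suc n) \<cdot> f (Suc n) = f1 (Suc n) \<cdot> u (Suc n) \<oplus> df X1 n \<cdot> H n"
    and w: "w = (\<lambda>i. if i \<le> n then a1' i \<cdot> (u (Suc i) \<cdot> a i) \<oplus> (b1' i \<cdot> (v i \<cdot> b i) \<oplus> b1' i \<cdot> (H i \<cdot> a i)) else v i)"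
  shows "w \<in> chain_maps n C M M1" "w 0 = u (Suc 0)" "w (Suc n) = v (Suc n)"
    "i \<le> n \<Longrightarrow> a1 i \<cdot> w i = u (Suc i) \<cdot> a i" "i \<le> n \<Longrightarrow> b1 i \<cdot> w i = v i \<cdot> b i \<oplus> H i \<cdot> a i"
proof -
  have H' [simp]: "\<And>j. j \<le> n \<Longrightarrow> ar (H j)" "\<And>j. j \<le> n \<Longrightarrow> dm (H j) = ob Y (Suc j)" "\<And>j. j \<le> n \<Longrightarrow> cd (H j) = ob X1 j"
    using H by auto
  note [simp] = complexesD[OF X] complexesD[OF Y] chain_mapsD[OF f Y X] cone_dataD[OF M Y X]
    complexesD[OF X1] complexesD[OF Y1] chain_mapsD[OF f1 Y1 X1] cone_dataD[OF M1 Y1 X1]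
    chain_mapsD[OF u Y Y1] chain_mapsD[OF v X X1] cone_data_typed[OF M Y X f] cone_data_typed[OF M1 Y1 X1 f1]
  note d = cone_data_df[OF M] and d1 = cone_data_df[OF M1]
  show w0: "w 0 = u (Suc 0)" by (simp add: w)
  show wn: "w (Suc n) = v (Suc n)" by (simp add: w)
  have t: "ar (w i) \<and> dm (w i) = ob M i \<and> cd (w i) = ob M1 i" if "i \<le> Suc n" for i
    using that by (cases "i = Suc n") (auto simp: w)
  have aw: "a1 i \<cdot> w i = u (Suc i) \<cdot> a i" if "i \<le> n" for i using that by (simp add: w)
  have bw: "b1 i \<cdot> w i = v i \<cdot> b i \<oplus> H i \<cdot> a i" if "i \<le> n" for i
    using that by (cases i) (simp_all add: w H0)
  show "i \<le> n \<Longrightarrow> a1 i \<cdot> w i = u (Suc i) \<cdot> a i" "i \<le> n \<Longrightarrow> b1 i \<cdot> w i = v i \<cdot> b i \<oplus> H i \<cdot> a i"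
    by (fact aw, fact bw)
  have "w (Suc i) \<cdot> df M i = df M1 i \<cdot> w i" if i: "i \<le> n" for i
  proof (cases "i = n")
    case True
    have b: "b (Suc n) \<cdot> df M n = f (Suc n) \<cdot> a n \<oplus> df X n \<cdot> b n" by (rule cone_data_proj(2)[OF M Y X f]) simp
    have "df M1 n \<cdot> w n = f1 (Suc n) \<cdot> (a1 n \<cdot> w n) \<oplus> df X1 n \<cdot> (b1 n \<cdot> w n)"
      unfolding d1(2) using t[of n] by simp
    also have "\<dots> = (f1 (Suc n) \<cdot> u (Suc n) \<oplus> df X1 n \<cdot> H n) \<cdot> a n \<oplus> v (Suc n) \<cdot> (df X n \<cdot> b n)"
      unfolding aw[OF order_refl] bw[OF order_refl] by (simp add: padd_ac)
    also have "\<dots> = v (Suc n) \<cdot> df M n" unfolding Hn[symmetric] d(2) by simp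
    finally show ?thesis using True wn by simp
  next
    case False
    then have i: "i < n" using i by simp
    note pr = cone_data_proj(1,2)[OF M Y X f]
    have "df M1 i \<cdot> w i = a1' (Suc i) \<cdot> (neg (df Y1 (Suc i)) \<cdot> (a1 i \<cdot> w i)) \<oplus>
      (b1' (Suc i) \<cdot> (f1 (Suc i) \<cdot> (a1 i \<cdot> w i)) \<oplus> b1' (Suc i) \<cdot> (df X1 i \<cdot> (b1 i \<cdot> w i)))"
      unfolding d1(1)[OF i] using t[of i] i by simp
    also have "\<dots> = neg (a1' (Suc i) \<cdot> (df Y1 (Suc i) \<cdot> (u (Suc i) \<cdot> a i))) \<oplus>
      (b1' (Suc i) \<cdot> (f1 (Suc i) \<cdot> (u (Suc i) \<cdot> a i)) \<oplus>
       (b1' (Suc i) \<cdot> (df X1 i \<cdot> (v i \<cdot> b i)) \<oplus> b1' (Suc i) \<cdot> (df X1 i \<cdot> (H i \<cdot> a i))))"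
      using i by (simp add: aw bw)
    finally have R: "df M1 i \<cdot> w i = neg (a1' (Suc i) \<cdot> (df Y1 (Suc i) \<cdot> (u (Suc i) \<cdot> a i))) \<oplus>
      (b1' (Suc i) \<cdot> (f1 (Suc i) \<cdot> (u (Suc i) \<cdot> a i)) \<oplus>
       (b1' (Suc i) \<cdot> (df X1 i \<cdot> (v i \<cdot> b i)) \<oplus> b1' (Suc i) \<cdot> (df X1 i \<cdot> (H i \<cdot> a i))))" .
    have "w (Suc i) \<cdot> df M i = a1' (Suc i) \<cdot> (u (Suc (Suc i)) \<cdot> (a (Suc i) \<cdot> df M i)) \<oplus>
      (b1' (Suc i) \<cdot> (v (Suc i) \<cdot> (b (Suc i) \<cdot> df M i)) \<oplus> b1' (Suc i) \<cdot> (H (Suc i) \<cdot> (a (Suc i) \<cdot> df M i)))"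
      using i by (simp add: w)
    also have "\<dots> = neg (a1' (Suc i) \<cdot> (df Y1 (Suc i) \<cdot> (u (Suc i) \<cdot> a i))) \<oplus>
      (b1' (Suc i) \<cdot> ((v (Suc i) \<cdot> f (Suc i)) \<cdot> a i \<oplus> df X1 i \<cdot> (v i \<cdot> b i)) \<oplus>
       neg (b1' (Suc i) \<cdot> (H (Suc i) \<cdot> (df Y (Suc i) \<cdot> a i))))"
      using i by (simp add: pr)
    also have "b1' (Suc i) \<cdot> ((v (Suc i) \<cdot> f (Suc i)) \<cdot> a i \<oplus> df X1 i \<cdot> (v i \<cdot> b i)) =
      b1' (Suc i) \<cdot> (f1 (Suc i) \<cdot> (u (Suc i) \<cdot> a i)) \<oplus> (b1' (Suc i) \<cdot> (df X1 i \<cdot> (H i \<cdot> a i)) \<oplus>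
      (b1' (Suc i) \<cdot> (H (Suc i) \<cdot> (df Y (Suc i) \<cdot> a i)) \<oplus> b1' (Suc i) \<cdot> (df X1 i \<cdot> (v i \<cdot> b i))))"
      unfolding Hj[rule_format, OF i] using i by (simp add: padd_assoc)
    finally show ?thesis unfolding R using i by (simp add: padd_norm)
  qed
  then show "w \<in> chain_maps n C M M1" by (subst chain_maps_iff) (use t in auto)
qed

end

context additive_category
begin

lemma bip_of_biproduct: "A \<in> Obj C \<Longrightarrow> B \<in> Obj C \<Longrightarrow> is_biproduct C A B (bip_of C A B)"
  unfolding bip_of_def by (rule someI_ex) (rule ex_biproduct)

lemma mapping_cone_is_cone:
  assumes Y: "Y \<in> complexes n C" and X: "X \<in> complexes n C" and f: "f \<in> chain_maps n C Y X" and n: "1 \<le> n"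
  shows "is_cone n Y X f (mapping_cone n C Y X f)"
proof -
  note [simp] = complexesD[OF X] complexesD[OF Y] chain_mapsD[OF f Y X]
  define B where "B i = bip_of C (ob Y (Suc i)) (ob X i)" for i
  have B: "is_biproduct C (ob Y (Suc i)) (ob X i) (B i)" if "i \<le> n" for i
    unfolding B_def using that by (intro bip_of_biproduct) auto
  have b [simp]: "bob (B i) \<in> Obj C"
    "ar (inl (B i))" "dm (inl (B i)) = ob Y (Suc i)" "cd (inl (B i)) = bob (B i)"
    "ar (inr (B i))" "dm (inr (B i)) = ob X i" "cd (inr (B i)) = bob (B i)"
    "ar (prl (B i))" "dm (prl (B i)) = bob (B i)" "cd (prl (B i)) = ob Y (Suc i)"
    "ar (prr (B i))" "dm (prr (B i)) = bob (B i)" "cd (prr (B i)) = ob X i"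
    "prl (B i) \<cdot> inl (B i) = Idt C (ob Y (Suc i))" "prr (B i) \<cdot> inr (B i) = Idt C (ob X i)"
    "prl (B i) \<cdot> inr (B i) = zr (ob X i) (ob Y (Suc i))" "prr (B i) \<cdot> inl (B i) = zr (ob Y (Suc i)) (ob X i)"
    "inl (B i) \<cdot> prl (B i) \<oplus> inr (B i) \<cdot> prr (B i) = Idt C (bob (B i))"
    if "i \<le> n" for i
    by (rule biproductD[OF B[OF that]]; use that in simp)+
  define a where "a i = (if i = 0 then Idt C (ob Y (Suc 0)) else prl (B i))" for i
  define a' where "a' i = (if i = 0 then Idt C (ob Y (Suc 0)) else inl (B i))" for i
  define b where "b i = (if i = 0 then zr (ob Y (Suc 0)) (ob X 0) else if i \<le> n then prr (B i) else Idt C (ob X i))" for i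
  define b' where "b' i = (if i = 0 then zr (ob X 0) (ob Y (Suc 0)) else if i \<le> n then inr (B i) else Idt C (ob X i))" for i
  let ?M = "mapping_cone n C Y X f"
  have ob: "ob ?M i = (if i = 0 then ob Y (Suc 0) else if i \<le> n then bob (B i) else ob X (Suc n))" for i
    by (simp add: mapping_cone_def B_def)
  have df: "df ?M i = a' (Suc i) \<cdot> (neg (df Y (Suc i)) \<cdot> a i) \<oplus>
          (b' (Suc i) \<cdot> (f (Suc i) \<cdot> a i) \<oplus> b' (Suc i) \<cdot> (df X i \<cdot> b i))" if "i < n" for i
  proof (cases i)
    case 0
    have "df ?M 0 = inl (B (Suc 0)) \<cdot> neg (df Y (Suc 0)) \<oplus> inr (B (Suc 0)) \<cdot> f (Suc 0)"
      using that 0 unfolding mapping_cone_def Let_def col_def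
      by (simp add: B_def[of "Suc 0", simplified, symmetric] numeral_2_eq_2)
    then show ?thesis using that 0 by (simp add: a_def a'_def b_def b'_def)
  next
    case (Suc j)
    have "df ?M i = inl (B (Suc i)) \<cdot> (neg (df Y (Suc i)) \<cdot> prl (B i) \<oplus> zr (ob X i) (ob Y (Suc (Suc i))) \<cdot> prr (B i)) \<oplus>
      inr (B (Suc i)) \<cdot> (f (Suc i) \<cdot> prl (B i) \<oplus> df X i \<cdot> prr (B i))"
      using that Suc unfolding mapping_cone_def Let_def col_def row_def
      by (simp add: B_def[of "Suc i", simplified, symmetric] B_def[of i, simplified, symmetric]
        B_def[of "Suc (Suc j)", symmetric] B_def[of "Suc j", symmetric])
    then show ?thesis using that Suc by (simp add: a_def a'_def b_def b'_def padd_ac)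
  qed
  have dfn: "df ?M n = f (Suc n) \<cdot> a n \<oplus> df X n \<cdot> b n"
    using n unfolding mapping_cone_def Let_def row_def
    by (simp add: B_def[of n, simplified, symmetric] a_def b_def)
  have "cone_data n Y X f ?M a a' b b'"
    unfolding cone_data_def
  proof (intro conjI allI impI)
    fix i assume "i < n"
    then show "df ?M i = a' (Suc i) \<cdot> (neg (df Y (Suc i)) \<cdot> a i) \<oplus>
          (b' (Suc i) \<cdot> (f (Suc i) \<cdot> a i) \<oplus> b' (Suc i) \<cdot> (df X i \<cdot> b i))" by (rule df)
  next
    show "df ?M n = f (Suc n) \<cdot> a n \<oplus> df X n \<cdot> b n" by (rule dfn)
  qed (use n in \<open>auto simp: ob a_def a'_def b_def b'_def\<close>)
  then show ?thesis unfolding is_cone_def by blast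
qed

end

context realisation
begin

text \<open>The identity of \<open>W\<close>, read as \<open>inr P \<cdot> prr Q\<close> from degree
  \<open>m + 1\<close> to degree \<open>m\<close>, contracts the new summand, so the padded complex
  is a homotopy retract of \<open>X\<close>. The bounds on \<open>m\<close> keep the end terms
  unchanged.\<close>

lemma realises_pad:
  assumes R: "realises n C s K A \<delta> X" and d: "\<delta> \<in> carrier (Ext E K A)"
    and m: "m < n" "1 \<le> m" and W: "W \<in> Obj C"
    and P: "is_biproduct C (ob X m) W P" and Q: "is_biproduct C (ob X (Suc m)) W Q"
  shows "realises n C s K A \<delta> (pad X m P Q)"
proof -
  note X = realisesD(1)[OF R]
  note e [simp] = realisesD(2-)[OF R]
  note pp = pad_props[OF X m W P Q]
  note [simp] = complexesD[OF X] complexesD[OF pp(1)] W d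
  have [simp]: "ob X m \<in> Obj C" "ob X (Suc m) \<in> Obj C" using m by auto
  note p [simp] = biproductD[OF P] biproductD[OF Q]
  have e0: "ob (pad X m P Q) 0 = A" "ob (pad X m P Q) (Suc n) = K"
    "pad_in X m P Q 0 = Idt C A" "pad_pr X m P Q 0 = Idt C A"
    "pad_in X m P Q (Suc n) = Idt C K" "pad_pr X m P Q (Suc n) = Idt C K"
    using m by (auto simp: pad_sel pad_in_def pad_pr_def)
  let ?h = "\<lambda>j. if j = m then inr P \<cdot> prr Q else zr (ob (pad X m P Q) (Suc j)) (ob (pad X m P Q) j)"
  have ex: "exangle n C E (pad X m P Q) \<delta>"
  proof (rule exangle_retract[OF realises_exangle[OF d R] pp(1) _ pp(3) pp(2), of \<delta> ?h])
    fix j assume j: "j < n"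
    consider "Suc j = m" | "j = m" | "Suc j \<noteq> m" "j \<noteq> m" by blast
    then show "Idt C (ob (pad X m P Q) (Suc j)) = pad_in X m P Q (Suc j) \<cdot> pad_pr X m P Q (Suc j) \<oplus>
      (?h (Suc j) \<cdot> df (pad X m P Q) (Suc j) \<oplus> df (pad X m P Q) j \<cdot> ?h j)"
      using j m by cases (auto simp: pad_in_def pad_pr_def pad_sel)
  qed (use m e0 in \<open>auto simp: pad_sel\<close>)
  show ?thesis
    by (rule realises_retractI[OF R d ex e0(1,2) pp(3,2)]) (use e0 in auto)
qed

end

section \<open>Strict retracts and composition of inflations\<close>

context preadditive_category
begin

text \<open>When the idempotents \<open>i p\<close> commute with the differential, the compressed
  differentials \<open>p d i\<close> form a complex, and \<open>i\<close> and \<open>p\<close>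
  become chain maps.\<close>

lemma retract_complex:
  assumes V: "V \<in> complexes n C"
    and i: "\<And>j. j \<le> Suc n \<Longrightarrow> ar (i j)" "\<And>j. j \<le> Suc n \<Longrightarrow> dm (i j) = Q j" "\<And>j. j \<le> Suc n \<Longrightarrow> cd (i j) = ob V j"
    and p: "\<And>j. j \<le> Suc n \<Longrightarrow> ar (p j)" "\<And>j. j \<le> Suc n \<Longrightarrow> dm (p j) = ob V j" "\<And>j. j \<le> Suc n \<Longrightarrow> cd (p j) = Q j"
    and pi: "\<And>j. j \<le> Suc n \<Longrightarrow> p j \<cdot> i j = Idt C (Q j)"
    and e: "\<And>j. j \<le> n \<Longrightarrow> i (Suc j) \<cdot> (p (Suc j) \<cdot> df V j) = df V j \<cdot> (i j \<cdot> p j)"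
  defines "Y \<equiv> \<lparr>ob = Q, df = \<lambda>j. p (Suc j) \<cdot> (df V j \<cdot> i j)\<rparr>"
  shows "Y \<in> complexes n C" "i \<in> chain_maps n C Y V" "p \<in> chain_maps n C V Y"
proof -
  note [simp] = complexesD[OF V] i p
  have Q [simp]: "Q j \<in> Obj C" if "j \<le> Suc n" for j using ar_obj(1)[of "i j"] that by simp
  have pi': "p j \<cdot> (i j \<cdot> u) = u" if "j \<le> Suc n" "ar u" "cd u = Q j" for j u
    using cmp_extend[OF pi, of j u] that by simp
  have 1: "i (Suc j) \<cdot> (p (Suc j) \<cdot> (df V j \<cdot> i j)) = df V j \<cdot> i j" if "j \<le> n" for j
  proof -
    have "i (Suc j) \<cdot> (p (Suc j) \<cdot> (df V j \<cdot> i j)) = (i (Suc j) \<cdot> (p (Suc j) \<cdot> df V j)) \<cdot> i j"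
      using that by simp
    then show ?thesis unfolding e[OF that] using that pi by simp
  qed
  have 2: "p (Suc j) \<cdot> (df V j \<cdot> (i j \<cdot> p j)) = p (Suc j) \<cdot> df V j" if "j \<le> n" for j
    unfolding e[OF that, symmetric] using that by (subst pi') auto
  have "p (Suc (Suc j)) \<cdot> (df V (Suc j) \<cdot> (i (Suc j) \<cdot> (p (Suc j) \<cdot> (df V j \<cdot> i j)))) = zr (Q j) (Q (Suc (Suc j)))"
    if "j < n" for j
    using that 1[of j] by simp
  then show Y: "Y \<in> complexes n C" unfolding complexes_iff by (auto simp: Y_def)
  show "i \<in> chain_maps n C Y V" by (subst chain_maps_iff) (auto simp: Y_def 1)
  show "p \<in> chain_maps n C V Y" by (subst chain_maps_iff) (auto simp: Y_def 2)
qed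

end

context biadditive_functor
begin

text \<open>The homotopy that enters a map of mapping cones has to vanish in degree \<open>0\<close>.\<close>

lemma normalise_homotopy:
  assumes Y: "exangle n C E Y \<delta>" and X: "X \<in> complexes n C" and n: "1 \<le> n"
    and e: "e \<in> chain_maps n C X X" and g: "g \<in> chain_maps n C Y Y"
    and ee: "e 0 \<cdot> e 0 = e 0" and gg: "g (Suc (Suc 0)) \<cdot> g (Suc (Suc 0)) = g (Suc (Suc 0))"
    and T: "\<And>j. j \<le> n \<Longrightarrow> ar (T j)" "\<And>j. j \<le> n \<Longrightarrow> dm (T j) = ob Y (Suc j)" "\<And>j. j \<le> n \<Longrightarrow> cd (T j) = ob X j"
    and eTg: "\<And>j. j \<le> n \<Longrightarrow> e j \<cdot> (T j \<cdot> g (Suc j)) = T j"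
    and T0: "T 0 \<cdot> df Y 0 = zr (ob Y 0) (ob X 0)"
  obtains T' where "\<And>j. j \<le> n \<Longrightarrow> ar (T' j)" "\<And>j. j \<le> n \<Longrightarrow> dm (T' j) = ob Y (Suc j)" "\<And>j. j \<le> n \<Longrightarrow> cd (T' j) = ob X j"
    "T' 0 = zr (ob Y (Suc 0)) (ob X 0)"
    "\<And>j. j < n \<Longrightarrow> df X j \<cdot> T' j \<oplus> T' (Suc j) \<cdot> df Y (Suc j) = df X j \<cdot> T j \<oplus> T (Suc j) \<cdot> df Y (Suc j)"
    "df X n \<cdot> T' n = df X n \<cdot> T n"
    "\<And>j. j \<le> n \<Longrightarrow> e j \<cdot> (T' j \<cdot> g (Suc j)) = T' j"
proof -
  have Y': "Y \<in> complexes n C" using exangleD(1)[OF Y] .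
  note [simp] = complexesD[OF X] complexesD[OF Y'] chain_mapsD[OF e X X] chain_mapsD[OF g Y' Y'] T
  have [simp]: "ob Y (Suc (Suc 0)) \<in> Obj C" "ar (g (Suc (Suc 0)))" "dm (g (Suc (Suc 0))) = ob Y (Suc (Suc 0))"
    "cd (g (Suc (Suc 0))) = ob Y (Suc (Suc 0))" "ob Y (Suc 0) \<in> Obj C" "ob X (Suc 0) \<in> Obj C"
    "ar (df Y (Suc 0))" "dm (df Y (Suc 0)) = ob Y (Suc 0)" "cd (df Y (Suc 0)) = ob Y (Suc (Suc 0))"
    using n by auto
  obtain t where t: "ar t" "dm t = ob Y (Suc (Suc 0))" "cd t = ob X 0" "T 0 = t \<cdot> df Y (Suc 0)"
    by (rule exangle_con[OF Y, of 0 "T 0" "ob X 0"]) (use n T0 in auto)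
  note [simp] = t(1-3)
  \<comment> \<open>Compressing \<open>t\<close> by \<open>e\<close> and \<open>g\<close> keeps the
    relation \<open>e T g = T\<close> intact for the modified homotopy. It still factors
    \<open>T 0\<close>, as \<open>e\<close> and \<open>g\<close> commute with the
    differentials.\<close>
  define t' where "t' = e 0 \<cdot> (t \<cdot> g (Suc (Suc 0)))"
  have t' [simp]: "ar t'" "dm t' = ob Y (Suc (Suc 0))" "cd t' = ob X 0" by (auto simp: t'_def)
  have td: "t' \<cdot> df Y (Suc 0) = T 0"
  proof -
    have "g (Suc (Suc 0)) \<cdot> df Y (Suc 0) = df Y (Suc 0) \<cdot> g (Suc 0)" using n by simp
    then have "t' \<cdot> df Y (Suc 0) = e 0 \<cdot> ((t \<cdot> df Y (Suc 0)) \<cdot> g (Suc 0))"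
      unfolding t'_def by simp
    then show ?thesis unfolding t(4)[symmetric] using eTg[of 0] by simp
  qed
  have et: "e 0 \<cdot> (t' \<cdot> g (Suc (Suc 0))) = t'"
  proof -
    have "e 0 \<cdot> (t' \<cdot> g (Suc (Suc 0))) = (e 0 \<cdot> e 0) \<cdot> (t \<cdot> (g (Suc (Suc 0)) \<cdot> g (Suc (Suc 0))))"
      unfolding t'_def by simp
    then show ?thesis unfolding ee gg t'_def .
  qed
  \<comment> \<open>The homotopy is changed by a boundary of second order built from
    \<open>t'\<close>: \<open>T 0 = t' d\<close> is subtracted in degree 0 and \<open>d t'\<close>
    is added in degree 1, so that \<open>d T + T d\<close> stays the same.\<close>
  define T' where "T' = (\<lambda>j. if j = 0 then zr (ob Y (Suc 0)) (ob X 0)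
    else if j = 1 then T 1 \<oplus> df X 0 \<cdot> t' else T j)"
  show ?thesis
  proof
    show "ar (T' j)" "dm (T' j) = ob Y (Suc j)" "cd (T' j) = ob X j" if "j \<le> n" for j
      using that by (auto simp: T'_def)
    show "T' 0 = zr (ob Y (Suc 0)) (ob X 0)" by (simp add: T'_def)
    show "df X j \<cdot> T' j \<oplus> T' (Suc j) \<cdot> df Y (Suc j) = df X j \<cdot> T j \<oplus> T (Suc j) \<cdot> df Y (Suc j)" if "j < n" for j
    proof -
      consider "j = 0" | "j = 1" | "j \<noteq> 0" "j \<noteq> 1" by blast
      then show ?thesis using that by cases (simp_all add: T'_def td padd_ac)
    qed
    show "df X n \<cdot> T' n = df X n \<cdot> T n" using n by (auto simp: T'_def)
    show "e j \<cdot> (T' j \<cdot> g (Suc j)) = T' j" if "j \<le> n" for j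
    proof -
      consider "j = 0" | "j = 1" | "j \<noteq> 0" "j \<noteq> 1" by blast
      then show ?thesis
      proof cases
        case 1
        then show ?thesis by (simp add: T'_def)
      next
        case 2
        have "e (Suc 0) \<cdot> ((T (Suc 0) \<oplus> df X 0 \<cdot> t') \<cdot> g (Suc (Suc 0))) =
          e (Suc 0) \<cdot> (T (Suc 0) \<cdot> g (Suc (Suc 0))) \<oplus> df X 0 \<cdot> (e 0 \<cdot> (t' \<cdot> g (Suc (Suc 0))))"
          using n by simp
        then show ?thesis using 2 n eTg[of "Suc 0"] by (simp add: T'_def et)
      next
        case 3
        then show ?thesis using that eTg[of j] by (simp add: T'_def)
      qed
    qed
  qed
qed

end

text \<open>The situation of a category in its idempotent completion: the objects \<open>S\<close> of the smaller category are
  dense, and \<open>R K A \<delta> X\<close> says that \<open>X\<close> realises \<open>\<delta>\<close> already there.\<close>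

locale dense_realisation = realisation n C E s
  for n :: nat and C :: "('o, 'm) cat" (structure) and E :: "('o, 'm, 'x) ext"
    and s :: "('o, 'm, 'x) realisation" +
  fixes S :: "'o set" and R :: "'o \<Rightarrow> 'o \<Rightarrow> 'x \<Rightarrow> ('o, 'm) cpx \<Rightarrow> bool"
  assumes idem: "idempotent_complete C"
    and dense: "A \<in> Obj C \<Longrightarrow> \<exists>B\<in>S. \<exists>i p. ar i \<and> dm i = A \<and> cd i = B \<and> ar p \<and> dm p = B \<and> cd p = A \<and> p \<cdot> i = Idt C A"
    and R_realises: "R K A \<delta> X \<Longrightarrow> realises n C s K A \<delta> X"
    and R_ext: "R K A \<delta> X \<Longrightarrow> \<delta> \<in> carrier (Ext E K A)"
    and R_S: "R K A \<delta> X \<Longrightarrow> i \<le> Suc n \<Longrightarrow> ob X i \<in> S"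
    and R_ex: "K \<in> S \<Longrightarrow> A \<in> S \<Longrightarrow> \<delta> \<in> carrier (Ext E K A) \<Longrightarrow> \<exists>X. R K A \<delta> X"
    and R_pad: "R K A \<delta> X \<Longrightarrow> W \<in> S \<Longrightarrow> 1 \<le> m \<Longrightarrow> m < n \<Longrightarrow>
      \<exists>P Q. is_biproduct C (ob X m) W P \<and> is_biproduct C (ob X (Suc m)) W Q \<and> R K A \<delta> (pad X m P Q)"
    and R_inflation: "R K A \<delta> X \<Longrightarrow> R L (ob X 1) \<epsilon> Z \<Longrightarrow>
      \<exists>M \<mu> V. R M A \<mu> V \<and> ob V 1 = ob Z 1 \<and> df V 0 = df Z 0 \<cdot> df X 0"
    and R_cone: "R D A \<delta> X \<Longrightarrow> K \<in> S \<Longrightarrow> ar c \<Longrightarrow> dm c = K \<Longrightarrow> cd c = D \<Longrightarrow> R K A (Act E c (Idt C A) \<delta>) Y \<Longrightarrow>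
      \<exists>f M. f \<in> lifts n C Y X (Idt C A) c \<and> is_cone n Y X f M \<and> R D (ob Y 1) (Act E (Idt C D) (df Y 0) \<delta>) M"
    and S_obj: "A \<in> S \<Longrightarrow> A \<in> Obj C"
begin

text \<open>If \<open>p i = 1\<close> below degree \<open>m\<close>, then \<open>1 - p i\<close> in degree \<open>m\<close> factors through the differential of \<open>Y\<close>,
  and adding \<open>W = W\<close> to \<open>X\<close>, with \<open>Y\<^sub>m\<^sub>+\<^sub>1\<close> a summand of \<open>W\<close>, makes room for the correction.\<close>

lemma strict_step:
  assumes X: "R L B \<epsilon> X" and eY: "exangle n C E Y \<delta>"
    and i: "i \<in> chain_maps n C Y X" and p: "p \<in> chain_maps n C X Y"
    and m: "m = Suc m'" "m < n" and pi: "\<And>j. j < m \<Longrightarrow> p j \<cdot> i j = Idt C (ob Y j)"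
  shows "\<exists>X' i' p'. R L B \<epsilon> X' \<and> i' \<in> chain_maps n C Y X' \<and> p' \<in> chain_maps n C X' Y \<and>
    i' 0 = i 0 \<and> p' 0 = p 0 \<and> i' (Suc n) = i (Suc n) \<and> p' (Suc n) = p (Suc n) \<and>
    (\<forall>j<Suc m. p' j \<cdot> i' j = Idt C (ob Y j))"
proof -
  have Y: "Y \<in> complexes n C" using exangleD(1)[OF eY] .
  have Xc: "X \<in> complexes n C" using realisesD(1)[OF R_realises[OF X]] .
  note [simp] = complexesD[OF Xc] complexesD[OF Y] chain_mapsD[OF i Y Xc] chain_mapsD[OF p Xc Y]
  have m' [simp]: "m' < n" "m' \<le> n" "m' \<le> Suc n" "Suc m' \<le> n" using m by auto
  have "ob Y (Suc m) \<in> Obj C" using m by simp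
  then obtain W \<iota> \<rho> where W: "W \<in> S" and w [simp]: "ar \<iota>" "dm \<iota> = ob Y (Suc m)" "cd \<iota> = W"
    "ar \<rho>" "dm \<rho> = W" "cd \<rho> = ob Y (Suc m)" "\<rho> \<cdot> \<iota> = Idt C (ob Y (Suc m))"
    using dense by blast
  have W' [simp]: "W \<in> Obj C" using S_obj[OF W] .
  obtain P Q where P: "is_biproduct C (ob X m) W P" and Q: "is_biproduct C (ob X (Suc m)) W Q"
    and X': "R L B \<epsilon> (pad X m P Q)"
    using R_pad[OF X W, of m] m by auto
  have Xc': "pad X m P Q \<in> complexes n C" using realisesD(1)[OF R_realises[OF X']] .
  have ty [simp]: "ob X m \<in> Obj C" "ob X (Suc m) \<in> Obj C" "ob Y m \<in> Obj C" "ob Y (Suc m) \<in> Obj C" using m by auto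
  note bp [simp] = biproductD[OF P] biproductD[OF Q]
  \<comment> \<open>The defect in degree \<open>m\<close>. It vanishes on the incoming differential
    because \<open>p i = 1\<close> already holds in degree \<open>m'\<close>.\<close>
  define h where "h = Idt C (ob Y m) \<oplus> neg (p m \<cdot> i m)"
  have tym [simp]: "ar (p m)" "ar (i m)" "dm (p m) = ob X m" "cd (p m) = ob Y m" "dm (i m) = ob Y m" "cd (i m) = ob X m"
    using m(2) by auto
  have h [simp]: "ar h" "dm h = ob Y m" "cd h = ob Y m" by (auto simp: h_def)
  have "h \<cdot> df Y m' = df Y m' \<oplus> neg (p m \<cdot> (i m \<cdot> df Y m'))" unfolding h_def using m by simp
  also have "p m \<cdot> (i m \<cdot> df Y m') = df Y m' \<cdot> (p m' \<cdot> i m')" unfolding m(1) using m' by simp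
  also have "\<dots> = df Y m'" using pi[of m'] m by simp
  finally have "h \<cdot> df Y m' = zr (ob Y m') (ob Y m)" using m by simp
  then obtain k where k: "ar k" "dm k = ob Y (Suc m)" "cd k = ob Y m" "h = k \<cdot> df Y m"
    using exangle_con[OF eY m'(1), of h "ob Y m"] m by auto
  note [simp] = k(1-3)
  \<comment> \<open>With \<open>h = k d\<close>, the missing part is sent through \<open>W\<close>:
    \<open>i'\<close> stores the differential in the new coordinate by \<open>\<iota>\<close>, and
    \<open>p'\<close> reads it out by \<open>\<rho>\<close> and applies \<open>k\<close>. The
    further entries in degree \<open>m + 1\<close> are forced by compatibility with the
    differentials, where \<open>W\<close> is connected to \<open>W\<close> by the identity.\<close>
  define i' where "i' j = (if j = m then inl P \<cdot> i m \<oplus> inr P \<cdot> (\<iota> \<cdot> df Y m)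
    else if j = Suc m then inl Q \<cdot> i (Suc m) \<oplus> inr Q \<cdot> \<iota> else i j)" for j
  define p' where "p' j = (if j = m then p m \<cdot> prl P \<oplus> k \<cdot> (\<rho> \<cdot> prr P)
    else if j = Suc m then p (Suc m) \<cdot> prl Q \<oplus> df Y m \<cdot> (k \<cdot> (\<rho> \<cdot> prr Q)) else p j)" for j
  have consider_j: "j = m' \<or> j = m \<or> j = Suc m \<or> (j \<noteq> m \<and> j \<noteq> Suc m \<and> Suc j \<noteq> m)" for j
    using m by auto
  have "\<rho> \<cdot> (\<iota> \<cdot> u) = u" if "ar u" "cd u = ob Y (Suc m)" for u
    using cmp_extend[OF w(7), of u] that by simp
  note [simp] = this
  have pd: "ob (pad X m P Q) m = bob P" "ob (pad X m P Q) (Suc m) = bob Q"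
    "\<And>j. j \<noteq> m \<Longrightarrow> j \<noteq> Suc m \<Longrightarrow> ob (pad X m P Q) j = ob X j"
    "df (pad X m P Q) m = inl Q \<cdot> (df X m \<cdot> prl P) \<oplus> inr Q \<cdot> prr P"
    "df (pad X m P Q) m' = inl P \<cdot> df X m'"
    "df (pad X m P Q) (Suc m) = df X (Suc m) \<cdot> prl Q"
    "\<And>j. j \<le> n \<Longrightarrow> j \<noteq> m \<Longrightarrow> j \<noteq> Suc m \<Longrightarrow> Suc j \<noteq> m \<Longrightarrow> df (pad X m P Q) j = df X j"
    using m by (simp_all add: pad_sel pad_in_def pad_pr_def)
  have it: "ar (i' j) \<and> dm (i' j) = ob Y j \<and> cd (i' j) = ob (pad X m P Q) j" if "j \<le> Suc n" for j
    using that m(2) by (auto simp: i'_def pd)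
  have pt: "ar (p' j) \<and> dm (p' j) = ob (pad X m P Q) j \<and> cd (p' j) = ob Y j" if "j \<le> Suc n" for j
    using that m(2) by (auto simp: p'_def pd)
  have "i' (Suc j) \<cdot> df Y j = df (pad X m P Q) j \<cdot> i' j" if "j \<le> n" for j
    using consider_j[of j]
  proof (elim disjE)
    assume "j = m'"
    then show ?thesis using m by (simp add: i'_def pd[unfolded m(1)])
  next
    assume "j = m"
    then show ?thesis using m(2) by (simp add: i'_def pd)
  next
    assume "j = Suc m"
    then show ?thesis using m(2) by (simp add: i'_def pd)
  next
    assume "j \<noteq> m \<and> j \<noteq> Suc m \<and> Suc j \<noteq> m"
    then show ?thesis using that by (simp add: i'_def pd)
  qed
  then have ic: "i' \<in> chain_maps n C Y (pad X m P Q)"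
    by (subst chain_maps_iff) (use it complexesD(1)[OF Xc'] in auto)
  have "p' (Suc j) \<cdot> df (pad X m P Q) j = df Y j \<cdot> p' j" if "j \<le> n" for j
    using consider_j[of j]
  proof (elim disjE)
    assume "j = m'"
    then show ?thesis using m by (simp add: p'_def pd[unfolded m(1)])
  next
    assume "j = m"
    then show ?thesis using m(2) by (simp add: p'_def pd)
  next
    assume "j = Suc m"
    then show ?thesis using m(2) by (simp add: p'_def pd)
  next
    assume "j \<noteq> m \<and> j \<noteq> Suc m \<and> Suc j \<noteq> m"
    then show ?thesis using that by (simp add: p'_def pd)
  qed
  then have pc: "p' \<in> chain_maps n C (pad X m P Q) Y"
    by (subst chain_maps_iff) (use pt complexesD(1)[OF Xc'] in auto)
  have "p' m \<cdot> i' m = p m \<cdot> i m \<oplus> k \<cdot> df Y m"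
    using m(2) by (simp add: i'_def p'_def)
  also have "\<dots> = Idt C (ob Y m)" unfolding k(4)[symmetric] h_def by (simp add: padd_norm)
  finally have "\<forall>j<Suc m. p' j \<cdot> i' j = Idt C (ob Y j)"
    using pi by (auto simp: less_Suc_eq i'_def p'_def)
  moreover have "i' 0 = i 0" "p' 0 = p 0" "i' (Suc n) = i (Suc n)" "p' (Suc n) = p (Suc n)"
    using m by (auto simp: i'_def p'_def)
  ultimately show ?thesis using X' ic pc by blast
qed

text \<open>Padding takes care of the degrees below \<open>n\<close>; degree 0 holds by assumption.
  A summand in degrees \<open>n\<close>, \<open>n + 1\<close> would alter an end term, so degree
  \<open>n\<close> needs another argument: the defect \<open>h\<close> there satisfies
  \<open>h d = 0\<close>, and also \<open>d h = 0\<close> because \<open>p i = 1\<close> in degree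
  \<open>n + 1\<close>. As \<open>h\<close> factors through \<open>d\<close>, it squares to
  zero.\<close>

lemma strictify:
  assumes X: "R L B \<epsilon> X" and eY: "exangle n C E Y \<delta>"
    and i: "i \<in> lifts n C Y X i0 ik" and p: "p \<in> lifts n C X Y p0 pk"
    and pi: "p0 \<cdot> i0 = Idt C (ob Y 0)" "pk \<cdot> ik = Idt C (ob Y (Suc n))"
  shows "\<exists>X' i' p'. R L B \<epsilon> X' \<and> i' \<in> lifts n C Y X' i0 ik \<and> p' \<in> lifts n C X' Y p0 pk \<and>
    (\<forall>j\<le>Suc n. p' j \<cdot> i' j = Idt C (ob Y j))"
proof -
  have Y: "Y \<in> complexes n C" using exangleD(1)[OF eY] .
  have "\<exists>X' i' p'. R L B \<epsilon> X' \<and> i' \<in> lifts n C Y X' i0 ik \<and> p' \<in> lifts n C X' Y p0 pk \<and>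
    (\<forall>j<Suc m. p' j \<cdot> i' j = Idt C (ob Y j))" if "m < n" for m
    using that
  proof (induction m)
    case 0
    then show ?case using X i p pi(1) by (auto simp: lifts_def)
  next
    case (Suc m)
    then obtain X' i' p' where *: "R L B \<epsilon> X'" "i' \<in> lifts n C Y X' i0 ik" "p' \<in> lifts n C X' Y p0 pk"
      "\<And>j. j<Suc m \<Longrightarrow> p' j \<cdot> i' j = Idt C (ob Y j)" by auto
    have "i' \<in> chain_maps n C Y X'" "p' \<in> chain_maps n C X' Y" using *(2,3) by (auto simp: lifts_def)
    from strict_step[OF *(1) eY this refl Suc.prems *(4)] *(2,3)
    show ?case by (auto simp: lifts_def)
  qed
  from this[of "n - 1"] n_pos obtain X' i' p' where X': "R L B \<epsilon> X'"
    and i': "i' \<in> lifts n C Y X' i0 ik" and p': "p' \<in> lifts n C X' Y p0 pk"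
    and pj: "\<And>j. j < n \<Longrightarrow> p' j \<cdot> i' j = Idt C (ob Y j)" by auto
  have Xc: "X' \<in> complexes n C" using realisesD(1)[OF R_realises[OF X']] .
  have ic: "i' \<in> chain_maps n C Y X'" and pc: "p' \<in> chain_maps n C X' Y"
    and ends: "i' 0 = i0" "i' (Suc n) = ik" "p' 0 = p0" "p' (Suc n) = pk"
    using i' p' by (auto simp: lifts_def)
  note [simp] = complexesD[OF Xc] complexesD[OF Y] chain_mapsD[OF ic Y Xc] chain_mapsD[OF pc Xc Y]
  obtain m where m: "n = Suc m" using n_pos by (cases n) auto
  define h where "h = Idt C (ob Y n) \<oplus> neg (p' n \<cdot> i' n)"
  have h [simp]: "ar h" "dm h = ob Y n" "cd h = ob Y n" by (auto simp: h_def)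
  have mn: "m < n" "m \<le> n" using m by auto
  have "h \<cdot> df Y m = df Y m \<oplus> neg (p' n \<cdot> (i' n \<cdot> df Y m))" unfolding h_def using mn m by simp
  also have "p' n \<cdot> (i' n \<cdot> df Y m) = df Y m \<cdot> (p' m \<cdot> i' m)" using chain_mapsD(4)[OF ic Y Xc mn(2)]
      chain_mapsD(5)[OF pc Xc Y mn(2), of "i' m"] mn m by simp
  also have "\<dots> = df Y m" using pj[of m] mn m by simp
  finally have hd: "h \<cdot> df Y m = zr (ob Y m) (ob Y n)" using mn m by simp
  then have hd': "h \<cdot> (df Y m \<cdot> u) = zr (dm u) (ob Y n)" if "ar u" "cd u = ob Y m" for u
    using cmp_extend[OF hd, of u] that mn m by simp
  obtain k where k: "ar k" "dm k = ob Y (Suc n)" "cd k = ob Y n" "h = k \<cdot> df Y n"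
    using exangle_con[OF eY mn(1), of h "ob Y n"] hd m by auto
  note [simp] = k(1-3)
  have "p' (Suc n) \<cdot> i' (Suc n) = Idt C (ob Y (Suc n))" using pi(2) ends by simp
  then have pin: "p' (Suc n) \<cdot> (i' (Suc n) \<cdot> u) = u" if "ar u" "cd u = ob Y (Suc n)" for u
    using cmp_extend[of "p' (Suc n)" "i' (Suc n)" _ u] that by simp
  have "df Y n \<cdot> (p' n \<cdot> i' n) = p' (Suc n) \<cdot> (i' (Suc n) \<cdot> df Y n)" by simp
  also have "\<dots> = df Y n" by (subst pin) auto
  finally have dh: "df Y n \<cdot> h = zr (ob Y n) (ob Y (Suc n))" by (simp add: h_def)
  have dh': "df Y n \<cdot> (h \<cdot> u) = zr (dm u) (ob Y (Suc n))" if "ar u" "cd u = ob Y n" for u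
    using cmp_extend[OF dh, of u] that by simp
  have hh: "h \<cdot> h = zr (ob Y n) (ob Y n)"
    by (subst k(4)) (simp add: dh)
  have pin': "p' n \<cdot> i' n = Idt C (ob Y n) \<oplus> neg h" by (simp add: h_def padd_norm)
  \<comment> \<open>In degree \<open>n\<close> the factor \<open>1 + h\<close> inverts
    \<open>p' i' = 1 - h\<close>. It is compatible with both neighbouring differentials since they
    annihilate \<open>h\<close>.\<close>
  define q where "q j = (if j = n then p' n \<oplus> h \<cdot> p' n else p' j)" for j
  have "q (Suc j) \<cdot> df X' j = df Y j \<cdot> q j" if j: "j \<le> n" for j
  proof -
    consider "j = n" | "j = m" | "j < n" "Suc j \<noteq> n" using j m by linarith
    then show ?thesis
    proof cases
      case 1
      then show ?thesis by (simp add: q_def dh')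
    next
      case 2
      have "p' n \<cdot> df X' m = df Y m \<cdot> p' m" using chain_mapsD(4)[OF pc Xc Y mn(2)] m by simp
      then have "(p' n \<oplus> h \<cdot> p' n) \<cdot> df X' m = df Y m \<cdot> p' m \<oplus> h \<cdot> (df Y m \<cdot> p' m)" using mn m by simp
      also have "\<dots> = df Y m \<cdot> p' m" using mn m by (simp add: hd')
      finally show ?thesis using 2 m by (simp add: q_def)
    next
      case 3
      then show ?thesis by (simp add: q_def)
    qed
  qed
  then have qc: "q \<in> chain_maps n C X' Y"
    by (subst chain_maps_iff) (auto simp: q_def)
  have "q n \<cdot> i' n = p' n \<cdot> i' n \<oplus> h \<cdot> (p' n \<cdot> i' n)" by (simp add: q_def)
  also have "\<dots> = Idt C (ob Y n)" unfolding pin' by (simp add: hh padd_norm)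
  finally have qn: "q n \<cdot> i' n = Idt C (ob Y n)" .
  have "q j \<cdot> i' j = Idt C (ob Y j)" if jn: "j \<le> Suc n" for j
  proof -
    consider "j < n" | "j = n" | "j = Suc n" using jn by linarith
    then show ?thesis using pj qn pi(2) ends by cases (auto simp: q_def)
  qed
  moreover have "q \<in> lifts n C X' Y p0 pk" using qc ends n_pos by (simp add: lifts_def q_def)
  ultimately show ?thesis using X' i' by blast
qed

text \<open>The extension is transported along embeddings of the end terms into objects of
  \<open>S\<close>. The identities \<open>p0 i0 = 1\<close> and \<open>pk ik = 1\<close> make the
  two pairs of end arrows morphisms of extensions, so (R0) provides lifts, which are then made
  strict.\<close>

lemma strict_retract:
  assumes Y: "realises n C s K A \<delta> Y" and d: "\<delta> \<in> carrier (Ext E K A)" and BL: "B \<in> S" "L \<in> S"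
    and i0: "ar i0" "dm i0 = A" "cd i0 = B" and p0: "ar p0" "dm p0 = B" "cd p0 = A" and pi0: "p0 \<cdot> i0 = Idt C A"
    and ik: "ar ik" "dm ik = K" "cd ik = L" and pk: "ar pk" "dm pk = L" "cd pk = K" and pik: "pk \<cdot> ik = Idt C K"
  obtains X i p where "R L B (Act E pk i0 \<delta>) X" "i \<in> lifts n C Y X i0 ik" "p \<in> lifts n C X Y p0 pk"
    "\<And>j. j \<le> Suc n \<Longrightarrow> p j \<cdot> i j = Idt C (ob Y j)"
proof -
  note [simp] = i0 p0 ik pk pi0 pik d S_obj[OF BL(1)] S_obj[OF BL(2)]
  note Y' = realisesD[OF Y]
  have e: "Act E pk i0 \<delta> \<in> carrier (Ext E L B)" by simp
  obtain X where X: "R L B (Act E pk i0 \<delta>) X" using R_ex[OF BL(2,1) e] by blast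
  obtain i where i: "i \<in> lifts n C Y X i0 ik"
    by (rule realises_lift[OF Y R_realises[OF X] d e, of i0 ik]) (use Y'(4,5) in auto)
  obtain p where p: "p \<in> lifts n C X Y p0 pk"
    by (rule realises_lift[OF R_realises[OF X] Y e d, of p0 pk]) (use Y'(4,5) in auto)
  from strictify[OF X realises_exangle[OF d Y] i p] that show ?thesis using Y' by auto
qed

text \<open>The composite is a summand of the inflation \<open>w\<close> of a complex \<open>V\<close> of the smaller category. Its
  complement consists of \<open>\<pi>\<close> in degree \<open>0\<close>, which \<open>w\<close> maps isomorphically onto a summand of degree
  \<open>1\<close>, and an idempotent \<open>c\<close> in degree \<open>1\<close>, which the next differential maps isomorphically onto the
  summand \<open>1 - e\<close> of degree \<open>2\<close>. Splitting \<open>e\<close> removes both.\<close>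

lemma inflation_compose:
  assumes Y: "realises n C s K A \<delta> Y" and d: "\<delta> \<in> carrier (Ext E K A)"
    and Z: "realises n C s L (ob Y (Suc 0)) \<epsilon> Z" and e: "\<epsilon> \<in> carrier (Ext E L (ob Y (Suc 0)))"
  shows "\<exists>M \<mu> V. \<mu> \<in> carrier (Ext E M A) \<and> realises n C s M A \<mu> V \<and> df V 0 = df Z 0 \<cdot> df Y 0"
proof -
  note Y' = realisesD[OF Y] and Z' = realisesD[OF Z]
  note cY [simp] = complexesD[OF Y'(1)] complexesD[OF Z'(1)] Y'(2-) Z'(2-)
  have n1 [simp]: "Suc 0 \<le> n" "0 < n" using n_pos by auto
  obtain A' i0 p0 where A': "A' \<in> S" and a [simp]: "ar i0" "dm i0 = A" "cd i0 = A'" "ar p0" "dm p0 = A'" "cd p0 = A" "p0 \<cdot> i0 = Idt C A"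
    using dense[OF Y'(4)] by blast
  obtain K' ik pk where K': "K' \<in> S" and k: "ar ik" "dm ik = K" "cd ik = K'" "ar pk" "dm pk = K'" "cd pk = K" "pk \<cdot> ik = Idt C K"
    using dense[OF Y'(5)] by blast
  obtain L' il pl where L': "L' \<in> S" and l: "ar il" "dm il = L" "cd il = L'" "ar pl" "dm pl = L'" "cd pl = L" "pl \<cdot> il = Idt C L"
    using dense[OF Z'(5)] by blast
  obtain X i p where X: "R K' A' (Act E pk i0 \<delta>) X" and i: "i \<in> lifts n C Y X i0 ik" and p: "p \<in> lifts n C X Y p0 pk"
    and pi: "\<And>j. j \<le> Suc n \<Longrightarrow> p j \<cdot> i j = Idt C (ob Y j)"
    by (rule strict_retract[OF Y d A' K' a k]) blast
  note X' = realisesD[OF R_realises[OF X]]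
  have ic: "i \<in> chain_maps n C Y X" and pc: "p \<in> chain_maps n C X Y"
    and ie [simp]: "i 0 = i0" "i (Suc n) = ik" "p 0 = p0" "p (Suc n) = pk" using i p by (auto simp: lifts_def)
  note [simp] = complexesD[OF X'(1)] X'(2-) chain_mapsD[OF ic Y'(1) X'(1)] chain_mapsD[OF pc X'(1) Y'(1)]
  \<comment> \<open>The retract of \<open>Z\<close> is built over the embedding \<open>i 1\<close>
    of \<open>Y 1 = Z 0\<close> into \<open>X 1\<close>; thereby the inflations of \<open>X\<close>
    and \<open>U\<close> are composable in the smaller category.\<close>
  define B where "B = ob X (Suc 0)"
  have B: "B \<in> S" unfolding B_def by (rule R_S[OF X]) simp
  have b: "ar (i (Suc 0))" "dm (i (Suc 0)) = ob Y (Suc 0)" "cd (i (Suc 0)) = B"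
    "ar (p (Suc 0))" "dm (p (Suc 0)) = B" "cd (p (Suc 0)) = ob Y (Suc 0)" "p (Suc 0) \<cdot> i (Suc 0) = Idt C (ob Y (Suc 0))"
    using pi[of "Suc 0"] by (auto simp: B_def)
  obtain U j q where U: "R L' B (Act E pl (i (Suc 0)) \<epsilon>) U" and j: "j \<in> lifts n C Z U (i (Suc 0)) il" and q: "q \<in> lifts n C U Z (p (Suc 0)) pl"
    and qj: "\<And>m. m \<le> Suc n \<Longrightarrow> q m \<cdot> j m = Idt C (ob Z m)"
    by (rule strict_retract[OF Z e B L' b l]) blast
  note U' = realisesD[OF R_realises[OF U]]
  have jc: "j \<in> chain_maps n C Z U" and qc: "q \<in> chain_maps n C U Z"
    and je [simp]: "j 0 = i (Suc 0)" "q 0 = p (Suc 0)" using j q by (auto simp: lifts_def)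
  note [simp] = complexesD[OF U'(1)] U'(2-) chain_mapsD[OF jc Z'(1) U'(1)] chain_mapsD[OF qc U'(1) Z'(1)]
  obtain M \<mu> V where V: "R M A' \<mu> V" and V1: "ob V (Suc 0) = ob U (Suc 0)" and dV: "df V 0 = df U 0 \<cdot> df X 0"
    using R_inflation[OF X, of L' "Act E pl (i (Suc 0)) \<epsilon>" U] U by (auto simp: B_def)
  note V' = realisesD[OF R_realises[OF V]]
  have eV: "exangle n C E V \<mu>" by (rule realises_exangle[OF R_ext[OF V] R_realises[OF V]])
  note [simp] = complexesD[OF V'(1)] V'(2-) V1
  define w where "w = df V 0"
  define g where "g = df Z 0 \<cdot> df Y 0"
  define G where "G = ob Z (Suc 0)"
  define jj where "jj = j (Suc 0)"
  define qq where "qq = q (Suc 0)"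
  define W where "W = ob U (Suc 0)"
  have G [simp]: "G \<in> Obj C" "W \<in> Obj C" "A \<in> Obj C" "A' \<in> Obj C" "M \<in> Obj C" by (auto simp: G_def W_def)
  have ty [simp]: "ar w" "dm w = A'" "cd w = W" "ar g" "dm g = A" "cd g = G"
    "ar jj" "dm jj = G" "cd jj = W" "ar qq" "dm qq = W" "cd qq = G"
    by (auto simp: w_def g_def G_def jj_def qq_def W_def dV B_def)
  have wd: "w = df U 0 \<cdot> df X 0" by (simp add: w_def dV)
  have qqjj [simp]: "qq \<cdot> jj = Idt C G" using qj[of "Suc 0"] by (simp add: qq_def jj_def G_def)
  have wi: "w \<cdot> i0 = jj \<cdot> g"
  proof -
    have "w \<cdot> i0 = df U 0 \<cdot> (df X 0 \<cdot> i 0)" by (simp add: wd B_def)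
    also have "df X 0 \<cdot> i 0 = j 0 \<cdot> df Y 0" using chain_mapsD(4)[OF ic Y'(1) X'(1), of 0] by simp
    also have "df U 0 \<cdot> (j 0 \<cdot> df Y 0) = (j (Suc 0) \<cdot> df Z 0) \<cdot> df Y 0"
      using chain_mapsD(4)[OF jc Z'(1) U'(1), of 0] by (simp add: B_def)
    finally show ?thesis by (simp add: jj_def g_def B_def)
  qed
  have qw: "qq \<cdot> w = g \<cdot> p0"
  proof -
    have "qq \<cdot> w = (q (Suc 0) \<cdot> df U 0) \<cdot> df X 0" by (simp add: wd qq_def B_def)
    also have "q (Suc 0) \<cdot> df U 0 = df Z 0 \<cdot> p (Suc 0)" using chain_mapsD(4)[OF qc U'(1) Z'(1), of 0] by simp
    also have "(df Z 0 \<cdot> p (Suc 0)) \<cdot> df X 0 = df Z 0 \<cdot> (p (Suc 0) \<cdot> df X 0)" by (simp del: chain_mapsD(4)[OF pc X'(1) Y'(1)])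
    also have "p (Suc 0) \<cdot> df X 0 = df Y 0 \<cdot> p0" using chain_mapsD(4)[OF pc X'(1) Y'(1), of 0] by simp
    finally show ?thesis by (simp add: g_def)
  qed
  define \<pi> where "\<pi> = Idt C A' \<oplus> neg (i0 \<cdot> p0)"
  have [simp]: "ar \<pi>" "dm \<pi> = A'" "cd \<pi> = A'" by (auto simp: \<pi>_def)
  have p0i0: "p0 \<cdot> (i0 \<cdot> u) = u" if "ar u" "cd u = A" for u
    using cmp_extend[OF a(7), of u] that by simp
  have pi_i0: "\<pi> \<cdot> i0 = zr A A'" and p0_pi: "p0 \<cdot> \<pi> = zr A' A" by (auto simp: \<pi>_def p0i0)
  have pipi: "\<pi> \<cdot> \<pi> = \<pi>" using p0_pi cmp_extend[OF p0_pi] unfolding \<pi>_def by (simp add: p0i0)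
  have p0_pi': "p0 \<cdot> (\<pi> \<cdot> u) = zr (dm u) A" if "ar u" "cd u = A'" for u
    using cmp_extend[OF p0_pi, of u] that by simp
  \<comment> \<open>The complement \<open>\<pi>\<close> of \<open>A\<close> annihilates the
    transported extension because \<open>\<pi> i0 = 0\<close>; hence it factors through the
    inflation of \<open>X\<close>.\<close>
  obtain k1 where k1: "ar k1" "dm k1 = B" "cd k1 = A'" "\<pi> = k1 \<cdot> df X 0"
  proof (rule exangle_conE[OF realises_exangle[OF R_ext[OF X] R_realises[OF X]], of \<pi> A'])
    show "Act E (Idt C (ob X (Suc n))) \<pi> (Act E pk i0 \<delta>) = \<one>\<^bsub>Ext E (ob X (Suc n)) A'\<^esub>"
      using d k by (simp add: pi_i0)
  qed (auto simp: B_def)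
  define \<pi>' where "\<pi>' = Idt C B \<oplus> neg (i (Suc 0) \<cdot> p (Suc 0))"
  have [simp]: "B \<in> Obj C" using S_obj[OF B] .
  note [simp] = b(1-6) k1(1-3)
  have [simp]: "ar \<pi>'" "dm \<pi>' = B" "cd \<pi>' = B" by (auto simp: \<pi>'_def)
  have pi_i1: "\<pi>' \<cdot> i (Suc 0) = zr (ob Y (Suc 0)) B"
    using b(7) cY(1)[of "Suc 0"] by (simp add: \<pi>'_def del: cY)
  obtain k2 where k2: "ar k2" "dm k2 = W" "cd k2 = B" "\<pi>' = k2 \<cdot> df U 0"
  proof (rule exangle_conE[OF realises_exangle[OF R_ext[OF U] R_realises[OF U]], of \<pi>' B])
    show "Act E (Idt C (ob U (Suc n))) \<pi>' (Act E pl (i (Suc 0)) \<epsilon>) = \<one>\<^bsub>Ext E (ob U (Suc n)) B\<^esub>"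
      using e l by (simp add: pi_i1)
  qed (auto simp: W_def)
  note [simp] = k2(1-3)
  have dX: "ar (df X 0)" "dm (df X 0) = A'" "cd (df X 0) = B" and dU: "ar (df U 0)" "dm (df U 0) = B" "cd (df U 0) = W"
    by (auto simp: B_def W_def)
  \<comment> \<open>The complements are recovered one after the other: \<open>k2 d = \<pi>'\<close>
    for \<open>U\<close>, then \<open>\<pi>' d = d \<pi>\<close> and \<open>k1 d = \<pi>\<close> for
    \<open>X\<close>.\<close>
  have kkw: "k1 \<cdot> (k2 \<cdot> w) = \<pi>"
  proof -
    have "k1 \<cdot> (k2 \<cdot> w) = k1 \<cdot> (\<pi>' \<cdot> df X 0)" unfolding k2(4) wd using dX dU by simp
    also have "\<pi>' \<cdot> df X 0 = df X 0 \<oplus> neg (i (Suc 0) \<cdot> (p (Suc 0) \<cdot> df X 0))" unfolding \<pi>'_def using dX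
      by (simp del: chain_mapsD(4,5)[OF pc X'(1) Y'(1)])
    also have "i (Suc 0) \<cdot> (p (Suc 0) \<cdot> df X 0) = df X 0 \<cdot> (i0 \<cdot> p0)" by simp
    also have "k1 \<cdot> (df X 0 \<oplus> neg (df X 0 \<cdot> (i0 \<cdot> p0))) = (k1 \<cdot> df X 0) \<oplus> neg ((k1 \<cdot> df X 0) \<cdot> (i0 \<cdot> p0))"
      using dX by simp
    also have "\<dots> = \<pi> \<oplus> neg (\<pi> \<cdot> (i0 \<cdot> p0))" unfolding k1(4) ..
    also have "\<pi> \<cdot> (i0 \<cdot> p0) = zr A' A'" using cmp_extend[OF pi_i0, of p0] by simp
    finally show ?thesis by simp
  qed
  define \<theta> where "\<theta> = Idt C W \<oplus> neg (jj \<cdot> qq)"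
  have [simp]: "ar \<theta>" "dm \<theta> = W" "cd \<theta> = W" by (auto simp: \<theta>_def)
  have tj: "\<theta> \<cdot> jj = zr G W" by (simp add: \<theta>_def)
  have tw: "\<theta> \<cdot> w = w \<cdot> \<pi>"
  proof -
    have "\<theta> \<cdot> w = w \<oplus> neg (jj \<cdot> (qq \<cdot> w))" by (simp add: \<theta>_def)
    also have "jj \<cdot> (qq \<cdot> w) = (jj \<cdot> g) \<cdot> p0" unfolding qw by simp
    also have "\<dots> = w \<cdot> (i0 \<cdot> p0)" unfolding wi[symmetric] by simp
    finally show ?thesis by (simp add: \<pi>_def)
  qed
  \<comment> \<open>A retraction of \<open>w\<close> on the image of \<open>\<pi>\<close>. The
    factors \<open>\<pi>\<close> and \<open>\<theta>\<close> make it land in that image and vanish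
    on the summand that is to be kept, which \<open>k1 k2\<close> alone need not do.\<close>
  define \<kappa> where "\<kappa> = \<pi> \<cdot> (k1 \<cdot> (k2 \<cdot> \<theta>))"
  have [simp]: "ar \<kappa>" "dm \<kappa> = W" "cd \<kappa> = A'" by (auto simp: \<kappa>_def)
  have kj: "\<kappa> \<cdot> jj = zr G A'" by (simp add: \<kappa>_def tj)
  have kj': "\<kappa> \<cdot> (jj \<cdot> u) = zr (dm u) A'" if "ar u" "cd u = G" for u using cmp_extend[OF kj, of u] that by simp
  have kw: "\<kappa> \<cdot> w = \<pi>"
  proof -
    have "\<kappa> \<cdot> w = \<pi> \<cdot> (k1 \<cdot> (k2 \<cdot> (\<theta> \<cdot> w)))" by (simp add: \<kappa>_def)
    also have "\<dots> = \<pi> \<cdot> ((k1 \<cdot> (k2 \<cdot> w)) \<cdot> \<pi>)" unfolding tw by simp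
    also have "\<dots> = \<pi>" unfolding kkw pipi ..
    finally show ?thesis .
  qed
  have kw': "\<kappa> \<cdot> (w \<cdot> u) = \<pi> \<cdot> u" if "ar u" "cd u = A'" for u using cmp_extend[OF kw, of u] that by simp
  have pk': "\<pi> \<cdot> \<kappa> = \<kappa>" unfolding \<kappa>_def using cmp_extend[OF pipi] by simp
  have qwk: "qq \<cdot> (w \<cdot> \<kappa>) = zr W G"
  proof -
    have "qq \<cdot> (w \<cdot> \<kappa>) = (g \<cdot> p0) \<cdot> (\<pi> \<cdot> \<kappa>)" unfolding qw[symmetric] pk' by simp
    then show ?thesis by (simp add: p0_pi')
  qed
  \<comment> \<open>What is left of degree 1 after removing the wanted summand \<open>jj qq\<close>
    and the copy \<open>w \<kappa>\<close> of the complement in degree 0. It annihilates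
    \<open>w\<close>, so exactness lets it factor through the next differential.\<close>
  define c where "c = \<theta> \<oplus> neg (w \<cdot> \<kappa>)"
  have [simp]: "ar c" "dm c = W" "cd c = W" by (auto simp: c_def)
  have cw: "c \<cdot> w = zr A' W" by (simp add: c_def tw kw)
  have cj: "c \<cdot> jj = zr G W" by (simp add: c_def tj kj)
  have cw': "c \<cdot> (w \<cdot> u) = zr (dm u) W" if "ar u" "cd u = A'" for u using cmp_extend[OF cw, of u] that by simp
  have cj': "c \<cdot> (jj \<cdot> u) = zr (dm u) W" if "ar u" "cd u = G" for u using cmp_extend[OF cj, of u] that by simp
  have cc: "c \<cdot> c = c"
  proof -
    have "c \<cdot> c = c \<cdot> (Idt C W \<oplus> (neg (jj \<cdot> qq) \<oplus> neg (w \<cdot> \<kappa>)))" by (subst (2) c_def) (simp add: \<theta>_def padd_assoc)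
    also have "\<dots> = c" by (simp add: cw' cj')
    finally show ?thesis .
  qed
  define d1 where "d1 = df V (Suc 0)"
  define V2 where "V2 = ob V (Suc (Suc 0))"
  have [simp]: "ar d1" "dm d1 = W" "cd d1 = V2" "V2 \<in> Obj C" by (auto simp: d1_def V2_def W_def)
  have d1w: "d1 \<cdot> w = zr A' V2" unfolding d1_def w_def V2_def using complexesD(5)[OF V'(1), of 0] by simp
  have d1w': "d1 \<cdot> (w \<cdot> u) = zr (dm u) V2" if "ar u" "cd u = A'" for u using cmp_extend[OF d1w, of u] that by simp
  obtain r where r: "ar r" "dm r = V2" "cd r = W" "c = r \<cdot> d1"
    by (rule exangle_con[OF eV, of 0 c W]) (use cw in \<open>auto simp: d1_def V2_def W_def w_def\<close>)
  note [simp] = r(1-3)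
  \<comment> \<open>From \<open>c = r d1\<close> and \<open>c c = c\<close> it follows that
    \<open>d1 c r\<close> is idempotent; it is the isomorphic image of \<open>c\<close> in degree 2,
    and \<open>e\<close> is the complementary idempotent.\<close>
  define e where "e = Idt C V2 \<oplus> neg (d1 \<cdot> (c \<cdot> r))"
  have [simp]: "ar e" "dm e = V2" "cd e = V2" by (auto simp: e_def)
  have crd: "c \<cdot> (r \<cdot> (d1 \<cdot> u)) = c \<cdot> u" if "ar u" "cd u = W" for u
  proof -
    have "c \<cdot> (r \<cdot> (d1 \<cdot> u)) = (c \<cdot> (r \<cdot> d1)) \<cdot> u" using that by simp
    then show ?thesis unfolding r(4)[symmetric] cc .
  qed
  have crd1: "c \<cdot> (r \<cdot> d1) = c" unfolding r(4)[symmetric] cc ..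
  have ee: "e \<cdot> e = e" unfolding e_def using cmp_extend[OF cc] by (simp add: crd padd_norm)
  have ed1: "e \<cdot> d1 = d1 \<cdot> (jj \<cdot> qq)"
  proof -
    have "e \<cdot> d1 = d1 \<oplus> neg (d1 \<cdot> c)" unfolding e_def using crd1 by simp
    also have "\<dots> = d1 \<cdot> (jj \<cdot> qq)" unfolding c_def \<theta>_def by (simp add: d1w' padd_norm)
    finally show ?thesis .
  qed
  obtain V2' \<rho> \<sigma> where V2': "V2' \<in> Obj C" and \<rho>: "\<rho> \<in> Arr C V2 V2'" and \<sigma>: "\<sigma> \<in> Arr C V2' V2"
    and \<sigma>\<rho>: "e = \<sigma> \<cdot> \<rho>" and \<rho>\<sigma>: "\<rho> \<cdot> \<sigma> = Idt C V2'"
  proof -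
    have "V2 \<in> Obj C" "e \<in> Arr C V2 V2" by auto
    then show ?thesis using idem ee that unfolding idempotent_complete_def by blast
  qed
  have rs [simp]: "V2' \<in> Obj C" "ar \<rho>" "dm \<rho> = V2" "cd \<rho> = V2'" "ar \<sigma>" "dm \<sigma> = V2'" "cd \<sigma> = V2"
    using V2' \<rho> \<sigma> by auto
  \<comment> \<open>For \<open>n = 1\<close>, degree 2 is the end term, so the splitting of
    \<open>e\<close> also changes the object over which the extension lives. This is why the action
    of \<open>I P\<close> in degree \<open>n + 1\<close> on \<open>\<mu>\<close> is treated
    separately for \<open>n = 1\<close> below.\<close>
  define Q where "Q = (\<lambda>m. if m = 0 then A else if m = 1 then G else if m = 2 then V2' else ob V m)"
  define I where "I = (\<lambda>m. if m = 0 then i0 else if m = 1 then jj else if m = 2 then \<sigma> else Idt C (ob V m))"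
  define P where "P = (\<lambda>m. if m = 0 then p0 else if m = 1 then qq else if m = 2 then \<rho> else Idt C (ob V m))"
  have It: "ar (I m)" "dm (I m) = Q m" "cd (I m) = ob V m" if "m \<le> Suc n" for m
    using that by (auto simp: I_def Q_def W_def V2_def numeral_2_eq_2)
  have Pt: "ar (P m)" "dm (P m) = ob V m" "cd (P m) = Q m" if "m \<le> Suc n" for m
    using that by (auto simp: P_def Q_def W_def V2_def numeral_2_eq_2)
  have PI: "P m \<cdot> I m = Idt C (Q m)" if "m \<le> Suc n" for m
    using that \<rho>\<sigma> by (auto simp: P_def Q_def I_def)
  have comm: "I (Suc m) \<cdot> (P (Suc m) \<cdot> df V m) = df V m \<cdot> (I m \<cdot> P m)" if m: "m \<le> n" for m
  proof -
    consider "m = 0" | "m = 1" | "m = 2" | "m > 2" by linarith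
    then show ?thesis
    proof cases
      case 1
      have "jj \<cdot> (qq \<cdot> w) = (jj \<cdot> g) \<cdot> p0" unfolding qw by simp
      also have "\<dots> = w \<cdot> (i0 \<cdot> p0)" unfolding wi[symmetric] by simp
      finally show ?thesis using 1 by (simp add: I_def P_def w_def)
    next
      case 2
      have "\<sigma> \<cdot> (\<rho> \<cdot> d1) = d1 \<cdot> (jj \<cdot> qq)" unfolding ed1[symmetric] \<sigma>\<rho> by simp
      then show ?thesis using 2 by (simp add: I_def P_def d1_def)
    next
      case 3
      have n2: "Suc (Suc 0) \<le> n" "Suc 0 < n" using 3 m by auto
      have "df V (Suc (Suc 0)) \<cdot> (\<sigma> \<cdot> \<rho>) = df V (Suc (Suc 0)) \<cdot> e" unfolding \<sigma>\<rho> ..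
      also have "\<dots> = df V (Suc (Suc 0)) \<oplus> neg (df V (Suc (Suc 0)) \<cdot> (d1 \<cdot> (c \<cdot> r)))"
        unfolding e_def using n2 by (simp add: V2_def)
      also have "df V (Suc (Suc 0)) \<cdot> (d1 \<cdot> (c \<cdot> r)) = zr V2 (ob V (Suc (Suc (Suc 0))))"
        unfolding d1_def using n2 complexesD(6)[OF V'(1), of "Suc 0" "c \<cdot> r"] by (simp add: W_def)
      finally show ?thesis using 3 n2 m by (simp add: I_def P_def V2_def numeral_2_eq_2)
    next
      case 4
      then show ?thesis using m by (simp add: I_def P_def)
    qed
  qed
  define V' where "V' = \<lparr>ob = Q, df = \<lambda>m. P (Suc m) \<cdot> (df V m \<cdot> I m)\<rparr>"
  have rc: "V' \<in> complexes n C" "I \<in> chain_maps n C V' V" "P \<in> chain_maps n C V V'"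
    unfolding V'_def
    by (rule retract_complex[OF V'(1), of I Q P]; (fact It Pt PI comm)?; use It Pt PI comm in blast)+
  have ob': "ob V' = Q" by (simp add: V'_def)
  have Q0: "Q 0 = A" by (simp add: Q_def)
  have QM [simp]: "Q (Suc n) \<in> Obj C" using rc(1) ob' complexes_iff by auto
  have mu: "\<mu> \<in> carrier (Ext E M A')" by (rule R_ext[OF V])
  have Ie: "ar (I (Suc n))" "dm (I (Suc n)) = Q (Suc n)" "cd (I (Suc n)) = M"
    and Pe: "ar (P (Suc n))" "dm (P (Suc n)) = M" "cd (P (Suc n)) = Q (Suc n)"
    using It[of "Suc n"] Pt[of "Suc n"] by auto
  \<comment> \<open>As \<open>\<pi> = \<kappa> w\<close> and the pushforward of \<open>\<mu>\<close>
    along its inflation \<open>w\<close> is zero, \<open>\<pi>\<close> annihilates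
    \<open>\<mu>\<close>; hence \<open>i0 p0\<close> acts as the identity on it.\<close>
  have pimu: "Act E x \<pi> \<mu> = \<one>\<^bsub>Ext E (dm x) A'\<^esub>" if "ar x" "cd x = M" for x
  proof -
    have "Act E x \<pi> \<mu> = Act E x \<kappa> (Act E (Idt C M) w \<mu>)" using that mu by (simp add: kw)
    also have "Act E (Idt C M) w \<mu> = \<one>\<^bsub>Ext E M W\<^esub>"
      using exangleD(3)[OF eV] by (simp add: w_def W_def)
    finally show ?thesis using that by simp
  qed
  have 1: "Act E x (i0 \<cdot> p0) \<mu> = Act E x (Idt C A') \<mu>" if x: "ar x" "cd x = M" for x
  proof -
    have "Idt C A' = i0 \<cdot> p0 \<oplus> \<pi>" by (simp add: \<pi>_def padd_norm)
    then have "Act E x (Idt C A') \<mu> = Act E x (i0 \<cdot> p0) \<mu> \<otimes>\<^bsub>Ext E (dm x) A'\<^esub> Act E x \<pi> \<mu>"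
      using act_padd_push[of x "i0 \<cdot> p0" \<pi> \<mu>] x mu by simp
    then show ?thesis using x mu pimu[OF x] monoid.r_one[OF group.is_monoid[OF group_Ext], of "dm x" A' "Act E x (i0 \<cdot> p0) \<mu>"]
      by simp
  qed
  \<comment> \<open>The only case with something to show is \<open>n = 1\<close>: there
    \<open>d1\<close> is the deflation, so \<open>d1 c r\<close> annihilates \<open>\<mu>\<close>
    and \<open>e\<close> acts as the identity.\<close>
  have 2: "Act E (I (Suc n) \<cdot> P (Suc n)) y \<mu> = Act E (Idt C M) y \<mu>" if y: "ar y" "dm y = A'" for y
  proof (cases "n = 1")
    case False
    have "Suc n \<noteq> 0" "Suc n \<noteq> 1" "Suc n \<noteq> 2" using n_pos False by linarith+
    then have "I (Suc n) = Idt C M" "P (Suc n) = Idt C M" unfolding I_def P_def by (simp_all only: if_False V'(3))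
    then show ?thesis by simp
  next
    case True
    then have M: "M = V2" using V'(3) by (simp add: V2_def)
    have "Act E (d1 \<cdot> (c \<cdot> r)) y \<mu> = Act E (c \<cdot> r) y (Act E d1 (Idt C A') \<mu>)" using y mu M by simp
    also have "Act E d1 (Idt C A') \<mu> = \<one>\<^bsub>Ext E W A'\<^esub>"
      using exangleD(4)[OF eV] True by (simp add: d1_def W_def)
    finally have *: "Act E (d1 \<cdot> (c \<cdot> r)) y \<mu> = \<one>\<^bsub>Ext E V2 (cd y)\<^esub>" using y by simp
    have "Idt C V2 = e \<oplus> d1 \<cdot> (c \<cdot> r)" by (simp add: e_def padd_norm)
    then have "Act E (Idt C V2) y \<mu> = Act E e y \<mu> \<otimes>\<^bsub>Ext E V2 (cd y)\<^esub> Act E (d1 \<cdot> (c \<cdot> r)) y \<mu>"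
      using act_padd_pull[of e "d1 \<cdot> (c \<cdot> r)" y \<mu>] y mu M by simp
    then have "Act E (Idt C V2) y \<mu> = Act E e y \<mu>"
      using * y mu M monoid.r_one[OF group.is_monoid[OF group_Ext], of V2 "cd y" "Act E e y \<mu>"] by simp
    then show ?thesis using True M \<sigma>\<rho> by (simp add: I_def P_def numeral_2_eq_2)
  qed
  define \<mu>' where "\<mu>' = Act E (I (Suc n)) p0 \<mu>"
  have mu': "\<mu>' \<in> carrier (Ext E (Q (Suc n)) A)" unfolding \<mu>'_def using Ie mu by simp
  have real: "realises n C s (Q (Suc n)) A \<mu>' V'"
  proof (rule realises_strict_retract[OF R_realises[OF V] mu rc(1) _ _ mu' rc(2,3)])
    show "Act E (Idt C (Q (Suc n))) (I 0) \<mu>' = Act E (I (Suc n)) (Idt C A') \<mu>"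
      unfolding \<mu>'_def using Ie mu 1[of "I (Suc n)"] by (simp add: I_def)
    show "Act E (Idt C M) (P 0) \<mu> = Act E (P (Suc n)) (Idt C A) \<mu>'"
      unfolding \<mu>'_def using Ie Pe mu 2[of p0] by (simp add: P_def)
  qed (use PI ob' Q0 in auto)
  have "df V' 0 = qq \<cdot> (w \<cdot> i0)" by (simp add: V'_def P_def I_def w_def)
  also have "\<dots> = g" unfolding wi using cmp_extend[OF qqjj, of g] by simp
  finally show ?thesis using real mu' g_def by blast
qed

end

section \<open>Good lifts\<close>

context biadditive_functor
begin

text \<open>From \<open>e i = 0\<close> and \<open>p e = 0\<close>, and because
  \<open>\<delta>1\<close> arises from \<open>\<delta>\<close> by pulling back along
  \<open>p\<close> and pushing along \<open>i\<close>, both end components of \<open>e\<close>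
  annihilate \<open>\<delta>1\<close>. This is the situation of
  \<open>null_idempotent\<close>.\<close>

lemma complement_null:
  assumes X1: "exangle n C E X1 \<delta>1" and X: "X \<in> complexes n C" and n: "1 \<le> n"
    and i: "i \<in> chain_maps n C X X1" and p: "p \<in> chain_maps n C X1 X"
    and pi: "\<forall>j\<le>Suc n. p j \<cdot> i j = Idt C (ob X j)"
    and d: "\<delta> \<in> carrier (Ext E (ob X (Suc n)) (ob X 0))" and d1: "\<delta>1 = Act E (p (Suc n)) (i 0) \<delta>"
    and e_def: "e = (\<lambda>j. Idt C (ob X1 j) \<oplus> neg (i j \<cdot> p j))"
  shows "e \<in> chain_maps n C X1 X1" "\<And>j. j \<le> Suc n \<Longrightarrow> e j \<cdot> e j = e j"
    "\<And>j. j \<le> Suc n \<Longrightarrow> e j \<cdot> i j = zr (ob X j) (ob X1 j)"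
    "\<And>j. j \<le> Suc n \<Longrightarrow> p j \<cdot> e j = zr (ob X1 j) (ob X j)"
    "null n X1 X1 e"
proof -
  have X1': "X1 \<in> complexes n C" using exangleD(1)[OF X1] .
  note [simp] = complexesD[OF X1'] complexesD[OF X] chain_mapsD[OF i X X1'] chain_mapsD[OF p X1' X] pi[rule_format] d
  have pi': "p j \<cdot> (i j \<cdot> u) = u" if "j \<le> Suc n" "ar u" "cd u = ob X j" for j u
    using cmp_extend[OF pi[rule_format], of j u] that by simp
  have et [simp]: "ar (e j)" "dm (e j) = ob X1 j" "cd (e j) = ob X1 j" if "j \<le> Suc n" for j
    using that by (simp_all add: e_def)
  show c: "e \<in> chain_maps n C X1 X1" by (subst chain_maps_iff) (auto simp: e_def)
  show ei: "e j \<cdot> i j = zr (ob X j) (ob X1 j)" if "j \<le> Suc n" for j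
    using that by (simp add: e_def)
  show pe: "p j \<cdot> e j = zr (ob X1 j) (ob X j)" if "j \<le> Suc n" for j
    using that by (simp add: e_def pi')
  show ee: "e j \<cdot> e j = e j" if "j \<le> Suc n" for j
  proof -
    have "e j \<cdot> e j = e j \<oplus> neg (i j \<cdot> (p j \<cdot> e j))" by (subst (1) e_def) (use that in simp)
    then show ?thesis using that by (simp add: pe)
  qed
  show "null n X1 X1 e"
    by (rule null_idempotent[OF X1 c n ee]) (auto simp: d1 ei pe)
qed

end

context dense_realisation
begin

text \<open>A good lift \<open>f1\<close> between strict retracts in the smaller category is
  compressed to \<open>f = p f1 j\<close>. Then \<open>i f\<close> and \<open>f1 j\<close> differ by
  \<open>e f1 j\<close>, and \<open>p f1\<close> and \<open>f q\<close> by \<open>p f1 g\<close>,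
  where \<open>e\<close> and \<open>g\<close> are the complementary idempotents. Contractions of
  \<open>e\<close> and \<open>g\<close> yield homotopies for both squares, and these induce maps of
  cones in both directions. Confining the homotopies to the complements makes the composite on the
  smaller cone exactly the identity.\<close>

lemma good_lift:
  assumes X: "realises n C s D A \<delta> X" and d: "\<delta> \<in> carrier (Ext E D A)"
    and c: "ar c" "dm c = K" "cd c = D" and Y: "realises n C s K A (Act E c (Idt C A) \<delta>) Y"
  shows "\<exists>f\<in>lifts n C Y X (Idt C A) c.
    realises n C s D (ob Y (Suc 0)) (Act E (Idt C D) (df Y 0) \<delta>) (mapping_cone n C Y X f)"
proof -
  note X' = realisesD[OF X] and Y' = realisesD[OF Y]
  have [simp]: "A \<in> Obj C" "D \<in> Obj C" "K \<in> Obj C" using X'(4,5) Y'(5) .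
  note [simp] = c d
  have dY: "Act E c (Idt C A) \<delta> \<in> carrier (Ext E K A)" by simp
  obtain A' i0 p0 where A': "A' \<in> S" and a [simp]: "ar i0" "dm i0 = A" "cd i0 = A'" "ar p0" "dm p0 = A'" "cd p0 = A" "p0 \<cdot> i0 = Idt C A"
    using dense[OF X'(4)] by blast
  obtain D' iD pD where D': "D' \<in> S" and D [simp]: "ar iD" "dm iD = D" "cd iD = D'" "ar pD" "dm pD = D'" "cd pD = D" "pD \<cdot> iD = Idt C D"
    using dense[OF X'(5)] by blast
  obtain K' iK pK where K': "K' \<in> S" and k [simp]: "ar iK" "dm iK = K" "cd iK = K'" "ar pK" "dm pK = K'" "cd pK = K" "pK \<cdot> iK = Idt C K"
    using dense[OF Y'(5)] by blast
  have [simp]: "A' \<in> Obj C" "D' \<in> Obj C" "K' \<in> Obj C" using S_obj A' D' K' by blast+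
  obtain X1 i p where X1: "R D' A' (Act E pD i0 \<delta>) X1" and i: "i \<in> lifts n C X X1 i0 iD" and p: "p \<in> lifts n C X1 X p0 pD"
    and pi: "\<And>j. j \<le> Suc n \<Longrightarrow> p j \<cdot> i j = Idt C (ob X j)"
    by (rule strict_retract[OF X d A' D' a D]) blast
  obtain Y1 j q where Y1: "R K' A' (Act E pK i0 (Act E c (Idt C A) \<delta>)) Y1" and j: "j \<in> lifts n C Y Y1 i0 iK" and q: "q \<in> lifts n C Y1 Y p0 pK"
    and qj: "\<And>m. m \<le> Suc n \<Longrightarrow> q m \<cdot> j m = Idt C (ob Y m)"
    by (rule strict_retract[OF Y dY A' K' a k]) blast
  \<comment> \<open>Extending \<open>c\<close> by zero on the complements: pulling back the
    transported extension along \<open>c1\<close> gives the transport of the pullback along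
    \<open>c\<close>, since \<open>pD iD = 1\<close>.\<close>
  define c1 where "c1 = iD \<cdot> (c \<cdot> pK)"
  have c1 [simp]: "ar c1" "dm c1 = K'" "cd c1 = D'" by (auto simp: c1_def)
  have pDiD: "pD \<cdot> (iD \<cdot> u) = u" if "ar u" "cd u = D" for u
    using cmp_extend[OF D(7), of u] that by simp
  have "Act E pK i0 (Act E c (Idt C A) \<delta>) = Act E c1 (Idt C A') (Act E pD i0 \<delta>)"
    by (simp add: c1_def pDiD)
  then have Y1': "R K' A' (Act E c1 (Idt C A') (Act E pD i0 \<delta>)) Y1" using Y1 by simp
  obtain f1 M1 where f1: "f1 \<in> lifts n C Y1 X1 (Idt C A') c1" and M1: "is_cone n Y1 X1 f1 M1"
    and RM1: "R D' (ob Y1 1) (Act E (Idt C D') (df Y1 0) (Act E pD i0 \<delta>)) M1"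
    using R_cone[OF X1 K' c1 Y1'] by blast
  note X1r = R_realises[OF X1] and Y1r = R_realises[OF Y1]
  have Xc: "X \<in> complexes n C" and Yc: "Y \<in> complexes n C" and X1c: "X1 \<in> complexes n C" and Y1c: "Y1 \<in> complexes n C"
    using X'(1) Y'(1) realisesD(1)[OF X1r] realisesD(1)[OF Y1r] .
  have eX1: "exangle n C E X1 (Act E pD i0 \<delta>)" by (rule realises_exangle[OF R_ext[OF X1] X1r])
  have eY1: "exangle n C E Y1 (Act E pK i0 (Act E c (Idt C A) \<delta>))" by (rule realises_exangle[OF R_ext[OF Y1] Y1r])
  have eY: "exangle n C E Y (Act E c (Idt C A) \<delta>)" by (rule realises_exangle[OF dY Y])
  have ic: "i \<in> chain_maps n C X X1" and pc: "p \<in> chain_maps n C X1 X" and jc: "j \<in> chain_maps n C Y Y1"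
    and qc: "q \<in> chain_maps n C Y1 Y" and f1c: "f1 \<in> chain_maps n C Y1 X1"
    and ends [simp]: "i 0 = i0" "p 0 = p0" "j 0 = i0" "q 0 = p0" "f1 0 = Idt C A'"
      "i (Suc n) = iD" "p (Suc n) = pD" "j (Suc n) = iK" "q (Suc n) = pK" "f1 (Suc n) = c1"
    using i p j q f1 by (auto simp: lifts_def)
  have obs [simp]: "ob X 0 = A" "ob X (Suc n) = D" "ob Y 0 = A" "ob Y (Suc n) = K"
    "ob X1 0 = A'" "ob X1 (Suc n) = D'" "ob Y1 0 = A'" "ob Y1 (Suc n) = K'"
    using X' Y' realisesD[OF X1r] realisesD[OF Y1r] by simp_all
  note [simp] = complexesD[OF Xc] complexesD[OF Yc] complexesD[OF X1c] complexesD[OF Y1c]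
    chain_mapsD[OF ic Xc X1c] chain_mapsD[OF pc X1c Xc] chain_mapsD[OF jc Yc Y1c] chain_mapsD[OF qc Y1c Yc]
    chain_mapsD[OF f1c Y1c X1c]
  have qj': "q m \<cdot> (j m \<cdot> u) = u" if "m \<le> Suc n" "ar u" "cd u = ob Y m" for m u
    using cmp_extend[OF qj, of m u] that by simp
  have pi': "p m \<cdot> (i m \<cdot> u) = u" if "m \<le> Suc n" "ar u" "cd u = ob X m" for m u
    using cmp_extend[OF pi, of m u] that by simp
  define f where "f m = p m \<cdot> (f1 m \<cdot> j m)" for m
  have f: "f \<in> lifts n C Y X (Idt C A) c"
    using lifts_cmp[OF lifts_cmp[OF j f1 Yc Y1c X1c] p Yc X1c Xc] unfolding f_def[abs_def]
    by (simp add: c1_def pDiD)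
  have fc: "f \<in> chain_maps n C Y X" using f by (simp add: lifts_def)
  define M where "M = mapping_cone n C Y X f"
  obtain a a' b b' where M: "cone_data n Y X f M a a' b b'"
    using mapping_cone_is_cone[OF Yc Xc fc n_pos] unfolding M_def is_cone_def by blast
  obtain a1 a1' b1 b1' where M1: "cone_data n Y1 X1 f1 M1 a1 a1' b1 b1'"
    using M1 unfolding is_cone_def by blast

  define e where "e = (\<lambda>m. Idt C (ob X1 m) \<oplus> neg (i m \<cdot> p m))"
  have dX': "\<delta> \<in> carrier (Ext E (ob X (Suc n)) (ob X 0))" by simp
  have dX1': "Act E pD i0 \<delta> = Act E (p (Suc n)) (i 0) \<delta>" by simp
  have pi_all: "\<forall>j\<le>Suc n. p j \<cdot> i j = Idt C (ob X j)" and qj_all: "\<forall>m\<le>Suc n. q m \<cdot> j m = Idt C (ob Y m)"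
    using pi qj by auto
  note e = complement_null[OF eX1 Xc n_pos ic pc pi_all dX' dX1' e_def]
  define g where "g = (\<lambda>m. Idt C (ob Y1 m) \<oplus> neg (j m \<cdot> q m))"
  have dY': "Act E c (Idt C A) \<delta> \<in> carrier (Ext E (ob Y (Suc n)) (ob Y 0))" by simp
  have dY1': "Act E pK i0 (Act E c (Idt C A) \<delta>) = Act E (q (Suc n)) (j 0) (Act E c (Idt C A) \<delta>)" by simp
  note g = complement_null[OF eY1 Yc n_pos jc qc qj_all dY' dY1' g_def]
  note [simp] = chain_mapsD[OF e(1) X1c X1c] chain_mapsD[OF g(1) Y1c Y1c]
  obtain k where k0: "\<forall>m\<le>n. ar (k m) \<and> dm (k m) = ob X1 (Suc m) \<and> cd (k m) = ob X1 m"
    and ke: "e 0 = k 0 \<cdot> df X1 0" "\<forall>m<n. e (Suc m) = k (Suc m) \<cdot> df X1 (Suc m) \<oplus> df X1 m \<cdot> k m"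
    "e (Suc n) = df X1 n \<cdot> k n" using e(5) unfolding null_def by blast
  have k [simp]: "\<And>m. m \<le> n \<Longrightarrow> ar (k m)" "\<And>m. m \<le> n \<Longrightarrow> dm (k m) = ob X1 (Suc m)" "\<And>m. m \<le> n \<Longrightarrow> cd (k m) = ob X1 m"
    using k0 by auto
  obtain l where l0: "\<forall>m\<le>n. ar (l m) \<and> dm (l m) = ob Y1 (Suc m) \<and> cd (l m) = ob Y1 m"
    and lg: "g 0 = l 0 \<cdot> df Y1 0" "\<forall>m<n. g (Suc m) = l (Suc m) \<cdot> df Y1 (Suc m) \<oplus> df Y1 m \<cdot> l m"
    "g (Suc n) = df Y1 n \<cdot> l n" using g(5) unfolding null_def by blast
  have l [simp]: "\<And>m. m \<le> n \<Longrightarrow> ar (l m)" "\<And>m. m \<le> n \<Longrightarrow> dm (l m) = ob Y1 (Suc m)" "\<And>m. m \<le> n \<Longrightarrow> cd (l m) = ob Y1 m"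
    using l0 by auto
  have ee': "e m \<cdot> (e m \<cdot> u) = e m \<cdot> u" if "m \<le> Suc n" "ar u" "cd u = ob X1 m" for m u
    using cmp_extend[OF e(2), of m u] that by simp

  \<comment> \<open>The contraction \<open>k\<close> of \<open>e\<close> composed with
    \<open>f1 j\<close> contracts \<open>e f1 j\<close>. The additional factor \<open>e\<close>
    confines the homotopy to the complement of \<open>X\<close>; it costs nothing as
    \<open>e\<close> is an idempotent chain map.\<close>
  define T where "T m = e m \<cdot> (k m \<cdot> (f1 (Suc m) \<cdot> j (Suc m)))" for m
  have T1: "df X1 m \<cdot> T m \<oplus> T (Suc m) \<cdot> df Y (Suc m) = e (Suc m) \<cdot> (f1 (Suc m) \<cdot> j (Suc m))" if m: "m < n" for m
  proof -
    have "e (Suc m) \<cdot> (f1 (Suc m) \<cdot> j (Suc m)) = e (Suc m) \<cdot> (e (Suc m) \<cdot> (f1 (Suc m) \<cdot> j (Suc m)))"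
      using m by (simp add: ee')
    also have "\<dots> = e (Suc m) \<cdot> ((k (Suc m) \<cdot> df X1 (Suc m) \<oplus> df X1 m \<cdot> k m) \<cdot> (f1 (Suc m) \<cdot> j (Suc m)))"
      using ke(2) m by simp
    also have "\<dots> = df X1 m \<cdot> T m \<oplus> T (Suc m) \<cdot> df Y (Suc m)"
      unfolding T_def using m by (simp add: padd_ac)
    finally show ?thesis ..
  qed
  have Tn: "df X1 n \<cdot> T n = e (Suc n) \<cdot> (f1 (Suc n) \<cdot> j (Suc n))"
  proof -
    have "e (Suc n) \<cdot> (f1 (Suc n) \<cdot> j (Suc n)) = e (Suc n) \<cdot> (e (Suc n) \<cdot> (f1 (Suc n) \<cdot> j (Suc n)))"
      by (simp add: ee')
    also have "\<dots> = e (Suc n) \<cdot> ((df X1 n \<cdot> k n) \<cdot> (f1 (Suc n) \<cdot> j (Suc n)))"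
      unfolding ke(3)[symmetric] ..
    also have "\<dots> = df X1 n \<cdot> T n" unfolding T_def by simp
    finally show ?thesis ..
  qed
  have T0: "T 0 \<cdot> df Y 0 = zr (ob Y 0) (ob X1 0)"
  proof -
    have "T 0 \<cdot> df Y 0 = e 0 \<cdot> ((k 0 \<cdot> df X1 0) \<cdot> i0)" unfolding T_def by simp
    also have "\<dots> = zr (ob Y 0) (ob X1 0)" unfolding ke(1)[symmetric] using e(3)[of 0] by simp
    finally show ?thesis .
  qed
  note idY = chain_maps_id[OF Yc]
  have n0: "0 \<le> Suc n" "Suc (Suc 0) \<le> Suc n" using n_pos by auto
  \<comment> \<open>Normalised with \<open>e\<close> on the left and the identity of
    \<open>Y\<close> on the right. The preserved relation \<open>e T' = T'\<close> is what gives
    \<open>p T' = 0\<close>.\<close>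
  obtain T' where T' [simp]: "\<And>m. m \<le> n \<Longrightarrow> ar (T' m)" "\<And>m. m \<le> n \<Longrightarrow> dm (T' m) = ob Y (Suc m)" "\<And>m. m \<le> n \<Longrightarrow> cd (T' m) = ob X1 m"
    and T'0: "T' 0 = zr (ob Y (Suc 0)) (ob X1 0)"
    and T'1: "\<And>m. m < n \<Longrightarrow> df X1 m \<cdot> T' m \<oplus> T' (Suc m) \<cdot> df Y (Suc m) = df X1 m \<cdot> T m \<oplus> T (Suc m) \<cdot> df Y (Suc m)"
    and T'n: "df X1 n \<cdot> T' n = df X1 n \<cdot> T n"
    and eT': "\<And>m. m \<le> n \<Longrightarrow> e m \<cdot> (T' m \<cdot> Idt C (ob Y (Suc m))) = T' m"
    by (rule normalise_homotopy[OF eY X1c n_pos e(1) idY e(2)[OF n0(1)], of T])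
      (use n0 T0 in \<open>auto simp: T_def ee'\<close>)
  \<comment> \<open>The sign comes from \<open>i f = f1 j - e f1 j\<close>.\<close>
  define H where "H m = neg (T' m)" for m
  have H [simp]: "\<And>m. m \<le> n \<Longrightarrow> ar (H m)" "\<And>m. m \<le> n \<Longrightarrow> dm (H m) = ob Y (Suc m)" "\<And>m. m \<le> n \<Longrightarrow> cd (H m) = ob X1 m"
    by (simp_all add: H_def)
  have pT': "p m \<cdot> T' m = zr (ob Y (Suc m)) (ob X m)" if "m \<le> n" for m
  proof -
    have "p m \<cdot> T' m = (p m \<cdot> e m) \<cdot> T' m" by (subst eT'[OF that, symmetric]) (use that in simp)
    then show ?thesis using that by (simp add: e(4))
  qed
  have pH: "p m \<cdot> (H m \<cdot> u) = zr (dm u) (ob X m)" if "m \<le> n" "ar u" "cd u = ob Y (Suc m)" for m u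
    using that cmp_extend[OF pT'[OF that(1)], of u] by (simp add: H_def)
  have eif: "e m \<cdot> (f1 m \<cdot> j m) = f1 m \<cdot> j m \<oplus> neg (i m \<cdot> f m)" if "m \<le> Suc n" for m
    unfolding e_def f_def using that by simp
  have if_eq: "i m \<cdot> f m = f1 m \<cdot> j m \<oplus> neg (e m \<cdot> (f1 m \<cdot> j m))" if "m \<le> Suc n" for m
    unfolding eif[OF that] using that by (simp add: f_def padd_norm)
  have Hj: "i (Suc m) \<cdot> f (Suc m) = f1 (Suc m) \<cdot> j (Suc m) \<oplus> (df X1 m \<cdot> H m \<oplus> H (Suc m) \<cdot> df Y (Suc m))" if m: "m < n" for m
  proof -
    have "df X1 m \<cdot> H m \<oplus> H (Suc m) \<cdot> df Y (Suc m) = neg (df X1 m \<cdot> T' m \<oplus> T' (Suc m) \<cdot> df Y (Suc m))"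
      unfolding H_def using m by simp
    also have "\<dots> = neg (e (Suc m) \<cdot> (f1 (Suc m) \<cdot> j (Suc m)))" unfolding T'1[OF m] T1[OF m] ..
    finally show ?thesis using if_eq[of "Suc m"] m by simp
  qed
  have Hn: "i (Suc n) \<cdot> f (Suc n) = f1 (Suc n) \<cdot> j (Suc n) \<oplus> df X1 n \<cdot> H n"
  proof -
    have "df X1 n \<cdot> H n = neg (e (Suc n) \<cdot> (f1 (Suc n) \<cdot> j (Suc n)))"
      unfolding H_def Tn[symmetric] T'n[symmetric] by simp
    then show ?thesis using if_eq[of "Suc n"] by simp
  qed
  have H0: "H 0 = zr (ob Y (Suc 0)) (ob X1 0)" by (simp add: H_def T'0)
  define U where "U = (\<lambda>m. if m \<le> n then a1' m \<cdot> (j (Suc m) \<cdot> a m) \<oplus> (b1' m \<cdot> (i m \<cdot> b m) \<oplus> b1' m \<cdot> (H m \<cdot> a m)) else i m)"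
  have H_all: "\<forall>m\<le>n. ar (H m) \<and> dm (H m) = ob Y (Suc m) \<and> cd (H m) = ob X1 m"
    and Hj_all: "\<forall>m<n. i (Suc m) \<cdot> f (Suc m) = f1 (Suc m) \<cdot> j (Suc m) \<oplus> (df X1 m \<cdot> H m \<oplus> H (Suc m) \<cdot> df Y (Suc m))"
    using H Hj by blast+
  note U = cone_map[OF M Yc Xc fc n_pos M1 Y1c X1c f1c jc ic H_all H0 Hj_all Hn U_def]

  have gg': "g m \<cdot> (g m \<cdot> u) = g m \<cdot> u" if "m \<le> Suc n" "ar u" "cd u = ob Y1 m" for m u
    using cmp_extend[OF g(2), of m u] that by simp
  \<comment> \<open>The mirror image of \<open>T\<close>: the factor \<open>g\<close> on the right
    confines this homotopy to the complement of \<open>Y\<close>, which leads to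
    \<open>G j = 0\<close> after normalisation.\<close>
  define L where "L m = p m \<cdot> (f1 m \<cdot> (l m \<cdot> g (Suc m)))" for m
  have L1: "df X m \<cdot> L m \<oplus> L (Suc m) \<cdot> df Y1 (Suc m) = p (Suc m) \<cdot> (f1 (Suc m) \<cdot> g (Suc m))" if m: "m < n" for m
  proof -
    have "p (Suc m) \<cdot> (f1 (Suc m) \<cdot> g (Suc m)) = p (Suc m) \<cdot> (f1 (Suc m) \<cdot> (g (Suc m) \<cdot> g (Suc m)))"
      using m g(2)[of "Suc m"] by simp
    also have "\<dots> = p (Suc m) \<cdot> (f1 (Suc m) \<cdot> ((l (Suc m) \<cdot> df Y1 (Suc m) \<oplus> df Y1 m \<cdot> l m) \<cdot> g (Suc m)))"
      using lg(2) m by simp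
    also have "\<dots> = df X m \<cdot> L m \<oplus> L (Suc m) \<cdot> df Y1 (Suc m)"
      unfolding L_def using m by (simp add: padd_ac)
    finally show ?thesis ..
  qed
  have Ln: "df X n \<cdot> L n = p (Suc n) \<cdot> (f1 (Suc n) \<cdot> g (Suc n))"
  proof -
    have "p (Suc n) \<cdot> (f1 (Suc n) \<cdot> g (Suc n)) = p (Suc n) \<cdot> (f1 (Suc n) \<cdot> (g (Suc n) \<cdot> g (Suc n)))"
      using g(2)[of "Suc n"] by simp
    also have "\<dots> = p (Suc n) \<cdot> (f1 (Suc n) \<cdot> ((df Y1 n \<cdot> l n) \<cdot> g (Suc n)))"
      unfolding lg(3)[symmetric] ..
    also have "\<dots> = p (Suc n) \<cdot> ((f1 (Suc n) \<cdot> df Y1 n) \<cdot> (l n \<cdot> g (Suc n)))"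
      by (simp del: ends chain_mapsD(4,5)[OF f1c Y1c X1c])
    also have "\<dots> = (p (Suc n) \<cdot> df X1 n) \<cdot> (f1 n \<cdot> (l n \<cdot> g (Suc n)))"
      unfolding chain_mapsD(4)[OF f1c Y1c X1c order_refl] by (simp del: ends)
    also have "\<dots> = df X n \<cdot> L n" unfolding chain_mapsD(4)[OF pc X1c Xc order_refl] L_def by (simp del: ends)
    finally show ?thesis ..
  qed
  have L0: "L 0 \<cdot> df Y1 0 = zr (ob Y1 0) (ob X 0)"
  proof -
    have "L 0 \<cdot> df Y1 0 = p0 \<cdot> ((l 0 \<cdot> df Y1 0) \<cdot> g 0)" unfolding L_def by simp
    also have "\<dots> = zr (ob Y1 0) (ob X 0)" unfolding lg(1)[symmetric] using g(4)[of 0] g(2)[of 0] by simp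
    finally show ?thesis .
  qed
  note idX = chain_maps_id[OF Xc]
  have idX0: "Idt C (ob X 0) \<cdot> Idt C (ob X 0) = Idt C (ob X 0)" by simp
  obtain G where G [simp]: "\<And>m. m \<le> n \<Longrightarrow> ar (G m)" "\<And>m. m \<le> n \<Longrightarrow> dm (G m) = ob Y1 (Suc m)" "\<And>m. m \<le> n \<Longrightarrow> cd (G m) = ob X m"
    and G0: "G 0 = zr (ob Y1 (Suc 0)) (ob X 0)"
    and G1: "\<And>m. m < n \<Longrightarrow> df X m \<cdot> G m \<oplus> G (Suc m) \<cdot> df Y1 (Suc m) = df X m \<cdot> L m \<oplus> L (Suc m) \<cdot> df Y1 (Suc m)"
    and Gn: "df X n \<cdot> G n = df X n \<cdot> L n"
    and Gg: "\<And>m. m \<le> n \<Longrightarrow> Idt C (ob X m) \<cdot> (G m \<cdot> g (Suc m)) = G m"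
    by (rule normalise_homotopy[OF eY1 Xc n_pos idX g(1) idX0 g(2)[OF n0(2)], of L])
      (use n0 L0 g(2) in \<open>auto simp: L_def\<close>)
  have Gj: "G m \<cdot> (j (Suc m) \<cdot> u) = zr (dm u) (ob X m)" if "m \<le> n" "ar u" "cd u = ob Y (Suc m)" for m u
  proof -
    have "G m \<cdot> (j (Suc m) \<cdot> u) = G m \<cdot> ((g (Suc m) \<cdot> j (Suc m)) \<cdot> u)"
      by (subst Gg[OF that(1), symmetric]) (use that in simp)
    then show ?thesis using that by (simp add: g(3))
  qed
  have pfg: "p m \<cdot> (f1 m \<cdot> g m) = p m \<cdot> f1 m \<oplus> neg (f m \<cdot> q m)" if "m \<le> Suc n" for m
    unfolding g_def f_def using that by simp
  have pf_eq: "p m \<cdot> f1 m = f m \<cdot> q m \<oplus> p m \<cdot> (f1 m \<cdot> g m)" if "m \<le> Suc n" for m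
    unfolding pfg[OF that] using that by (simp add: f_def padd_norm)
  have Gj': "p (Suc m) \<cdot> f1 (Suc m) = f (Suc m) \<cdot> q (Suc m) \<oplus> (df X m \<cdot> G m \<oplus> G (Suc m) \<cdot> df Y1 (Suc m))" if m: "m < n" for m
    unfolding G1[OF m] L1[OF m] using m by (intro pf_eq) simp
  have Gn': "p (Suc n) \<cdot> f1 (Suc n) = f (Suc n) \<cdot> q (Suc n) \<oplus> df X n \<cdot> G n"
    unfolding Gn Ln by (intro pf_eq) simp
  define V where "V = (\<lambda>m. if m \<le> n then a' m \<cdot> (q (Suc m) \<cdot> a1 m) \<oplus> (b' m \<cdot> (p m \<cdot> b1 m) \<oplus> b' m \<cdot> (G m \<cdot> a1 m)) else p m)"
  have G_all: "\<forall>m\<le>n. ar (G m) \<and> dm (G m) = ob Y1 (Suc m) \<and> cd (G m) = ob X m"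
    and Gj_all: "\<forall>m<n. p (Suc m) \<cdot> f1 (Suc m) = f (Suc m) \<cdot> q (Suc m) \<oplus> (df X m \<cdot> G m \<oplus> G (Suc m) \<cdot> df Y1 (Suc m))"
    using G Gj' by blast+
  note V = cone_map[OF M1 Y1c X1c f1c n_pos M Yc Xc fc qc pc G_all G0 Gj_all Gn' V_def]

  have Mc: "M \<in> complexes n C" and M1c: "M1 \<in> complexes n C"
    using cone_complex[OF M Yc Xc fc n_pos] cone_complex[OF M1 Y1c X1c f1c n_pos] .
  note cM [simp] = cone_dataD[OF M Yc Xc] and cM1 [simp] = cone_dataD[OF M1 Y1c X1c]
  note [simp] = chain_mapsD(1-3)[OF U(1) Mc M1c] chain_mapsD(1-3)[OF V(1) M1c Mc]
  \<comment> \<open>Apart from the diagonal, where \<open>q j = 1\<close> and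
    \<open>p i = 1\<close>, the composite has the entries \<open>p H\<close> and \<open>G j\<close>,
    and both vanish.\<close>
  have VU: "V m \<cdot> U m = Idt C (ob M m)" if "m \<le> Suc n" for m
  proof (cases "m = Suc n")
    case True
    then show ?thesis by (simp add: U(3) V(3))
  next
    case False
    then have m: "m \<le> n" using that by simp
    have "V m \<cdot> U m = a' m \<cdot> (q (Suc m) \<cdot> (a1 m \<cdot> U m)) \<oplus> (b' m \<cdot> (p m \<cdot> (b1 m \<cdot> U m)) \<oplus> b' m \<cdot> (G m \<cdot> (a1 m \<cdot> U m)))"
      by (subst V_def) (use m in simp)
    also have "\<dots> = a' m \<cdot> a m \<oplus> b' m \<cdot> b m"
      unfolding U(4)[OF m] U(5)[OF m] using m by (simp add: qj' pi' pH Gj)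
    also have "\<dots> = Idt C (ob M m)" by (rule cone_data_df(3)[OF M m])
    finally show ?thesis .
  qed
  have RM: "realises n C s D' (ob Y1 (Suc 0)) (Act E (Idt C D') (df Y1 0) (Act E pD i0 \<delta>)) M1"
    using R_realises[OF RM1] by simp
  have "realises n C s D (ob Y (Suc 0)) (Act E (Idt C D) (df Y 0) \<delta>) M"
  proof (rule realises_strict_retract[OF RM _ Mc _ _ _ U(1) V(1) VU])
    have "df Y1 0 \<cdot> i0 = j (Suc 0) \<cdot> df Y 0" by simp
    then show "Act E (Idt C D) (U 0) (Act E (Idt C D) (df Y 0) \<delta>) =
      Act E (U (Suc n)) (Idt C (ob Y1 (Suc 0))) (Act E (Idt C D') (df Y1 0) (Act E pD i0 \<delta>))"
      by (simp add: U(2,3))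
    have "q (Suc 0) \<cdot> (df Y1 0 \<cdot> i0) = df Y 0 \<cdot> (p0 \<cdot> i0)" by simp
    also have "\<dots> = df Y 0" by simp
    finally show "Act E (Idt C D') (V 0) (Act E (Idt C D') (df Y1 0) (Act E pD i0 \<delta>)) =
      Act E (V (Suc n)) (Idt C (ob Y (Suc 0))) (Act E (Idt C D) (df Y 0) \<delta>)"
      by (simp add: V(2,3))
  qed auto
  then show ?thesis using f unfolding M_def by blast
qed

lemma EA2: "EA2 n C E s"
  unfolding EA2_def
proof (intro ballI allI impI)
  fix A K D \<delta> c X Y
  assume o: "A \<in> Obj C" "K \<in> Obj C" "D \<in> Obj C" and d: "\<delta> \<in> carrier (Ext E D A)" and c: "c \<in> Arr C K D"
    and r: "realises n C s K A (pull C E A c \<delta>) Y \<and> realises n C s D A \<delta> X"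
  show "\<exists>f\<in>lifts n C Y X (Idt C A) c.
          realises n C s D (ob Y 1) (push C E D (df Y 0) \<delta>) (mapping_cone n C Y X f)"
    using good_lift[of D A \<delta> X c K Y] o d c r by (simp add: push_def pull_def)
qed

lemma inflation_closed:
  assumes "A \<in> Obj C" "B \<in> Obj C" "D \<in> Obj C" "f \<in> Arr C A B" "g \<in> Arr C B D"
    and f: "inflation n C E s f" and g: "inflation n C E s g"
  shows "inflation n C E s (g \<cdot> f)"
proof -
  obtain K A' \<delta> Y where Y: "realises n C s K A' \<delta> Y" "\<delta> \<in> carrier (Ext E K A')" "f = df Y 0"
    using f unfolding inflation_def by blast
  obtain L B' \<epsilon> Z where Z: "realises n C s L B' \<epsilon> Z" "\<epsilon> \<in> carrier (Ext E L B')" "g = df Z 0"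
    using g unfolding inflation_def by blast
  note Y' = realisesD[OF Y(1)] and Z' = realisesD[OF Z(1)]
  \<comment> \<open>The complexes witnessing the two inflations are unrelated a priori; disjointness
    of hom-sets forces their terms to match at the common object.\<close>
  have "B' = ob Y (Suc 0)"
    using complexesD(4)[OF Y'(1), of 0] complexesD(3)[OF Z'(1), of 0] Y(3) Z(3) Z'(2) assms by simp
  then obtain M \<mu> V where V: "\<mu> \<in> carrier (Ext E M A')" "realises n C s M A' \<mu> V" "df V 0 = g \<cdot> f"
    using inflation_compose[OF Y(1,2), of L \<epsilon> Z] Z Y(3) by auto
  show ?thesis unfolding inflation_def
    using V realisesD(4,5)[OF V(2)] by metis
qed

end

section \<open>The idempotent completion\<close>

context preadditive_category
begin

lemma idem_Obj: "P \<in> Obj (idem_cat C) \<longleftrightarrow>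
    fst P \<in> Obj C \<and> ar (snd P) \<and> dm (snd P) = fst P \<and> cd (snd P) = fst P \<and> snd P \<cdot> snd P = snd P"
  by (cases P) (auto simp: idem_cat_def)

lemma idem_ObjD:
  assumes "P \<in> Obj (idem_cat C)"
  shows "fst P \<in> Obj C" "ar (snd P)" "dm (snd P) = fst P" "cd (snd P) = fst P" "snd P \<cdot> snd P = snd P"
    "ar u \<Longrightarrow> cd u = fst P \<Longrightarrow> snd P \<cdot> (snd P \<cdot> u) = snd P \<cdot> u"
  using assms cmp_extend[of "snd P" "snd P" "snd P" u] unfolding idem_Obj by auto

lemma idem_sel [simp]:
  "Cmp (idem_cat C) (x, r, y) (x', r', y') = (x, r \<cdot> r', y')"
  "Idt (idem_cat C) A = (snd A, snd A, snd A)"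
  "\<one>\<^bsub>Hom (idem_cat C) A B\<^esub> = (snd B, zr (fst A) (fst B), snd A)"
  "(x, r, y) \<otimes>\<^bsub>Hom (idem_cat C) A B\<^esub> (x', r', y') = (snd B, r \<otimes>\<^bsub>Hom C (fst A) (fst B)\<^esub> r', snd A)"
  by (simp_all add: idem_cat_def split_beta)

lemma idem_Arr: "A \<in> Obj (idem_cat C) \<Longrightarrow> B \<in> Obj (idem_cat C) \<Longrightarrow> t \<in> Arr (idem_cat C) A B \<longleftrightarrow>
    (\<exists>r. t = (snd B, r, snd A) \<and> ar r \<and> dm r = fst A \<and> cd r = fst B \<and> r \<cdot> snd A = r \<and> snd B \<cdot> r = r)"
  using idem_ObjD[of A] idem_ObjD[of B] by (cases A; cases B) (auto simp: idem_cat_def)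

lemma idem_ArrE:
  assumes "t \<in> Arr (idem_cat C) A B" "A \<in> Obj (idem_cat C)" "B \<in> Obj (idem_cat C)"
  obtains r where "t = (snd B, r, snd A)" "ar r" "dm r = fst A" "cd r = fst B" "r \<cdot> snd A = r" "snd B \<cdot> r = r"
    "\<And>u. ar u \<Longrightarrow> cd u = fst A \<Longrightarrow> r \<cdot> (snd A \<cdot> u) = r \<cdot> u"
    "\<And>u. ar u \<Longrightarrow> cd u = fst A \<Longrightarrow> snd B \<cdot> (r \<cdot> u) = r \<cdot> u"
proof -
  note o = idem_ObjD[OF assms(2)] idem_ObjD[OF assms(3)]
  obtain r where r: "t = (snd B, r, snd A)" "ar r" "dm r = fst A" "cd r = fst B" "r \<cdot> snd A = r" "snd B \<cdot> r = r"
    using assms idem_Arr by blast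
  show ?thesis
  proof (rule that[OF r])
    fix u assume "ar u" "cd u = fst A"
    then show "r \<cdot> (snd A \<cdot> u) = r \<cdot> u" "snd B \<cdot> (r \<cdot> u) = r \<cdot> u"
      using cmp_extend[OF r(5), of u] cmp_extend[OF r(6), of u] r o by auto
  qed
qed

lemma idem_hom_comm_group:
  assumes A: "A \<in> Obj (idem_cat C)" and B: "B \<in> Obj (idem_cat C)"
  shows "comm_group (Hom (idem_cat C) A B)"
proof (rule comm_groupI)
  note [simp] = idem_ObjD[OF A] idem_ObjD[OF B]
  fix x y z assume "x \<in> Arr (idem_cat C) A B" "y \<in> Arr (idem_cat C) A B" "z \<in> Arr (idem_cat C) A B"
  then show "x \<otimes>\<^bsub>Hom (idem_cat C) A B\<^esub> y \<otimes>\<^bsub>Hom (idem_cat C) A B\<^esub> z =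
    x \<otimes>\<^bsub>Hom (idem_cat C) A B\<^esub> (y \<otimes>\<^bsub>Hom (idem_cat C) A B\<^esub> z)"
    by (elim idem_ArrE[OF _ A B]) (simp add: padd_ac)
next
  note [simp] = idem_ObjD[OF A] idem_ObjD[OF B]
  fix x y assume "x \<in> Arr (idem_cat C) A B" "y \<in> Arr (idem_cat C) A B"
  then show "x \<otimes>\<^bsub>Hom (idem_cat C) A B\<^esub> y \<in> Arr (idem_cat C) A B"
    "x \<otimes>\<^bsub>Hom (idem_cat C) A B\<^esub> y = y \<otimes>\<^bsub>Hom (idem_cat C) A B\<^esub> x"
    by (elim idem_ArrE[OF _ A B], simp add: padd_ac idem_Arr[OF A B])+
next
  note [simp] = idem_ObjD[OF A] idem_ObjD[OF B]
  show "\<one>\<^bsub>Hom (idem_cat C) A B\<^esub> \<in> Arr (idem_cat C) A B" by (simp add: idem_Arr[OF A B])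
  fix x assume "x \<in> Arr (idem_cat C) A B"
  then show "\<one>\<^bsub>Hom (idem_cat C) A B\<^esub> \<otimes>\<^bsub>Hom (idem_cat C) A B\<^esub> x = x"
    by (elim idem_ArrE[OF _ A B]) simp
  from \<open>x \<in> Arr (idem_cat C) A B\<close> obtain r where r: "x = (snd B, r, snd A)" "ar r" "dm r = fst A" "cd r = fst B" "r \<cdot> snd A = r" "snd B \<cdot> r = r"
    by (elim idem_ArrE[OF _ A B])
  then show "\<exists>y\<in>Arr (idem_cat C) A B. y \<otimes>\<^bsub>Hom (idem_cat C) A B\<^esub> x = \<one>\<^bsub>Hom (idem_cat C) A B\<^esub>"
    by (intro bexI[of _ "(snd B, neg r, snd A)"]) (simp_all add: idem_Arr[OF A B])
qed

lemma idem_preadditive: "preadditive_category (idem_cat C)"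
proof (rule preadditive_category.intro, goal_cases)
  case 1
  then show ?case by (rule idem_hom_comm_group)
next
  case (2 A B A' B' f)
  \<comment> \<open>A triplet records both idempotents, and each of these determines its object
    because hom-sets of \<open>C\<close> are disjoint.\<close>
  have "fst A = fst A'" "fst B = fst B'" "snd A = snd A'" "snd B = snd B'"
    using idem_ObjD(3)[OF 2(1)] idem_ObjD(3)[OF 2(2)] idem_ObjD(3)[OF 2(3)] idem_ObjD(3)[OF 2(4)]
      2(5)[unfolded idem_Arr[OF 2(1,2)]] 2(6)[unfolded idem_Arr[OF 2(3,4)]] by auto
  then show ?case by (simp add: prod_eq_iff)
next
  case (3 A)
  then show ?case using idem_ObjD[OF 3] by (simp add: idem_Arr)
next
  case (4 A B D f g)
  note [simp] = idem_ObjD[OF 4(1)] idem_ObjD[OF 4(2)] idem_ObjD[OF 4(3)]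
  show ?case using 4(4,5)
    by (elim idem_ArrE[OF _ 4(1,2)] idem_ArrE[OF _ 4(2,3)]) (simp add: idem_Arr[OF 4(1,3)])
next
  case (5 A B D D' f g h)
  note [simp] = idem_ObjD[OF 5(1)] idem_ObjD[OF 5(2)] idem_ObjD[OF 5(3)] idem_ObjD[OF 5(4)]
  show ?case using 5(5,6,7)
    by (elim idem_ArrE[OF _ 5(1,2)] idem_ArrE[OF _ 5(2,3)] idem_ArrE[OF _ 5(3,4)]) simp
next
  case (6 A B f)
  then show ?case by (elim idem_ArrE[OF _ 6(1,2)]) simp
next
  case (7 A B f)
  then show ?case by (elim idem_ArrE[OF _ 7(1,2)]) simp
next
  case (8 A B D f f' g)
  note [simp] = idem_ObjD[OF 8(1)] idem_ObjD[OF 8(2)] idem_ObjD[OF 8(3)]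
  show ?case using 8(4-)
    by (elim idem_ArrE[OF _ 8(1,2)] idem_ArrE[OF _ 8(2,3)]) simp
next
  case (9 A B D f g g')
  note [simp] = idem_ObjD[OF 9(1)] idem_ObjD[OF 9(2)] idem_ObjD[OF 9(3)]
  show ?case using 9(4-)
    by (elim idem_ArrE[OF _ 9(1,2)] idem_ArrE[OF _ 9(2,3)]) simp
qed

lemma idem_typed:
  assumes A: "A \<in> Obj (idem_cat C)" and B: "B \<in> Obj (idem_cat C)"
    and r: "ar r" "dm r = fst A" "cd r = fst B" "r \<cdot> snd A = r" "snd B \<cdot> r = r"
    and xy: "x = snd B" "y = snd A"
  shows "preadditive_category.ar (idem_cat C) (x, r, y)" "dom_of (idem_cat C) (x, r, y) = A"
    "cod_of (idem_cat C) (x, r, y) = B"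
  using preadditive_category.dm_cd_eq[OF idem_preadditive A B, of "(x, r, y)"] r xy
  by (auto simp: idem_Arr[OF A B])

lemma idem_typedE:
  assumes "preadditive_category.ar (idem_cat C) t" "dom_of (idem_cat C) t = A" "cod_of (idem_cat C) t = B"
  obtains r where "t = (snd B, r, snd A)" "ar r" "dm r = fst A" "cd r = fst B" "r \<cdot> snd A = r" "snd B \<cdot> r = r"
    "\<And>u. ar u \<Longrightarrow> cd u = fst A \<Longrightarrow> r \<cdot> (snd A \<cdot> u) = r \<cdot> u"
    "\<And>u. ar u \<Longrightarrow> cd u = fst A \<Longrightarrow> snd B \<cdot> (r \<cdot> u) = r \<cdot> u"
  using idem_ArrE[of t A B] preadditive_category.ar_Arr[OF idem_preadditive, of t] assms by metis

end

section \<open>Zero object, biproducts and splittings in the completion\<close>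

context additive_category
begin

lemma idem_additive: "additive_category (idem_cat C)"
proof (intro additive_category.intro additive_category_axioms.intro idem_preadditive)
  interpret D: preadditive_category "idem_cat C" by (rule idem_preadditive)
  obtain Z where Z: "zero_object C Z" using ex_zero by blast
  then have Zo [simp]: "Z \<in> Obj C" by (simp add: zero_object_def)
  have u: "f = zr Z A" if "ar f" "dm f = Z" "cd f = A" for f A
  proof -
    have "A \<in> Obj C" using that by auto
    then have "\<exists>!f. f \<in> Arr C Z A" using Z by (auto simp: zero_object_def)
    moreover have "f \<in> Arr C Z A" "zr Z A \<in> Arr C Z A" using that \<open>A \<in> Obj C\<close> by auto
    ultimately show ?thesis by blast
  qed
  have v: "f = zr A Z" if "ar f" "dm f = A" "cd f = Z" for f A
  proof -
    have "A \<in> Obj C" using that by auto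
    then have "\<exists>!f. f \<in> Arr C A Z" using Z by (auto simp: zero_object_def)
    moreover have "f \<in> Arr C A Z" "zr A Z \<in> Arr C A Z" using that \<open>A \<in> Obj C\<close> by auto
    ultimately show ?thesis by blast
  qed
  have Zi: "(Z, Idt C Z) \<in> Obj (idem_cat C)" by (simp add: idem_Obj)
  have "zero_object (idem_cat C) (Z, Idt C Z)"
    unfolding zero_object_def
  proof (intro conjI ballI Zi)
    fix A assume A: "A \<in> Obj (idem_cat C)"
    note [simp] = idem_ObjD[OF A]
    show "\<exists>!f. f \<in> Arr (idem_cat C) (Z, Idt C Z) A"
      by (rule ex1I[of _ "(snd A, zr Z (fst A), Idt C Z)"])
        (use u in \<open>auto simp: idem_Arr[OF Zi A] simp del: D.Arr_iff\<close>)
    show "\<exists>!f. f \<in> Arr (idem_cat C) A (Z, Idt C Z)"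
      by (rule ex1I[of _ "(Idt C Z, zr (fst A) Z, snd A)"])
        (use v in \<open>auto simp: idem_Arr[OF A Zi] simp del: D.Arr_iff\<close>)
  qed
  then show "\<exists>Z. zero_object (idem_cat C) Z" by blast
next
  interpret D: preadditive_category "idem_cat C" by (rule idem_preadditive)
  fix A B assume A: "A \<in> Obj (idem_cat C)" and B: "B \<in> Obj (idem_cat C)"
  note [simp] = idem_ObjD[OF A] idem_ObjD[OF B]
  obtain P where "is_biproduct C (fst A) (fst B) P" using ex_biproduct[of "fst A" "fst B"] by auto
  note [simp] = biproductD[OF this]
  \<comment> \<open>The biproduct in the completion is the biproduct of the underlying objects, cut
    down by the diagonal idempotent.\<close>
  define e where "e = inl P \<cdot> (snd A \<cdot> prl P) \<oplus> inr P \<cdot> (snd B \<cdot> prr P)"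
  have e [simp]: "ar e" "dm e = bob P" "cd e = bob P" by (simp_all add: e_def)
  have e': "prl P \<cdot> e = snd A \<cdot> prl P" "prr P \<cdot> e = snd B \<cdot> prr P"
    "e \<cdot> inl P = inl P \<cdot> snd A" "e \<cdot> inr P = inr P \<cdot> snd B" by (simp_all add: e_def)
  have e'': "e \<cdot> (inl P \<cdot> u) = inl P \<cdot> (snd A \<cdot> u)" if "ar u" "cd u = fst A" for u
    using cmp_extend[OF e'(3), of u] that by simp
  have e''': "e \<cdot> (inr P \<cdot> u) = inr P \<cdot> (snd B \<cdot> u)" if "ar u" "cd u = fst B" for u
    using cmp_extend[OF e'(4), of u] that by simp
  have ee: "e \<cdot> e = e" by (subst (2) e_def) (simp add: e'' e''', simp add: e_def)
  have M: "(bob P, e) \<in> Obj (idem_cat C)" by (simp add: idem_Obj ee)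
  let ?Q = "\<lparr>bob = (bob P, e), inl = (e, inl P \<cdot> snd A, snd A), inr = (e, inr P \<cdot> snd B, snd B),
    prl = (snd A, snd A \<cdot> prl P, e), prr = (snd B, snd B \<cdot> prr P, e)\<rparr>"
  have "is_biproduct (idem_cat C) A B ?Q"
    unfolding is_biproduct_def bip.simps using M
    by (simp add: idem_Arr[OF A M] idem_Arr[OF M A] idem_Arr[OF B M] idem_Arr[OF M B] e' e'' e''' del: D.Arr_iff D.padd_eq)
      (simp add: e_def)
  then show "\<exists>P. is_biproduct (idem_cat C) A B P" by blast
qed

text \<open>An idempotent \<open>r\<close> on \<open>(X, e)\<close> absorbs \<open>e\<close> on both
  sides, so \<open>r\<close> itself, read as an arrow to and from \<open>(X, r)\<close>, provides
  the splitting.\<close>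

lemma idem_idempotent_complete: "idempotent_complete (idem_cat C)"
  unfolding idempotent_complete_def
proof (intro ballI impI)
  fix X t assume X: "X \<in> Obj (idem_cat C)" and t: "t \<in> Arr (idem_cat C) X X" and tt: "t \<cdot>\<^bsub>idem_cat C\<^esub> t = t"
  note [simp] = idem_ObjD[OF X]
  obtain r where r [simp]: "t = (snd X, r, snd X)" "ar r" "dm r = fst X" "cd r = fst X" "r \<cdot> snd X = r" "snd X \<cdot> r = r"
    using idem_ArrE[OF t X X] by blast
  have [simp]: "r \<cdot> r = r" using tt by simp
  have Y: "(fst X, r) \<in> Obj (idem_cat C)" by (simp add: idem_Obj)
  show "\<exists>Y\<in>Obj (idem_cat C). \<exists>r\<in>Arr (idem_cat C) X Y. \<exists>s\<in>Arr (idem_cat C) Y X.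
    t = s \<cdot>\<^bsub>idem_cat C\<^esub> r \<and> r \<cdot>\<^bsub>idem_cat C\<^esub> s = Idt (idem_cat C) Y"
    by (rule bexI[OF _ Y], rule bexI[of _ "(r, r, snd X)"], rule bexI[of _ "(snd X, r, r)"])
      (simp_all add: idem_Arr[OF X Y] idem_Arr[OF Y X])
qed

end

section \<open>The extension groups of the completion\<close>

context biadditive_functor
begin

lemma idem_ext_sel [simp]:
  "\<one>\<^bsub>Ext (idem_ext C E) K A\<^esub> = (snd A, \<one>\<^bsub>Ext E (fst K) (fst A)\<^esub>, snd K)"
  "(x, \<delta>, y) \<otimes>\<^bsub>Ext (idem_ext C E) K A\<^esub> (x', \<delta>', y') = (snd A, \<delta> \<otimes>\<^bsub>Ext E (fst K) (fst A)\<^esub> \<delta>', snd K)"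
  "Act (idem_ext C E) (z, c, x) (y, a, w) (p, \<delta>, q) = (y, Act E c a \<delta>, x)"
  by (simp_all add: idem_ext_def split_beta)

lemma idem_Ext: "t \<in> carrier (Ext (idem_ext C E) K A) \<longleftrightarrow>
    (\<exists>\<delta>. t = (snd A, \<delta>, snd K) \<and> \<delta> \<in> carrier (Ext E (fst K) (fst A)) \<and>
      Act E (Idt C (fst K)) (snd A) \<delta> = \<delta> \<and> Act E (snd K) (Idt C (fst A)) \<delta> = \<delta>)"
  by (cases K; cases A) (auto simp: idem_ext_def push_def pull_def)

lemma act_mult:
  assumes "ar c" "ar a" "\<delta> \<in> carrier (Ext E (cd c) (dm a))" "\<delta>' \<in> carrier (Ext E (cd c) (dm a))" "cd c = K" "dm a = A"
  shows "Act E c a (\<delta> \<otimes>\<^bsub>Ext E K A\<^esub> \<delta>') =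
    Act E c a \<delta> \<otimes>\<^bsub>Ext E (dm c) (cd a)\<^esub> Act E c a \<delta>'"
  using act_hom[of "cd c" "dm c" "dm a" "cd a" c a] assms by (auto simp: hom_def)

lemma idem_ext_comm_group:
  assumes K: "K \<in> Obj (idem_cat C)" and A: "A \<in> Obj (idem_cat C)"
  shows "comm_group (Ext (idem_ext C E) K A)"
proof -
  note [simp] = idem_ObjD[OF A] idem_ObjD[OF K]
  interpret G: comm_group "Ext E (fst K) (fst A)" by (rule ext_group) simp_all
  have act_inv: "Act E c a (inv\<^bsub>Ext E (fst K) (fst A)\<^esub> \<delta>) = inv\<^bsub>Ext E (fst K) (fst A)\<^esub> \<delta>"
    if "\<delta> \<in> carrier (Ext E (fst K) (fst A))" "Act E c a \<delta> = \<delta>" "ar c" "ar a" "dm c = fst K" "cd c = fst K" "dm a = fst A" "cd a = fst A" for c a \<delta>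
  proof (rule G.inv_equality[symmetric])
    show "Act E c a (inv\<^bsub>Ext E (fst K) (fst A)\<^esub> \<delta>) \<otimes>\<^bsub>Ext E (fst K) (fst A)\<^esub> \<delta> = \<one>\<^bsub>Ext E (fst K) (fst A)\<^esub>"
      using act_mult[of c a "inv\<^bsub>Ext E (fst K) (fst A)\<^esub> \<delta>" \<delta> "fst K" "fst A"] that by simp
  qed (use that in auto)
  show ?thesis
  proof (rule comm_groupI)
    fix x assume "x \<in> carrier (Ext (idem_ext C E) K A)"
    then obtain \<delta> where d: "x = (snd A, \<delta>, snd K)" "\<delta> \<in> carrier (Ext E (fst K) (fst A))"
      "Act E (Idt C (fst K)) (snd A) \<delta> = \<delta>" "Act E (snd K) (Idt C (fst A)) \<delta> = \<delta>" unfolding idem_Ext by blast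
    then show "\<one>\<^bsub>Ext (idem_ext C E) K A\<^esub> \<otimes>\<^bsub>Ext (idem_ext C E) K A\<^esub> x = x" by simp
    show "\<exists>y\<in>carrier (Ext (idem_ext C E) K A). y \<otimes>\<^bsub>Ext (idem_ext C E) K A\<^esub> x = \<one>\<^bsub>Ext (idem_ext C E) K A\<^esub>"
      using d act_inv by (intro bexI[of _ "(snd A, inv\<^bsub>Ext E (fst K) (fst A)\<^esub> \<delta>, snd K)"]) (simp_all add: idem_Ext)
  qed (auto simp: idem_Ext G.m_ac act_mult)
qed

lemma idem_biadditive: "biadditive_functor (idem_cat C) (idem_ext C E)"
proof (intro biadditive_functor.intro biadditive_functor_axioms.intro idem_additive, goal_cases)
  case 1
  then show ?case by (rule idem_ext_comm_group)
next
  case (2 K L A B c a)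
  note [simp] = idem_ObjD[OF 2(1)] idem_ObjD[OF 2(2)] idem_ObjD[OF 2(3)] idem_ObjD[OF 2(4)]
  obtain c' where c: "c = (snd K, c', snd L)" and [simp]: "ar c'" "dm c' = fst L" "cd c' = fst K" "c' \<cdot> snd L = c'" "snd K \<cdot> c' = c'"
    using idem_ArrE[OF 2(5,2,1)] by blast
  obtain a' where a: "a = (snd B, a', snd A)" and [simp]: "ar a'" "dm a' = fst A" "cd a' = fst B" "a' \<cdot> snd A = a'" "snd B \<cdot> a' = a'"
    using idem_ArrE[OF 2(6,3,4)] by blast
  show ?case by (rule homI) (auto simp: c a idem_Ext act_mult)
next
  case (3 K A \<delta>)
  note [simp] = idem_ObjD[OF 3(1)] idem_ObjD[OF 3(2)]
  obtain d where d: "\<delta> = (snd A, d, snd K)" "d \<in> carrier (Ext E (fst K) (fst A))"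
      "Act E (Idt C (fst K)) (snd A) d = d" "Act E (snd K) (Idt C (fst A)) d = d" using 3(3) unfolding idem_Ext by blast
  have "Act E (snd K) (snd A) d = Act E (snd K) (Idt C (fst A)) (Act E (Idt C (fst K)) (snd A) d)"
    using d(2) by simp
  then have "Act E (snd K) (snd A) d = d" unfolding d(3) d(4) .
  then show ?case by (simp add: d(1))
next
  case (4 K L M A B D c c' a a' \<delta>)
  note [simp] = idem_ObjD[OF 4(1)] idem_ObjD[OF 4(2)] idem_ObjD[OF 4(3)] idem_ObjD[OF 4(4)] idem_ObjD[OF 4(5)] idem_ObjD[OF 4(6)]
  obtain d where d: "\<delta> = (snd A, d, snd K)" "d \<in> carrier (Ext E (fst K) (fst A))"
    using 4(11) unfolding idem_Ext by blast
  show ?case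
    by (rule idem_ArrE[OF 4(7,2,1)], rule idem_ArrE[OF 4(8,3,2)], rule idem_ArrE[OF 4(9,4,5)], rule idem_ArrE[OF 4(10,5,6)])
      (simp add: d)
next
  case (5 K A B a a' \<delta>)
  note [simp] = idem_ObjD[OF 5(1)] idem_ObjD[OF 5(2)] idem_ObjD[OF 5(3)]
  obtain d where d: "\<delta> = (snd A, d, snd K)" "d \<in> carrier (Ext E (fst K) (fst A))"
    using 5(6) unfolding idem_Ext by blast
  show ?case
    by (rule idem_ArrE[OF 5(4,2,3)], rule idem_ArrE[OF 5(5,2,3)]) (simp add: d push_def act_padd_push)
next
  case (6 K L A c c' \<delta>)
  note [simp] = idem_ObjD[OF 6(1)] idem_ObjD[OF 6(2)] idem_ObjD[OF 6(3)]
  obtain d where d: "\<delta> = (snd A, d, snd K)" "d \<in> carrier (Ext E (fst K) (fst A))"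
    using 6(6) unfolding idem_Ext by blast
  show ?case
    by (rule idem_ArrE[OF 6(4,2,1)], rule idem_ArrE[OF 6(5,2,1)]) (simp add: d pull_def act_padd_pull)
qed

end

section \<open>The realisation of the completion\<close>

locale preadditive_functor = src: preadditive_category C + tgt: preadditive_category D
  for C :: "('o, 'm) cat" (structure) and D :: "('p, 'q) cat" and F :: "('o, 'm, 'p, 'q) cfunctor" +
  assumes additive: "additive_functor C D F"
begin

lemma fob_Obj [simp]: "A \<in> Obj C \<Longrightarrow> fob F A \<in> Obj D"
  and farr_Idt [simp]: "A \<in> Obj C \<Longrightarrow> farr F (Idt C A) = Idt D (fob F A)"
  using additive by (auto simp: additive_functor_def)

lemma farr_hom: "A \<in> Obj C \<Longrightarrow> B \<in> Obj C \<Longrightarrow> farr F \<in> hom (Hom C A B) (Hom D (fob F A) (fob F B))"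
  using additive by (simp add: additive_functor_def)

lemma farr_typed [simp]:
  assumes "src.ar f"
  shows "tgt.ar (farr F f)" "dom_of D (farr F f) = fob F (dom_of C f)" "cod_of D (farr F f) = fob F (cod_of C f)"
proof -
  have "farr F f \<in> Arr D (fob F (dom_of C f)) (fob F (cod_of C f))"
    using farr_hom[OF src.ar_Arr(2,3)[OF assms]] src.ar_Arr(1)[OF assms] by (auto simp: hom_def simp del: tgt.Arr_iff)
  from tgt.dm_cd_eq[OF fob_Obj[OF src.ar_Arr(2)[OF assms]] fob_Obj[OF src.ar_Arr(3)[OF assms]] this]
  show "tgt.ar (farr F f)" "dom_of D (farr F f) = fob F (dom_of C f)" "cod_of D (farr F f) = fob F (cod_of C f)" .
qed

lemma farr_cmp [simp]:
  assumes "src.ar f" "src.ar g" "cod_of C f = dom_of C g"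
  shows "farr F (g \<cdot> f) = farr F g \<cdot>\<^bsub>D\<^esub> farr F f"
  using additive src.ar_Arr[OF assms(1)] src.ar_Arr[OF assms(2)] assms(3) unfolding additive_functor_def by metis

lemma farr_padd [simp]:
  assumes "src.ar f" "src.ar g" "dom_of C g = dom_of C f" "cod_of C g = cod_of C f"
  shows "farr F (src.padd f g) = tgt.padd (farr F f) (farr F g)"
proof -
  have "farr F (f \<otimes>\<^bsub>Hom C (dom_of C f) (cod_of C f)\<^esub> g) =
    farr F f \<otimes>\<^bsub>Hom D (fob F (dom_of C f)) (fob F (cod_of C f))\<^esub> farr F g"
    using farr_hom[OF src.ar_Arr(2,3)[OF assms(1)]] src.ar_Arr(1)[OF assms(1)] src.ar_Arr(1)[OF assms(2)] assms(3,4)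
    by (auto simp: hom_def simp del: src.Arr_iff tgt.Arr_iff src.padd_eq tgt.padd_eq)
  then show ?thesis using assms by simp
qed

lemma farr_zr [simp]:
  assumes "A \<in> Obj C" "B \<in> Obj C"
  shows "farr F \<one>\<^bsub>Hom C A B\<^esub> = \<one>\<^bsub>Hom D (fob F A) (fob F B)\<^esub>"
  using tgt.padd_idem_zr[of "farr F \<one>\<^bsub>Hom C A B\<^esub>"] farr_padd[of "\<one>\<^bsub>Hom C A B\<^esub>" "\<one>\<^bsub>Hom C A B\<^esub>"] assms
  by simp

lemma farr_neg [simp]:
  assumes "src.ar f"
  shows "farr F (src.neg f) = tgt.neg (farr F f)"
  by (rule tgt.neg_unique) (use assms farr_padd[of f "src.neg f"] in auto)

lemma map_cpx_sel [simp]: "ob (map_cpx F X) i = fob F (ob X i)" "df (map_cpx F X) i = farr F (df X i)"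
  by (simp_all add: map_cpx_def)

lemma map_cpx_complexes:
  assumes X: "X \<in> complexes n C"
  shows "map_cpx F X \<in> complexes n D"
proof -
  note [simp] = src.complexesD[OF X]
  have "farr F (df X (Suc i)) \<cdot>\<^bsub>D\<^esub> farr F (df X i) = \<one>\<^bsub>Hom D (fob F (ob X i)) (fob F (ob X (Suc (Suc i))))\<^esub>" if "i < n" for i
    using that farr_cmp[of "df X i" "df X (Suc i)"] by (simp del: farr_cmp)
  then show ?thesis unfolding tgt.complexes_iff by auto
qed

lemma map_chain_maps:
  assumes f: "f \<in> chain_maps n C X Y" and X: "X \<in> complexes n C" and Y: "Y \<in> complexes n C"
  shows "(\<lambda>i. farr F (f i)) \<in> chain_maps n D (map_cpx F X) (map_cpx F Y)"
proof -
  note [simp] = src.complexesD(1-4)[OF X] src.complexesD(1-4)[OF Y] src.chain_mapsD(1-3)[OF f X Y]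
  have "farr F (f (Suc i)) \<cdot>\<^bsub>D\<^esub> farr F (df X i) = farr F (df Y i) \<cdot>\<^bsub>D\<^esub> farr F (f i)" if "i \<le> n" for i
    using that src.chain_mapsD(4)[OF f X Y that] farr_cmp[of "df X i" "f (Suc i)"] farr_cmp[of "f i" "df Y i"]
    by (simp del: farr_cmp)
  then show ?thesis by (subst tgt.chain_maps_iff) auto
qed

lemma map_lifts:
  assumes f: "f \<in> lifts n C X Y a c" and X: "X \<in> complexes n C" and Y: "Y \<in> complexes n C"
  shows "(\<lambda>i. farr F (f i)) \<in> lifts n D (map_cpx F X) (map_cpx F Y) (farr F a) (farr F c)"
  using assms map_chain_maps[of f n X Y] by (auto simp: lifts_def)

end

context realisation
begin

text \<open>\<open>1 - a\<close> and \<open>1 - k\<close> annihilate \<open>\<delta>\<close>, so they are end terms of idempotent chain maps \<open>\<alpha>\<close>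
  in degrees \<open>0, 1\<close> and \<open>\<beta>\<close> in degrees \<open>n, n + 1\<close>. As \<open>\<beta> \<alpha> = 0\<close>, the product \<open>(1 - \<alpha>) (1 - \<beta>)\<close> is
  idempotent.\<close>

lemma idempotent_lift:
  assumes X: "realises n C s K A \<delta> X" and d: "\<delta> \<in> carrier (Ext E K A)"
    and a: "ar a" "dm a = A" "cd a = A" "a \<cdot> a = a" and k: "ar k" "dm k = K" "cd k = K" "k \<cdot> k = k"
    and ad: "Act E (Idt C K) a \<delta> = \<delta>" and kd: "Act E k (Idt C A) \<delta> = \<delta>"
  shows "\<exists>e \<in> lifts n C X X a k. \<forall>i\<le>Suc n. e i \<cdot> e i = e i"
proof -
  note X' = realisesD[OF X] and eX = realises_exangle[OF d X]
  note [simp] = complexesD[OF X'(1)] X'(2-) a k d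
  have akc: "a \<cdot> (a \<cdot> u) = a \<cdot> u" if "ar u" "cd u = A" for u using cmp_extend[OF a(4), of u] that by simp
  have kkc: "k \<cdot> (k \<cdot> u) = k \<cdot> u" if "ar u" "cd u = K" for u using cmp_extend[OF k(4), of u] that by simp
  have [simp]: "0 < n" "Suc 0 \<le> n" "n \<noteq> 0" using n_pos by auto
  interpret G: comm_group "Ext E K A" by (rule ext_group) simp_all
  define p where "p = Idt C A \<oplus> neg a"
  have p [simp]: "ar p" "dm p = A" "cd p = A" by (simp_all add: p_def)
  have pp: "p \<cdot> p = p" by (simp add: p_def padd_norm)
  have "\<delta> = Act E (Idt C K) (a \<oplus> p) \<delta>" by (simp add: p_def padd_norm)
  also have "\<dots> = \<delta> \<otimes>\<^bsub>Ext E K A\<^esub> Act E (Idt C K) p \<delta>" using act_padd_push[of "Idt C K" a p \<delta>] ad by simp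
  finally have pd: "Act E (Idt C K) p \<delta> = \<one>\<^bsub>Ext E K A\<^esub>"
    using G.l_cancel_one'[of \<delta> "Act E (Idt C K) p \<delta>"] by simp
  obtain h where h: "ar h" "dm h = ob X (Suc 0)" "cd h = A" "p = h \<cdot> df X 0"
    by (rule exangle_conE[OF eX, of p A]) (use pd in auto)
  define q where "q = Idt C K \<oplus> neg k"
  have q [simp]: "ar q" "dm q = K" "cd q = K" by (simp_all add: q_def)
  have qq: "q \<cdot> q = q" by (simp add: q_def padd_norm)
  have "\<delta> = Act E (k \<oplus> q) (Idt C A) \<delta>" by (simp add: q_def padd_norm)
  also have "\<dots> = \<delta> \<otimes>\<^bsub>Ext E K A\<^esub> Act E q (Idt C A) \<delta>" using act_padd_pull[of k q "Idt C A" \<delta>] kd by simp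
  finally have qd: "Act E q (Idt C A) \<delta> = \<one>\<^bsub>Ext E K A\<^esub>"
    using G.l_cancel_one'[of \<delta> "Act E q (Idt C A) \<delta>"] by simp
  obtain l where l: "ar l" "dm l = K" "cd l = ob X n" "q = df X n \<cdot> l"
    by (rule exangle_covE[OF eX, of q K]) (use qd in auto)
  note [simp] = h(1-3) l(1-3)
  \<comment> \<open>The idempotent \<open>p = h d\<close> in degree 0 is moved to degree 1 as
    \<open>d p h\<close>, and dually \<open>q = d l\<close> is moved from degree
    \<open>n + 1\<close> to degree \<open>n\<close> as \<open>l q d\<close>.\<close>
  define u where "u = df X 0 \<cdot> (p \<cdot> h)"
  define v where "v = l \<cdot> (q \<cdot> df X n)"
  have u [simp]: "ar u" "dm u = ob X (Suc 0)" "cd u = ob X (Suc 0)" by (simp_all add: u_def)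
  have v [simp]: "ar v" "dm v = ob X n" "cd v = ob X n" by (simp_all add: v_def)
  have hd: "h \<cdot> (df X 0 \<cdot> w) = p \<cdot> w" if "ar w" "cd w = A" for w
    using cmp_extend[OF h(4)[symmetric], of w] that by simp
  have dl: "df X n \<cdot> (l \<cdot> w) = q \<cdot> w" if "ar w" "cd w = K" for w
    using cmp_extend[OF l(4)[symmetric], of w] that by simp
  have ppc: "p \<cdot> (p \<cdot> w) = p \<cdot> w" if "ar w" "cd w = A" for w using cmp_extend[OF pp, of w] that by simp
  have qqc: "q \<cdot> (q \<cdot> w) = q \<cdot> w" if "ar w" "cd w = K" for w using cmp_extend[OF qq, of w] that by simp
  have uu: "u \<cdot> u = u" by (simp add: u_def hd ppc)
  have vv: "v \<cdot> v = v" by (simp add: v_def dl qqc)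
  have ud: "u \<cdot> df X 0 = df X 0 \<cdot> p" by (simp add: u_def h(4)[symmetric] pp)
  have du: "df X (Suc 0) \<cdot> u = zr (ob X (Suc 0)) (ob X (Suc (Suc 0)))"
    using complexesD(6)[OF X'(1), of 0 "p \<cdot> h"] by (simp add: u_def)
  have dv: "df X n \<cdot> v = q \<cdot> df X n" by (simp add: v_def dl qqc)
  obtain n' where n': "n = Suc n'" using n_pos by (cases n) auto
  have vd: "v \<cdot> df X n' = zr (ob X n') (ob X n)"
  proof -
    have "ar (df X n')" "dm (df X n') = ob X n'" "cd (df X n') = ob X n" "ob X n' \<in> Obj C"
      "df X n \<cdot> df X n' = zr (ob X n') (ob X (Suc n))"
      using n' complexesD(5)[OF X'(1), of n'] by auto
    then show ?thesis by (simp add: v_def)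
  qed
  define \<alpha> where "\<alpha> = (\<lambda>i. if i = 0 then p else if i = 1 then u else zr (ob X i) (ob X i))"
  define \<beta> where "\<beta> = (\<lambda>i. if i = Suc n then q else if i = n then v else zr (ob X i) (ob X i))"
  have [simp]: "ar (\<alpha> i)" "dm (\<alpha> i) = ob X i" "cd (\<alpha> i) = ob X i" "ar (\<beta> i)" "dm (\<beta> i) = ob X i" "cd (\<beta> i) = ob X i"
    if "i \<le> Suc n" for i using that by (auto simp: \<alpha>_def \<beta>_def)
  have \<alpha>\<alpha>: "\<alpha> i \<cdot> \<alpha> i = \<alpha> i" if "i \<le> Suc n" for i using that pp uu by (auto simp: \<alpha>_def)
  have \<beta>\<beta>: "\<beta> i \<cdot> \<beta> i = \<beta> i" if "i \<le> Suc n" for i using that qq vv by (auto simp: \<beta>_def)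
  \<comment> \<open>The supports \<open>0, 1\<close> and \<open>n, n + 1\<close> overlap only for
    \<open>n = 1\<close>, in degree 1. There \<open>v u\<close> contains two consecutive
    differentials.\<close>
  have \<beta>\<alpha>: "\<beta> i \<cdot> \<alpha> i = zr (ob X i) (ob X i)" if "i \<le> Suc n" for i
  proof (cases "i = 1 \<and> n = 1")
    case True
    then have o: "ob X (Suc 0) = ob X n" "df X (Suc 0) = df X n" "ob X (Suc (Suc 0)) = K" "ob X i = ob X n"
      using X'(3) by auto
    have "v \<cdot> u = l \<cdot> (q \<cdot> (df X n \<cdot> u))" by (simp add: v_def o(1))
    then have "v \<cdot> u = zr (ob X i) (ob X i)" unfolding du[unfolded o] o by simp
    then show ?thesis using True by (simp add: \<alpha>_def \<beta>_def)
  qed (use that n_pos in \<open>auto simp: \<alpha>_def \<beta>_def\<close>)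
  have ac: "\<alpha> (Suc i) \<cdot> df X i = df X i \<cdot> \<alpha> i" if "i \<le> n" for i
    using that ud du by (auto simp: \<alpha>_def)
  have bc: "\<beta> (Suc i) \<cdot> df X i = df X i \<cdot> \<beta> i" if "i \<le> n" for i
  proof -
    consider "i = n" | "i = n'" | "i \<noteq> n" "Suc i \<noteq> n" using n' by auto
    then show ?thesis using that dv vd n' by cases (auto simp: \<beta>_def)
  qed
  have bc': "\<beta> (Suc i) \<cdot> (df X i \<cdot> w) = df X i \<cdot> (\<beta> i \<cdot> w)" if "i \<le> n" "ar w" "cd w = ob X i" for i w
    using cmp_extend[OF bc, of i w] that by simp
  have ac': "\<alpha> (Suc i) \<cdot> (df X i \<cdot> w) = df X i \<cdot> (\<alpha> i \<cdot> w)" if "i \<le> n" "ar w" "cd w = ob X i" for i w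
    using cmp_extend[OF ac, of i w] that by simp
  \<comment> \<open>The order of the factors matters: \<open>\<beta> \<alpha> = 0\<close> is known,
    and with it \<open>\<alpha> e = 0\<close> and \<open>\<beta> e = 0\<close>, hence
    \<open>e e = e\<close>.\<close>
  define e where "e i = (Idt C (ob X i) \<oplus> neg (\<alpha> i)) \<cdot> (Idt C (ob X i) \<oplus> neg (\<beta> i))" for i
  have "e \<in> chain_maps n C X X"
    by (subst chain_maps_iff) (auto simp: e_def ac bc ac' bc')
  moreover have "e 0 = a" by (simp add: e_def \<alpha>_def \<beta>_def p_def padd_norm)
  moreover have "e (Suc n) = k" using n_pos by (simp add: e_def \<alpha>_def \<beta>_def q_def padd_norm)
  moreover have "e i \<cdot> e i = e i" if i: "i \<le> Suc n" for i
  proof -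
    have 1: "\<beta> i \<cdot> (\<alpha> i \<cdot> w) = zr (dm w) (ob X i)" if "ar w" "cd w = ob X i" for w
      using cmp_extend[OF \<beta>\<alpha>[OF i], of w] i that by simp
    have 2: "\<alpha> i \<cdot> (\<alpha> i \<cdot> w) = \<alpha> i \<cdot> w" if "ar w" "cd w = ob X i" for w
      using cmp_extend[OF \<alpha>\<alpha>[OF i], of w] i that by simp
    have 3: "\<beta> i \<cdot> (\<beta> i \<cdot> w) = \<beta> i \<cdot> w" if "ar w" "cd w = ob X i" for w
      using cmp_extend[OF \<beta>\<beta>[OF i], of w] i that by simp
    have 4: "\<beta> i \<cdot> e i = zr (ob X i) (ob X i)" unfolding e_def using i by (simp add: 1 \<beta>\<beta> \<beta>\<alpha>)
    have 5: "\<alpha> i \<cdot> e i = zr (ob X i) (ob X i)" unfolding e_def using i by (simp add: 2 \<alpha>\<alpha> padd_norm)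
    have et: "ar (e i)" "dm (e i) = ob X i" "cd (e i) = ob X i" using i by (simp_all add: e_def)
    have "e i \<cdot> e i = ((Idt C (ob X i) \<oplus> neg (\<alpha> i)) \<cdot> (Idt C (ob X i) \<oplus> neg (\<beta> i))) \<cdot> e i"
      by (subst (1) e_def) (rule refl)
    also have "\<dots> = e i" using i et by (simp add: 4 5)
    finally show ?thesis .
  qed
  ultimately show ?thesis by (auto simp: lifts_def)
qed

section \<open>The inclusion of the category into its completion\<close>

interpretation D: biadditive_functor "idem_cat C" "idem_ext C E" by (rule idem_biadditive)

lemma incl_Obj [simp]: "A \<in> Obj C \<Longrightarrow> (A, Idt C A) \<in> Obj (idem_cat C)"
  by (simp add: idem_Obj)

lemma incl_sel: "fob (idem_incl C) A = (A, Idt C A)" "farr (idem_incl C) f = (Idt C (cd f), f, Idt C (dm f))"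
  by (simp_all add: idem_incl_def)

lemma incl_additive: "additive_functor C (idem_cat C) (idem_incl C)"
  unfolding additive_functor_def
proof (intro conjI)
  show "\<forall>A\<in>Obj C. \<forall>B\<in>Obj C. farr (idem_incl C) \<in> hom (Hom C A B) (Hom (idem_cat C) (fob (idem_incl C) A) (fob (idem_incl C) B))"
  proof (intro ballI homI)
    fix A B f assume AB: "A \<in> Obj C" "B \<in> Obj C" and f: "f \<in> Arr C A B"
    have o: "(A, Idt C A) \<in> Obj (idem_cat C)" "(B, Idt C B) \<in> Obj (idem_cat C)" using AB by auto
    show "farr (idem_incl C) f \<in> Arr (idem_cat C) (fob (idem_incl C) A) (fob (idem_incl C) B)"
      using AB f by (simp add: incl_sel idem_Arr[OF o] del: D.Arr_iff)
    fix g assume g: "g \<in> Arr C A B"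
    show "farr (idem_incl C) (f \<otimes>\<^bsub>Hom C A B\<^esub> g) =
      farr (idem_incl C) f \<otimes>\<^bsub>Hom (idem_cat C) (fob (idem_incl C) A) (fob (idem_incl C) B)\<^esub> farr (idem_incl C) g"
      using AB f g by (simp add: incl_sel del: D.padd_eq)
  qed
qed (auto simp: incl_sel)

interpretation I: preadditive_functor C "idem_cat C" "idem_incl C"
  by (intro preadditive_functor.intro preadditive_functor_axioms.intro incl_additive) unfold_locales

text \<open>A test object \<open>(W, w)\<close> is a summand of \<open>W\<close>. The underlying
  arrow is factored in \<open>C\<close>, and composing the factor with \<open>w\<close> on the outer
  side makes it an arrow of the completion without changing the product.\<close>

lemma incl_exangle:
  assumes X: "exangle n C E X \<delta>"
  shows "exangle n (idem_cat C) (idem_ext C E) (map_cpx (idem_incl C) X)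
    (idem_incl_ext C (ob X (Suc n)) (ob X 0) \<delta>)"
proof -
  note X' = exangleD(1)[OF X]
  note [simp] = complexesD[OF X'] exangleD(2)[OF X]
  show ?thesis
    unfolding D.exangle_iff
  proof (intro conjI allI impI)
    show "map_cpx (idem_incl C) X \<in> complexes n (idem_cat C)" by (rule I.map_cpx_complexes[OF X'])
    show "idem_incl_ext C (ob X (Suc n)) (ob X 0) \<delta>
      \<in> carrier (Ext (idem_ext C E) (ob (map_cpx (idem_incl C) X) (Suc n)) (ob (map_cpx (idem_incl C) X) 0))"
      by (simp add: idem_incl_ext_def idem_Ext incl_sel)
  next
    fix j u assume a: "j < n \<and> D.ar u \<and> D.cd u = ob (map_cpx (idem_incl C) X) (Suc j) \<and>
      df (map_cpx (idem_incl C) X) (Suc j) \<cdot>\<^bsub>idem_cat C\<^esub> u = D.zr (D.dm u) (ob (map_cpx (idem_incl C) X) (Suc (Suc j)))"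
    then have j: "j < n" by simp
    define W where "W = D.dm u"
    have W: "W \<in> Obj (idem_cat C)" unfolding W_def using a by simp
    note [simp] = idem_ObjD[OF W]
    have au: "D.ar u" "D.dm u = W" "D.cd u = (ob X (Suc j), Idt C (ob X (Suc j)))" using a by (simp_all add: W_def incl_sel)
    obtain r where r: "u = (Idt C (ob X (Suc j)), r, snd W)" "ar r" "dm r = fst W" "cd r = ob X (Suc j)" "r \<cdot> snd W = r"
      by (rule idem_typedE[OF au, unfolded fst_conv snd_conv]) blast
    have "df X (Suc j) \<cdot> r = zr (fst W) (ob X (Suc (Suc j)))"
      using a r j unfolding W_def[symmetric] by (simp add: incl_sel)
    then obtain v where v: "ar v" "dm v = fst W" "cd v = ob X j" "r = df X j \<cdot> v"
      using exangle_cov[OF X j r(2,3,4)] by blast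
    have o: "(ob X j, Idt C (ob X j)) \<in> Obj (idem_cat C)" using j by simp
    have t: "D.ar (Idt C (ob X j), v \<cdot> snd W, snd W)" "D.dm (Idt C (ob X j), v \<cdot> snd W, snd W) = W"
      "D.cd (Idt C (ob X j), v \<cdot> snd W, snd W) = (ob X j, Idt C (ob X j))"
      by (rule idem_typed[OF W o]; use v j in simp)+
    show "\<exists>v. D.ar v \<and> D.dm v = D.dm u \<and> D.cd v = ob (map_cpx (idem_incl C) X) j \<and>
      u = df (map_cpx (idem_incl C) X) j \<cdot>\<^bsub>idem_cat C\<^esub> v"
      unfolding W_def[symmetric]
      by (intro exI[of _ "(Idt C (ob X j), v \<cdot> snd W, snd W)"] conjI t)
        (use t r v j in \<open>simp_all add: incl_sel\<close>)
  next
    fix u assume a: "D.ar u \<and> D.cd u = ob (map_cpx (idem_incl C) X) (Suc n) \<and>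
      Act (idem_ext C E) u (Idt (idem_cat C) (ob (map_cpx (idem_incl C) X) 0)) (idem_incl_ext C (ob X (Suc n)) (ob X 0) \<delta>) =
      \<one>\<^bsub>Ext (idem_ext C E) (D.dm u) (ob (map_cpx (idem_incl C) X) 0)\<^esub>"
    define W where "W = D.dm u"
    have W: "W \<in> Obj (idem_cat C)" unfolding W_def using a by simp
    note [simp] = idem_ObjD[OF W]
    have au: "D.ar u" "D.dm u = W" "D.cd u = (ob X (Suc n), Idt C (ob X (Suc n)))" using a by (simp_all add: W_def incl_sel)
    obtain r where r: "u = (Idt C (ob X (Suc n)), r, snd W)" "ar r" "dm r = fst W" "cd r = ob X (Suc n)" "r \<cdot> snd W = r"
      by (rule idem_typedE[OF au, unfolded fst_conv snd_conv]) blast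
    have "Act E r (Idt C (ob X 0)) \<delta> = \<one>\<^bsub>Ext E (fst W) (ob X 0)\<^esub>"
      using a r unfolding W_def[symmetric] by (simp add: incl_sel idem_incl_ext_def)
    then obtain v where v: "ar v" "dm v = fst W" "cd v = ob X n" "r = df X n \<cdot> v"
      using exangle_covE[OF X r(2,3,4)] by blast
    have o: "(ob X n, Idt C (ob X n)) \<in> Obj (idem_cat C)" by simp
    have t: "D.ar (Idt C (ob X n), v \<cdot> snd W, snd W)" "D.dm (Idt C (ob X n), v \<cdot> snd W, snd W) = W"
      "D.cd (Idt C (ob X n), v \<cdot> snd W, snd W) = (ob X n, Idt C (ob X n))"
      by (rule idem_typed[OF W o]; use v in simp)+
    show "\<exists>v. D.ar v \<and> D.dm v = D.dm u \<and> D.cd v = ob (map_cpx (idem_incl C) X) n \<and>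
      u = df (map_cpx (idem_incl C) X) n \<cdot>\<^bsub>idem_cat C\<^esub> v"
      unfolding W_def[symmetric]
      by (intro exI[of _ "(Idt C (ob X n), v \<cdot> snd W, snd W)"] conjI t)
        (use t r v in \<open>simp_all add: incl_sel\<close>)
  next
    fix j u assume a: "j < n \<and> D.ar u \<and> D.dm u = ob (map_cpx (idem_incl C) X) (Suc j) \<and>
      u \<cdot>\<^bsub>idem_cat C\<^esub> df (map_cpx (idem_incl C) X) j = D.zr (ob (map_cpx (idem_incl C) X) j) (D.cd u)"
    then have j: "j < n" by simp
    define W where "W = D.cd u"
    have W: "W \<in> Obj (idem_cat C)" unfolding W_def using a by simp
    note [simp] = idem_ObjD[OF W]
    have au: "D.ar u" "D.dm u = (ob X (Suc j), Idt C (ob X (Suc j)))" "D.cd u = W" using a by (simp_all add: W_def incl_sel)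
    obtain r where r: "u = (snd W, r, Idt C (ob X (Suc j)))" "ar r" "dm r = ob X (Suc j)" "cd r = fst W" "snd W \<cdot> r = r"
      by (rule idem_typedE[OF au, unfolded fst_conv snd_conv]) blast
    have "r \<cdot> df X j = zr (ob X j) (fst W)"
      using a r j unfolding W_def[symmetric] by (simp add: incl_sel)
    then obtain v where v: "ar v" "dm v = ob X (Suc (Suc j))" "cd v = fst W" "r = v \<cdot> df X (Suc j)"
      using exangle_con[OF X j r(2,3,4)] by blast
    have o: "(ob X (Suc (Suc j)), Idt C (ob X (Suc (Suc j)))) \<in> Obj (idem_cat C)" using j by simp
    have t: "D.ar (snd W, snd W \<cdot> v, Idt C (ob X (Suc (Suc j))))" "D.dm (snd W, snd W \<cdot> v, Idt C (ob X (Suc (Suc j)))) = (ob X (Suc (Suc j)), Idt C (ob X (Suc (Suc j))))"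
      "D.cd (snd W, snd W \<cdot> v, Idt C (ob X (Suc (Suc j)))) = W"
      by (rule idem_typed[OF o W]; use v j in simp)+
    show "\<exists>v. D.ar v \<and> D.dm v = ob (map_cpx (idem_incl C) X) (Suc (Suc j)) \<and> D.cd v = D.cd u \<and>
      u = v \<cdot>\<^bsub>idem_cat C\<^esub> df (map_cpx (idem_incl C) X) (Suc j)"
      unfolding W_def[symmetric]
      by (intro exI[of _ "(snd W, snd W \<cdot> v, Idt C (ob X (Suc (Suc j))))"] conjI t)
        (use t r v j in \<open>simp_all add: incl_sel\<close>)
  next
    fix u assume a: "D.ar u \<and> D.dm u = ob (map_cpx (idem_incl C) X) 0 \<and>
      Act (idem_ext C E) (Idt (idem_cat C) (ob (map_cpx (idem_incl C) X) (Suc n))) u (idem_incl_ext C (ob X (Suc n)) (ob X 0) \<delta>) =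
      \<one>\<^bsub>Ext (idem_ext C E) (ob (map_cpx (idem_incl C) X) (Suc n)) (D.cd u)\<^esub>"
    define W where "W = D.cd u"
    have W: "W \<in> Obj (idem_cat C)" unfolding W_def using a by simp
    note [simp] = idem_ObjD[OF W]
    have au: "D.ar u" "D.dm u = (ob X 0, Idt C (ob X 0))" "D.cd u = W" using a by (simp_all add: W_def incl_sel)
    obtain r where r: "u = (snd W, r, Idt C (ob X 0))" "ar r" "dm r = ob X 0" "cd r = fst W" "snd W \<cdot> r = r"
      by (rule idem_typedE[OF au, unfolded fst_conv snd_conv]) blast
    have "Act E (Idt C (ob X (Suc n))) r \<delta> = \<one>\<^bsub>Ext E (ob X (Suc n)) (fst W)\<^esub>"
      using a r unfolding W_def[symmetric] by (simp add: incl_sel idem_incl_ext_def)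
    then obtain v where v: "ar v" "dm v = ob X (Suc 0)" "cd v = fst W" "r = v \<cdot> df X 0"
      using exangle_conE[OF X r(2,3,4)] by blast
    have o: "(ob X (Suc 0), Idt C (ob X (Suc 0))) \<in> Obj (idem_cat C)" by simp
    have t: "D.ar (snd W, snd W \<cdot> v, Idt C (ob X (Suc 0)))" "D.dm (snd W, snd W \<cdot> v, Idt C (ob X (Suc 0))) = (ob X (Suc 0), Idt C (ob X (Suc 0)))"
      "D.cd (snd W, snd W \<cdot> v, Idt C (ob X (Suc 0))) = W"
      by (rule idem_typed[OF o W]; use v in simp)+
    show "\<exists>v. D.ar v \<and> D.dm v = ob (map_cpx (idem_incl C) X) (Suc 0) \<and> D.cd v = D.cd u \<and>
      u = v \<cdot>\<^bsub>idem_cat C\<^esub> df (map_cpx (idem_incl C) X) 0"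
      unfolding W_def[symmetric]
      by (intro exI[of _ "(snd W, snd W \<cdot> v, Idt C (ob X (Suc 0)))"] conjI t)
        (use t r v in \<open>simp_all add: incl_sel\<close>)
  qed (use exangleD(3,4)[OF X] in \<open>simp_all add: incl_sel idem_incl_ext_def\<close>)
qed

lemma idem_cpx_sel: "ob (idem_cpx C X e) i = (ob X i, e i)"
  "df (idem_cpx C X e) i = (e (Suc i), e (Suc i) \<cdot> df X i \<cdot> e i, e i)"
  by (simp_all add: idem_cpx_def)

text \<open>Each component \<open>e i\<close> serves both as the inclusion of \<open>(X, e)\<close>
  into the image of \<open>X\<close> and as the projection back. As their composite
  \<open>e e\<close> is the identity of \<open>(X, e)\<close>, this is a strict retract.\<close>

lemma idem_cpx_props:
  assumes X: "X \<in> complexes n C" and e: "e \<in> chain_maps n C X X" and ee: "\<forall>i\<le>Suc n. e i \<cdot> e i = e i"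
  shows "idem_cpx C X e \<in> complexes n (idem_cat C)"
    "(\<lambda>i. (Idt C (ob X i), e i, e i)) \<in> chain_maps n (idem_cat C) (idem_cpx C X e) (map_cpx (idem_incl C) X)"
    "(\<lambda>i. (e i, e i, Idt C (ob X i))) \<in> chain_maps n (idem_cat C) (map_cpx (idem_incl C) X) (idem_cpx C X e)"
proof -
  note [simp] = complexesD[OF X] chain_mapsD[OF e X X]
  have ee' [simp]: "e i \<cdot> e i = e i" if "i \<le> Suc n" for i using ee that by blast
  have eec [simp]: "e i \<cdot> (e i \<cdot> u) = e i \<cdot> u" if "i \<le> Suc n" "ar u" "cd u = ob X i" for i u
    using cmp_extend[OF ee', of i u] that by simp
  have o: "(ob X i, e i) \<in> Obj (idem_cat C)" if "i \<le> Suc n" for i using that by (simp add: idem_Obj)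
  have oI: "(ob X i, Idt C (ob X i)) \<in> Obj (idem_cat C)" if "i \<le> Suc n" for i using that by simp
  have d: "D.ar (df (idem_cpx C X e) i)" "D.dm (df (idem_cpx C X e) i) = (ob X i, e i)"
    "D.cd (df (idem_cpx C X e) i) = (ob X (Suc i), e (Suc i))" if "i \<le> n" for i
    unfolding idem_cpx_sel by (rule idem_typed[OF o o]; use that in simp)+
  have i: "D.ar (Idt C (ob X i), e i, e i)" "D.dm (Idt C (ob X i), e i, e i) = (ob X i, e i)"
    "D.cd (Idt C (ob X i), e i, e i) = (ob X i, Idt C (ob X i))" if "i \<le> Suc n" for i
    by (rule idem_typed[OF o oI]; use that in simp)+
  have p: "D.ar (e i, e i, Idt C (ob X i))" "D.dm (e i, e i, Idt C (ob X i)) = (ob X i, Idt C (ob X i))"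
    "D.cd (e i, e i, Idt C (ob X i)) = (ob X i, e i)" if "i \<le> Suc n" for i
    by (rule idem_typed[OF oI o]; use that in simp)+
  have "df (idem_cpx C X e) (Suc i) \<cdot>\<^bsub>idem_cat C\<^esub> df (idem_cpx C X e) i =
    D.zr (ob X i, e i) (ob X (Suc (Suc i)), e (Suc (Suc i)))" if "i < n" for i
    using that by (simp add: idem_cpx_sel)
  then show Z: "idem_cpx C X e \<in> complexes n (idem_cat C)"
    unfolding D.complexes_iff using o d by (auto simp: idem_cpx_sel(1))
  note IX = I.map_cpx_complexes[OF X]
  show "(\<lambda>i. (Idt C (ob X i), e i, e i)) \<in> chain_maps n (idem_cat C) (idem_cpx C X e) (map_cpx (idem_incl C) X)"
    by (subst D.chain_maps_iff)
      (use D.complexesD(1)[OF Z] D.complexesD(1)[OF IX] i in \<open>simp_all add: incl_sel idem_cpx_sel\<close>)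
  show "(\<lambda>i. (e i, e i, Idt C (ob X i))) \<in> chain_maps n (idem_cat C) (map_cpx (idem_incl C) X) (idem_cpx C X e)"
    by (subst D.chain_maps_iff)
      (use D.complexesD(1)[OF Z] D.complexesD(1)[OF IX] p in \<open>simp_all add: incl_sel idem_cpx_sel\<close>)
qed

text \<open>The choice hidden in \<open>idem_real\<close> is opened here once;
  \<open>idempotent_lift\<close> guarantees that there is something to choose. Afterwards only the
  resulting strict retract of an included realisation is used.\<close>

lemma idem_real_obtain:
  assumes K: "K \<in> Obj (idem_cat C)" and A: "A \<in> Obj (idem_cat C)" and t: "t \<in> carrier (Ext (idem_ext C E) K A)"
  obtains \<delta> X e where "t = (snd A, \<delta>, snd K)" "\<delta> \<in> carrier (Ext E (fst K) (fst A))"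
    "Act E (Idt C (fst K)) (snd A) \<delta> = \<delta>" "Act E (snd K) (Idt C (fst A)) \<delta> = \<delta>"
    "realises n C s (fst K) (fst A) \<delta> X"
    "realises n (idem_cat C) (idem_real n C s) K A t (idem_cpx C X e)"
    "exangle n (idem_cat C) (idem_ext C E) (idem_cpx C X e) t"
    "(\<lambda>i. (Idt C (ob X i), e i, e i)) \<in> lifts n (idem_cat C) (idem_cpx C X e) (map_cpx (idem_incl C) X)
      (Idt C (fst A), snd A, snd A) (Idt C (fst K), snd K, snd K)"
    "(\<lambda>i. (e i, e i, Idt C (ob X i))) \<in> lifts n (idem_cat C) (map_cpx (idem_incl C) X) (idem_cpx C X e)
      (snd A, snd A, Idt C (fst A)) (snd K, snd K, Idt C (fst K))"
proof -
  note [simp] = idem_ObjD[OF K] idem_ObjD[OF A]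
  obtain \<delta> where d: "t = (snd A, \<delta>, snd K)" "\<delta> \<in> carrier (Ext E (fst K) (fst A))"
    "Act E (Idt C (fst K)) (snd A) \<delta> = \<delta>" "Act E (snd K) (Idt C (fst A)) \<delta> = \<delta>"
    using t unfolding idem_Ext by blast
  define P where "P = (\<lambda>(X, e). realises n C s (fst K) (fst A) \<delta> X \<and> e \<in> lifts n C X X (snd A) (snd K) \<and>
                     (\<forall>i\<le>n+1. e i \<cdot> e i = e i))"
  obtain X0 where X0: "realises n C s (fst K) (fst A) \<delta> X0" using realised[of "fst K" "fst A" \<delta>] d by auto
  obtain e0 where "e0 \<in> lifts n C X0 X0 (snd A) (snd K)" "\<forall>i\<le>Suc n. e0 i \<cdot> e0 i = e0 i"
    using idempotent_lift[OF X0 d(2) _ _ _ _ _ _ _ _ d(3,4)] by auto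
  then have "P (X0, e0)" using X0 by (simp add: P_def)
  then have "P (SOME x. P x)" by (rule someI)
  moreover obtain X e where Xe: "(SOME x. P x) = (X, e)" by (cases "SOME x. P x")
  ultimately have P: "realises n C s (fst K) (fst A) \<delta> X" "e \<in> lifts n C X X (snd A) (snd K)" "\<forall>i\<le>Suc n. e i \<cdot> e i = e i"
    by (simp_all add: P_def)
  have r: "idem_real n C s K A t = iso_class n (idem_cat C) A K (idem_cpx C X e)"
    using Xe unfolding idem_real_def d(1) P_def by (simp add: case_prod_unfold)
  note X' = realisesD[OF P(1)]
  have e: "e \<in> chain_maps n C X X" "e 0 = snd A" "e (Suc n) = snd K" using P(2) by (auto simp: lifts_def)
  note pr = idem_cpx_props[OF X'(1) e(1) P(3)]
  have Zb: "idem_cpx C X e \<in> complexes_between n (idem_cat C) A K"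
    using pr(1) e X' by (simp add: D.complexes_between_iff idem_cpx_sel prod_eq_iff)
  have i: "(\<lambda>i. (Idt C (ob X i), e i, e i)) \<in> lifts n (idem_cat C) (idem_cpx C X e) (map_cpx (idem_incl C) X)
      (Idt C (fst A), snd A, snd A) (Idt C (fst K), snd K, snd K)"
    and p: "(\<lambda>i. (e i, e i, Idt C (ob X i))) \<in> lifts n (idem_cat C) (map_cpx (idem_incl C) X) (idem_cpx C X e)
      (snd A, snd A, Idt C (fst A)) (snd K, snd K, Idt C (fst K))"
    using pr(2,3) e X' by (simp_all add: lifts_def)
  have ak: "Act E (snd K) (snd A) \<delta> = \<delta>"
  proof -
    have "Act E (snd K) (snd A) \<delta> = Act E (snd K) (Idt C (fst A)) (Act E (Idt C (fst K)) (snd A) \<delta>)"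
      using d(2) by simp
    then show ?thesis unfolding d(3,4) .
  qed
  have "exangle n (idem_cat C) (idem_ext C E) (idem_cpx C X e) t"
  proof (rule D.exangle_strict_retract[OF incl_exangle[OF realises_exangle[OF d(2) P(1)]] pr(1) _ pr(2,3)])
    show "t \<in> carrier (Ext (idem_ext C E) (ob (idem_cpx C X e) (Suc n)) (ob (idem_cpx C X e) 0))"
      using t Zb by (simp add: D.complexes_between_iff)
    show "(e j, e j, Idt C (ob X j)) \<cdot>\<^bsub>idem_cat C\<^esub> (Idt C (ob X j), e j, e j) = Idt (idem_cat C) (ob (idem_cpx C X e) j)" if "j \<le> Suc n" for j
      using that P(3) by (simp add: idem_cpx_sel)
  qed (use d ak e X' in \<open>simp_all add: idem_cpx_sel incl_sel idem_incl_ext_def\<close>)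
  then show ?thesis using that[OF d P(1) _ _ i p] r Zb by (simp add: realises_def)
qed

text \<open>The analogue of \<open>realises_iff\<close> at a stage where (R0) is not yet known for
  the completion: a single representative that is an exangle suffices for it.\<close>

lemma realises_idem_iff:
  assumes Z: "realises n (idem_cat C) (idem_real n C s) K A t Z" and eZ: "exangle n (idem_cat C) (idem_ext C E) Z t"
  shows "realises n (idem_cat C) (idem_real n C s) K A t Y \<longleftrightarrow> Y \<in> complexes_between n (idem_cat C) A K \<and>
    exangle n (idem_cat C) (idem_ext C E) Y t \<and>
    (\<exists>f. f \<in> lifts n (idem_cat C) Z Y (Idt (idem_cat C) A) (Idt (idem_cat C) K)) \<and>
    (\<exists>f. f \<in> lifts n (idem_cat C) Y Z (Idt (idem_cat C) A) (Idt (idem_cat C) K))"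
proof -
  have Zb: "Z \<in> complexes_between n (idem_cat C) A K" using Z by (simp add: realises_def)
  have "realises n (idem_cat C) (idem_real n C s) K A t Y \<longleftrightarrow> Y \<in> iso_class n (idem_cat C) A K Z"
  proof
    assume "realises n (idem_cat C) (idem_real n C s) K A t Y"
    then show "Y \<in> iso_class n (idem_cat C) A K Z"
      using Z D.iso_class_refl[of Y n A K] unfolding realises_def by blast
  next
    assume Y: "Y \<in> iso_class n (idem_cat C) A K Z"
    then have "iso_class n (idem_cat C) A K Z = iso_class n (idem_cat C) A K Y"
      using D.iso_class_eq[OF n_pos eZ _ Zb] unfolding D.iso_class_iff[OF eZ n_pos Zb] by blast
    then show "realises n (idem_cat C) (idem_real n C s) K A t Y"
      using Z Y unfolding realises_def iso_class_def[of n "idem_cat C" A K Z] by auto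
  qed
  then show ?thesis unfolding D.iso_class_iff[OF eZ n_pos Zb] .
qed

lemma idem_realisation: "realisation n (idem_cat C) (idem_ext C E) (idem_real n C s)"
proof (intro realisation.intro realisation_axioms.intro idem_biadditive n_pos)
  fix K A t assume a: "K \<in> Obj (idem_cat C)" "A \<in> Obj (idem_cat C)" "t \<in> carrier (Ext (idem_ext C E) K A)"
  show "\<exists>X. realises n (idem_cat C) (idem_real n C s) K A t X"
    by (rule idem_real_obtain[OF a]) blast
  fix Y assume Y: "realises n (idem_cat C) (idem_real n C s) K A t Y"
  obtain X e where Z: "realises n (idem_cat C) (idem_real n C s) K A t (idem_cpx C X e)"
    "exangle n (idem_cat C) (idem_ext C E) (idem_cpx C X e) t"
    by (rule idem_real_obtain[OF a]) blast
  show "exangle n (idem_cat C) (idem_ext C E) Y t"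
    using Y unfolding realises_idem_iff[OF Z] by blast
next
  fix K A L B t u a c X Y
  assume o: "K \<in> Obj (idem_cat C)" "A \<in> Obj (idem_cat C)" "L \<in> Obj (idem_cat C)" "B \<in> Obj (idem_cat C)"
    and t: "t \<in> carrier (Ext (idem_ext C E) K A)" and u: "u \<in> carrier (Ext (idem_ext C E) L B)"
    and a: "a \<in> Arr (idem_cat C) A B" and c: "c \<in> Arr (idem_cat C) K L"
    and eq: "push (idem_cat C) (idem_ext C E) K a t = pull (idem_cat C) (idem_ext C E) B c u"
    and X: "realises n (idem_cat C) (idem_real n C s) K A t X" and Y: "realises n (idem_cat C) (idem_real n C s) L B u Y"
  note [simp] = idem_ObjD[OF o(1)] idem_ObjD[OF o(2)] idem_ObjD[OF o(3)] idem_ObjD[OF o(4)]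
  obtain \<delta> V e where d: "t = (snd A, \<delta>, snd K)" "\<delta> \<in> carrier (Ext E (fst K) (fst A))"
    "Act E (Idt C (fst K)) (snd A) \<delta> = \<delta>" "Act E (snd K) (Idt C (fst A)) \<delta> = \<delta>"
    and V: "realises n C s (fst K) (fst A) \<delta> V"
    and ZV: "realises n (idem_cat C) (idem_real n C s) K A t (idem_cpx C V e)" "exangle n (idem_cat C) (idem_ext C E) (idem_cpx C V e) t"
    and i: "(\<lambda>i. (Idt C (ob V i), e i, e i)) \<in> lifts n (idem_cat C) (idem_cpx C V e) (map_cpx (idem_incl C) V)
      (Idt C (fst A), snd A, snd A) (Idt C (fst K), snd K, snd K)"
    by (rule idem_real_obtain[OF o(1,2) t]) blast
  obtain \<epsilon> W f where e: "u = (snd B, \<epsilon>, snd L)" "\<epsilon> \<in> carrier (Ext E (fst L) (fst B))"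
    "Act E (Idt C (fst L)) (snd B) \<epsilon> = \<epsilon>" "Act E (snd L) (Idt C (fst B)) \<epsilon> = \<epsilon>"
    and W: "realises n C s (fst L) (fst B) \<epsilon> W"
    and ZW: "realises n (idem_cat C) (idem_real n C s) L B u (idem_cpx C W f)" "exangle n (idem_cat C) (idem_ext C E) (idem_cpx C W f) u"
    and p: "(\<lambda>i. (f i, f i, Idt C (ob W i))) \<in> lifts n (idem_cat C) (map_cpx (idem_incl C) W) (idem_cpx C W f)
      (snd B, snd B, Idt C (fst B)) (snd L, snd L, Idt C (fst L))"
    by (rule idem_real_obtain[OF o(3,4) u]) blast
  obtain a' where a': "a = (snd B, a', snd A)" and a'' [simp]: "ar a'" "dm a' = fst A" "cd a' = fst B" "a' \<cdot> snd A = a'" "snd B \<cdot> a' = a'"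
    using idem_ArrE[OF a o(2,4)] by blast
  obtain c' where c': "c = (snd L, c', snd K)" and c'' [simp]: "ar c'" "dm c' = fst K" "cd c' = fst L" "c' \<cdot> snd K = c'" "snd L \<cdot> c' = c'"
    using idem_ArrE[OF c o(1,3)] by blast
  \<comment> \<open>Read off from the triplets, the condition on \<open>(a, c)\<close> contains the
    idempotents \<open>snd K\<close> and \<open>snd B\<close>. As the extensions absorb them, it
    becomes the condition on the underlying arrows in \<open>C\<close>.\<close>
  have 1: "Act E (snd K) a' \<delta> = Act E c' (snd B) \<epsilon>"
    using eq unfolding push_def pull_def d(1) e(1) a' c' by simp
  have 2: "Act E (snd K) a' \<delta> = Act E (Idt C (fst K)) a' \<delta>"
    by (subst (2) d(4)[symmetric]) (use d(2) in simp)
  have 3: "Act E c' (snd B) \<epsilon> = Act E c' (Idt C (fst B)) \<epsilon>"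
    by (subst (2) e(3)[symmetric]) (use e(2) in simp)
  obtain g where g: "g \<in> lifts n C V W a' c'"
    by (rule realises_lift[OF V W d(2) e(2), of a' c']) (use 1 2 3 in auto)
  note Vc = realisesD(1)[OF V] and Wc = realisesD(1)[OF W]
  have Ig: "(\<lambda>i. farr (idem_incl C) (g i)) \<in> lifts n (idem_cat C) (map_cpx (idem_incl C) V) (map_cpx (idem_incl C) W)
     (Idt C (fst B), a', Idt C (fst A)) (Idt C (fst L), c', Idt C (fst K))"
    using I.map_lifts[OF g Vc Wc] by (simp add: incl_sel)
  obtain x where x: "x \<in> lifts n (idem_cat C) X (idem_cpx C V e) (Idt (idem_cat C) A) (Idt (idem_cat C) K)"
    using X unfolding realises_idem_iff[OF ZV] by blast
  obtain y where y: "y \<in> lifts n (idem_cat C) (idem_cpx C W f) Y (Idt (idem_cat C) B) (Idt (idem_cat C) L)"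
    using Y unfolding realises_idem_iff[OF ZW] by blast
  have cs: "X \<in> complexes n (idem_cat C)" "Y \<in> complexes n (idem_cat C)"
    using X Y by (simp_all add: realises_def D.complexes_between_iff)
  note zs = D.exangleD(1)[OF ZV(2)] D.exangleD(1)[OF ZW(2)] I.map_cpx_complexes[OF Vc] I.map_cpx_complexes[OF Wc]
  \<comment> \<open>The lift is the composite of \<open>X \<rightarrow> (V, e) \<rightarrow> V
    \<rightarrow> W \<rightarrow> (W, f) \<rightarrow> Y\<close>, whose middle part comes from (R0)
    in \<open>C\<close>.\<close>
  note l1 = D.lifts_cmp[OF x i cs(1) zs(1) zs(3)]
  note l2 = D.lifts_cmp[OF l1 Ig cs(1) zs(3) zs(4)]
  note l3 = D.lifts_cmp[OF l2 p cs(1) zs(4) zs(2)]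
  note l4 = D.lifts_cmp[OF l3 y cs(1) zs(2) cs(2)]
  have ends: "Idt (idem_cat C) B \<cdot>\<^bsub>idem_cat C\<^esub> ((snd B, snd B, Idt C (fst B)) \<cdot>\<^bsub>idem_cat C\<^esub>
      ((Idt C (fst B), a', Idt C (fst A)) \<cdot>\<^bsub>idem_cat C\<^esub> ((Idt C (fst A), snd A, snd A) \<cdot>\<^bsub>idem_cat C\<^esub> Idt (idem_cat C) A))) = a"
    "Idt (idem_cat C) L \<cdot>\<^bsub>idem_cat C\<^esub> ((snd L, snd L, Idt C (fst L)) \<cdot>\<^bsub>idem_cat C\<^esub>
      ((Idt C (fst L), c', Idt C (fst K)) \<cdot>\<^bsub>idem_cat C\<^esub> ((Idt C (fst K), snd K, snd K) \<cdot>\<^bsub>idem_cat C\<^esub> Idt (idem_cat C) K))) = c"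
    by (simp_all add: a' c')
  show "\<exists>f. f \<in> lifts n (idem_cat C) X Y a c"
    using l4 unfolding ends by blast
qed

text \<open>The representative chosen in the completion may be a proper summand of some realisation
  \<open>V\<close>. Its end idempotents are identities, so its inclusion and projection are lifts of
  identities and can be composed with those between \<open>V\<close> and \<open>X\<close>.\<close>

lemma incl_realises:
  assumes X: "realises n C s K A \<delta> X" and d: "\<delta> \<in> carrier (Ext E K A)"
  shows "realises n (idem_cat C) (idem_real n C s) (fob (idem_incl C) K) (fob (idem_incl C) A)
    (idem_incl_ext C K A \<delta>) (map_cpx (idem_incl C) X)"
proof -
  interpret R: realisation n "idem_cat C" "idem_ext C E" "idem_real n C s" by (rule idem_realisation)
  note X' = realisesD[OF X]
  note [simp] = X'(4,5) d
  have o: "(K, Idt C K) \<in> Obj (idem_cat C)" "(A, Idt C A) \<in> Obj (idem_cat C)" by simp_all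
  have t: "(Idt C A, \<delta>, Idt C K) \<in> carrier (Ext (idem_ext C E) (K, Idt C K) (A, Idt C A))"
    by (simp add: idem_Ext)
  obtain \<delta>' V e where d: "(Idt C A, \<delta>, Idt C K) = (snd (A, Idt C A), \<delta>', snd (K, Idt C K))"
    and V: "realises n C s (fst (K, Idt C K)) (fst (A, Idt C A)) \<delta>' V"
    and Z: "realises n (idem_cat C) (idem_real n C s) (K, Idt C K) (A, Idt C A) (Idt C A, \<delta>, Idt C K) (idem_cpx C V e)"
      "exangle n (idem_cat C) (idem_ext C E) (idem_cpx C V e) (Idt C A, \<delta>, Idt C K)"
    and i: "(\<lambda>i. (Idt C (ob V i), e i, e i)) \<in> lifts n (idem_cat C) (idem_cpx C V e) (map_cpx (idem_incl C) V)
      (Idt C (fst (A, Idt C A)), snd (A, Idt C A), snd (A, Idt C A)) (Idt C (fst (K, Idt C K)), snd (K, Idt C K), snd (K, Idt C K))"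
    and p: "(\<lambda>i. (e i, e i, Idt C (ob V i))) \<in> lifts n (idem_cat C) (map_cpx (idem_incl C) V) (idem_cpx C V e)
      (snd (A, Idt C A), snd (A, Idt C A), Idt C (fst (A, Idt C A))) (snd (K, Idt C K), snd (K, Idt C K), Idt C (fst (K, Idt C K)))"
    by (rule idem_real_obtain[OF o t]) blast
  have V: "realises n C s K A \<delta> V" using V d by simp
  note V' = realisesD[OF V]
  obtain f g where f: "f \<in> lifts n C V X (Idt C A) (Idt C K)" and g: "g \<in> lifts n C X V (Idt C A) (Idt C K)"
    using X unfolding realises_iff[OF V \<open>\<delta> \<in> _\<close>] by blast
  note zs = D.exangleD(1)[OF Z(2)] I.map_cpx_complexes[OF V'(1)] I.map_cpx_complexes[OF X'(1)]
  note If = I.map_lifts[OF f V'(1) X'(1)] and Ig = I.map_lifts[OF g X'(1) V'(1)]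
  note l1 = D.lifts_cmp[OF i If zs(1,2,3)] and l2 = D.lifts_cmp[OF Ig p zs(3,2,1)]
  have l1': "\<exists>f. f \<in> lifts n (idem_cat C) (idem_cpx C V e) (map_cpx (idem_incl C) X) (Idt (idem_cat C) (A, Idt C A)) (Idt (idem_cat C) (K, Idt C K))"
    using l1 by (auto simp: incl_sel)
  have l2': "\<exists>f. f \<in> lifts n (idem_cat C) (map_cpx (idem_incl C) X) (idem_cpx C V e) (Idt (idem_cat C) (A, Idt C A)) (Idt (idem_cat C) (K, Idt C K))"
    using l2 by (auto simp: incl_sel)
  have ex: "exangle n (idem_cat C) (idem_ext C E) (map_cpx (idem_incl C) X) (Idt C A, \<delta>, Idt C K)"
    using incl_exangle[OF realises_exangle[OF \<open>\<delta> \<in> _\<close> X]] X' by (simp add: idem_incl_ext_def)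
  have cb: "map_cpx (idem_incl C) X \<in> complexes_between n (idem_cat C) (A, Idt C A) (K, Idt C K)"
    using zs(3) X' by (simp add: D.complexes_between_iff incl_sel)
  show ?thesis unfolding incl_sel idem_incl_ext_def realises_idem_iff[OF Z] using cb ex l1' l2' by blast
qed

lemma incl_exangulated:
  "exangulated_functor n C E s (idem_cat C) (idem_ext C E) (idem_real n C s) (idem_incl C) (idem_incl_ext C)"
  unfolding exangulated_functor_def
proof (intro conjI ballI allI impI incl_additive)
  show "ext_transformation C E (idem_ext C E) (idem_incl C) (idem_incl_ext C)"
    unfolding ext_transformation_def
  proof (intro conjI ballI homI)
    fix K A \<delta> \<epsilon> assume a: "K \<in> Obj C" "A \<in> Obj C" "\<delta> \<in> carrier (Ext E K A)"
    then show "idem_incl_ext C K A \<delta> \<in> carrier (Ext (idem_ext C E) (fob (idem_incl C) K) (fob (idem_incl C) A))"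
      by (simp add: idem_Ext incl_sel idem_incl_ext_def)
    show "idem_incl_ext C K A (\<delta> \<otimes>\<^bsub>Ext E K A\<^esub> \<epsilon>) =
      idem_incl_ext C K A \<delta> \<otimes>\<^bsub>Ext (idem_ext C E) (fob (idem_incl C) K) (fob (idem_incl C) A)\<^esub> idem_incl_ext C K A \<epsilon>"
      by (simp add: incl_sel idem_incl_ext_def)
  next
    fix K L A B c a \<delta> assume "K \<in> Obj C" "L \<in> Obj C" "A \<in> Obj C" "B \<in> Obj C" "c \<in> Arr C L K" "a \<in> Arr C A B"
    then show "idem_incl_ext C L B (Act E c a \<delta>) =
      Act (idem_ext C E) (farr (idem_incl C) c) (farr (idem_incl C) a) (idem_incl_ext C K A \<delta>)"
      by (simp add: incl_sel idem_incl_ext_def)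
  qed
qed (rule incl_realises)

text \<open>The split complex on \<open>(X, e)\<close> is a strict retract of the included split
  complex on \<open>X\<close>. The latter uses a zero object \<open>N\<close> of \<open>C\<close>;
  only zero arrows lead to or from the given zero object \<open>Z\<close>.\<close>

lemma idem_split:
  assumes A: "A \<in> Obj (idem_cat C)" and Z: "zero_object (idem_cat C) Z"
    and R2: "\<And>A Z. A \<in> Obj C \<Longrightarrow> zero_object C Z \<Longrightarrow>
          realises n C s Z A \<one>\<^bsub>Ext E Z A\<^esub> (split_left C A Z) \<and>
          realises n C s A Z \<one>\<^bsub>Ext E A Z\<^esub> (split_right n C Z A)"
  shows "realises n (idem_cat C) (idem_real n C s) Z A \<one>\<^bsub>Ext (idem_ext C E) Z A\<^esub> (split_left (idem_cat C) A Z)"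
    "realises n (idem_cat C) (idem_real n C s) A Z \<one>\<^bsub>Ext (idem_ext C E) A Z\<^esub> (split_right n (idem_cat C) Z A)"
proof -
  interpret R: realisation n "idem_cat C" "idem_ext C E" "idem_real n C s" by (rule idem_realisation)
  note [simp] = idem_ObjD[OF A]
  obtain N where N: "zero_object C N" using ex_zero by blast
  have [simp]: "N \<in> Obj C" using N by (simp add: zero_object_def)
  have Zo [simp]: "Z \<in> Obj (idem_cat C)" using Z by (simp add: zero_object_def)
  \<comment> \<open>This equality makes the composite of the two zero arrows between
    \<open>Z\<close> and \<open>N0\<close> an identity, as strictness demands.\<close>
  have ZZ: "D.zr Z Z = Idt (idem_cat C) Z"
  proof -
    have "\<exists>!f. f \<in> Arr (idem_cat C) Z Z" using Z Zo unfolding zero_object_def by blast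
    moreover have "D.zr Z Z \<in> Arr (idem_cat C) Z Z" "Idt (idem_cat C) Z \<in> Arr (idem_cat C) Z Z"
      by (simp_all del: idem_sel)
    ultimately show ?thesis by blast
  qed
  define A0 where "A0 = fob (idem_incl C) (fst A)"
  define N0 where "N0 = fob (idem_incl C) N"
  have o [simp]: "A0 \<in> Obj (idem_cat C)" "N0 \<in> Obj (idem_cat C)" by (simp_all add: A0_def N0_def incl_sel)
  define i where "i = (Idt C (fst A), snd A, snd A)"
  define p where "p = (snd A, snd A, Idt C (fst A))"
  have i [simp]: "D.ar i" "D.dm i = A" "D.cd i = A0"
    unfolding i_def A0_def by (rule idem_typed[OF A o(1)[unfolded A0_def]]; simp add: incl_sel)+
  have p [simp]: "D.ar p" "D.dm p = A0" "D.cd p = A"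
    unfolding p_def A0_def by (rule idem_typed[OF o(1)[unfolded A0_def] A]; simp add: incl_sel)+
  have pi [simp]: "p \<cdot>\<^bsub>idem_cat C\<^esub> i = Idt (idem_cat C) A" by (simp add: p_def i_def)
  note [simp del] = idem_sel
  have [simp]: "A \<in> Obj (idem_cat C)" by (rule A)
  have n0: "n \<noteq> 0" "0 < n" "Suc 0 \<le> n" using n_pos by auto
  have one: "\<one>\<^bsub>Ext (idem_ext C E) (fob (idem_incl C) K) (fob (idem_incl C) B)\<^esub> = idem_incl_ext C K B \<one>\<^bsub>Ext E K B\<^esub>" for K B
    by (simp add: incl_sel idem_incl_ext_def)
  note [simp del] = idem_ext_sel

  let ?Y = "split_left (idem_cat C) A Z"
  define X1 where "X1 = map_cpx (idem_incl C) (split_left C (fst A) N)"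
  have Xs: "ob X1 j = (if j \<le> 1 then A0 else N0)"
    "df X1 j = (if j = 0 then Idt (idem_cat C) A0 else D.zr (if j \<le> 1 then A0 else N0) N0)" for j
    by (auto simp: X1_def split_left_def Let_def A0_def N0_def)
  have Ys: "ob ?Y j = (if j \<le> 1 then A else Z)"
    "df ?Y j = (if j = 0 then Idt (idem_cat C) A else D.zr (if j \<le> 1 then A else Z) Z)" for j
    by (auto simp: split_left_def Let_def)
  have Rx: "realises n (idem_cat C) (idem_real n C s) N0 A0 \<one>\<^bsub>Ext (idem_ext C E) N0 A0\<^esub> X1"
    unfolding X1_def N0_def A0_def one by (rule incl_realises) (use R2[OF _ N, of "fst A"] in auto)
  have Yc: "?Y \<in> complexes n (idem_cat C)" unfolding D.complexes_iff Ys by auto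
  show "realises n (idem_cat C) (idem_real n C s) Z A \<one>\<^bsub>Ext (idem_ext C E) Z A\<^esub> ?Y"
  proof (rule R.realises_strict_retract[OF Rx _ Yc, of A Z _ "\<lambda>j. if j \<le> 1 then i else D.zr Z N0" "\<lambda>j. if j \<le> 1 then p else D.zr N0 Z"])
    show "(\<lambda>j. if j \<le> 1 then i else D.zr Z N0) \<in> chain_maps n (idem_cat C) ?Y X1"
      by (subst D.chain_maps_iff) (auto simp: Xs Ys)
    show "(\<lambda>j. if j \<le> 1 then p else D.zr N0 Z) \<in> chain_maps n (idem_cat C) X1 ?Y"
      by (subst D.chain_maps_iff) (auto simp: Xs Ys)
  qed (use n0 ZZ in \<open>auto simp: Ys\<close>)

  let ?Y = "split_right n (idem_cat C) Z A"
  define X2 where "X2 = map_cpx (idem_incl C) (split_right n C N (fst A))"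
  have Xs: "ob X2 j = (if j < n then N0 else A0)"
    "df X2 j = (if j = n then Idt (idem_cat C) A0 else D.zr (if j < n then N0 else A0) (if Suc j < n then N0 else A0))" for j
    by (auto simp: X2_def split_right_def Let_def A0_def N0_def)
  have Ys: "ob ?Y j = (if j < n then Z else A)"
    "df ?Y j = (if j = n then Idt (idem_cat C) A else D.zr (if j < n then Z else A) (if Suc j < n then Z else A))" for j
    by (auto simp: split_right_def Let_def)
  have Rx: "realises n (idem_cat C) (idem_real n C s) A0 N0 \<one>\<^bsub>Ext (idem_ext C E) A0 N0\<^esub> X2"
    unfolding X2_def N0_def A0_def one by (rule incl_realises) (use R2[OF _ N, of "fst A"] in auto)
  have Yc: "?Y \<in> complexes n (idem_cat C)" unfolding D.complexes_iff Ys by auto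
  show "realises n (idem_cat C) (idem_real n C s) A Z \<one>\<^bsub>Ext (idem_ext C E) A Z\<^esub> ?Y"
  proof (rule R.realises_strict_retract[OF Rx _ Yc, of Z A _ "\<lambda>j. if j < n then D.zr Z N0 else i" "\<lambda>j. if j < n then D.zr N0 Z else p"])
    show "(\<lambda>j. if j < n then D.zr Z N0 else i) \<in> chain_maps n (idem_cat C) ?Y X2"
      by (subst D.chain_maps_iff) (auto simp: Xs Ys)
    show "(\<lambda>j. if j < n then D.zr N0 Z else p) \<in> chain_maps n (idem_cat C) X2 ?Y"
      by (subst D.chain_maps_iff) (auto simp: Xs Ys)
  qed (use n0 ZZ in \<open>auto simp: Ys\<close>)
qed

end

lemma (in exact_realisation) idem_exact_realisation:
  assumes n: "1 \<le> n"
  shows "exact_realisation n (idem_cat C) (idem_ext C E) (idem_real n C s)"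
proof -
  interpret R: realisation n C E s by (rule realisation[OF n])
  interpret I: realisation n "idem_cat C" "idem_ext C E" "idem_real n C s" by (rule R.idem_realisation)
  show ?thesis
    by (intro exact_realisation.intro exact_realisation_axioms.intro I.biadditive_functor_axioms I.realised I.R0 I.R1 conjI
      R.idem_split R2)
qed

section \<open>Dense embeddings\<close>

context preadditive_category
begin

lemma cone_data_agree:
  assumes M: "cone_data n Y X f M a a' b b'" and Y: "agree n Y Y'" and X: "agree n X X'" and n: "1 \<le> n"
  shows "cone_data n Y' X' f M a a' b b'"
proof -
  have "\<And>i. i \<le> Suc n \<Longrightarrow> ob Y i = ob Y' i" "\<And>i. i \<le> Suc n \<Longrightarrow> ob X i = ob X' i"
    "\<And>i. i \<le> n \<Longrightarrow> df Y i = df Y' i" "\<And>i. i \<le> n \<Longrightarrow> df X i = df X' i"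
    using X Y by (auto simp: agree_def)
  then show ?thesis using M n unfolding cone_data_def by simp
qed

end

definition map_bip :: "('o, 'm, 'p, 'q) cfunctor \<Rightarrow> ('o, 'm) bip \<Rightarrow> ('p, 'q) bip" where
  "map_bip F P = \<lparr>bob = fob F (bob P), inl = farr F (inl P), inr = farr F (inr P),
     prl = farr F (prl P), prr = farr F (prr P)\<rparr>"

lemma map_bip_sel [simp]: "bob (map_bip F P) = fob F (bob P)" "inl (map_bip F P) = farr F (inl P)"
  "inr (map_bip F P) = farr F (inr P)" "prl (map_bip F P) = farr F (prl P)" "prr (map_bip F P) = farr F (prr P)"
  by (simp_all add: map_bip_def)

context preadditive_functor
begin

lemma map_biproduct:
  assumes P: "is_biproduct C A B P" and AB: "A \<in> Obj C" "B \<in> Obj C"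
  shows "is_biproduct D (fob F A) (fob F B) (map_bip F P)"
proof -
  note p = src.biproductD[OF P AB]
  note [simp] = p(1-13) AB
  have "tgt.padd (farr F (inl P) \<cdot>\<^bsub>D\<^esub> farr F (prl P)) (farr F (inr P) \<cdot>\<^bsub>D\<^esub> farr F (prr P)) = Idt D (fob F (bob P))"
    using arg_cong[OF p(22), of "farr F"] by simp
  moreover have "farr F (prl P) \<cdot>\<^bsub>D\<^esub> farr F (inl P) = Idt D (fob F A)" "farr F (prr P) \<cdot>\<^bsub>D\<^esub> farr F (inr P) = Idt D (fob F B)"
    "farr F (prl P) \<cdot>\<^bsub>D\<^esub> farr F (inr P) = tgt.zr (fob F B) (fob F A)" "farr F (prr P) \<cdot>\<^bsub>D\<^esub> farr F (inl P) = tgt.zr (fob F A) (fob F B)"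
    using arg_cong[OF p(14), of "farr F"] arg_cong[OF p(15), of "farr F"] arg_cong[OF p(16), of "farr F"] arg_cong[OF p(17), of "farr F"]
    by simp_all
  ultimately show ?thesis unfolding is_biproduct_def by simp
qed

lemma map_pad:
  assumes X: "X \<in> complexes n C" and m: "m < n" "1 \<le> m" and W: "W \<in> Obj C"
    and P: "is_biproduct C (ob X m) W P" and Q: "is_biproduct C (ob X (Suc m)) W Q"
    and Y: "agree n (map_cpx F X) Y"
  shows "agree n (map_cpx F (src.pad X m P Q)) (tgt.pad Y m (map_bip F P) (map_bip F Q))"
proof -
  note [simp] = src.complexesD[OF X] W
  have [simp]: "ob X m \<in> Obj C" "ob X (Suc m) \<in> Obj C" using m by auto
  note [simp] = src.biproductD(1-13)[OF P] src.biproductD(1-13)[OF Q]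
  have [simp]: "i \<le> Suc n \<Longrightarrow> ob Y i = fob F (ob X i)" "i \<le> n \<Longrightarrow> df Y i = farr F (df X i)" for i
    using Y by (auto simp: agree_def)
  show ?thesis unfolding agree_def
  proof (intro conjI allI impI)
    fix i assume "i \<le> Suc n"
    then show "ob (map_cpx F (src.pad X m P Q)) i = ob (tgt.pad Y m (map_bip F P) (map_bip F Q)) i"
      by (simp add: src.pad_sel tgt.pad_sel)
  next
    fix i assume i: "i \<le> n"
    have pi: "farr F (src.pad_in X m P Q j) = tgt.pad_in Y m (map_bip F P) (map_bip F Q) j"
      "farr F (src.pad_pr X m P Q j) = tgt.pad_pr Y m (map_bip F P) (map_bip F Q) j" if "j \<le> Suc n" for j
      using that by (simp_all add: src.pad_in_def tgt.pad_in_def src.pad_pr_def tgt.pad_pr_def)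
    note pp = src.pad_props[OF X m W P Q]
    note t = src.chain_mapsD(1-3)[OF pp(2) X pp(1)] src.chain_mapsD(1-3)[OF pp(3) pp(1) X]
    show "df (map_cpx F (src.pad X m P Q)) i = df (tgt.pad Y m (map_bip F P) (map_bip F Q)) i"
    proof (cases "i = m")
      case True
      then show ?thesis using m by (simp add: src.pad_sel tgt.pad_sel)
    next
      case False
      then show ?thesis using i by (simp add: src.pad_sel(2) tgt.pad_sel(2) t pi[symmetric])
    qed
  qed
qed

lemma map_cone_data:
  assumes M: "src.cone_data n Y X f M a a' b b'" and Y: "Y \<in> complexes n C" and X: "X \<in> complexes n C"
    and f: "f \<in> chain_maps n C Y X"
  shows "tgt.cone_data n (map_cpx F Y) (map_cpx F X) (\<lambda>i. farr F (f i)) (map_cpx F M)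
    (\<lambda>i. farr F (a i)) (\<lambda>i. farr F (a' i)) (\<lambda>i. farr F (b i)) (\<lambda>i. farr F (b' i))"
proof -
  note [simp] = src.complexesD(1-4)[OF X] src.complexesD(1-4)[OF Y] src.chain_mapsD(1-3)[OF f Y X] src.cone_data_typed(1)[OF M Y X f]
  note t [simp] = src.cone_dataD(1-20)[OF M Y X]
  note d = src.cone_data_df[OF M]
  note e = M[unfolded src.cone_data_def]
  have e1: "a i \<cdot> a' i = Idt C (ob Y (Suc i))" "a i \<cdot> b' i = \<one>\<^bsub>Hom C (ob X i) (ob Y (Suc i))\<^esub>"
    "b i \<cdot> a' i = \<one>\<^bsub>Hom C (ob Y (Suc i)) (ob X i)\<^esub>" if "i \<le> n" for i using e that by blast+
  have e2: "b (Suc i) \<cdot> b' (Suc i) = Idt C (ob X (Suc i))" if "i < n" for i using e that by blast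
  show ?thesis unfolding tgt.cone_data_def
  proof (intro conjI allI impI)
    fix i assume i: "i \<le> n"
    show "farr F (a i) \<cdot>\<^bsub>D\<^esub> farr F (a' i) = Idt D (ob (map_cpx F Y) (Suc i))"
      "farr F (a i) \<cdot>\<^bsub>D\<^esub> farr F (b' i) = tgt.zr (ob (map_cpx F X) i) (ob (map_cpx F Y) (Suc i))"
      "farr F (b i) \<cdot>\<^bsub>D\<^esub> farr F (a' i) = tgt.zr (ob (map_cpx F Y) (Suc i)) (ob (map_cpx F X) i)"
      using arg_cong[OF e1(1)[OF i], of "farr F"] arg_cong[OF e1(2)[OF i], of "farr F"] arg_cong[OF e1(3)[OF i], of "farr F"] i
      by simp_all
    show "tgt.padd (farr F (a' i) \<cdot>\<^bsub>D\<^esub> farr F (a i)) (farr F (b' i) \<cdot>\<^bsub>D\<^esub> farr F (b i)) = Idt D (ob (map_cpx F M) i)"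
      using arg_cong[OF d(3)[OF i], of "farr F"] i by simp
  next
    fix i assume i: "i < n"
    show "farr F (b (Suc i)) \<cdot>\<^bsub>D\<^esub> farr F (b' (Suc i)) = Idt D (ob (map_cpx F X) (Suc i))"
      using arg_cong[OF e2[OF i], of "farr F"] i by simp
    show "df (map_cpx F M) i = tgt.padd (farr F (a' (Suc i)) \<cdot>\<^bsub>D\<^esub> (tgt.neg (df (map_cpx F Y) (Suc i)) \<cdot>\<^bsub>D\<^esub> farr F (a i)))
      (tgt.padd (farr F (b' (Suc i)) \<cdot>\<^bsub>D\<^esub> (farr F (f (Suc i)) \<cdot>\<^bsub>D\<^esub> farr F (a i)))
       (farr F (b' (Suc i)) \<cdot>\<^bsub>D\<^esub> (df (map_cpx F X) i \<cdot>\<^bsub>D\<^esub> farr F (b i))))"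
      using i by (simp add: d(1))
  next
    show "df (map_cpx F M) n = tgt.padd (farr F (f (Suc n)) \<cdot>\<^bsub>D\<^esub> farr F (a n)) (df (map_cpx F X) n \<cdot>\<^bsub>D\<^esub> farr F (b n))"
      by (simp add: d(2))
  qed simp_all
qed

end

section \<open>Deflations as inflations of the opposite category\<close>

context realisation
begin

lemma deflation_op_iff: "deflation n C E s f \<longleftrightarrow> inflation n (op_cat C) (op_ext E) (op_real n s) f"
proof
  assume "deflation n C E s f"
  then obtain K A \<delta> X where X: "realises n C s K A \<delta> X" "\<delta> \<in> carrier (Ext E K A)" "f = df X n"
    unfolding deflation_def by blast
  note X' = realisesD[OF X(1)]
  have "realises n (op_cat C) (op_real n s) A K \<delta> (rev_cpx n X)"
    unfolding realises_op_iff[OF X(2) X'(5,4)]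
    by (rule realises_agree[OF X(1,2) agree_sym[OF agree_rev_rev]])
  moreover have "f = df (rev_cpx n X) 0" using X(3) by simp
  ultimately show "inflation n (op_cat C) (op_ext E) (op_real n s) f"
    unfolding inflation_def op_cat_sel op_ext_sel using X(2) X'(4,5) by blast
next
  assume "inflation n (op_cat C) (op_ext E) (op_real n s) f"
  then obtain K A \<delta> X where X: "K \<in> Obj C" "A \<in> Obj C" "realises n (op_cat C) (op_real n s) K A \<delta> X" "\<delta> \<in> carrier (Ext E A K)" "f = df X 0"
    unfolding inflation_def op_cat_sel op_ext_sel by blast
  have "realises n C s A K \<delta> (rev_cpx n X)" using X(3) realises_op_iff[OF X(4,2,1)] by blast
  moreover have "f = df (rev_cpx n X) n" using X(5) by simp
  ultimately show "deflation n C E s f" unfolding deflation_def using X by blast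
qed

end

text \<open>Half of (EA1), isolated so that the statement about deflations is the same statement for
  the opposite triple.\<close>

definition inflations_compose :: "nat \<Rightarrow> ('o, 'm) cat \<Rightarrow> ('o, 'm, 'x) ext \<Rightarrow> ('o, 'm, 'x) realisation \<Rightarrow> bool" where
  "inflations_compose n C E s \<longleftrightarrow> (\<forall>A\<in>Obj C. \<forall>B\<in>Obj C. \<forall>D\<in>Obj C. \<forall>f\<in>Arr C A B. \<forall>g\<in>Arr C B D.
     inflation n C E s f \<and> inflation n C E s g \<longrightarrow> inflation n C E s (g \<cdot>\<^bsub>C\<^esub> f))"

lemma (in realisation) EA1_iff:
  "EA1 n C E s \<longleftrightarrow> inflations_compose n C E s \<and> inflations_compose n (op_cat C) (op_ext E) (op_real n s)"
  unfolding EA1_def inflations_compose_def deflation_op_iff op_cat_sel by blast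

text \<open>A description of the inclusion that survives passage to the opposite categories:
  fullness, bijectivity on extensions, density up to retracts and splitting of idempotents are all
  self-dual.\<close>

locale dense_embedding = src: realisation n C E s + tgt: realisation n D G t
  for n :: nat and C :: "('o, 'm) cat" (structure) and E :: "('o, 'm, 'x) ext" and s :: "('o, 'm, 'x) realisation"
    and D :: "('p, 'q) cat" and G :: "('p, 'q, 'y) ext" and t :: "('p, 'q, 'y) realisation" +
  fixes F :: "('o, 'm, 'p, 'q) cfunctor" and \<Gamma> :: "'o \<Rightarrow> 'o \<Rightarrow> 'x \<Rightarrow> 'y"
  assumes exangulated: "exangulated_functor n C E s D G t F \<Gamma>"
    and fob_inj: "inj_on (fob F) (Obj C)"
    and full: "A \<in> Obj C \<Longrightarrow> B \<in> Obj C \<Longrightarrow> g \<in> Arr D (fob F A) (fob F B) \<Longrightarrow> \<exists>f\<in>Arr C A B. farr F f = g"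
    and ext_bij: "K \<in> Obj C \<Longrightarrow> A \<in> Obj C \<Longrightarrow> bij_betw (\<Gamma> K A) (carrier (Ext E K A)) (carrier (Ext G (fob F K) (fob F A)))"
    and dense: "Y \<in> Obj D \<Longrightarrow> \<exists>B\<in>Obj C. \<exists>i\<in>Arr D Y (fob F B). \<exists>p\<in>Arr D (fob F B) Y. p \<cdot>\<^bsub>D\<^esub> i = Idt D Y"
    and idem: "idempotent_complete D"
begin

sublocale F: preadditive_functor C D F
  by unfold_locales (use exangulated in \<open>simp add: exangulated_functor_def\<close>)

lemma \<Gamma>_natural:
  assumes "src.ar c" "src.ar a" "\<delta> \<in> carrier (Ext E (src.cd c) (src.dm a))"
  shows "\<Gamma> (src.dm c) (src.cd a) (Act E c a \<delta>) = Act G (farr F c) (farr F a) (\<Gamma> (src.cd c) (src.dm a) \<delta>)"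
  using exangulated assms src.ar_Arr[OF assms(1)] src.ar_Arr[OF assms(2)]
  unfolding exangulated_functor_def ext_transformation_def by blast

text \<open>Taken up to \<open>agree\<close>, because padding and taking cones commute with the
  functor only in the meaningful degrees.\<close>

definition R where
  "R K A \<delta> X \<longleftrightarrow> (\<exists>K0 A0 \<delta>0 X0. \<delta>0 \<in> carrier (Ext E K0 A0) \<and> K = fob F K0 \<and> A = fob F A0 \<and>
     \<delta> = \<Gamma> K0 A0 \<delta>0 \<and> realises n C s K0 A0 \<delta>0 X0 \<and> agree n (map_cpx F X0) X)"

lemma R_elim:
  assumes "R K A \<delta> X"
  obtains K0 A0 \<delta>0 X0 where "\<delta>0 \<in> carrier (Ext E K0 A0)" "K = fob F K0" "A = fob F A0"
     "\<delta> = \<Gamma> K0 A0 \<delta>0" "realises n C s K0 A0 \<delta>0 X0" "agree n (map_cpx F X0) X"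
  using assms unfolding R_def by blast

lemma R_intro:
  assumes "realises n C s K0 A0 \<delta>0 X0" "\<delta>0 \<in> carrier (Ext E K0 A0)"
  shows "R (fob F K0) (fob F A0) (\<Gamma> K0 A0 \<delta>0) (map_cpx F X0)"
  using assms agree_refl unfolding R_def by blast

lemma dense_realisation:
  assumes EA1: "inflations_compose n C E s" and EA2: "EA2 n C E s"
  shows "dense_realisation n D G t (fob F ` Obj C) R"
proof (intro dense_realisation.intro dense_realisation_axioms.intro tgt.realisation_axioms idem)
  fix A assume "A \<in> Obj D"
  then show "\<exists>B\<in>fob F ` Obj C. \<exists>i p. tgt.ar i \<and> tgt.dm i = A \<and> tgt.cd i = B \<and> tgt.ar p \<and> tgt.dm p = B \<and> tgt.cd p = A \<and> p \<cdot>\<^bsub>D\<^esub> i = Idt D A"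
    using dense[of A] by fastforce
next
  fix K A \<delta> X assume R: "R K A \<delta> X"
  then obtain K0 A0 \<delta>0 X0 where d: "\<delta>0 \<in> carrier (Ext E K0 A0)" "K = fob F K0" "A = fob F A0"
     "\<delta> = \<Gamma> K0 A0 \<delta>0" and X0: "realises n C s K0 A0 \<delta>0 X0" and ag: "agree n (map_cpx F X0) X" by (rule R_elim)
  note X0' = src.realisesD[OF X0]
  show d': "\<delta> \<in> carrier (Ext G K A)" using ext_bij[OF X0'(5,4)] d by (auto simp: bij_betw_def)
  have "realises n D t K A \<delta> (map_cpx F X0)"
    using exangulated X0 X0'(4,5) d unfolding exangulated_functor_def by blast
  then show "realises n D t K A \<delta> X" using d' ag by (rule tgt.realises_agree)
  show "ob X i \<in> fob F ` Obj C" if "i \<le> Suc n" for i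
  proof -
    have "ob X i = fob F (ob X0 i)" using ag that by (simp add: agree_def)
    then show ?thesis using src.complexesD(1)[OF X0'(1) that] by blast
  qed
  show "\<exists>P Q. is_biproduct D (ob X m) W P \<and> is_biproduct D (ob X (Suc m)) W Q \<and> R K A \<delta> (tgt.pad X m P Q)"
    if W: "W \<in> fob F ` Obj C" and m: "1 \<le> m" "m < n" for W m
  proof -
    obtain W0 where W0: "W0 \<in> Obj C" "W = fob F W0" using W by blast
    have o: "ob X0 m \<in> Obj C" "ob X0 (Suc m) \<in> Obj C" using src.complexesD(1)[OF X0'(1)] m by auto
    obtain P Q where P: "is_biproduct C (ob X0 m) W0 P" and Q: "is_biproduct C (ob X0 (Suc m)) W0 Q"
      using src.ex_biproduct o W0 by blast
    have "R K A \<delta> (tgt.pad X m (map_bip F P) (map_bip F Q))"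
      unfolding R_def using d src.realises_pad[OF X0 d(1) m(2,1) W0(1) P Q] F.map_pad[OF X0'(1) m(2,1) W0(1) P Q ag] by blast
    moreover have "ob X m = fob F (ob X0 m)" "ob X (Suc m) = fob F (ob X0 (Suc m))" using ag m by (auto simp: agree_def)
    ultimately show ?thesis using F.map_biproduct[OF P o(1) W0(1)] F.map_biproduct[OF Q o(2) W0(1)] W0 by metis
  qed
  show "\<exists>M \<mu> V. R M A \<mu> V \<and> ob V 1 = ob Z 1 \<and> df V 0 = df Z 0 \<cdot>\<^bsub>D\<^esub> df X 0" if Z: "R L (ob X 1) \<epsilon> Z" for L \<epsilon> Z
  proof -
    obtain L0 B0 \<epsilon>0 Z0 where e: "\<epsilon>0 \<in> carrier (Ext E L0 B0)" "L = fob F L0" "ob X 1 = fob F B0"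
       "\<epsilon> = \<Gamma> L0 B0 \<epsilon>0" and Z0: "realises n C s L0 B0 \<epsilon>0 Z0" and agZ: "agree n (map_cpx F Z0) Z" using Z by (rule R_elim)
    note Z0' = src.realisesD[OF Z0]
    \<comment> \<open>Injectivity on objects turns the coincidence of the images into genuine
      composability of the two inflations in \<open>C\<close>.\<close>
    have "fob F B0 = fob F (ob X0 (Suc 0))" using ag e(3) by (simp add: agree_def)
    then have B0: "B0 = ob X0 (Suc 0)" using fob_inj Z0'(4) src.complexesD(1)[OF X0'(1), of "Suc 0"] by (auto dest: inj_onD)
    have x: "src.ar (df X0 0)" "src.dm (df X0 0) = A0" "src.cd (df X0 0) = B0"
      "src.ar (df Z0 0)" "src.dm (df Z0 0) = B0" "src.cd (df Z0 0) = ob Z0 (Suc 0)"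
      using src.complexesD(2-4)[OF X0'(1), of 0] src.complexesD(2-4)[OF Z0'(1), of 0] X0' Z0' B0 by auto
    have "inflation n C E s (df X0 0)" "inflation n C E s (df Z0 0)"
      unfolding inflation_def using X0 d X0' Z0 e Z0' by blast+
    moreover have "df X0 0 \<in> Arr C A0 B0" "df Z0 0 \<in> Arr C B0 (ob Z0 (Suc 0))" "ob Z0 (Suc 0) \<in> Obj C"
      using x X0' Z0' src.complexesD(1)[OF Z0'(1), of "Suc 0"] by auto
    ultimately have "inflation n C E s (df Z0 0 \<cdot> df X0 0)"
      using EA1 X0'(4) Z0'(4) unfolding inflations_compose_def by blast
    then obtain M0 A1 \<mu>0 V0 where V0: "realises n C s M0 A1 \<mu>0 V0" "\<mu>0 \<in> carrier (Ext E M0 A1)"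
      and dV: "df Z0 0 \<cdot> df X0 0 = df V0 0" unfolding inflation_def by blast
    note V0' = src.realisesD[OF V0(1)]
    have "src.dm (df V0 0) = A0" "src.cd (df V0 0) = ob Z0 (Suc 0)" unfolding dV[symmetric] using x by simp_all
    then have A1: "A1 = A0" and V1: "ob V0 (Suc 0) = ob Z0 (Suc 0)"
      using src.complexesD(3,4)[OF V0'(1), of 0] V0' by auto
    have "R (fob F M0) A (\<Gamma> M0 A1 \<mu>0) (map_cpx F V0)" using R_intro[OF V0] A1 d(3) by simp
    moreover have "ob (map_cpx F V0) 1 = ob Z 1" using V1 agZ by (simp add: agree_def)
    moreover have "df (map_cpx F V0) 0 = df Z 0 \<cdot>\<^bsub>D\<^esub> df X 0"
      using arg_cong[OF dV, of "farr F"] x ag agZ by (simp add: agree_def)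
    ultimately show ?thesis by blast
  qed
  show "\<exists>f M. f \<in> lifts n D Y X (Idt D A) c \<and> tgt.is_cone n Y X f M \<and>
      R K (ob Y 1) (Act G (Idt D K) (df Y 0) \<delta>) M"
    if L: "L \<in> fob F ` Obj C" and c: "tgt.ar c" "tgt.dm c = L" "tgt.cd c = K" and Y: "R L A (Act G c (Idt D A) \<delta>) Y" for L c Y
  proof -
    obtain L0 A1 \<epsilon>0 Y0 where e: "\<epsilon>0 \<in> carrier (Ext E L0 A1)" "L = fob F L0" "A = fob F A1"
       "Act G c (Idt D A) \<delta> = \<Gamma> L0 A1 \<epsilon>0" and Y0: "realises n C s L0 A1 \<epsilon>0 Y0" and agY: "agree n (map_cpx F Y0) Y" using Y by (rule R_elim)
    note Y0' = src.realisesD[OF Y0]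
    have A1: "A1 = A0" using fob_inj e(3) d(3) Y0'(4) X0'(4) by (auto dest: inj_onD)
    have "c \<in> Arr D (fob F L0) (fob F K0)" using c e d Y0' X0' by simp
    then obtain c0 where c0: "c0 \<in> Arr C L0 K0" "farr F c0 = c" using full Y0'(5) X0'(5) by blast
    have c0' [simp]: "src.ar c0" "src.dm c0 = L0" "src.cd c0 = K0" using c0 Y0'(5) X0'(5) by auto
    note [simp] = X0'(4,5) Y0'(5)
    have "\<Gamma> L0 A0 (Act E c0 (Idt C A0) \<delta>0) = Act G c (Idt D A) \<delta>"
      using \<Gamma>_natural[of c0 "Idt C A0" \<delta>0] d c0 by simp
    then have "\<Gamma> L0 A0 (Act E c0 (Idt C A0) \<delta>0) = \<Gamma> L0 A0 \<epsilon>0" using e(4) A1 by simp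
    moreover have "Act E c0 (Idt C A0) \<delta>0 \<in> carrier (Ext E L0 A0)" using d by simp
    \<comment> \<open>Fullness has produced \<open>c0\<close> over \<open>c\<close>; injectivity on
      extensions now identifies \<open>\<epsilon>0\<close> with the pullback of
      \<open>\<delta>0\<close> along \<open>c0\<close>, so that (EA2) of \<open>C\<close> applies to
      it.\<close>
    ultimately have \<epsilon>0: "\<epsilon>0 = Act E c0 (Idt C A0) \<delta>0"
      using ext_bij[OF Y0'(5) X0'(4)] e(1) A1 by (auto simp: bij_betw_def dest: inj_onD)
    have "realises n C s L0 A0 (pull C E A0 c0 \<delta>0) Y0" using Y0 A1 \<epsilon>0 by (simp add: pull_def)
    then obtain f0 where f0: "f0 \<in> lifts n C Y0 X0 (Idt C A0) c0"
      and M0: "realises n C s K0 (ob Y0 1) (push C E K0 (df Y0 0) \<delta>0) (mapping_cone n C Y0 X0 f0)"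
      using EA2 X0 X0'(4,5) Y0'(5) d(1) c0(1) unfolding EA2_def by blast
    let ?M = "mapping_cone n C Y0 X0 f0"
    have f0c: "f0 \<in> chain_maps n C Y0 X0" using f0 by (simp add: lifts_def)
    obtain a a' b b' where "src.cone_data n Y0 X0 f0 ?M a a' b b'"
      using src.mapping_cone_is_cone[OF Y0'(1) X0'(1) f0c src.n_pos] unfolding src.is_cone_def by blast
    then have cone: "tgt.is_cone n Y X (\<lambda>i. farr F (f0 i)) (map_cpx F ?M)"
      unfolding tgt.is_cone_def
      using tgt.cone_data_agree[OF F.map_cone_data[OF _ Y0'(1) X0'(1) f0c] agY ag src.n_pos] by blast
    have f: "(\<lambda>i. farr F (f0 i)) \<in> lifts n D Y X (Idt D A) c"
      using F.map_lifts[OF f0 Y0'(1) X0'(1)] c0 d tgt.lifts_agree[OF agY ag] by simp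
    have dY: "src.ar (df Y0 0)" "src.dm (df Y0 0) = A0" "src.cd (df Y0 0) = ob Y0 (Suc 0)" "ob Y0 (Suc 0) \<in> Obj C"
      using src.complexesD(1-4)[OF Y0'(1), of 0] src.complexesD(1)[OF Y0'(1), of "Suc 0"] Y0' A1 by auto
    have "push C E K0 (df Y0 0) \<delta>0 \<in> carrier (Ext E K0 (ob Y0 1))" using dY d by (simp add: push_def)
    from R_intro[OF M0 this]
    have "R K (ob Y 1) (\<Gamma> K0 (ob Y0 1) (push C E K0 (df Y0 0) \<delta>0)) (map_cpx F ?M)"
      using d agY by (simp add: agree_def)
    moreover have "\<Gamma> K0 (ob Y0 1) (push C E K0 (df Y0 0) \<delta>0) = Act G (Idt D K) (df Y 0) \<delta>"
      using \<Gamma>_natural[of "Idt C K0" "df Y0 0" \<delta>0] dY d agY by (simp add: push_def agree_def)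
    ultimately show ?thesis using cone f by metis
  qed
next
  fix K A \<delta> assume a: "K \<in> fob F ` Obj C" "A \<in> fob F ` Obj C" "\<delta> \<in> carrier (Ext G K A)"
  then obtain K0 A0 where o: "K0 \<in> Obj C" "A0 \<in> Obj C" "K = fob F K0" "A = fob F A0" by blast
  then obtain \<delta>0 where "\<delta>0 \<in> carrier (Ext E K0 A0)" "\<delta> = \<Gamma> K0 A0 \<delta>0"
    using ext_bij[OF o(1,2)] a by (auto simp: bij_betw_def)
  then show "\<exists>X. R K A \<delta> X" using src.realised o R_intro by metis
next
  fix A assume "A \<in> fob F ` Obj C"
  then show "A \<in> Obj D" by auto
qed

lemma inflations_compose_EA2:
  assumes "inflations_compose n C E s" and "EA2 n C E s"
  shows "inflations_compose n D G t" "EA2 n D G t"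
proof -
  interpret dense_realisation n D G t "fob F ` Obj C" R by (rule dense_realisation[OF assms])
  show "EA2 n D G t" by (rule EA2)
  show "inflations_compose n D G t" unfolding inflations_compose_def using inflation_closed by blast
qed

lemma dense_embedding_op: "dense_embedding n (op_cat C) (op_ext E) (op_real n s) (op_cat D) (op_ext G) (op_real n t) F (\<lambda>K A. \<Gamma> A K)"
proof (intro dense_embedding.intro dense_embedding_axioms.intro src.realisation_op tgt.realisation_op)
  show "exangulated_functor n (op_cat C) (op_ext E) (op_real n s) (op_cat D) (op_ext G) (op_real n t) F (\<lambda>K A. \<Gamma> A K)"
    unfolding exangulated_functor_def
  proof (intro conjI ballI allI impI)
    show "additive_functor (op_cat C) (op_cat D) F"
      using F.additive unfolding additive_functor_def op_cat_sel by blast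
    show "ext_transformation (op_cat C) (op_ext E) (op_ext G) F (\<lambda>K A. \<Gamma> A K)"
      using exangulated unfolding exangulated_functor_def ext_transformation_def op_cat_sel op_ext_sel by blast
    fix K A \<delta> X assume a: "K \<in> Obj (op_cat C)" "A \<in> Obj (op_cat C)" "\<delta> \<in> carrier (Ext (op_ext E) K A)"
      "realises n (op_cat C) (op_real n s) K A \<delta> X"
    then have a': "K \<in> Obj C" "A \<in> Obj C" "\<delta> \<in> carrier (Ext E A K)" by simp_all
    have "realises n C s A K \<delta> (rev_cpx n X)" using a(4) src.realises_op_iff[OF a'(3,2,1)] by blast
    then have "realises n D t (fob F A) (fob F K) (\<Gamma> A K \<delta>) (map_cpx F (rev_cpx n X))"
      using exangulated a' unfolding exangulated_functor_def by blast
    moreover have "map_cpx F (rev_cpx n X) = rev_cpx n (map_cpx F X)" by (simp add: map_cpx_def rev_cpx_def)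
    moreover have "\<Gamma> A K \<delta> \<in> carrier (Ext G (fob F A) (fob F K))" using ext_bij[OF a'(2,1)] a'(3) by (auto simp: bij_betw_def)
    ultimately show "realises n (op_cat D) (op_real n t) (fob F K) (fob F A) (\<Gamma> A K \<delta>) (map_cpx F X)"
      using tgt.realises_op_iff a'(1,2) by (metis F.fob_Obj)
  qed
  fix A assume "A \<in> Obj (op_cat D)"
  then show "\<exists>B\<in>Obj (op_cat C). \<exists>i\<in>Arr (op_cat D) A (fob F B). \<exists>p\<in>Arr (op_cat D) (fob F B) A. p \<cdot>\<^bsub>op_cat D\<^esub> i = Idt (op_cat D) A"
    using dense unfolding op_cat_sel by blast
next
  show "idempotent_complete (op_cat D)"
    unfolding idempotent_complete_def op_cat_sel
  proof (intro ballI impI)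
    fix X e assume "X \<in> Obj D" "e \<in> Arr D X X" "e \<cdot>\<^bsub>D\<^esub> e = e"
    then have "\<exists>Y\<in>Obj D. \<exists>r\<in>Arr D X Y. \<exists>s\<in>Arr D Y X. e = s \<cdot>\<^bsub>D\<^esub> r \<and> r \<cdot>\<^bsub>D\<^esub> s = Idt D Y"
      using idem unfolding idempotent_complete_def by blast
    then show "\<exists>Y\<in>Obj D. \<exists>r\<in>Arr D Y X. \<exists>s\<in>Arr D X Y. e = r \<cdot>\<^bsub>D\<^esub> s \<and> s \<cdot>\<^bsub>D\<^esub> r = Idt D Y" by blast
  qed
qed (use fob_inj full ext_bij in \<open>simp_all del: src.Arr_iff tgt.Arr_iff\<close>)

end

section \<open>The axioms for the completion\<close>

context realisation
begin

lemma idem_dense_embedding: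
  "dense_embedding n C E s (idem_cat C) (idem_ext C E) (idem_real n C s) (idem_incl C) (idem_incl_ext C)"
proof -
  interpret D: biadditive_functor "idem_cat C" "idem_ext C E" by (rule idem_biadditive)
  show ?thesis
  proof (intro dense_embedding.intro dense_embedding_axioms.intro realisation_axioms idem_realisation incl_exangulated idem_idempotent_complete)
    show "inj_on (fob (idem_incl C)) (Obj C)" by (rule inj_onI) (simp add: incl_sel)
  next
    fix A B g assume AB: "A \<in> Obj C" "B \<in> Obj C" and g: "g \<in> Arr (idem_cat C) (fob (idem_incl C) A) (fob (idem_incl C) B)"
    have o: "(A, Idt C A) \<in> Obj (idem_cat C)" "(B, Idt C B) \<in> Obj (idem_cat C)" using AB by auto
    show "\<exists>f\<in>Arr C A B. farr (idem_incl C) f = g"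
      using g AB unfolding incl_sel idem_Arr[OF o] by auto
  next
    fix K A assume KA: "K \<in> Obj C" "A \<in> Obj C"
    show "bij_betw (idem_incl_ext C K A) (carrier (Ext E K A)) (carrier (Ext (idem_ext C E) (fob (idem_incl C) K) (fob (idem_incl C) A)))"
      unfolding bij_betw_def
    proof
      show "inj_on (idem_incl_ext C K A) (carrier (Ext E K A))" by (rule inj_onI) (simp add: idem_incl_ext_def)
      show "idem_incl_ext C K A ` carrier (Ext E K A) = carrier (Ext (idem_ext C E) (fob (idem_incl C) K) (fob (idem_incl C) A))"
        using KA by (auto simp: idem_Ext incl_sel idem_incl_ext_def)
    qed
  next
    fix A assume A: "A \<in> Obj (idem_cat C)"
    note [simp] = idem_ObjD[OF A]
    have o: "(fst A, Idt C (fst A)) \<in> Obj (idem_cat C)" by simp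
    show "\<exists>B\<in>Obj C. \<exists>i\<in>Arr (idem_cat C) A (fob (idem_incl C) B). \<exists>p\<in>Arr (idem_cat C) (fob (idem_incl C) B) A.
      p \<cdot>\<^bsub>idem_cat C\<^esub> i = Idt (idem_cat C) A"
      unfolding incl_sel
      by (rule bexI[of _ "fst A"], rule bexI[of _ "(Idt C (fst A), snd A, snd A)"], rule bexI[of _ "(snd A, snd A, Idt C (fst A))"])
        (simp_all add: idem_Arr[OF A o] idem_Arr[OF o A] del: D.Arr_iff)
  qed
qed

end

context exangulated_category
begin

text \<open>The transfer is applied to the inclusion and to its opposite; (EA1) is reassembled from
  its two halves, and the second application gives the dual of (EA2).\<close>

lemma idem_exangulated:
  assumes n: "1 \<le> n"
  shows "exangulated_category n (idem_cat C) (idem_ext C E) (idem_real n C s)"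
proof -
  interpret R: realisation n C E s by (rule realisation[OF n])
  interpret I: realisation n "idem_cat C" "idem_ext C E" "idem_real n C s" by (rule R.idem_realisation)
  interpret em: dense_embedding n C E s "idem_cat C" "idem_ext C E" "idem_real n C s" "idem_incl C" "idem_incl_ext C"
    by (rule R.idem_dense_embedding)
  have "inflations_compose n C E s" and c: "inflations_compose n (op_cat C) (op_ext E) (op_real n s)"
    using EA1 unfolding R.EA1_iff by auto
  from em.inflations_compose_EA2[OF this(1) EA2] dense_embedding.inflations_compose_EA2[OF em.dense_embedding_op c EA2_op]
  show ?thesis
    by (intro exangulated_category.intro exangulated_category_axioms.intro idem_exact_realisation n)
      (auto simp: I.EA1_iff)
qed

end

section \<open>The universal property\<close>

locale idempotent_extension = src: realisation n C E s + tgt: realisation n D G t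
  for n :: nat and C :: "('o, 'm) cat" (structure) and E :: "('o, 'm, 'x) ext" and s :: "('o, 'm, 'x) realisation"
    and D :: "('p, 'q) cat" and G :: "('p, 'q, 'y) ext" and t :: "('p, 'q, 'y) realisation" +
  fixes F :: "('o, 'm, 'p, 'q) cfunctor" and \<Lambda> :: "'o \<Rightarrow> 'o \<Rightarrow> 'x \<Rightarrow> 'y"
  assumes exangulated: "exangulated_functor n C E s D G t F \<Lambda>"
    and idem: "idempotent_complete D"
    and EA1: "inflations_compose n C E s" and EA2: "EA2 n C E s"
begin

sublocale F: preadditive_functor C D F
  by unfold_locales (use exangulated in \<open>simp add: exangulated_functor_def\<close>)

interpretation I: biadditive_functor "idem_cat C" "idem_ext C E" by (rule src.idem_biadditive)

interpretation IR: realisation n "idem_cat C" "idem_ext C E" "idem_real n C s" by (rule src.idem_realisation)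

interpretation em: dense_embedding n C E s "idem_cat C" "idem_ext C E" "idem_real n C s" "idem_incl C" "idem_incl_ext C"
  by (rule src.idem_dense_embedding)

interpretation di: dense_realisation n "idem_cat C" "idem_ext C E" "idem_real n C s" "fob (idem_incl C) ` Obj C" em.R
  by (rule em.dense_realisation[OF EA1 EA2])

lemma \<Lambda>_natural:
  assumes "src.ar c" "src.ar a" "\<delta> \<in> carrier (Ext E (src.cd c) (src.dm a))"
  shows "\<Lambda> (src.dm c) (src.cd a) (Act E c a \<delta>) = Act G (farr F c) (farr F a) (\<Lambda> (src.cd c) (src.dm a) \<delta>)"
  using exangulated assms src.ar_Arr[OF assms(1)] src.ar_Arr[OF assms(2)]
  unfolding exangulated_functor_def ext_transformation_def by blast

lemma \<Lambda>_hom: "K \<in> Obj C \<Longrightarrow> A \<in> Obj C \<Longrightarrow> \<Lambda> K A \<in> hom (Ext E K A) (Ext G (fob F K) (fob F A))"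
  using exangulated unfolding exangulated_functor_def ext_transformation_def by blast

lemma \<Lambda>_typed [simp]:
  "K \<in> Obj C \<Longrightarrow> A \<in> Obj C \<Longrightarrow> \<delta> \<in> carrier (Ext E K A) \<Longrightarrow> \<Lambda> K A \<delta> \<in> carrier (Ext G (fob F K) (fob F A))"
  using \<Lambda>_hom by (auto simp: hom_def)

text \<open>A splitting of \<open>F e\<close> chosen for each idempotent \<open>e\<close>; the key is \<open>e\<close> alone because \<open>e\<close> determines
  its object.\<close>

definition splitting :: "'m \<Rightarrow> 'p \<times> 'q \<times> 'q" where
  "splitting e = (SOME (Y, r, q). Y \<in> Obj D \<and> r \<in> Arr D (fob F (src.dm e)) Y \<and> q \<in> Arr D Y (fob F (src.dm e)) \<and>
     farr F e = q \<cdot>\<^bsub>D\<^esub> r \<and> r \<cdot>\<^bsub>D\<^esub> q = Idt D Y)"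

definition spo where "spo e = fst (splitting e)"
definition spr where "spr e = fst (snd (splitting e))"
definition sps where "sps e = snd (snd (splitting e))"

lemma splitting:
  assumes A: "A \<in> Obj (idem_cat C)" and a: "a = snd A"
  shows "spo a \<in> Obj D" "tgt.ar (spr a)" "tgt.dm (spr a) = fob F (fst A)" "tgt.cd (spr a) = spo a"
    "tgt.ar (sps a)" "tgt.dm (sps a) = spo a" "tgt.cd (sps a) = fob F (fst A)"
    "sps a \<cdot>\<^bsub>D\<^esub> spr a = farr F a" "spr a \<cdot>\<^bsub>D\<^esub> sps a = Idt D (spo a)"
    "\<And>u. tgt.ar u \<Longrightarrow> tgt.cd u = fob F (fst A) \<Longrightarrow> sps a \<cdot>\<^bsub>D\<^esub> (spr a \<cdot>\<^bsub>D\<^esub> u) = farr F a \<cdot>\<^bsub>D\<^esub> u"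
    "\<And>u. tgt.ar u \<Longrightarrow> tgt.cd u = spo a \<Longrightarrow> spr a \<cdot>\<^bsub>D\<^esub> (sps a \<cdot>\<^bsub>D\<^esub> u) = u"
    "spr a \<cdot>\<^bsub>D\<^esub> farr F a = spr a" "farr F a \<cdot>\<^bsub>D\<^esub> sps a = sps a"
    "\<And>u. tgt.ar u \<Longrightarrow> tgt.cd u = fob F (fst A) \<Longrightarrow> spr a \<cdot>\<^bsub>D\<^esub> (farr F a \<cdot>\<^bsub>D\<^esub> u) = spr a \<cdot>\<^bsub>D\<^esub> u"
    "\<And>u. tgt.ar u \<Longrightarrow> tgt.cd u = spo a \<Longrightarrow> farr F a \<cdot>\<^bsub>D\<^esub> (sps a \<cdot>\<^bsub>D\<^esub> u) = sps a \<cdot>\<^bsub>D\<^esub> u"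
proof -
  note o = src.idem_ObjD[OF A, folded a]
  note [simp] = o(1-4)
  define P where "P = (\<lambda>(Y, r, q). Y \<in> Obj D \<and> r \<in> Arr D (fob F (src.dm a)) Y \<and> q \<in> Arr D Y (fob F (src.dm a)) \<and>
     farr F a = q \<cdot>\<^bsub>D\<^esub> r \<and> r \<cdot>\<^bsub>D\<^esub> q = Idt D Y)"
  have "farr F a \<cdot>\<^bsub>D\<^esub> farr F a = farr F a" using F.farr_cmp[of a a] o(5) by simp
  moreover have "farr F a \<in> Arr D (fob F (fst A)) (fob F (fst A))" "fob F (fst A) \<in> Obj D" by simp_all
  ultimately have "\<exists>Y\<in>Obj D. \<exists>r\<in>Arr D (fob F (fst A)) Y. \<exists>q\<in>Arr D Y (fob F (fst A)). farr F a = q \<cdot>\<^bsub>D\<^esub> r \<and> r \<cdot>\<^bsub>D\<^esub> q = Idt D Y"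
    using idem unfolding idempotent_complete_def by blast
  then have "\<exists>x. P x" unfolding P_def by auto
  then have "P (splitting a)" unfolding splitting_def P_def[symmetric] by (rule someI_ex)
  then have p: "spo a \<in> Obj D" "spr a \<in> Arr D (fob F (fst A)) (spo a)" "sps a \<in> Arr D (spo a) (fob F (fst A))"
    "farr F a = sps a \<cdot>\<^bsub>D\<^esub> spr a" "spr a \<cdot>\<^bsub>D\<^esub> sps a = Idt D (spo a)"
    unfolding P_def spo_def spr_def sps_def by (auto simp: case_prod_unfold)
  show t: "spo a \<in> Obj D" "tgt.ar (spr a)" "tgt.dm (spr a) = fob F (fst A)" "tgt.cd (spr a) = spo a"
    "tgt.ar (sps a)" "tgt.dm (sps a) = spo a" "tgt.cd (sps a) = fob F (fst A)"
    using p by simp_all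
  show e: "sps a \<cdot>\<^bsub>D\<^esub> spr a = farr F a" "spr a \<cdot>\<^bsub>D\<^esub> sps a = Idt D (spo a)" using p by simp_all
  note [simp] = t
  show e1: "sps a \<cdot>\<^bsub>D\<^esub> (spr a \<cdot>\<^bsub>D\<^esub> u) = farr F a \<cdot>\<^bsub>D\<^esub> u" if "tgt.ar u" "tgt.cd u = fob F (fst A)" for u
    using tgt.cmp_extend[OF e(1), of u] that by simp
  show e2: "spr a \<cdot>\<^bsub>D\<^esub> (sps a \<cdot>\<^bsub>D\<^esub> u) = u" if "tgt.ar u" "tgt.cd u = spo a" for u
    using tgt.cmp_extend[OF e(2), of u] that by simp
  show e3: "spr a \<cdot>\<^bsub>D\<^esub> farr F a = spr a" unfolding e(1)[symmetric] by (simp add: e2)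
  have "farr F a \<cdot>\<^bsub>D\<^esub> sps a = sps a \<cdot>\<^bsub>D\<^esub> (spr a \<cdot>\<^bsub>D\<^esub> sps a)" unfolding e(1)[symmetric] by simp
  then show e4: "farr F a \<cdot>\<^bsub>D\<^esub> sps a = sps a" unfolding e(2) by simp
  show "spr a \<cdot>\<^bsub>D\<^esub> (farr F a \<cdot>\<^bsub>D\<^esub> u) = spr a \<cdot>\<^bsub>D\<^esub> u" if "tgt.ar u" "tgt.cd u = fob F (fst A)" for u
    using tgt.cmp_extend[OF e3, of u] that by simp
  show "farr F a \<cdot>\<^bsub>D\<^esub> (sps a \<cdot>\<^bsub>D\<^esub> u) = sps a \<cdot>\<^bsub>D\<^esub> u" if "tgt.ar u" "tgt.cd u = spo a" for u
    using tgt.cmp_extend[OF e4, of u] that by simp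
qed

text \<open>An arrow is compressed by the splittings at its two ends. A triplet names the
  idempotents but not the objects, which is why splittings are indexed by idempotents.\<close>

definition ext_fun :: "('o \<times> 'm, 'm \<times> 'm \<times> 'm, 'p, 'q) cfunctor" where
  "ext_fun = \<lparr>fob = (\<lambda>A. spo (snd A)), farr = (\<lambda>(x, r, y). spr x \<cdot>\<^bsub>D\<^esub> (farr F r \<cdot>\<^bsub>D\<^esub> sps y))\<rparr>"

lemma ext_fun_sel [simp]: "fob ext_fun A = spo (snd A)"
  "farr ext_fun (x, r, y) = spr x \<cdot>\<^bsub>D\<^esub> (farr F r \<cdot>\<^bsub>D\<^esub> sps y)"
  by (simp_all add: ext_fun_def)

definition ext_trans :: "'o \<times> 'm \<Rightarrow> 'o \<times> 'm \<Rightarrow> 'm \<times> 'x \<times> 'm \<Rightarrow> 'y" where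
  "ext_trans K A = (\<lambda>(_, \<delta>, _). Act G (sps (snd K)) (spr (snd A)) (\<Lambda> (fst K) (fst A) \<delta>))"

lemma ext_trans_sel [simp]:
  "ext_trans K A (x, \<delta>, y) = Act G (sps (snd K)) (spr (snd A)) (\<Lambda> (fst K) (fst A) \<delta>)"
  by (simp add: ext_trans_def)

lemma farr_idem:
  assumes "src.ar r" "src.ar e" "src.dm e = src.cd r" "e \<cdot> r = r"
  shows "farr F e \<cdot>\<^bsub>D\<^esub> farr F r = farr F r"
    "\<And>u. tgt.ar u \<Longrightarrow> tgt.cd u = fob F (src.dm r) \<Longrightarrow> src.cd e = src.cd r \<Longrightarrow> farr F e \<cdot>\<^bsub>D\<^esub> (farr F r \<cdot>\<^bsub>D\<^esub> u) = farr F r \<cdot>\<^bsub>D\<^esub> u"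
proof -
  show *: "farr F e \<cdot>\<^bsub>D\<^esub> farr F r = farr F r" using F.farr_cmp[of r e] assms by simp
  show "farr F e \<cdot>\<^bsub>D\<^esub> (farr F r \<cdot>\<^bsub>D\<^esub> u) = farr F r \<cdot>\<^bsub>D\<^esub> u" if "tgt.ar u" "tgt.cd u = fob F (src.dm r)" "src.cd e = src.cd r" for u
    using tgt.cmp_extend[OF *, of u] that assms by simp
qed

lemma ext_fun_additive: "additive_functor (idem_cat C) D ext_fun"
  unfolding additive_functor_def
proof (intro conjI)
  show "\<forall>A\<in>Obj (idem_cat C). fob ext_fun A \<in> Obj D \<and> farr ext_fun (Idt (idem_cat C) A) = Idt D (fob ext_fun A)"
  proof
    fix A assume A: "A \<in> Obj (idem_cat C)"
    note [simp] = splitting[OF A refl]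
    show "fob ext_fun A \<in> Obj D \<and> farr ext_fun (Idt (idem_cat C) A) = Idt D (fob ext_fun A)" by simp
  qed
next
  show "\<forall>A\<in>Obj (idem_cat C). \<forall>B\<in>Obj (idem_cat C). farr ext_fun \<in> hom (Hom (idem_cat C) A B) (Hom D (fob ext_fun A) (fob ext_fun B))"
  proof (intro ballI homI)
    fix A B f assume A: "A \<in> Obj (idem_cat C)" and B: "B \<in> Obj (idem_cat C)" and f: "f \<in> Arr (idem_cat C) A B"
    note [simp] = splitting[OF A refl] splitting[OF B refl] src.idem_ObjD[OF A] src.idem_ObjD[OF B]
    obtain f' where f' [simp]: "f = (snd B, f', snd A)" "src.ar f'" "src.dm f' = fst A" "src.cd f' = fst B"
      using src.idem_ArrE[OF f A B] by blast
    show "farr ext_fun f \<in> Arr D (fob ext_fun A) (fob ext_fun B)" by simp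
    fix g assume g: "g \<in> Arr (idem_cat C) A B"
    obtain g' where g' [simp]: "g = (snd B, g', snd A)" "src.ar g'" "src.dm g' = fst A" "src.cd g' = fst B"
      using src.idem_ArrE[OF g A B] by blast
    show "farr ext_fun (f \<otimes>\<^bsub>Hom (idem_cat C) A B\<^esub> g) = farr ext_fun f \<otimes>\<^bsub>Hom D (fob ext_fun A) (fob ext_fun B)\<^esub> farr ext_fun g"
      by (simp del: I.padd_eq)
  qed
next
  show "\<forall>A\<in>Obj (idem_cat C). \<forall>B\<in>Obj (idem_cat C). \<forall>B'\<in>Obj (idem_cat C). \<forall>f\<in>Arr (idem_cat C) A B. \<forall>g\<in>Arr (idem_cat C) B B'.
    farr ext_fun (g \<cdot>\<^bsub>idem_cat C\<^esub> f) = farr ext_fun g \<cdot>\<^bsub>D\<^esub> farr ext_fun f"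
  proof (intro ballI)
    fix A B B' f g assume A: "A \<in> Obj (idem_cat C)" and B: "B \<in> Obj (idem_cat C)" and B': "B' \<in> Obj (idem_cat C)"
      and f: "f \<in> Arr (idem_cat C) A B" and g: "g \<in> Arr (idem_cat C) B B'"
    note [simp] = splitting[OF A refl] splitting[OF B refl] splitting[OF B' refl] src.idem_ObjD[OF A] src.idem_ObjD[OF B] src.idem_ObjD[OF B']
    obtain f' where f' [simp]: "f = (snd B, f', snd A)" "src.ar f'" "src.dm f' = fst A" "src.cd f' = fst B" "snd B \<cdot> f' = f'"
      using src.idem_ArrE[OF f A B] by blast
    obtain g' where g' [simp]: "g = (snd B', g', snd B)" "src.ar g'" "src.dm g' = fst B" "src.cd g' = fst B'"
      using src.idem_ArrE[OF g B B'] by blast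
    show "farr ext_fun (g \<cdot>\<^bsub>idem_cat C\<^esub> f) = farr ext_fun g \<cdot>\<^bsub>D\<^esub> farr ext_fun f"
      using farr_idem[of f' "snd B"] by simp
  qed
qed

interpretation EX: preadditive_functor "idem_cat C" D ext_fun
  by (intro preadditive_functor.intro preadditive_functor_axioms.intro ext_fun_additive) unfold_locales

lemma ext_trans_transformation: "ext_transformation (idem_cat C) (idem_ext C E) G ext_fun ext_trans"
  unfolding ext_transformation_def
proof (intro conjI ballI)
  fix K A assume K: "K \<in> Obj (idem_cat C)" and A: "A \<in> Obj (idem_cat C)"
  note [simp] = splitting[OF A refl] splitting[OF K refl] src.idem_ObjD[OF A] src.idem_ObjD[OF K]
  show "ext_trans K A \<in> hom (Ext (idem_ext C E) K A) (Ext G (fob ext_fun K) (fob ext_fun A))"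
  proof (rule homI)
    fix x assume "x \<in> carrier (Ext (idem_ext C E) K A)"
    then obtain \<delta> where x: "x = (snd A, \<delta>, snd K)" "\<delta> \<in> carrier (Ext E (fst K) (fst A))" unfolding src.idem_Ext by blast
    then show "ext_trans K A x \<in> carrier (Ext G (fob ext_fun K) (fob ext_fun A))" by simp
    fix y assume "y \<in> carrier (Ext (idem_ext C E) K A)"
    then obtain \<epsilon> where y: "y = (snd A, \<epsilon>, snd K)" "\<epsilon> \<in> carrier (Ext E (fst K) (fst A))" unfolding src.idem_Ext by blast
    have "\<Lambda> (fst K) (fst A) (\<delta> \<otimes>\<^bsub>Ext E (fst K) (fst A)\<^esub> \<epsilon>) =
      \<Lambda> (fst K) (fst A) \<delta> \<otimes>\<^bsub>Ext G (fob F (fst K)) (fob F (fst A))\<^esub> \<Lambda> (fst K) (fst A) \<epsilon>"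
      using \<Lambda>_hom[of "fst K" "fst A"] x y by (simp add: hom_def)
    then show "ext_trans K A (x \<otimes>\<^bsub>Ext (idem_ext C E) K A\<^esub> y) =
      ext_trans K A x \<otimes>\<^bsub>Ext G (fob ext_fun K) (fob ext_fun A)\<^esub> ext_trans K A y"
      using x y by (simp add: tgt.act_mult)
  qed
next
  fix K L A B c a x assume K: "K \<in> Obj (idem_cat C)" and L: "L \<in> Obj (idem_cat C)" and A: "A \<in> Obj (idem_cat C)" and B: "B \<in> Obj (idem_cat C)"
    and c: "c \<in> Arr (idem_cat C) L K" and a: "a \<in> Arr (idem_cat C) A B" and x: "x \<in> carrier (Ext (idem_ext C E) K A)"
  note [simp] = splitting[OF A refl] splitting[OF K refl] splitting[OF B refl] splitting[OF L refl]
    src.idem_ObjD[OF A] src.idem_ObjD[OF K] src.idem_ObjD[OF B] src.idem_ObjD[OF L]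
  obtain \<delta> where x: "x = (snd A, \<delta>, snd K)" and d [simp]: "\<delta> \<in> carrier (Ext E (fst K) (fst A))" using x unfolding src.idem_Ext by blast
  obtain c' where c [simp]: "c = (snd K, c', snd L)" "src.ar c'" "src.dm c' = fst L" "src.cd c' = fst K" "snd K \<cdot> c' = c'"
    using src.idem_ArrE[OF c L K] by blast
  obtain a' where a [simp]: "a = (snd B, a', snd A)" "src.ar a'" "src.dm a' = fst A" "src.cd a' = fst B" "a' \<cdot> snd A = a'"
    using src.idem_ArrE[OF a A B] by blast
  have a2: "farr F a' \<cdot>\<^bsub>D\<^esub> farr F (snd A) = farr F a'" using F.farr_cmp[of "snd A" a'] by simp
  have nat: "\<Lambda> (fst L) (fst B) (Act E c' a' \<delta>) = Act G (farr F c') (farr F a') (\<Lambda> (fst K) (fst A) \<delta>)"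
    using \<Lambda>_natural[of c' a' \<delta>] by simp
  show "ext_trans L B (Act (idem_ext C E) c a x) = Act G (farr ext_fun c) (farr ext_fun a) (ext_trans K A x)"
    using farr_idem[of c' "snd K"] by (simp add: x nat a2)
qed

text \<open>The splitting chosen for an identity need not be the trivial one; it is an isomorphism
  of \<open>F A\<close> with the chosen object, and therefore the extension restricts to
  \<open>F\<close> only up to natural isomorphism.\<close>

lemma splitting_id:
  assumes "A \<in> Obj C"
  shows "sps (Idt C A) \<cdot>\<^bsub>D\<^esub> spr (Idt C A) = Idt D (fob F A)"
    "tgt.ar u \<Longrightarrow> tgt.cd u = fob F A \<Longrightarrow> sps (Idt C A) \<cdot>\<^bsub>D\<^esub> (spr (Idt C A) \<cdot>\<^bsub>D\<^esub> u) = u"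
  using splitting(8,10)[OF src.incl_Obj[OF assms], of "Idt C A"] assms by auto

text \<open>A realisation \<open>Y\<close> in the completion is a strict retract of the image of
  some \<open>X0\<close> in \<open>C\<close>. Applying \<open>ext_fun\<close> and composing with the
  split identities, which identify \<open>ext_fun\<close> of that image with \<open>F X0\<close>,
  exhibits the image of \<open>Y\<close> as a strict retract of \<open>F X0\<close>. The latter is a
  realisation by assumption on \<open>F\<close>.\<close>

lemma ext_fun_exangulated:
  "exangulated_functor n (idem_cat C) (idem_ext C E) (idem_real n C s) D G t ext_fun ext_trans"
  unfolding exangulated_functor_def
proof (intro conjI ballI allI impI ext_fun_additive ext_trans_transformation)
  fix K A x Y assume K: "K \<in> Obj (idem_cat C)" and A: "A \<in> Obj (idem_cat C)"
    and x: "x \<in> carrier (Ext (idem_ext C E) K A)" and Y: "realises n (idem_cat C) (idem_real n C s) K A x Y"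
  note oA = src.idem_ObjD[OF A] and oK = src.idem_ObjD[OF K]
  note sA = splitting[OF A refl] and sK = splitting[OF K refl]
  note [simp] = oA oK sA sK
  obtain \<delta> where xd: "x = (snd A, \<delta>, snd K)" and d: "\<delta> \<in> carrier (Ext E (fst K) (fst A))"
    and ad: "Act E (Idt C (fst K)) (snd A) \<delta> = \<delta>" and kd: "Act E (snd K) (Idt C (fst A)) \<delta> = \<delta>"
    using x unfolding src.idem_Ext by blast
  note [simp] = d
  define A0 where "A0 = fob (idem_incl C) (fst A)"
  define K0 where "K0 = fob (idem_incl C) (fst K)"
  have A0: "A0 \<in> fob (idem_incl C) ` Obj C" "A0 \<in> Obj (idem_cat C)" "A0 = (fst A, Idt C (fst A))"
    and K0: "K0 \<in> fob (idem_incl C) ` Obj C" "K0 \<in> Obj (idem_cat C)" "K0 = (fst K, Idt C (fst K))"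
    unfolding A0_def K0_def by (auto simp: src.incl_sel intro: src.incl_Obj)
  have i0: "I.ar (Idt C (fst A), snd A, snd A)" "I.dm (Idt C (fst A), snd A, snd A) = A" "I.cd (Idt C (fst A), snd A, snd A) = A0"
    by (rule src.idem_typed[OF A A0(2)]; simp add: A0(3))+
  have p0: "I.ar (snd A, snd A, Idt C (fst A))" "I.dm (snd A, snd A, Idt C (fst A)) = A0" "I.cd (snd A, snd A, Idt C (fst A)) = A"
    by (rule src.idem_typed[OF A0(2) A]; simp add: A0(3))+
  have ik: "I.ar (Idt C (fst K), snd K, snd K)" "I.dm (Idt C (fst K), snd K, snd K) = K" "I.cd (Idt C (fst K), snd K, snd K) = K0"
    by (rule src.idem_typed[OF K K0(2)]; simp add: K0(3))+
  have pk: "I.ar (snd K, snd K, Idt C (fst K))" "I.dm (snd K, snd K, Idt C (fst K)) = K0" "I.cd (snd K, snd K, Idt C (fst K)) = K"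
    by (rule src.idem_typed[OF K0(2) K]; simp add: K0(3))+
  have pi0: "(snd A, snd A, Idt C (fst A)) \<cdot>\<^bsub>idem_cat C\<^esub> (Idt C (fst A), snd A, snd A) = Idt (idem_cat C) A"
    and pik: "(snd K, snd K, Idt C (fst K)) \<cdot>\<^bsub>idem_cat C\<^esub> (Idt C (fst K), snd K, snd K) = Idt (idem_cat C) K" by simp_all
  have akd: "Act E (snd K) (snd A) \<delta> = \<delta>"
  proof -
    have "Act E (snd K) (snd A) \<delta> = Act E (snd K) (Idt C (fst A)) (Act E (Idt C (fst K)) (snd A) \<delta>)" by simp
    then show ?thesis unfolding ad kd .
  qed
  obtain X i p where X: "em.R K0 A0 (Act (idem_ext C E) (snd K, snd K, Idt C (fst K)) (Idt C (fst A), snd A, snd A) x) X"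
    and i: "i \<in> lifts n (idem_cat C) Y X (Idt C (fst A), snd A, snd A) (Idt C (fst K), snd K, snd K)"
    and p: "p \<in> lifts n (idem_cat C) X Y (snd A, snd A, Idt C (fst A)) (snd K, snd K, Idt C (fst K))"
    and pi: "\<And>j. j \<le> Suc n \<Longrightarrow> p j \<cdot>\<^bsub>idem_cat C\<^esub> i j = Idt (idem_cat C) (ob Y j)"
    by (rule di.strict_retract[OF Y x A0(1) K0(1) i0 p0 pi0 ik pk pik]) blast
  obtain K1 A1 \<delta>1 X0 where d1: "K0 = fob (idem_incl C) K1" "A0 = fob (idem_incl C) A1"
    "Act (idem_ext C E) (snd K, snd K, Idt C (fst K)) (Idt C (fst A), snd A, snd A) x = idem_incl_ext C K1 A1 \<delta>1"
    and X0: "realises n C s K1 A1 \<delta>1 X0" and ag: "agree n (map_cpx (idem_incl C) X0) X"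
    using X by (rule em.R_elim) blast
  \<comment> \<open>The transported extension is \<open>\<delta>\<close> itself between the
    underlying objects, because \<open>\<delta>\<close> absorbs both idempotents.\<close>
  have "K1 = fst K" "A1 = fst A" using d1(1,2) by (simp_all add: K0_def A0_def src.incl_sel)
  moreover have "\<delta>1 = \<delta>" using d1(3) by (simp add: xd akd idem_incl_ext_def)
  ultimately have X0: "realises n C s (fst K) (fst A) \<delta> X0" using X0 by simp
  note X0' = src.realisesD[OF X0]
  note IX = em.F.map_cpx_complexes[OF X0'(1)]
  have Xc: "X \<in> complexes n (idem_cat C)" using I.complexes_agree[OF ag] IX by simp
  have Yc: "Y \<in> complexes n (idem_cat C)" using IR.realisesD(1)[OF Y] .
  have FX: "realises n D t (fob F (fst K)) (fob F (fst A)) (\<Lambda> (fst K) (fst A) \<delta>) (map_cpx F X0)"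
    using exangulated X0 oA(1) oK(1) d unfolding exangulated_functor_def by blast
  have obX: "ob X j = (ob X0 j, Idt C (ob X0 j))" if "j \<le> Suc n" for j
    using ag that by (simp add: agree_def src.incl_sel)
  have dfX: "df X j = (Idt C (ob X0 (Suc j)), df X0 j, Idt C (ob X0 j))" if "j \<le> n" for j
  proof -
    have "df X j = farr (idem_incl C) (df X0 j)" using ag that by (simp add: agree_def)
    then show ?thesis using that src.complexesD(3,4)[OF X0'(1), of j] by (simp add: src.incl_sel)
  qed
  note xo = src.complexesD(1-4)[OF X0'(1)]
  have sX: "spo (Idt C (ob X0 j)) \<in> Obj D" "tgt.ar (spr (Idt C (ob X0 j)))" "tgt.dm (spr (Idt C (ob X0 j))) = fob F (ob X0 j)"
    "tgt.cd (spr (Idt C (ob X0 j))) = spo (Idt C (ob X0 j))"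
    "tgt.ar (sps (Idt C (ob X0 j)))" "tgt.dm (sps (Idt C (ob X0 j))) = spo (Idt C (ob X0 j))" "tgt.cd (sps (Idt C (ob X0 j))) = fob F (ob X0 j)"
    "spr (Idt C (ob X0 j)) \<cdot>\<^bsub>D\<^esub> sps (Idt C (ob X0 j)) = Idt D (spo (Idt C (ob X0 j)))"
    "\<And>u. tgt.ar u \<Longrightarrow> tgt.cd u = spo (Idt C (ob X0 j)) \<Longrightarrow> spr (Idt C (ob X0 j)) \<cdot>\<^bsub>D\<^esub> (sps (Idt C (ob X0 j)) \<cdot>\<^bsub>D\<^esub> u) = u"
    if "j \<le> Suc n" for j
    using splitting[OF src.incl_Obj[OF xo(1)[OF that]], of "Idt C (ob X0 j)"] by auto
  note sX' = splitting_id[OF xo(1)]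
  note EXX = EX.map_cpx_complexes[OF Xc] and EYc = EX.map_cpx_complexes[OF Yc] and FXc = F.map_cpx_complexes[OF X0'(1)]
  have u: "(\<lambda>j. sps (Idt C (ob X0 j))) \<in> chain_maps n D (map_cpx ext_fun X) (map_cpx F X0)"
    by (subst tgt.chain_maps_iff)
      (use tgt.complexesD(1)[OF EXX] tgt.complexesD(1)[OF FXc] in \<open>simp_all add: obX dfX sX sX' xo\<close>)
  have v: "(\<lambda>j. spr (Idt C (ob X0 j))) \<in> chain_maps n D (map_cpx F X0) (map_cpx ext_fun X)"
    by (subst tgt.chain_maps_iff)
      (use tgt.complexesD(1)[OF EXX] tgt.complexesD(1)[OF FXc] in \<open>simp_all add: obX dfX sX sX' xo\<close>)
  have ic: "i \<in> chain_maps n (idem_cat C) Y X" and pc: "p \<in> chain_maps n (idem_cat C) X Y" using i p by (auto simp: lifts_def)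
  note J = tgt.chain_maps_cmp[OF EX.map_chain_maps[OF ic Yc Xc] u EYc EXX FXc]
  note P = tgt.chain_maps_cmp[OF v EX.map_chain_maps[OF pc Xc Yc] FXc EXX EYc]
  have [simp]: "ob X0 0 = fst A" "ob X0 (Suc n) = fst K" "ob Y 0 = A" "ob Y (Suc n) = K" using X0' IR.realisesD[OF Y] by auto
  have ends: "i 0 = (Idt C (fst A), snd A, snd A)" "i (Suc n) = (Idt C (fst K), snd K, snd K)"
     "p 0 = (snd A, snd A, Idt C (fst A))" "p (Suc n) = (snd K, snd K, Idt C (fst K))" using i p by (auto simp: lifts_def)
  note idA = splitting_id[OF oA(1)] and idK = splitting_id[OF oK(1)]
  have sI: "tgt.ar (spr (Idt C (fst A)))" "tgt.dm (spr (Idt C (fst A))) = fob F (fst A)" "tgt.ar (sps (Idt C (fst A)))" "tgt.cd (sps (Idt C (fst A))) = fob F (fst A)"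
    "tgt.dm (sps (Idt C (fst A))) = tgt.cd (spr (Idt C (fst A)))"
    "tgt.ar (spr (Idt C (fst K)))" "tgt.dm (spr (Idt C (fst K))) = fob F (fst K)" "tgt.ar (sps (Idt C (fst K)))" "tgt.cd (sps (Idt C (fst K))) = fob F (fst K)"
    "tgt.dm (sps (Idt C (fst K))) = tgt.cd (spr (Idt C (fst K)))"
    using splitting[OF src.incl_Obj[OF oA(1)], of "Idt C (fst A)"] splitting[OF src.incl_Obj[OF oK(1)], of "Idt C (fst K)"] by auto
  have J0: "sps (Idt C (fst A)) \<cdot>\<^bsub>D\<^esub> farr ext_fun (i 0) = sps (snd A)" "sps (Idt C (fst K)) \<cdot>\<^bsub>D\<^esub> farr ext_fun (i (Suc n)) = sps (snd K)"
    and P0: "farr ext_fun (p 0) \<cdot>\<^bsub>D\<^esub> spr (Idt C (fst A)) = spr (snd A)" "farr ext_fun (p (Suc n)) \<cdot>\<^bsub>D\<^esub> spr (Idt C (fst K)) = spr (snd K)"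
    unfolding ends by (simp_all add: idA idK sI)
  \<comment> \<open>By naturality of \<open>\<Lambda>\<close> the image of \<open>\<delta>\<close>
    absorbs \<open>F\<close> of the two idempotents; this settles the compatibility of the end
    arrows with the extensions.\<close>
  have aL: "Act G u (farr F (snd A)) (\<Lambda> (fst K) (fst A) \<delta>) = Act G u (Idt D (fob F (fst A))) (\<Lambda> (fst K) (fst A) \<delta>)"
    if "tgt.ar u" "tgt.cd u = fob F (fst K)" for u
  proof -
    have "Act G u (farr F (snd A)) (\<Lambda> (fst K) (fst A) \<delta>) =
      Act G u (Idt D (fob F (fst A))) (Act G (farr F (Idt C (fst K))) (farr F (snd A)) (\<Lambda> (fst K) (fst A) \<delta>))"
      using that by simp
    also have "Act G (farr F (Idt C (fst K))) (farr F (snd A)) (\<Lambda> (fst K) (fst A) \<delta>) = \<Lambda> (fst K) (fst A) \<delta>"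
      using \<Lambda>_natural[of "Idt C (fst K)" "snd A" \<delta>] ad by simp
    finally show ?thesis .
  qed
  have kL: "Act G (farr F (snd K)) u (\<Lambda> (fst K) (fst A) \<delta>) = Act G (Idt D (fob F (fst K))) u (\<Lambda> (fst K) (fst A) \<delta>)"
    if "tgt.ar u" "tgt.dm u = fob F (fst A)" for u
  proof -
    have "Act G (farr F (snd K)) u (\<Lambda> (fst K) (fst A) \<delta>) =
      Act G (Idt D (fob F (fst K))) u (Act G (farr F (snd K)) (farr F (Idt C (fst A))) (\<Lambda> (fst K) (fst A) \<delta>))"
      using that by simp
    also have "Act G (farr F (snd K)) (farr F (Idt C (fst A))) (\<Lambda> (fst K) (fst A) \<delta>) = \<Lambda> (fst K) (fst A) \<delta>"
      using \<Lambda>_natural[of "snd K" "Idt C (fst A)" \<delta>] kd by simp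
    finally show ?thesis .
  qed
  show "realises n D t (fob ext_fun K) (fob ext_fun A) (ext_trans K A x) (map_cpx ext_fun Y)"
  proof (rule tgt.realises_strict_retract[OF FX _ EYc _ _ _ J P])
    fix j assume j: "j \<le> Suc n"
    have ij: "I.ar (i j)" "I.dm (i j) = ob Y j" "I.cd (i j) = ob X j" "I.ar (p j)" "I.dm (p j) = ob X j" "I.cd (p j) = ob Y j"
      using I.chain_mapsD(1-3)[OF ic Yc Xc j] I.chain_mapsD(1-3)[OF pc Xc Yc j] by auto
    have "(farr ext_fun (p j) \<cdot>\<^bsub>D\<^esub> spr (Idt C (ob X0 j))) \<cdot>\<^bsub>D\<^esub> (sps (Idt C (ob X0 j)) \<cdot>\<^bsub>D\<^esub> farr ext_fun (i j)) =
      farr ext_fun (p j) \<cdot>\<^bsub>D\<^esub> farr ext_fun (i j)"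
      using j ij by (simp add: sX obX)
    also have "\<dots> = farr ext_fun (p j \<cdot>\<^bsub>idem_cat C\<^esub> i j)" using ij by simp
    also have "\<dots> = Idt D (ob (map_cpx ext_fun Y) j)" unfolding pi[OF j]
      using EX.farr_Idt[OF I.complexesD(1)[OF Yc j]] by simp
    finally show "(farr ext_fun (p j) \<cdot>\<^bsub>D\<^esub> spr (Idt C (ob X0 j))) \<cdot>\<^bsub>D\<^esub> (sps (Idt C (ob X0 j)) \<cdot>\<^bsub>D\<^esub> farr ext_fun (i j)) =
      Idt D (ob (map_cpx ext_fun Y) j)" .
  qed (use J0 P0 in \<open>simp_all add: xd aL kL\<close>)
qed

section \<open>The comparison isomorphism and uniqueness of extended transformations\<close>

definition unit :: "'o \<Rightarrow> 'q" where
  "unit A = spr (Idt C A)"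

lemma unit_props:
  assumes A: "A \<in> Obj C"
  shows "tgt.ar (unit A)" "tgt.dm (unit A) = fob F A" "tgt.cd (unit A) = spo (Idt C A)"
    "tgt.ar (sps (Idt C A))" "tgt.dm (sps (Idt C A)) = spo (Idt C A)" "tgt.cd (sps (Idt C A)) = fob F A"
    "sps (Idt C A) \<cdot>\<^bsub>D\<^esub> unit A = Idt D (fob F A)" "unit A \<cdot>\<^bsub>D\<^esub> sps (Idt C A) = Idt D (spo (Idt C A))"
    "\<And>u. tgt.ar u \<Longrightarrow> tgt.cd u = fob F A \<Longrightarrow> sps (Idt C A) \<cdot>\<^bsub>D\<^esub> (unit A \<cdot>\<^bsub>D\<^esub> u) = u"
    "\<And>u. tgt.ar u \<Longrightarrow> tgt.cd u = spo (Idt C A) \<Longrightarrow> unit A \<cdot>\<^bsub>D\<^esub> (sps (Idt C A) \<cdot>\<^bsub>D\<^esub> u) = u"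
    "spo (Idt C A) \<in> Obj D"
  using splitting[OF src.incl_Obj[OF A], of "Idt C A"] splitting_id[OF A] unfolding unit_def by auto

lemma unit_iso:
  "exangulated_iso C E D G F \<Lambda> (functor_comp ext_fun (idem_incl C)) (ext_comp ext_trans (idem_incl C) (idem_incl_ext C)) unit"
proof -
  have c: "fob (functor_comp ext_fun (idem_incl C)) A = spo (Idt C A)"
    "farr (functor_comp ext_fun (idem_incl C)) f = spr (Idt C (src.cd f)) \<cdot>\<^bsub>D\<^esub> (farr F f \<cdot>\<^bsub>D\<^esub> sps (Idt C (src.dm f)))"
    "ext_comp ext_trans (idem_incl C) (idem_incl_ext C) K A \<delta> = Act G (sps (Idt C K)) (unit A) (\<Lambda> K A \<delta>)" for A K f \<delta>
    by (simp_all add: functor_comp_def ext_comp_def src.incl_sel idem_incl_ext_def unit_def)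
  have 1: "exangulated_trans C E D G F \<Lambda> (functor_comp ext_fun (idem_incl C)) (ext_comp ext_trans (idem_incl C) (idem_incl_ext C)) unit"
    unfolding exangulated_trans_def nat_transformation_def c push_def pull_def
  proof (intro conjI ballI)
    fix A assume A: "A \<in> Obj C"
    note [simp] = A unit_props[OF A]
    show "unit A \<in> Arr D (fob F A) (spo (Idt C A))" by simp
    fix B f assume B: "B \<in> Obj C" and f: "f \<in> Arr C A B"
    note [simp] = B unit_props[OF B]
    show "unit B \<cdot>\<^bsub>D\<^esub> farr F f = (spr (Idt C (src.cd f)) \<cdot>\<^bsub>D\<^esub> (farr F f \<cdot>\<^bsub>D\<^esub> sps (Idt C (src.dm f)))) \<cdot>\<^bsub>D\<^esub> unit A"
      using f by (simp flip: unit_def)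
  next
    fix K A \<delta> assume K: "K \<in> Obj C" and A: "A \<in> Obj C" and d: "\<delta> \<in> carrier (Ext E K A)"
    note [simp] = A K d unit_props[OF A] unit_props[OF K]
    show "Act G (Idt D (fob F K)) (unit A) (\<Lambda> K A \<delta>) =
      Act G (unit K) (Idt D (spo (Idt C A))) (Act G (sps (Idt C K)) (unit A) (\<Lambda> K A \<delta>))"
      by simp
  qed
  have 2: "exangulated_trans C E D G (functor_comp ext_fun (idem_incl C)) (ext_comp ext_trans (idem_incl C) (idem_incl_ext C)) F \<Lambda> (\<lambda>A. sps (Idt C A))"
    unfolding exangulated_trans_def nat_transformation_def c push_def pull_def
  proof (intro conjI ballI)
    fix A assume A: "A \<in> Obj C"
    note [simp] = A unit_props[OF A]
    show "sps (Idt C A) \<in> Arr D (spo (Idt C A)) (fob F A)" by simp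
    fix B f assume B: "B \<in> Obj C" and f: "f \<in> Arr C A B"
    note [simp] = B unit_props[OF B]
    show "sps (Idt C B) \<cdot>\<^bsub>D\<^esub> (spr (Idt C (src.cd f)) \<cdot>\<^bsub>D\<^esub> (farr F f \<cdot>\<^bsub>D\<^esub> sps (Idt C (src.dm f)))) = farr F f \<cdot>\<^bsub>D\<^esub> sps (Idt C A)"
      using f by (simp flip: unit_def)
  next
    fix K A \<delta> assume K: "K \<in> Obj C" and A: "A \<in> Obj C" and d: "\<delta> \<in> carrier (Ext E K A)"
    note [simp] = A K d unit_props[OF A] unit_props[OF K]
    show "Act G (Idt D (spo (Idt C K))) (sps (Idt C A)) (Act G (sps (Idt C K)) (unit A) (\<Lambda> K A \<delta>)) =
      Act G (sps (Idt C K)) (Idt D (fob F A)) (\<Lambda> K A \<delta>)"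
      by simp
  qed
  show ?thesis unfolding exangulated_iso_def
    by (intro conjI 1 exI[of _ "\<lambda>A. sps (Idt C A)"] 2) (auto simp: c unit_props)
qed

text \<open>Naturality at the projection \<open>(X, 1) \<rightarrow> (X, e)\<close> determines the
  component at \<open>(X, e)\<close> from the one at \<open>(X, 1)\<close>, and the latter is
  determined by \<open>\<beta>\<close> as \<open>unit\<close> is invertible. The restriction to
  \<open>extensional\<close> families fixes the values off the objects, so that uniqueness holds as
  an equality of functions.\<close>

lemma extension_unique:
  assumes H: "exangulated_functor n (idem_cat C) (idem_ext C E) (idem_real n C s) D G t H \<Theta>"
    and \<beta>: "exangulated_trans C E D G F \<Lambda> (functor_comp H (idem_incl C)) (ext_comp \<Theta> (idem_incl C) (idem_incl_ext C)) \<beta>"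
  shows "\<exists>!\<gamma>. \<gamma> \<in> extensional (Obj (idem_cat C)) \<and>
    exangulated_trans (idem_cat C) (idem_ext C E) D G ext_fun ext_trans H \<Theta> \<gamma> \<and>
    (\<forall>X\<in>Obj C. \<beta> X = \<gamma> (fob (idem_incl C) X) \<cdot>\<^bsub>D\<^esub> unit X)"
proof -
  interpret H: preadditive_functor "idem_cat C" D H
    by (intro preadditive_functor.intro preadditive_functor_axioms.intro) (unfold_locales, use H in \<open>simp add: exangulated_functor_def\<close>)
  have \<Theta>_natural: "\<Theta> (I.dm c) (I.cd a) (Act (idem_ext C E) c a x) = Act G (farr H c) (farr H a) (\<Theta> (I.cd c) (I.dm a) x)"
    if "I.ar c" "I.ar a" "x \<in> carrier (Ext (idem_ext C E) (I.cd c) (I.dm a))" for c a x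
    using H that I.ar_Arr[OF that(1)] I.ar_Arr[OF that(2)]
    unfolding exangulated_functor_def ext_transformation_def by blast
  have \<Theta>_typed: "\<Theta> K A x \<in> carrier (Ext G (fob H K) (fob H A))"
    if "K \<in> Obj (idem_cat C)" "A \<in> Obj (idem_cat C)" "x \<in> carrier (Ext (idem_ext C E) K A)" for K A x
    using H that unfolding exangulated_functor_def ext_transformation_def hom_def by blast
  have \<beta>t: "tgt.ar (\<beta> A)" "tgt.dm (\<beta> A) = fob F A" "tgt.cd (\<beta> A) = fob H (A, Idt C A)" if "A \<in> Obj C" for A
  proof -
    have "\<beta> A \<in> Arr D (fob F A) (fob H (A, Idt C A))"
      using \<beta> that unfolding exangulated_trans_def nat_transformation_def functor_comp_def by (simp add: src.incl_sel del: tgt.Arr_iff)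
    then show "tgt.ar (\<beta> A)" "tgt.dm (\<beta> A) = fob F A" "tgt.cd (\<beta> A) = fob H (A, Idt C A)"
      using that src.incl_Obj[OF that] by auto
  qed
  have \<beta>n: "\<beta> (src.cd f) \<cdot>\<^bsub>D\<^esub> farr F f = farr H (Idt C (src.cd f), f, Idt C (src.dm f)) \<cdot>\<^bsub>D\<^esub> \<beta> (src.dm f)" if "src.ar f" for f
    using \<beta> src.ar_Arr[OF that] unfolding exangulated_trans_def nat_transformation_def functor_comp_def by (simp add: src.incl_sel del: src.Arr_iff)
  have \<beta>e: "Act G (Idt D (fob F K)) (\<beta> A) (\<Lambda> K A \<delta>) = Act G (\<beta> K) (Idt D (fob H (A, Idt C A))) (\<Theta> (K, Idt C K) (A, Idt C A) (Idt C A, \<delta>, Idt C K))"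
    if "K \<in> Obj C" "A \<in> Obj C" "\<delta> \<in> carrier (Ext E K A)" for K A \<delta>
    using \<beta> that unfolding exangulated_trans_def functor_comp_def ext_comp_def push_def pull_def by (simp add: src.incl_sel idem_incl_ext_def)
  have pr: "I.ar (snd A, snd A, Idt C (fst A))" "I.dm (snd A, snd A, Idt C (fst A)) = (fst A, Idt C (fst A))" "I.cd (snd A, snd A, Idt C (fst A)) = A"
    if "A \<in> Obj (idem_cat C)" for A
    by (rule src.idem_typed[OF src.incl_Obj that]; use src.idem_ObjD[OF that] in simp)+
  \<comment> \<open>The formula that naturality forces: embed into \<open>F X\<close> by the
    splitting, apply \<open>\<beta>\<close>, and project by the image under \<open>H\<close> of the
    projection onto \<open>(X, e)\<close>.\<close>
  define g where "g A = farr H (snd A, snd A, Idt C (fst A)) \<cdot>\<^bsub>D\<^esub> (\<beta> (fst A) \<cdot>\<^bsub>D\<^esub> sps (snd A))" for A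
  have gt: "tgt.ar (g A)" "tgt.dm (g A) = spo (snd A)" "tgt.cd (g A) = fob H A" if A: "A \<in> Obj (idem_cat C)" for A
    unfolding g_def using pr[OF A] splitting[OF A refl] \<beta>t[OF src.idem_ObjD(1)[OF A]] by simp_all
  have gn: "g B \<cdot>\<^bsub>D\<^esub> farr ext_fun f = farr H f \<cdot>\<^bsub>D\<^esub> g A"
    if A: "A \<in> Obj (idem_cat C)" and B: "B \<in> Obj (idem_cat C)" and f: "f \<in> Arr (idem_cat C) A B" for A B f
  proof -
    note oA [simp] = src.idem_ObjD[OF A] and oB [simp] = src.idem_ObjD[OF B]
    note [simp] = splitting[OF A refl] splitting[OF B refl] \<beta>t[OF oA(1)] \<beta>t[OF oB(1)] pr[OF A] pr[OF B]
    obtain f' where f' [simp]: "f = (snd B, f', snd A)" "src.ar f'" "src.dm f' = fst A" "src.cd f' = fst B" "f' \<cdot> snd A = f'" "snd B \<cdot> f' = f'"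
      using src.idem_ArrE[OF f A B] by blast
    have ft: "I.ar (snd B, f', snd A)" "I.dm (snd B, f', snd A) = A" "I.cd (snd B, f', snd A) = B"
      by (rule src.idem_typed[OF A B]; simp)+
    have it: "I.ar (Idt C (fst B), f', Idt C (fst A))" "I.dm (Idt C (fst B), f', Idt C (fst A)) = (fst A, Idt C (fst A))"
      "I.cd (Idt C (fst B), f', Idt C (fst A)) = (fst B, Idt C (fst B))"
      by (rule src.idem_typed[OF src.incl_Obj src.incl_Obj]; simp)+
    have "g B \<cdot>\<^bsub>D\<^esub> farr ext_fun f = farr H (snd B, snd B, Idt C (fst B)) \<cdot>\<^bsub>D\<^esub> ((\<beta> (fst B) \<cdot>\<^bsub>D\<^esub> farr F f') \<cdot>\<^bsub>D\<^esub> sps (snd A))"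
      unfolding g_def using farr_idem[of f' "snd B"] by simp
    also have "\<beta> (fst B) \<cdot>\<^bsub>D\<^esub> farr F f' = farr H (Idt C (fst B), f', Idt C (fst A)) \<cdot>\<^bsub>D\<^esub> \<beta> (fst A)" using \<beta>n[of f'] by simp
    also have "farr H (snd B, snd B, Idt C (fst B)) \<cdot>\<^bsub>D\<^esub> ((farr H (Idt C (fst B), f', Idt C (fst A)) \<cdot>\<^bsub>D\<^esub> \<beta> (fst A)) \<cdot>\<^bsub>D\<^esub> sps (snd A)) =
      (farr H (snd B, snd B, Idt C (fst B)) \<cdot>\<^bsub>D\<^esub> farr H (Idt C (fst B), f', Idt C (fst A))) \<cdot>\<^bsub>D\<^esub> (\<beta> (fst A) \<cdot>\<^bsub>D\<^esub> sps (snd A))"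
      using it by simp
    also have "farr H (snd B, snd B, Idt C (fst B)) \<cdot>\<^bsub>D\<^esub> farr H (Idt C (fst B), f', Idt C (fst A)) =
      farr H ((snd B, snd B, Idt C (fst B)) \<cdot>\<^bsub>idem_cat C\<^esub> (Idt C (fst B), f', Idt C (fst A)))"
      using it by (intro H.farr_cmp[symmetric]) simp_all
    also have "(snd B, snd B, Idt C (fst B)) \<cdot>\<^bsub>idem_cat C\<^esub> (Idt C (fst B), f', Idt C (fst A)) =
      (snd B, f', snd A) \<cdot>\<^bsub>idem_cat C\<^esub> (snd A, snd A, Idt C (fst A))" by simp
    also have "farr H \<dots> = farr H f \<cdot>\<^bsub>D\<^esub> farr H (snd A, snd A, Idt C (fst A))"
      unfolding f'(1) using ft by (intro H.farr_cmp) simp_all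
    also have "(farr H f \<cdot>\<^bsub>D\<^esub> farr H (snd A, snd A, Idt C (fst A))) \<cdot>\<^bsub>D\<^esub> (\<beta> (fst A) \<cdot>\<^bsub>D\<^esub> sps (snd A)) = farr H f \<cdot>\<^bsub>D\<^esub> g A"
      unfolding g_def f'(1) using ft by simp
    finally show ?thesis .
  qed
  have ge: "Act G (Idt D (spo (snd K))) (g A) (ext_trans K A x) = Act G (g K) (Idt D (fob H A)) (\<Theta> K A x)"
    if K: "K \<in> Obj (idem_cat C)" and A: "A \<in> Obj (idem_cat C)" and x: "x \<in> carrier (Ext (idem_ext C E) K A)" for K A x
  proof -
    note oA [simp] = src.idem_ObjD[OF A] and oK [simp] = src.idem_ObjD[OF K]
    note [simp] = splitting[OF A refl] splitting[OF K refl] \<beta>t(1,2)[OF oA(1)] \<beta>t(1,2)[OF oK(1)] A K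
    obtain \<delta> where xd: "x = (snd A, \<delta>, snd K)" and d [simp]: "\<delta> \<in> carrier (Ext E (fst K) (fst A))"
      and ad: "Act E (Idt C (fst K)) (snd A) \<delta> = \<delta>" and kd: "Act E (snd K) (Idt C (fst A)) \<delta> = \<delta>"
      using x unfolding src.idem_Ext by blast
    define A0 where "A0 = (fst A, Idt C (fst A))"
    define K0 where "K0 = (fst K, Idt C (fst K))"
    define x0 where "x0 = (Idt C (fst A), \<delta>, Idt C (fst K))"
    define \<pi>A where "\<pi>A = (snd A, snd A, Idt C (fst A))"
    define \<pi>K where "\<pi>K = (snd K, snd K, Idt C (fst K))"
    have o [simp]: "A0 \<in> Obj (idem_cat C)" "K0 \<in> Obj (idem_cat C)" by (auto simp: A0_def K0_def intro: src.incl_Obj)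
    have x0 [simp]: "x0 \<in> carrier (Ext (idem_ext C E) K0 A0)" by (simp add: x0_def K0_def A0_def src.idem_Ext)
    have pA [simp]: "I.ar \<pi>A" "I.dm \<pi>A = A0" "I.cd \<pi>A = A" "I.ar \<pi>K" "I.dm \<pi>K = K0" "I.cd \<pi>K = K"
      using pr[OF A] pr[OF K] by (simp_all add: \<pi>A_def \<pi>K_def A0_def K0_def)
    have \<Theta>0 [simp]: "\<Theta> K0 A0 x0 \<in> carrier (Ext G (fob H K0) (fob H A0))" "\<Theta> K A x \<in> carrier (Ext G (fob H K) (fob H A))"
      using \<Theta>_typed x x0 by simp_all
    have \<beta>A [simp]: "tgt.cd (\<beta> (fst A)) = fob H A0" "tgt.cd (\<beta> (fst K)) = fob H K0" by (simp_all add: A0_def K0_def \<beta>t(3))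
    have aL: "Act G (Idt D (fob F (fst K))) (farr F (snd A)) (\<Lambda> (fst K) (fst A) \<delta>) = \<Lambda> (fst K) (fst A) \<delta>"
      using \<Lambda>_natural[of "Idt C (fst K)" "snd A" \<delta>] ad by simp
    have akd: "Act E (snd K) (snd A) \<delta> = \<delta>"
    proof -
      have "Act E (snd K) (snd A) \<delta> = Act E (snd K) (Idt C (fst A)) (Act E (Idt C (fst K)) (snd A) \<delta>)" by simp
      then show ?thesis unfolding ad kd .
    qed
    \<comment> \<open>The extension \<open>x\<close> and its copy \<open>x0\<close> between
      underlying objects become equal after pushing \<open>x0\<close> forward along one projection
      and pulling \<open>x\<close> back along the other. Thus the known identity for
      \<open>\<beta>\<close> at \<open>x0\<close> passes to \<open>x\<close>.\<close>
    have x1: "Act (idem_ext C E) (Idt (idem_cat C) K0) \<pi>A x0 = Act (idem_ext C E) \<pi>K (Idt (idem_cat C) A) x"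
      by (simp add: \<pi>A_def \<pi>K_def x0_def K0_def xd ad akd)
    have "Act G (Idt D (spo (snd K))) (g A) (ext_trans K A x) =
      Act G (sps (snd K)) (farr H \<pi>A \<cdot>\<^bsub>D\<^esub> \<beta> (fst A)) (Act G (Idt D (fob F (fst K))) (farr F (snd A)) (\<Lambda> (fst K) (fst A) \<delta>))"
      unfolding g_def xd \<pi>A_def[symmetric] by (simp del: src.idem_sel)
    also have "\<dots> = Act G (sps (snd K)) (farr H \<pi>A) (Act G (Idt D (fob F (fst K))) (\<beta> (fst A)) (\<Lambda> (fst K) (fst A) \<delta>))"
      unfolding aL by (simp del: src.idem_sel)
    also have "\<dots> = Act G (sps (snd K)) (farr H \<pi>A) (Act G (\<beta> (fst K)) (Idt D (fob H A0)) (\<Theta> K0 A0 x0))"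
      using \<beta>e[OF oK(1) oA(1) d] unfolding A0_def K0_def x0_def by simp
    also have "\<dots> = Act G (\<beta> (fst K) \<cdot>\<^bsub>D\<^esub> sps (snd K)) (Idt D (fob H A)) (Act G (Idt D (fob H K0)) (farr H \<pi>A) (\<Theta> K0 A0 x0))"
      by (simp del: src.idem_sel)
    also have "Act G (Idt D (fob H K0)) (farr H \<pi>A) (\<Theta> K0 A0 x0) = \<Theta> K0 A (Act (idem_ext C E) (Idt (idem_cat C) K0) \<pi>A x0)"
      using \<Theta>_natural[of "Idt (idem_cat C) K0" \<pi>A x0] by (simp del: src.idem_sel)
    also have "\<dots> = Act G (farr H \<pi>K) (Idt D (fob H A)) (\<Theta> K A x)"
      unfolding x1 using \<Theta>_natural[of \<pi>K "Idt (idem_cat C) A" x] x by (simp del: src.idem_sel)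
    finally show ?thesis unfolding g_def \<pi>K_def[symmetric] by (simp del: src.idem_sel)
  qed
  define \<gamma> where "\<gamma> = restrict g (Obj (idem_cat C))"
  have \<gamma>g: "\<gamma> A = g A" if "A \<in> Obj (idem_cat C)" for A using that by (simp add: \<gamma>_def)
  show ?thesis
  proof (rule ex1I[of _ \<gamma>], intro conjI ballI)
    show "\<gamma> \<in> extensional (Obj (idem_cat C))" by (simp add: \<gamma>_def)
    show "exangulated_trans (idem_cat C) (idem_ext C E) D G ext_fun ext_trans H \<Theta> \<gamma>"
      unfolding exangulated_trans_def nat_transformation_def push_def pull_def
    proof (intro conjI ballI)
      fix A assume A: "A \<in> Obj (idem_cat C)"
      then show "\<gamma> A \<in> Arr D (fob ext_fun A) (fob H A)" using gt[OF A] splitting(1)[OF A refl] by (simp add: \<gamma>g)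
      fix B f assume "B \<in> Obj (idem_cat C)" "f \<in> Arr (idem_cat C) A B"
      then show "\<gamma> B \<cdot>\<^bsub>D\<^esub> farr ext_fun f = farr H f \<cdot>\<^bsub>D\<^esub> \<gamma> A" using gn A by (simp add: \<gamma>g del: I.Arr_iff)
    next
      fix K A x assume "K \<in> Obj (idem_cat C)" "A \<in> Obj (idem_cat C)" "x \<in> carrier (Ext (idem_ext C E) K A)"
      then show "Act G (Idt D (fob ext_fun K)) (\<gamma> A) (ext_trans K A x) = Act G (\<gamma> K) (Idt D (fob H A)) (\<Theta> K A x)"
        using ge by (simp add: \<gamma>g)
    qed
  next
    fix X assume X: "X \<in> Obj C"
    note o = src.incl_Obj[OF X]
    note [simp] = X unit_props[OF X] \<beta>t[OF X]
    have "farr H (Idt C X, Idt C X, Idt C X) = Idt D (fob H (X, Idt C X))" using H.farr_Idt[OF o] by simp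
    then show "\<beta> X = \<gamma> (fob (idem_incl C) X) \<cdot>\<^bsub>D\<^esub> unit X"
      using o by (simp add: src.incl_sel \<gamma>g g_def)
  next
    fix \<gamma>' assume a: "\<gamma>' \<in> extensional (Obj (idem_cat C)) \<and>
       exangulated_trans (idem_cat C) (idem_ext C E) D G ext_fun ext_trans H \<Theta> \<gamma>' \<and>
       (\<forall>X\<in>Obj C. \<beta> X = \<gamma>' (fob (idem_incl C) X) \<cdot>\<^bsub>D\<^esub> unit X)"
    have "\<gamma>' A = g A" if A: "A \<in> Obj (idem_cat C)" for A
    proof -
      note oA [simp] = src.idem_ObjD[OF A]
      note sp [simp] = splitting[OF A refl] unit_props[OF oA(1)] \<beta>t[OF oA(1)] pr[OF A] A src.incl_Obj[OF oA(1)]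
      have t: "\<gamma>' B \<in> Arr D (fob ext_fun B) (fob H B)" if "B \<in> Obj (idem_cat C)" for B
        using a that unfolding exangulated_trans_def nat_transformation_def by blast
      have t1 [simp]: "tgt.ar (\<gamma>' A)" "tgt.dm (\<gamma>' A) = spo (snd A)" "tgt.cd (\<gamma>' A) = fob H A"
        using t[OF A] by auto
      have t2 [simp]: "tgt.ar (\<gamma>' (fst A, Idt C (fst A)))" "tgt.dm (\<gamma>' (fst A, Idt C (fst A))) = spo (Idt C (fst A))"
        "tgt.cd (\<gamma>' (fst A, Idt C (fst A))) = fob H (fst A, Idt C (fst A))"
        using t[of "(fst A, Idt C (fst A))"] by auto
      have b: "\<gamma>' (fst A, Idt C (fst A)) \<cdot>\<^bsub>D\<^esub> unit (fst A) = \<beta> (fst A)"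
        using a by (simp add: src.incl_sel)
      have m: "(snd A, snd A, Idt C (fst A)) \<in> Arr (idem_cat C) (fst A, Idt C (fst A)) A" by simp
      have n: "\<gamma>' A \<cdot>\<^bsub>D\<^esub> farr ext_fun (snd A, snd A, Idt C (fst A)) = farr H (snd A, snd A, Idt C (fst A)) \<cdot>\<^bsub>D\<^esub> \<gamma>' (fst A, Idt C (fst A))"
        using a m A src.incl_Obj[OF oA(1)] unfolding exangulated_trans_def nat_transformation_def by blast
      \<comment> \<open>The image of the projection under \<open>ext_fun\<close>, composed with
        \<open>unit\<close> and the splitting, is the identity; inserting it allows naturality to be
        applied.\<close>
      have "\<gamma>' A = (\<gamma>' A \<cdot>\<^bsub>D\<^esub> farr ext_fun (snd A, snd A, Idt C (fst A))) \<cdot>\<^bsub>D\<^esub> (unit (fst A) \<cdot>\<^bsub>D\<^esub> sps (snd A))"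
        by simp
      also have "\<dots> = farr H (snd A, snd A, Idt C (fst A)) \<cdot>\<^bsub>D\<^esub> ((\<gamma>' (fst A, Idt C (fst A)) \<cdot>\<^bsub>D\<^esub> unit (fst A)) \<cdot>\<^bsub>D\<^esub> sps (snd A))"
        unfolding n by simp
      also have "\<dots> = g A" unfolding b g_def ..
      finally show ?thesis .
    qed
    then show "\<gamma>' = \<gamma>" using a by (auto simp: \<gamma>_def fun_eq_iff extensional_def)
  qed
qed

lemma universal_property:
  "\<exists>\<E> \<Psi> \<alpha>.
          exangulated_functor n (idem_cat C) (idem_ext C E) (idem_real n C s) D G t \<E> \<Psi> \<and>
          exangulated_iso C E D G F \<Lambda>
            (functor_comp \<E> (idem_incl C)) (ext_comp \<Psi> (idem_incl C) (idem_incl_ext C)) \<alpha> \<and>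
          (\<forall>H \<Theta> \<beta>.
             exangulated_functor n (idem_cat C) (idem_ext C E) (idem_real n C s) D G t H \<Theta> \<and>
             exangulated_trans C E D G F \<Lambda>
               (functor_comp H (idem_incl C)) (ext_comp \<Theta> (idem_incl C) (idem_incl_ext C)) \<beta> \<longrightarrow>
             (\<exists>!\<gamma>. \<gamma> \<in> extensional (Obj (idem_cat C)) \<and>
                exangulated_trans (idem_cat C) (idem_ext C E) D G \<E> \<Psi> H \<Theta> \<gamma> \<and>
                (\<forall>X\<in>Obj C. \<beta> X = \<gamma> (fob (idem_incl C) X) \<cdot>\<^bsub>D\<^esub> \<alpha> X)))"
  by (intro exI[of _ ext_fun] exI[of _ ext_trans] exI[of _ unit] conjI allI impI ext_fun_exangulated unit_iso)
    (elim conjE, rule extension_unique)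

end

theorem theoremA:
  fixes n :: nat
    and C :: "('o, 'm) cat" and E :: "('o, 'm, 'x) ext" and s :: "('o, 'm, 'x) realisation"
  assumes n: "n \<ge> 1"
    and C: "exangulated_category n C E s"
  shows "exangulated_category n (idem_cat C) (idem_ext C E) (idem_real n C s) \<and>
    idempotent_complete (idem_cat C) \<and>
    exangulated_functor n C E s (idem_cat C) (idem_ext C E) (idem_real n C s)
      (idem_incl C) (idem_incl_ext C) \<and>
    (\<forall>(C' :: ('p, 'q) cat) (E' :: ('p, 'q, 'y) ext) s' F \<Lambda>.
       exangulated_category n C' E' s' \<and> idempotent_complete C' \<and>
       exangulated_functor n C E s C' E' s' F \<Lambda> \<longrightarrow>
       (\<exists>\<E> \<Psi> \<alpha>.
          exangulated_functor n (idem_cat C) (idem_ext C E) (idem_real n C s) C' E' s' \<E> \<Psi> \<and>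
          exangulated_iso C E C' E' F \<Lambda>
            (functor_comp \<E> (idem_incl C)) (ext_comp \<Psi> (idem_incl C) (idem_incl_ext C)) \<alpha> \<and>
          (\<forall>G \<Theta> \<beta>.
             exangulated_functor n (idem_cat C) (idem_ext C E) (idem_real n C s) C' E' s' G \<Theta> \<and>
             exangulated_trans C E C' E' F \<Lambda>
               (functor_comp G (idem_incl C)) (ext_comp \<Theta> (idem_incl C) (idem_incl_ext C)) \<beta> \<longrightarrow>
             (\<exists>!\<gamma>. \<gamma> \<in> extensional (Obj (idem_cat C)) \<and>
                exangulated_trans (idem_cat C) (idem_ext C E) C' E' \<E> \<Psi> G \<Theta> \<gamma> \<and>
                (\<forall>X\<in>Obj C. \<beta> X = \<gamma> (fob (idem_incl C) X) \<cdot>\<^bsub>C'\<^esub> \<alpha> X)))))"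
proof -
  interpret exangulated_category n C E s by (rule C)
  interpret R: realisation n C E s by (rule realisation[OF n])
  have ic: "inflations_compose n C E s" using EA1 unfolding R.EA1_iff by blast
  show ?thesis
  proof (intro conjI allI impI idem_exangulated[OF n] idem_idempotent_complete R.incl_exangulated)
    fix C' :: "('p, 'q) cat" and E' :: "('p, 'q, 'y) ext" and s' F \<Lambda>
    assume a: "exangulated_category n C' E' s' \<and> idempotent_complete C' \<and> exangulated_functor n C E s C' E' s' F \<Lambda>"
    have X: "idempotent_extension n C E s C' E' s' F \<Lambda>"
    proof (intro idempotent_extension.intro idempotent_extension_axioms.intro R.realisation_axioms ic EA2)
      show "realisation n C' E' s'" using a by (blast intro: exact_realisation.realisation exangulated_category.axioms(1) n)
      show "exangulated_functor n C E s C' E' s' F \<Lambda>" "idempotent_complete C'" using a by blast+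
    qed
    show "\<exists>\<E> \<Psi> \<alpha>.
          exangulated_functor n (idem_cat C) (idem_ext C E) (idem_real n C s) C' E' s' \<E> \<Psi> \<and>
          exangulated_iso C E C' E' F \<Lambda>
            (functor_comp \<E> (idem_incl C)) (ext_comp \<Psi> (idem_incl C) (idem_incl_ext C)) \<alpha> \<and>
          (\<forall>G \<Theta> \<beta>.
             exangulated_functor n (idem_cat C) (idem_ext C E) (idem_real n C s) C' E' s' G \<Theta> \<and>
             exangulated_trans C E C' E' F \<Lambda>
               (functor_comp G (idem_incl C)) (ext_comp \<Theta> (idem_incl C) (idem_incl_ext C)) \<beta> \<longrightarrow>
             (\<exists>!\<gamma>. \<gamma> \<in> extensional (Obj (idem_cat C)) \<and>
                exangulated_trans (idem_cat C) (idem_ext C E) C' E' \<E> \<Psi> G \<Theta> \<gamma> \<and>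
                (\<forall>X\<in>Obj C. \<beta> X = \<gamma> (fob (idem_incl C) X) \<cdot>\<^bsub>C'\<^esub> \<alpha> X)))"
      by (rule idempotent_extension.universal_property[OF X])
  qed
qed

end
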